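(* For $a\in\mathbb{Z}\setminus\{0\}$, $u\in\mathbb{N}$ and $v\in\mathbb{Z}\setminus\{-au\}$, define \[P_{a,u,v}(x,y)=\#\left\{p\le x\colon up+v\text{ has a shifted-prime divisor }q-a>y\right\}.\] Then \[P_{a,u,v}(x,y)\ll_{a,u,v}\frac{\pi(x)}{(\log y)^{\eta_0}\sqrt{\log\log y}}\] for all $x,y\ge3$, where $\eta_0=1-\frac{1+\log\log2}{\log2}$.
   Context: The letters $p$ and $q$ denote primes, and $\pi(x)$ is the number of primes up to $x$. That $up+v$ has a shifted-prime divisor $q-a>y$ means that there is a prime $q$ with $q-a>y$ and $(q-a)\mid(up+v)$. The number $\eta_0=0.0860713\ldots$ is the Erdős–Tenenbaum–Ford constant. The notation $\ll_{a,u,v}$ means that the implied constant depends only on $a,u,v$.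
   Formalization: Primes p with up+v=0 are not counted in P_{a,u,v}(x,y): every q-a divides 0, so such a p would be counted for every y and the bound would fail as y grows with x fixed (e.g. a=u=1, v=-2, p=2). *)

theory Defs
  imports Complex_Main "HOL-Computational_Algebra.Primes"
begin

definition prime_pi :: "real \<Rightarrow> nat" where
  "prime_pi x = card {p::nat. prime p \<and> real p \<le> x}"

text \<open>The Erdos--Tenenbaum--Ford constant.\<close>

definition eta0 :: real where
  "eta0 = 1 - (1 + ln (ln 2)) / ln 2"

text \<open>The shift \<open>a\<close> may be negative, so the divisor \<open>q - a\<close> is an integer.\<close>

definition has_shifted_prime_divisor_gt :: "int \<Rightarrow> real \<Rightarrow> int \<Rightarrow> bool" where
  "has_shifted_prime_divisor_gt a y n \<longleftrightarrow>
     (\<exists>q::nat. prime q \<and> real_of_int (int q - a) > y \<and> (int q - a) dvd n)"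

text \<open>
  Divisors are taken of nonzero integers only. Every integer divides \<open>0\<close>, so a prime \<open>p\<close> with
  \<open>u * p + v = 0\<close> would be counted for all \<open>y\<close> (for example \<open>u = 1\<close>, \<open>v = - 2\<close>, \<open>p = 2\<close>), and
  then no bound that tends to \<open>0\<close> as \<open>y\<close> grows with \<open>x\<close> fixed could hold. For \<open>u > 0\<close> the
  condition removes at most one prime. Negative values of \<open>u * p + v\<close> are kept.
\<close>

definition P_count :: "int \<Rightarrow> nat \<Rightarrow> int \<Rightarrow> real \<Rightarrow> real \<Rightarrow> nat" where
  "P_count a u v x y =
     card {p::nat. prime p \<and> real p \<le> x \<and> int u * int p + v \<noteq> 0 \<and>
                   has_shifted_prime_divisor_gt a y (int u * int p + v)}"

end

theory Submission
  imports Defs "HOL-Analysis.Analysis" "HOL-Number_Theory.Number_Theory" "HOL-Real_Asymp.Real_Asymp"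
begin

text \<open>Write \<open>N = u p + v\<close>. The divisors \<open>d = q - a > y\<close> are sorted into the scales \<open>z < d \<le> z^2\<close> with
\<open>z = y^(2^i)\<close>. With \<open>L = ln ln z\<close>, one scale contributes \<open>O(x / ln x * tau L)\<close>, where
\<open>tau L = exp (- eta0 L) / sqrt L\<close>. Since \<open>ln ln z = ln ln y + i ln 2\<close> and \<open>eta0 > 0\<close>, the sum over the
scales is dominated by a geometric series (\<open>sum_tau_scales_le\<close>), and Chebyshev's lower bound for
\<open>\<pi>(x)\<close> replaces \<open>x / ln x\<close>.

For one scale the decisive quantity is the number of prime factors of \<open>N\<close> up to a small power
\<open>w = z^(1/100)\<close>, compared with \<open>K = omega_cut L\<close>, the integer part of \<open>L / ln 2\<close>. That number behaves
like a Poisson variable of mean \<open>L\<close>, so it reaches \<open>K\<close> with probability \<open>O(tau L)\<close>; this bounds the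
primes with many small prime factors (\<open>card_many_small_primes_le\<close>). If there are fewer than \<open>K\<close>,
count pairs \<open>(d, m)\<close> with \<open>N = d m\<close>: each prime factor may go to \<open>d\<close> or to \<open>m\<close>, which doubles the mean,
and the shifted prime \<open>q = d + a\<close> saves a further logarithm. The sum of \<open>(2 L)^k / k!\<close> over \<open>k < K\<close> is
\<open>O(exp (2 L) tau L)\<close>, with the same \<open>tau\<close> because \<open>2^K\<close> is about \<open>exp L\<close>
(\<open>poisson_lower_tail\<close>, \<open>poisson_upper_tail\<close>, \<open>card_few_small_primes_le\<close>).

To make this rigorous, \<open>N\<close> is split as \<open>M r\<close> with \<open>M\<close> composed of small primes and \<open>r\<close> free of them
(\<open>prefix_decomposition\<close>). For fixed \<open>M\<close>, or for fixed smooth parts \<open>d1\<close>, \<open>m1\<close> of \<open>d\<close>, \<open>m\<close>, the primes \<open>p\<close> are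
counted by a sieve of Brun and Hooley applied to at most three linear forms (\<open>linear_forms_sieve\<close>);
the sums over \<open>M\<close> and over \<open>(d1, m1)\<close> are bounded by powers of \<open>\<Sum> 1/p\<close> over factorials. When the
primes of \<open>N\<close> up to \<open>w\<close> have too large a product, the decomposition stops at a prime \<open>P < w\<close>; the sieve
then only reaches \<open>P\<close>, but Rankin's trick gains \<open>exp (- c ln z / ln P)\<close> with \<open>c\<close> as large as desired,
which pays for all losses.

The sieve bounds carry arithmetic factors \<open>gfac\<close>. The troublesome one is \<open>gfac |a m + v|^3\<close>, in which the
shift correlates with the smooth number \<open>m\<close>; it is constant on average (\<open>shifted_weight_average\<close>).
The hypothesis \<open>v \<noteq> - a u\<close> is what makes \<open>a m + v\<close> nonzero: for \<open>a m + v = 0\<close> the equation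
\<open>u p + v = d m\<close> reads \<open>u p = q m\<close>, which for \<open>q > u\<close> forces \<open>q = p\<close> and \<open>m = u\<close>.

The cases \<open>u = 0\<close> and \<open>v = 0\<close> are separate. For \<open>v = 0\<close> the divisor is \<open>d' p\<close> with \<open>d'\<close> a divisor of \<open>u\<close>, so
that \<open>p\<close> and \<open>d' p + a\<close> are both prime, which is rarer by a full logarithm.\<close>

section \<open>Sums over primes\<close>

definition primes_le :: "real \<Rightarrow> nat set" where
 "primes_le x = {p. prime p \<and> real p \<le> x}"

lemma primes_le_iff: "p \<in> primes_le x \<longleftrightarrow> prime p \<and> real p \<le> x"
 by (simp add: primes_le_def)

lemma finite_nat_le_real [simp]: "finite {n::nat. real n \<le> x}"
proof (rule finite_subset)
 show "{n::nat. real n \<le> x} \<subseteq> {..nat \<lfloor>x\<rfloor>}"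
  by (auto simp: le_nat_iff le_floor_iff)
qed auto

lemma finite_primes_le [simp]: "finite (primes_le x)"
 by (rule finite_subset[OF _ finite_nat_le_real[of x]]) (auto simp: primes_le_def)

lemma primes_le_of_nat: "primes_le (real n) = {p. prime p \<and> p \<le> n}"
 by (auto simp: primes_le_def)

lemma primes_le_floor: "x \<ge> 0 \<Longrightarrow> primes_le x = primes_le (real (nat \<lfloor>x\<rfloor>))"
proof -
 assume x: "x \<ge> 0"
 have "real n \<le> x \<longleftrightarrow> real n \<le> real (nat \<lfloor>x\<rfloor>)" for n
 proof -
  have "n \<le> nat \<lfloor>x\<rfloor> \<longleftrightarrow> real n \<le> x" using x by (simp add: le_nat_iff le_floor_iff)
  then show ?thesis by (simp only: of_nat_le_iff)
 qed
 then show ?thesis by (simp only: primes_le_def)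
qed

lemma primes_le_mono: "x \<le> y \<Longrightarrow> primes_le x \<subseteq> primes_le y"
 by (auto simp: primes_le_def)

lemma bounded_sums_of_summable:
 fixes f :: "nat \<Rightarrow> real"
 assumes "summable f" "\<And>n. f n \<ge> 0"
 shows "\<exists>C\<ge>0. \<forall>A. finite A \<longrightarrow> sum f A \<le> C"
 using assms sum_le_suminf[OF assms(1)] suminf_nonneg[OF assms(1)] by (intro exI[of _ "suminf f"]) auto

lemma prod_primes_dvd:
 fixes F :: "nat set"
 assumes "finite F" "\<And>p. p \<in> F \<Longrightarrow> prime p" "\<And>p. p \<in> F \<Longrightarrow> p dvd n"
 shows "\<Prod>F dvd n"
 using assms
proof (induction F rule: finite_induct)
 case (insert p F)
 have "coprime p (\<Prod>F)"
  using insert by (intro prod_coprime_right) (metis insertCI primes_coprime)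
 then show ?case using insert by (simp add: divides_mult)
qed auto

text \<open>The primes in \<open>(m + 1, 2 m + 1]\<close> divide \<open>binomial (2 m + 1) m\<close>, which is at most \<open>4^m\<close>.\<close>

lemma theta_le: "(\<Sum>p | prime p \<and> p \<le> n. ln (real p)) \<le> real n * ln 4"
proof (induction n rule: less_induct)
 case (less n)
 consider "n \<le> 2" | "n > 2" "even n" | "n > 2" "odd n" by linarith
 then show ?case
 proof cases
  case 1
  have sub: "{p. prime p \<and> p \<le> n} \<subseteq> (if n = 2 then {2} else {})"
   using 1 by (auto dest: prime_ge_2_nat)
  have "(\<Sum>p | prime p \<and> p \<le> n. ln (real p)) \<le> (\<Sum>p \<in> (if n = 2 then {2} else {}). ln (real p))"
   using sub by (intro sum_mono2) (auto split: if_splits)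
  also have "\<dots> \<le> real n * ln 4"
  proof -
   have "ln (2::real) \<le> 2 * ln 4" using ln_le_cancel_iff[of 2 "4::real"] ln_gt_zero[of "4::real"] by linarith
   then show ?thesis by auto
  qed
  finally show ?thesis .
 next
  case 2
  have "{p. prime p \<and> p \<le> n} = {p. prime p \<and> p \<le> n - 1}"
  proof -
   have "p \<noteq> n" if "prime p" for p using that 2 prime_odd_nat by blast
   then show ?thesis using 2 by (auto simp: le_less)
  qed
  then have "(\<Sum>p | prime p \<and> p \<le> n. ln (real p)) \<le> real (n - 1) * ln 4"
   using less[of "n - 1"] 2 by simp
  also have "\<dots> \<le> real n * ln 4" by (intro mult_right_mono) auto
  finally show ?thesis .
 next
  case 3
  then obtain m where m: "n = 2 * m + 1" by (elim oddE)
  have m1: "m \<ge> 1" using 3 m by auto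
  define F where "F = {p. prime p \<and> m + 1 < p \<and> p \<le> 2 * m + 1}"
  have finF: "finite F" by (rule finite_subset[of _ "{..2*m+1}"]) (auto simp: F_def)
  have dvd: "\<Prod>F dvd (2 * m + 1) choose m"
  proof (rule prod_primes_dvd[OF finF])
   fix p assume p: "p \<in> F"
   then have pp: "prime p" by (auto simp: F_def)
   show "prime p" by fact
   have "fact m * fact (2 * m + 1 - m) * ((2 * m + 1) choose m) = (fact (2 * m + 1) :: nat)"
    by (rule binomial_fact_lemma) auto
   moreover have "p dvd fact (2 * m + 1)" "\<not> p dvd fact m" "\<not> p dvd fact (m + 1)"
    using p pp by (auto simp: prime_dvd_fact_iff F_def simp del: fact_Suc)
   ultimately show "p dvd (2 * m + 1) choose m"
    using pp prime_dvd_mult_iff[of p] by (metis add_diff_cancel_left' diff_add_inverse mult_2 group_cancel.add1)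
  qed
  have "2 * ((2 * m + 1) choose m) \<le> 2 ^ (2 * m + 1)"
  proof -
   have "((2 * m + 1) choose m) = ((2 * m + 1) choose (m + 1))"
    by (subst binomial_symmetric) auto
   then have "2 * ((2 * m + 1) choose m) = (\<Sum>k\<in>{m, m+1}. (2 * m + 1) choose k)" by simp
   also have "\<dots> \<le> (\<Sum>k\<le>2*m+1. (2 * m + 1) choose k)" by (intro sum_mono2) auto
   also have "\<dots> = 2 ^ (2 * m + 1)" by (rule choose_row_sum)
   finally show ?thesis .
  qed
  then have le: "((2 * m + 1) choose m) \<le> 4 ^ m" by (simp add: power_mult)
  have "\<Prod>F \<le> 4 ^ m" using dvd_imp_le[OF dvd] le by (simp del: binomial_Suc_Suc)
  then have "real (\<Prod>F) \<le> 4 ^ m" by (metis of_nat_le_iff of_nat_numeral of_nat_power)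
  moreover have pos: "real (\<Prod>F) > 0" using finF by (auto simp: F_def prime_gt_0_nat intro!: prod_pos)
  ultimately have "ln (real (\<Prod>F)) \<le> ln (4 ^ m)" by (subst ln_le_cancel_iff) auto
  moreover have "ln (real (\<Prod>F)) = (\<Sum>p\<in>F. ln (real p))"
   using finF by (simp add: of_nat_prod) (subst ln_prod, auto simp: F_def prime_gt_0_nat)
  ultimately have FF: "(\<Sum>p\<in>F. ln (real p)) \<le> real m * ln 4" by (simp add: ln_realpow)
  have "{p. prime p \<and> p \<le> n} = {p. prime p \<and> p \<le> m + 1} \<union> F" by (auto simp: F_def m)
  then have "(\<Sum>p | prime p \<and> p \<le> n. ln (real p)) = (\<Sum>p | prime p \<and> p \<le> m + 1. ln (real p)) + (\<Sum>p\<in>F. ln (real p))"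
   using finF by (simp add: F_def) (subst sum.union_disjoint, auto)
  also have "\<dots> \<le> real (m + 1) * ln 4 + real m * ln 4"
   using less[of "m + 1"] FF m m1 by (intro add_mono) auto
  also have "\<dots> = real n * ln 4" by (simp add: m algebra_simps)
  finally show ?thesis .
 qed
qed

lemma multiplicity_fact:
 fixes p :: nat
 assumes "prime p"
 shows "multiplicity p (fact N) = (\<Sum>k=1..N. N div p ^ k)"
proof -
 have mult: "multiplicity p (fact N) = (\<Sum>n=1..N. multiplicity p n)"
 proof (induction N)
  case (Suc N)
  have "multiplicity p (fact (Suc N)) = multiplicity p (Suc N) + multiplicity p (fact N)"
   using assms by (subst fact_Suc) (simp add: prime_elem_multiplicity_mult_distrib del: mult_Suc)
  then show ?case using Suc by simp
 qed auto
 have "multiplicity p n = (\<Sum>k=1..N. if p ^ k dvd n then 1 else 0)" if n: "n \<in> {1..N}" for n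
 proof -
  have "multiplicity p n \<le> N"
  proof -
   have "p ^ multiplicity p n \<le> n" using n by (intro dvd_imp_le multiplicity_dvd) auto
   moreover have "multiplicity p n < p ^ multiplicity p n"
    using prime_gt_1_nat[OF assms] by (simp add: power_gt_expt)
   ultimately show ?thesis using n by auto
  qed
  then have "{1..N} \<inter> {k. p ^ k dvd n} = {1..multiplicity p n}"
   using n prime_gt_1_nat[OF assms] by (auto simp: power_dvd_iff_le_multiplicity)
  then show ?thesis by (simp add: sum.If_cases)
 qed
 then have "(\<Sum>n=1..N. multiplicity p n) = (\<Sum>n=1..N. \<Sum>k=1..N. if p ^ k dvd n then 1 else 0)"
  by (intro sum.cong) auto
 also have "\<dots> = (\<Sum>k=1..N. \<Sum>n=1..N. if p ^ k dvd n then 1 else 0)" by (rule sum.swap)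
 also have "\<dots> = (\<Sum>k=1..N. N div p ^ k)"
 proof (rule sum.cong)
  fix k assume "k \<in> {1..N}"
  have q: "p ^ k > 0" using prime_gt_0_nat[OF assms] by simp
  have "{1..N} \<inter> {n. p ^ k dvd n} = (\<lambda>i. p ^ k * i) ` {1..N div p ^ k}"
  proof (intro equalityI subsetI)
   fix n assume "n \<in> {1..N} \<inter> {n. p ^ k dvd n}"
   then obtain i where i: "n = p ^ k * i" "1 \<le> n" "n \<le> N" by (auto elim!: dvdE simp del: One_nat_def)
   then have "i \<le> N div p ^ k" using q by (simp add: less_eq_div_iff_mult_less_eq mult.commute)
   moreover have "i \<ge> 1" using i by (cases i) auto
   ultimately show "n \<in> (\<lambda>i. p ^ k * i) ` {1..N div p ^ k}" using i by auto
  next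
   fix n assume "n \<in> (\<lambda>i. p ^ k * i) ` {1..N div p ^ k}"
   then obtain i where i: "n = p ^ k * i" "1 \<le> i" "i \<le> N div p ^ k" by (elim imageE) (metis atLeastAtMost_iff)
   then have "n \<le> N" using q by (simp add: less_eq_div_iff_mult_less_eq mult.commute)
   moreover have "n \<ge> 1" using i q by (simp add: Suc_le_eq)
   ultimately show "n \<in> {1..N} \<inter> {n. p ^ k dvd n}" using i by auto
  qed
  moreover have "card ((\<lambda>i. p ^ k * i) ` {1..N div p ^ k}) = N div p ^ k"
   using q by (subst card_image) (auto simp: inj_on_def)
  ultimately show "(\<Sum>n=1..N. if p ^ k dvd n then 1 else 0) = N div p ^ k"
   by (simp add: sum.If_cases)
 qed auto
 finally show ?thesis using mult by simp
qed

lemma ln_fact_eq_sum_primes: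
 "ln (fact N) = (\<Sum>p | prime p \<and> p \<le> N. real (multiplicity p (fact N :: nat)) * ln (real p))"
proof -
 have eq: "{p. prime p \<and> p \<le> N} = prime_factors (fact N)"
  by (auto simp: prime_factors_fact dest: prime_ge_2_nat)
 have "(fact N :: real) = real (fact N)" by simp
 also have "(fact N :: nat) = (\<Prod>p \<in> prime_factors (fact N). p ^ multiplicity p (fact N))"
  using prime_factorization_nat[of "fact N"] by simp
 finally have "ln (fact N) = ln (\<Prod>p \<in> prime_factors (fact N). real p ^ multiplicity p (fact N :: nat))"
  by simp
 also have "\<dots> = (\<Sum>p \<in> prime_factors (fact N). ln (real p ^ multiplicity p (fact N :: nat)))"
 proof (rule ln_prod)
  fix p :: nat assume "p \<in> prime_factors (fact N)"
  then have "p > 0" by (metis in_prime_factors_imp_prime prime_gt_0_nat)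
  then show "real p ^ multiplicity p (fact N :: nat) \<noteq> 0" by simp
 qed simp
 also have "\<dots> = (\<Sum>p \<in> prime_factors (fact N). real (multiplicity p (fact N :: nat)) * ln (real p))"
  by (intro sum.cong refl ln_realpow)
 finally show ?thesis by (simp add: eq)
qed

lemma ln_fact_le: "ln (fact N) \<le> real N * ln (real N)"
proof (cases "N = 0")
 case False
 have "(fact N :: real) \<le> real N ^ N" using fact_le_power[of N] by simp
 then have "ln (fact N) \<le> ln (real N ^ N)" using False by (subst ln_le_cancel_iff) auto
 then show ?thesis using False by (simp add: ln_realpow)
qed auto

lemma ln_fact_ge: "N > 0 \<Longrightarrow> ln (fact N) \<ge> real N * ln (real N) - real N"
proof -
 assume N: "N > 0"
 have "(\<Sum>n\<in>{N}. inverse (fact n) * real N ^ n) \<le> exp (real N)"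
  using summable_exp[of "real N"] sum_le_suminf[of "\<lambda>n. inverse (fact n) * real N ^ n" "{N}"] by (simp add: exp_def scaleR_conv_of_real field_simps)
 then have "real N ^ N \<le> exp (real N) * fact N" by (simp add: field_simps)
 then have "ln (real N ^ N) \<le> ln (exp (real N) * fact N)" using N by (subst ln_le_cancel_iff) auto
 then show ?thesis using N by (simp add: ln_realpow ln_mult)
qed

text \<open>Legendre's formula for \<open>N!\<close>, compared with Stirling's estimate
 \<open>ln N! = N ln N + O(N)\<close>, determines \<open>\<Sum> ln p / p\<close> up to a bounded error.\<close>

lemma mertens1_upper:
 assumes "x \<ge> 1"
 shows "(\<Sum>p\<in>primes_le x. ln (real p) / real p) \<le> ln x + ln 4"
proof -
 define N where "N = nat \<lfloor>x\<rfloor>"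
 have N: "N \<ge> 1" "real N \<le> x" using assms by (auto simp: N_def le_nat_iff le_floor_iff)
 have P: "primes_le x = {p. prime p \<and> p \<le> N}"
  using primes_le_floor[of x] assms unfolding N_def primes_le_of_nat by simp
 have fin: "finite {p::nat. prime p \<and> p \<le> N}" by simp
 have "(\<Sum>p | prime p \<and> p \<le> N. (real N / real p - 1) * ln (real p)) \<le> ln (fact N)"
  unfolding ln_fact_eq_sum_primes
 proof (intro sum_mono mult_right_mono)
  fix p assume p: "p \<in> {p. prime p \<and> p \<le> N}"
  have "N div p = (\<Sum>k\<in>{1}. N div p ^ k)" by simp
  also have "\<dots> \<le> (\<Sum>k=1..N. N div p ^ k)" using N by (intro sum_mono2) auto
  finally have "real (N div p) \<le> real (multiplicity p (fact N))"
   using p multiplicity_fact[of p N] by (metis mem_Collect_eq of_nat_le_iff)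
  moreover have "real N / real p - 1 \<le> real (N div p)"
  proof -
   have "real N = real (p * (N div p) + N mod p)" by (simp only: mult_div_mod_eq)
   also have "\<dots> = real p * real (N div p) + real (N mod p)" by (simp only: of_nat_add of_nat_mult)
   finally have "real N = real p * real (N div p) + real (N mod p)" .
   moreover have "N mod p < p" using p prime_gt_0_nat[of p] by simp
   ultimately have "real N < real p * (real (N div p) + 1)" unfolding distrib_left by simp
   then show ?thesis using p prime_gt_0_nat[of p] by (simp add: field_simps)
  qed
  ultimately show "real N / real p - 1 \<le> real (multiplicity p (fact N))" by simp
 next
  fix p assume "p \<in> {p. prime p \<and> p \<le> N}"
  then show "0 \<le> ln (real p)" using prime_ge_1_nat by simp
 qed
 also have "\<dots> \<le> real N * ln (real N)" by (rule ln_fact_le)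
 finally have *: "(\<Sum>p | prime p \<and> p \<le> N. (real N / real p - 1) * ln (real p)) \<le> real N * ln (real N)" .
 define S where "S = (\<Sum>p | prime p \<and> p \<le> N. ln (real p) / real p)"
 have "(\<Sum>p | prime p \<and> p \<le> N. (real N / real p - 1) * ln (real p))
    = (\<Sum>p | prime p \<and> p \<le> N. real N * (ln (real p) / real p) - ln (real p))"
  by (intro sum.cong refl) (simp add: left_diff_distrib)
 also have "\<dots> = real N * S - (\<Sum>p | prime p \<and> p \<le> N. ln (real p))"
  unfolding sum_subtractf sum_distrib_left S_def ..
 finally have "real N * S \<le> real N * ln (real N) + real N * ln 4"
  using theta_le[of N] * by linarith
 then have "real N * S \<le> real N * (ln (real N) + ln 4)" by (simp only: distrib_left)
 then have "S \<le> ln (real N) + ln 4"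
  by (rule mult_left_le_imp_le) (use N in simp)
 then show ?thesis unfolding P S_def by (rule order_trans) (use N in simp)
qed

lemma mertens1_lower:
 "\<exists>C. \<forall>x\<ge>1. (\<Sum>p\<in>primes_le x. ln (real p) / real p) \<ge> ln x - C"
proof -
 define f where "f = (\<lambda>n::nat. 2 * ln (real n) / (real n * real n))"
 have "summable f"
 proof (rule summable_comparison_test_bigo)
  show "summable (\<lambda>n. norm (real n powr (-3/2)))" by (simp add: summable_real_powr_iff)
  show "f \<in> O(\<lambda>n. real n powr (-3/2))" unfolding f_def by real_asymp
 qed
 moreover have "f n \<ge> 0" for n by (cases "n = 0") (auto simp: f_def)
 ultimately obtain C where C: "\<And>A. finite A \<Longrightarrow> sum f A \<le> C"
  using bounded_sums_of_summable[of f] by auto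
 show ?thesis
 proof (intro exI[of _ "C + 1 + ln 2"] allI impI)
  fix x :: real assume x: "x \<ge> 1"
  define N where "N = nat \<lfloor>x\<rfloor>"
  have N: "N \<ge> 1" "real N \<le> x" "x < real N + 1" using x unfolding N_def by linarith+
  have P: "primes_le x = {p. prime p \<and> p \<le> N}"
   using primes_le_floor[of x] x unfolding N_def primes_le_of_nat by simp
  have "real N * ln (real N) - real N \<le> ln (fact N)" using N by (intro ln_fact_ge) auto
  also have "\<dots> \<le> (\<Sum>p | prime p \<and> p \<le> N. real N * (ln (real p) / real p) + real N * f p)"
   unfolding ln_fact_eq_sum_primes
  proof (intro sum_mono)
   fix p assume p: "p \<in> {p. prime p \<and> p \<le> N}"
   then have p2: "real p \<ge> 2" using prime_ge_2_nat[of p] by simp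
   have "real (multiplicity p (fact N)) = (\<Sum>k=1..N. real (N div p ^ k))"
    using p by (simp only: mem_Collect_eq multiplicity_fact of_nat_sum)
   also have "\<dots> \<le> (\<Sum>k=1..N. real N * (1 / real p) ^ k)"
   proof (intro sum_mono)
    fix k
    have "real (N div p ^ k) \<le> real N / real (p ^ k)" by (rule of_nat_div_le_of_nat)
    then show "real (N div p ^ k) \<le> real N * (1 / real p) ^ k" by (simp add: power_one_over)
   qed
   also have "\<dots> \<le> real N * (1 / real p + 2 / (real p * real p))"
   proof -
    define y where "y = 1 / real p"
    have y: "0 < y" "y \<le> 1/2" using p2 by (auto simp: y_def)
    have "(\<Sum>k=1..N. y ^ k) = (y - y ^ Suc N) / (1 - y)" using y N by (subst sum_gp) auto
    also have "\<dots> \<le> y / (1 - y)" using y by (intro divide_right_mono) auto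
    also have "\<dots> \<le> y + 2 * y * y"
    proof -
     have "0 \<le> y * y * (1 - 2 * y)" using y by (intro mult_nonneg_nonneg) auto
     then show ?thesis using y by (simp add: divide_le_eq algebra_simps)
    qed
    finally have "(\<Sum>k=1..N. y ^ k) \<le> y + 2 * y * y" .
    then have "real N * (\<Sum>k=1..N. y ^ k) \<le> real N * (y + 2 * y * y)" by (intro mult_left_mono) auto
    then show ?thesis by (simp add: sum_distrib_left y_def)
   qed
   finally have "real (multiplicity p (fact N)) * ln (real p) \<le> real N * (1 / real p + 2 / (real p * real p)) * ln (real p)"
    using p2 by (intro mult_right_mono) auto
   moreover have "real N * (1 / real p + 2 / (real p * real p)) * ln (real p) = real N * (ln (real p) / real p) + real N * f p"
    by (simp add: f_def distrib_left distrib_right)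
   ultimately show "real (multiplicity p (fact N)) * ln (real p) \<le> real N * (ln (real p) / real p) + real N * f p"
    by linarith
  qed
  also have "\<dots> = real N * ((\<Sum>p | prime p \<and> p \<le> N. ln (real p) / real p) + sum f {p. prime p \<and> p \<le> N})"
   by (simp only: sum.distrib sum_distrib_left distrib_left)
  also have "\<dots> \<le> real N * ((\<Sum>p | prime p \<and> p \<le> N. ln (real p) / real p) + C)"
   by (intro mult_left_mono add_left_mono C) auto
  finally have "real N * (ln (real N) - 1) \<le> real N * ((\<Sum>p | prime p \<and> p \<le> N. ln (real p) / real p) + C)"
   by (simp only: right_diff_distrib mult_1_right)
  then have *: "ln (real N) - 1 \<le> (\<Sum>p | prime p \<and> p \<le> N. ln (real p) / real p) + C"
   by (rule mult_left_le_imp_le) (use N in simp)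
  have "ln x \<le> ln (2 * real N)" using N x by (subst ln_le_cancel_iff) linarith+
  also have "\<dots> = ln 2 + ln (real N)" using N by (simp add: ln_mult)
  finally have "ln x - (C + 1 + ln 2) \<le> ln (real N) - 1 - C" by simp
  also have "\<dots> \<le> (\<Sum>p\<in>primes_le x. ln (real p) / real p)" using * unfolding P by (simp only: diff_le_eq)
  finally show "(\<Sum>p\<in>primes_le x. ln (real p) / real p) \<ge> ln x - (C + 1 + ln 2)" .
 qed
qed

text \<open>The sums \<open>\<Sum> ln p / p\<close> up to \<open>x\<close> and up to \<open>c x\<close> differ by a positive constant when \<open>c\<close> is small,
so that a positive proportion of the weight lies on primes of size comparable to \<open>x\<close>.\<close>

lemma prime_pi_lower:
 "\<exists>c>0. \<forall>x\<ge>2. real (prime_pi x) \<ge> c * x / ln x"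
proof -
 obtain C0 where C0: "\<And>x. x \<ge> 1 \<Longrightarrow> (\<Sum>p\<in>primes_le x. ln (real p) / real p) \<ge> ln x - C0"
  using mertens1_lower by auto
 define C where "C = max C0 0"
 have C: "C \<ge> 0" "\<And>x. x \<ge> 1 \<Longrightarrow> (\<Sum>p\<in>primes_le x. ln (real p) / real p) \<ge> ln x - C"
 proof -
  show "C \<ge> 0" by (simp add: C_def)
  fix x :: real assume "x \<ge> 1"
  have "ln x - C \<le> ln x - C0" by (simp add: C_def)
  also note C0[OF \<open>x \<ge> 1\<close>]
  finally show "(\<Sum>p\<in>primes_le x. ln (real p) / real p) \<ge> ln x - C" .
 qed
 define B where "B = exp (C + ln 4 + 1)"
 have B: "B \<ge> 2" "ln B = C + ln 4 + 1"
 proof -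
  have "ln (2::real) \<le> ln 4" by simp
  then have "ln 2 \<le> C + ln 4 + 1" using C by linarith
  then show "B \<ge> 2" unfolding B_def by (metis exp_le_cancel_iff exp_ln zero_less_numeral)
  show "ln B = C + ln 4 + 1" by (simp add: B_def)
 qed
 have pi_eq: "prime_pi x = card (primes_le x)" for x by (simp add: prime_pi_def primes_le_def)
 show ?thesis
 proof (intro exI[of _ "ln 2 / B"] conjI allI impI)
  show "ln 2 / B > 0" using B by auto
  fix x :: real assume x: "x \<ge> 2"
  have lx: "ln x > 0" using x by simp
  show "ln 2 / B * x / ln x \<le> real (prime_pi x)"
  proof (cases "x \<ge> B")
   case False
   have "2 \<in> primes_le x" using x by (simp add: primes_le_iff)
   then have "card (primes_le x) > 0" by (subst card_gt_0_iff) auto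
   then have "1 \<le> real (prime_pi x)" by (simp add: pi_eq)
   moreover have "ln 2 / B * x / ln x \<le> 1"
   proof -
    have "ln 2 * x \<le> ln x * B" using x False B by (intro mult_mono) auto
    then show ?thesis using B lx by (simp add: field_simps)
   qed
   ultimately show ?thesis by linarith
  next
   case True
   have sub: "primes_le (x / B) \<subseteq> primes_le x"
    using B x by (intro primes_le_mono) (auto simp: field_simps mult_le_cancel_left1)
   have "1 \<le> (\<Sum>p\<in>primes_le x. ln (real p) / real p) - (\<Sum>p\<in>primes_le (x/B). ln (real p) / real p)"
    using C(2)[of x] mertens1_upper[of "x/B"] True B x by (simp add: ln_div)
   also have "\<dots> = (\<Sum>p\<in>primes_le x - primes_le (x/B). ln (real p) / real p)"
    using sub by (subst sum_diff) auto
   also have "\<dots> \<le> (\<Sum>p\<in>primes_le x - primes_le (x/B). ln x * (B / x))"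
   proof (intro sum_mono)
    fix p assume "p \<in> primes_le x - primes_le (x/B)"
    then have p: "prime p" "real p \<le> x" "real p > x / B" by (auto simp: primes_le_iff)
    have p0: "real p \<ge> 1" using p prime_ge_1_nat by simp
    have "ln (real p) / real p = ln (real p) * (1 / real p)" by simp
    also have "\<dots> \<le> ln x * (B / x)"
    proof (rule mult_mono)
     show "1 / real p \<le> B / x" using p p0 B x by (simp add: field_simps)
    qed (use p p0 x in auto)
    finally show "ln (real p) / real p \<le> ln x * (B / x)" .
   qed
   also have "\<dots> = real (card (primes_le x - primes_le (x/B))) * (ln x * (B / x))" by simp
   also have "\<dots> \<le> real (card (primes_le x)) * (ln x * (B / x))"
    using B x by (intro mult_right_mono of_nat_mono card_mono) auto
   finally have "1 \<le> real (prime_pi x) * (ln x * (B / x))" by (simp add: pi_eq)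
   then have "1 / B * x / ln x \<le> real (prime_pi x)" using B x lx by (simp add: field_simps)
   moreover have "ln 2 / B * x / ln x \<le> 1 / B * x / ln x"
    using ln_2_less_1 B x lx by (intro divide_right_mono mult_right_mono) auto
   ultimately show ?thesis by linarith
  qed
 qed
qed

text \<open>Partial summation, in the form that only the partial sums need to be compared.\<close>

lemma abel_domination:
 fixes a b w :: "nat \<Rightarrow> real"
 assumes "\<And>n. n \<le> N \<Longrightarrow> (\<Sum>k\<le>n. a k) \<le> (\<Sum>k\<le>n. b k)"
  and "\<And>n. n < N \<Longrightarrow> w (Suc n) \<le> w n" and "\<And>n. n \<le> N \<Longrightarrow> w n \<ge> 0"
 shows "(\<Sum>k\<le>N. a k * w k) \<le> (\<Sum>k\<le>N. b k * w k)"
proof -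
 have "((\<Sum>k\<le>n. b k) - (\<Sum>k\<le>n. a k)) * w n \<le> (\<Sum>k\<le>n. b k * w k) - (\<Sum>k\<le>n. a k * w k)" if "n \<le> N" for n
  using that
 proof (induction n)
  case (Suc n)
  have "((\<Sum>k\<le>n. b k) - (\<Sum>k\<le>n. a k)) * w (Suc n) \<le> ((\<Sum>k\<le>n. b k) - (\<Sum>k\<le>n. a k)) * w n"
   using Suc.prems assms(1)[of n] assms(2)[of n] by (intro mult_left_mono) auto
  then show ?case using Suc by (simp add: algebra_simps)
 qed (simp add: algebra_simps)
 from this[of N] have "0 \<le> (\<Sum>k\<le>N. b k * w k) - (\<Sum>k\<le>N. a k * w k)"
  using assms(1)[of N] assms(3)[of N] mult_nonneg_nonneg[of "(\<Sum>k\<le>N. b k) - (\<Sum>k\<le>N. a k)" "w N"] by linarith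
 then show ?thesis by simp
qed

lemma sum_primes_le_shift:
 fixes f :: "nat \<Rightarrow> real"
 shows "(\<Sum>p\<in>primes_le (real (n + 2)). f p) = (\<Sum>k\<le>n. if prime (k + 2) then f (k + 2) else 0)"
proof -
 have "primes_le (real (n + 2)) = (\<lambda>k. k + 2) ` ({..n} \<inter> {k. prime (k + 2)})"
 proof (intro equalityI subsetI)
  fix p assume p: "p \<in> primes_le (real (n + 2))"
  then have "p \<ge> 2" "prime p" "p \<le> n + 2" using prime_ge_2_nat by (auto simp only: primes_le_of_nat)
  then have "p = (p - 2) + 2" "p - 2 \<le> n" by auto
  then show "p \<in> (\<lambda>k. k + 2) ` ({..n} \<inter> {k. prime (k + 2)})" using \<open>prime p\<close> by (metis (mono_tags, lifting) IntI atMost_iff imageI mem_Collect_eq)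
 next
  fix p assume "p \<in> (\<lambda>k. k + 2) ` ({..n} \<inter> {k. prime (k + 2)})"
  then show "p \<in> primes_le (real (n + 2))" unfolding primes_le_of_nat by auto
 qed
 then have "(\<Sum>p\<in>primes_le (real (n + 2)). f p) = (\<Sum>k\<in>{..n} \<inter> {k. prime (k + 2)}. f (k + 2))"
  by (simp add: sum.reindex inj_on_def)
 also have "\<dots> = (\<Sum>k\<le>n. if prime (k + 2) then f (k + 2) else 0)"
  by (simp add: sum.If_cases)
 finally show ?thesis .
qed

lemma ln_diff_div_ln_bounds:
 fixes n :: real
 assumes "n \<ge> 3"
 shows "(ln n - ln (n - 1)) / ln n \<le> ln (ln n) - ln (ln (n - 1))"
  and "ln (ln (n + 1)) - ln (ln n) \<le> (ln n - ln (n - 1)) / ln n"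
proof -
 have pos: "ln (n - 1) > 0" "ln n > 0" "ln (n + 1) > 0" using assms by auto
 have "ln (ln (n - 1) / ln n) \<le> ln (n - 1) / ln n - 1" using pos by (intro ln_le_minus_one) auto
 then show "(ln n - ln (n - 1)) / ln n \<le> ln (ln n) - ln (ln (n - 1))"
  using pos by (simp add: ln_div field_simps)
 have "ln (ln (n + 1) / ln n) \<le> ln (n + 1) / ln n - 1" using pos by (intro ln_le_minus_one) auto
 also have "\<dots> = (ln (n + 1) - ln n) / ln n" using pos by (simp add: field_simps)
 also have "\<dots> \<le> (ln n - ln (n - 1)) / ln n"
 proof (rule divide_right_mono)
  have "ln (n + 1) + ln (n - 1) = ln ((n + 1) * (n - 1))" using assms by (simp add: ln_mult)
  also have "\<dots> \<le> ln (n * n)"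
  proof (subst ln_le_cancel_iff)
   show "(n + 1) * (n - 1) > 0" using assms by (intro mult_pos_pos) auto
  qed (use assms in \<open>auto simp: algebra_simps\<close>)
  also have "\<dots> = ln n + ln n" using assms by (simp add: ln_mult)
  finally show "ln (n + 1) - ln n \<le> ln n - ln (n - 1)" by simp
 qed (use pos in auto)
 finally show "ln (ln (n + 1)) - ln (ln n) \<le> (ln n - ln (n - 1)) / ln n"
  using pos by (simp add: ln_div)
qed

lemma sum_inverse_ln_telescope:
 "(\<Sum>k\<le>n. (if k = 0 then c else ln (real k + 2) - ln (real k + 1)) * (1 / ln (real k + 2)))
  \<le> c / ln 2 + ln (ln (real n + 2)) - ln (ln 2)"
 "(\<Sum>k\<le>n. (if k = 0 then c else ln (real k + 2) - ln (real k + 1)) * (1 / ln (real k + 2)))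
  \<ge> c / ln 2 + ln (ln (real n + 3)) - ln (ln 3)"
proof (induction n)
 case (Suc n)
 have e: "real (Suc n) + 2 = real n + 3" "real (Suc n) + 1 = real n + 3 - 1" "real (Suc n) + 3 = real n + 3 + 1" by auto
 { case 1 show ?case using Suc.IH(1) ln_diff_div_ln_bounds(1)[of "real n + 3"] unfolding sum.atMost_Suc e by (simp add: add.commute) }
 { case 2 show ?case using Suc.IH(2) ln_diff_div_ln_bounds(2)[of "real n + 3"] unfolding sum.atMost_Suc e by (simp add: add.commute) }
qed auto

lemma sum_diff_ln: "(\<Sum>k\<le>n. (if k = 0 then c else ln (real k + 2) - ln (real k + 1))) = c + ln (real n + 2) - ln 2"
 by (induction n) (auto simp: add.commute)

lemma ln_ln_floor_bounds:
 assumes "x \<ge> 2"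
 obtains n :: nat where "primes_le x = primes_le (real (n + 2))" "ln (ln (real n + 2)) \<le> ln (ln x)"
  "ln (ln x) \<le> ln (ln (real n + 3))"
proof -
 define N where "N = nat \<lfloor>x\<rfloor>"
 have N: "N \<ge> 2" "real N \<le> x" "x \<le> real N + 1" using assms by (auto simp: N_def le_nat_iff le_floor_iff)
 define n where "n = N - 2"
 have fl: "N = n + 2" using N by (auto simp: n_def)
 have "real n + 2 \<le> x" "x \<le> real n + 3" using N unfolding fl by auto
 moreover have "primes_le x = primes_le (real (n + 2))" using primes_le_floor[of x] assms fl unfolding N_def by simp
 moreover have "ln (ln (real n + 2)) \<le> ln (ln x)"
 proof -
  have "ln (real n + 2) \<le> ln x" using \<open>real n + 2 \<le> x\<close> by (subst ln_le_cancel_iff) auto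
  then show ?thesis by (subst ln_le_cancel_iff) (use assms in auto)
 qed
 moreover have "ln (ln x) \<le> ln (ln (real n + 3))"
 proof -
  have "ln x \<le> ln (real n + 3)" using \<open>x \<le> real n + 3\<close> assms by (subst ln_le_cancel_iff) auto
  then show ?thesis by (subst ln_le_cancel_iff) (use assms in auto)
 qed
 ultimately show ?thesis by (intro that[of n])
qed

lemma sum_recip_primes_eq:
 "(\<Sum>p\<in>primes_le (real (n + 2)). 1 / real p)
  = (\<Sum>k\<le>n. (if prime (k + 2) then ln (real (k + 2)) / real (k + 2) else 0) * (1 / ln (real k + 2)))"
proof -
 have "ln (real k + 2) > 0" for k by (intro ln_gt_zero) auto
 then have ne: "ln (real k + 2) \<noteq> 0" for k by (simp add: less_imp_neq[symmetric])
 show ?thesis unfolding sum_primes_le_shift by (intro sum.cong) (use ne in \<open>auto simp: add.commute\<close>)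
qed

text \<open>Partial summation with the weight \<open>1 / ln p\<close>, against the sequence \<open>ln (k + 2) - ln (k + 1)\<close> that has
the same partial sums up to \<open>O(1)\<close>.\<close>

theorem mertens2_upper:
 "\<exists>C. \<forall>x\<ge>2. (\<Sum>p\<in>primes_le x. 1 / real p) \<le> ln (ln x) + C"
proof (intro exI allI impI)
 fix x :: real assume "x \<ge> 2"
 then obtain n where n: "primes_le x = primes_le (real (n + 2))" "ln (ln (real n + 2)) \<le> ln (ln x)"
  by (rule ln_ln_floor_bounds)
 have "(\<Sum>p\<in>primes_le x. 1 / real p)
    \<le> (\<Sum>k\<le>n. (if k = 0 then ln 2 + ln 4 else ln (real k + 2) - ln (real k + 1)) * (1 / ln (real k + 2)))"
  unfolding n sum_recip_primes_eq
 proof (rule abel_domination)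
  fix m assume "m \<le> n"
  show "(\<Sum>k\<le>m. if prime (k + 2) then ln (real (k + 2)) / real (k + 2) else 0)
     \<le> (\<Sum>k\<le>m. if k = 0 then ln 2 + ln 4 else ln (real k + 2) - ln (real k + 1))"
   using mertens1_upper[of "real (m + 2)"] unfolding sum_primes_le_shift sum_diff_ln by (simp add: add.commute)
 qed (auto simp: divide_simps)
 also have "\<dots> \<le> (ln 2 + ln 4) / ln 2 + ln (ln (real n + 2)) - ln (ln 2)" by (rule sum_inverse_ln_telescope)
 also have "\<dots> \<le> ln (ln x) + ((ln 2 + ln 4) / ln 2 - ln (ln 2))" using n by simp
 finally show "(\<Sum>p\<in>primes_le x. 1 / real p) \<le> ln (ln x) + ((ln 2 + ln 4) / ln 2 - ln (ln 2))" .
qed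

theorem mertens2_lower:
 "\<exists>C. \<forall>x\<ge>2. (\<Sum>p\<in>primes_le x. 1 / real p) \<ge> ln (ln x) - C"
proof -
 obtain C where C: "\<And>x. x \<ge> 1 \<Longrightarrow> (\<Sum>p\<in>primes_le x. ln (real p) / real p) \<ge> ln x - C"
  using mertens1_lower by auto
 show ?thesis
 proof (intro exI allI impI)
 fix x :: real assume "x \<ge> 2"
 then obtain n where n: "primes_le x = primes_le (real (n + 2))" "ln (ln x) \<le> ln (ln (real n + 3))"
  by (rule ln_ln_floor_bounds)
 have "(\<Sum>p\<in>primes_le x. 1 / real p)
    \<ge> (\<Sum>k\<le>n. (if k = 0 then ln 2 - C else ln (real k + 2) - ln (real k + 1)) * (1 / ln (real k + 2)))"
  unfolding n sum_recip_primes_eq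
 proof (rule abel_domination)
  fix m assume "m \<le> n"
  show "(\<Sum>k\<le>m. if prime (k + 2) then ln (real (k + 2)) / real (k + 2) else 0)
     \<ge> (\<Sum>k\<le>m. if k = 0 then ln 2 - C else ln (real k + 2) - ln (real k + 1))"
   using C[of "real (m + 2)"] unfolding sum_primes_le_shift sum_diff_ln by (simp add: add.commute)
 qed (auto simp: divide_simps)
 moreover have "(\<Sum>k\<le>n. (if k = 0 then ln 2 - C else ln (real k + 2) - ln (real k + 1)) * (1 / ln (real k + 2)))
   \<ge> (ln 2 - C) / ln 2 + ln (ln (real n + 3)) - ln (ln 3)" by (rule sum_inverse_ln_telescope)
 ultimately show "(\<Sum>p\<in>primes_le x. 1 / real p) \<ge> ln (ln x) - (ln (ln 3) - (ln 2 - C) / ln 2)"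
  using n by simp
 qed
qed

section \<open>The sieve of Brun and Hooley\<close>

definition esym :: "('a \<Rightarrow> real) \<Rightarrow> 'a set \<Rightarrow> nat \<Rightarrow> real" where
 "esym f R k = (\<Sum>S | S \<subseteq> R \<and> card S = k. \<Prod>x\<in>S. f x)"

definition subs :: "'a set \<Rightarrow> nat \<Rightarrow> 'a set set" where
 "subs R b = {S. S \<subseteq> R \<and> card S < b}"

text \<open>The truncated inclusion--exclusion sum; for the sign \<open>- f\<close> it approximates \<open>\<Prod>(1 - f x)\<close>.\<close>

definition psum :: "('a \<Rightarrow> real) \<Rightarrow> 'a set \<Rightarrow> nat \<Rightarrow> real" where
 "psum f R b = (\<Sum>S\<in>subs R b. \<Prod>x\<in>S. f x)"

lemma finite_subs [simp]: "finite R \<Longrightarrow> finite (subs R b)"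
 unfolding subs_def by (rule finite_subset[of _ "Pow R"]) auto

lemma subs_0 [simp]: "subs R 0 = {}" by (simp add: subs_def)

lemma sum_subsets_insert:
 fixes f :: "'a \<Rightarrow> real"
 assumes "finite R" "x \<notin> R"
 shows "(\<Sum>S | S \<subseteq> insert x R \<and> P (card S). \<Prod>y\<in>S. f y)
   = (\<Sum>S | S \<subseteq> R \<and> P (card S). \<Prod>y\<in>S. f y)
    + f x * (\<Sum>S | S \<subseteq> R \<and> P (Suc (card S)). \<Prod>y\<in>S. f y)"
proof -
 have fin: "finite {S. S \<subseteq> R \<and> Q S}" for Q
  by (rule finite_subset[of _ "Pow R"]) (use assms in auto)
 have eq: "{S. S \<subseteq> insert x R \<and> P (card S)}
   = {S. S \<subseteq> R \<and> P (card S)} \<union> insert x ` {S. S \<subseteq> R \<and> P (Suc (card S))}" (is "?L = ?A \<union> ?B")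
 proof (intro equalityI subsetI)
  fix S assume S: "S \<in> ?L"
  show "S \<in> ?A \<union> ?B"
  proof (cases "x \<in> S")
   case True
   then have "S = insert x (S - {x})" "S - {x} \<subseteq> R" using S by auto
   moreover have "card S = Suc (card (S - {x}))"
    using True S assms finite_subset[of S "insert x R"] by (metis (no_types, lifting) card.remove finite_insert mem_Collect_eq)
   ultimately show ?thesis using S by (auto intro!: image_eqI[of _ _ "S - {x}"])
  next
   case False
   then show ?thesis using S by auto
  qed
 next
  fix S assume "S \<in> ?A \<union> ?B"
  then show "S \<in> ?L"
  proof
   assume "S \<in> ?B"
   then obtain T where T: "S = insert x T" "T \<subseteq> R" "P (Suc (card T))" by auto
   then have "card S = Suc (card T)" using assms finite_subset[of T R] by (subst T(1), subst card_insert_disjoint) auto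
   then show ?thesis using T by auto
  qed auto
 qed
 have disj: "?A \<inter> ?B = {}" using assms by auto
 have inj: "inj_on (insert x) {S. S \<subseteq> R \<and> P (Suc (card S))}"
  using assms by (auto simp: inj_on_def)
 have "(\<Sum>S\<in>?B. \<Prod>y\<in>S. f y) = (\<Sum>S | S \<subseteq> R \<and> P (Suc (card S)). \<Prod>y\<in>insert x S. f y)"
  using inj by (simp add: sum.reindex)
 also have "\<dots> = (\<Sum>S | S \<subseteq> R \<and> P (Suc (card S)). f x * (\<Prod>y\<in>S. f y))"
 proof (rule sum.cong)
  fix S assume "S \<in> {S. S \<subseteq> R \<and> P (Suc (card S))}"
  then have "finite S" "x \<notin> S" using assms finite_subset by auto
  then show "(\<Prod>y\<in>insert x S. f y) = f x * (\<Prod>y\<in>S. f y)" by simp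
 qed auto
 finally show ?thesis unfolding eq using fin disj
  by (subst sum.union_disjoint) (auto simp: sum_distrib_left)
qed

lemma esym_insert:
 "finite R \<Longrightarrow> x \<notin> R \<Longrightarrow> esym f (insert x R) (Suc k) = esym f R (Suc k) + f x * esym f R k"
 using sum_subsets_insert[where R = R and x = x and P = "\<lambda>c. c = Suc k" and f = f] by (simp add: esym_def)

lemma psum_insert:
 "finite R \<Longrightarrow> x \<notin> R \<Longrightarrow> psum f (insert x R) (Suc b) = psum f R (Suc b) + f x * psum f R b"
 using sum_subsets_insert[where R = R and x = x and P = "\<lambda>c. c < Suc b" and f = f] by (simp add: psum_def subs_def)

lemma esym_0: "finite R \<Longrightarrow> esym f R 0 = 1"
proof -
 assume fin: "finite R"
 have "S = {}" if "S \<subseteq> R" "card S = 0" for S using that fin rev_finite_subset[of R S] by simp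
 then have "{S. S \<subseteq> R \<and> card S = 0} = {{}}" by auto
 then show ?thesis by (simp add: esym_def)
qed

lemma esym_empty_Suc: "esym f {} (Suc k) = 0"
proof -
 have "{S. S \<subseteq> {} \<and> card S = Suc k} = {}" by auto
 then show ?thesis by (simp add: esym_def)
qed

lemma psum_0 [simp]: "psum f R 0 = 0" by (simp add: psum_def)

lemma psum_empty_Suc:
 fixes f :: "'a \<Rightarrow> real"
 shows "psum f {} (Suc b) = 1"
proof -
 have "subs ({} :: 'a set) (Suc b) = {{}}" by (auto simp: subs_def)
 then show ?thesis by (simp add: psum_def)
qed

lemma power_Suc_add_ge:
 fixes s t :: real
 assumes "s \<ge> 0" "t \<ge> 0"
 shows "s ^ Suc k + real (Suc k) * t * s ^ k \<le> (t + s) ^ Suc k"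
proof (induction k)
 case (Suc k)
 have "s ^ Suc (Suc k) + real (Suc (Suc k)) * t * s ^ Suc k
   \<le> (t + s) * (s ^ Suc k + real (Suc k) * t * s ^ k)"
  using assms by (simp add: algebra_simps)
 also have "\<dots> \<le> (t + s) * (t + s) ^ Suc k" using assms Suc by (intro mult_left_mono) auto
 finally show ?case by simp
qed auto

text \<open>Expanding the power of the sum counts every \<open>k\<close>-subset \<open>k!\<close> times.\<close>

lemma esym_le:
 assumes "finite R" "\<And>x. x \<in> R \<Longrightarrow> f x \<ge> 0"
 shows "esym f R k \<le> sum f R ^ k / fact k"
 using assms
proof (induction R arbitrary: k rule: finite_induct)
 case empty
 then show ?case by (cases k) (auto simp: esym_0 esym_empty_Suc)
next
 case (insert x R)
 show ?case
 proof (cases k)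
  case 0
  then show ?thesis using insert by (simp add: esym_0)
 next
  case (Suc j)
  have s: "sum f R \<ge> 0" and t: "f x \<ge> 0" using insert by (auto intro: sum_nonneg)
  have "esym f (insert x R) k = esym f R (Suc j) + f x * esym f R j"
   using insert Suc by (simp add: esym_insert)
  also have "\<dots> \<le> sum f R ^ Suc j / fact (Suc j) + f x * (sum f R ^ j / fact j)"
   using insert t by (intro add_mono mult_left_mono insert.IH) auto
  also have "\<dots> = (sum f R ^ Suc j + real (Suc j) * f x * sum f R ^ j) / fact (Suc j)"
  proof -
   have "f x * (sum f R ^ j / fact j) = real (Suc j) * f x * sum f R ^ j / fact (Suc j)"
    unfolding fact_Suc of_nat_mult by (simp del: of_nat_Suc)
   then show ?thesis by (simp only: add_divide_distrib)
  qed
  also have "\<dots> \<le> (f x + sum f R) ^ Suc j / fact (Suc j)"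
   by (intro divide_right_mono power_Suc_add_ge s t) auto
  finally show ?thesis using insert Suc by simp
 qed
qed

text \<open>Bonferroni's inequalities: the truncations of \<open>\<Prod>(1 - f x)\<close> lie alternately above and below
 it, and differ from it by at most the first omitted term.\<close>

lemma bonferroni_sign:
 assumes "finite R" "\<And>x. x \<in> R \<Longrightarrow> 0 \<le> f x \<and> f x \<le> 1"
 shows "(odd b \<longrightarrow> (\<Prod>x\<in>R. 1 - f x) \<le> psum (\<lambda>x. - f x) R b)
   \<and> (even b \<longrightarrow> psum (\<lambda>x. - f x) R b \<le> (\<Prod>x\<in>R. 1 - f x))"
 using assms
proof (induction R arbitrary: b rule: finite_induct)
 case empty
 then show ?case by (cases b) (auto simp: psum_empty_Suc)
next
 case (insert x R)
 have pos: "(\<Prod>y\<in>R. 1 - f y) \<ge> 0" using insert by (intro prod_nonneg) auto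
 show ?case
 proof (cases b)
  case 0
  have "(\<Prod>y\<in>insert x R. 1 - f y) \<ge> 0" using insert.prems by (intro prod_nonneg) auto
  then show ?thesis using 0 by simp
 next
  case (Suc c)
  have rec: "psum (\<lambda>x. - f x) (insert x R) b = psum (\<lambda>x. - f x) R (Suc c) - f x * psum (\<lambda>x. - f x) R c"
   using insert Suc by (simp add: psum_insert)
  have pr: "(\<Prod>y\<in>insert x R. 1 - f y) = (\<Prod>y\<in>R. 1 - f y) - f x * (\<Prod>y\<in>R. 1 - f y)"
   using insert by (simp add: algebra_simps)
  have IH: "(odd b \<longrightarrow> (\<Prod>x\<in>R. 1 - f x) \<le> psum (\<lambda>x. - f x) R b)
   \<and> (even b \<longrightarrow> psum (\<lambda>x. - f x) R b \<le> (\<Prod>x\<in>R. 1 - f x))" for b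
   using insert by blast
  have fx: "f x \<ge> 0" using insert by auto
  show ?thesis
  proof (intro conjI impI)
   assume "odd b"
   then have "f x * psum (\<lambda>x. - f x) R c \<le> f x * (\<Prod>y\<in>R. 1 - f y)"
    using IH[of c] Suc fx by (intro mult_left_mono) auto
   then show "(\<Prod>y\<in>insert x R. 1 - f y) \<le> psum (\<lambda>x. - f x) (insert x R) b"
    unfolding rec pr using IH[of "Suc c"] \<open>odd b\<close> Suc by auto
  next
   assume "even b"
   then have "f x * psum (\<lambda>x. - f x) R c \<ge> f x * (\<Prod>y\<in>R. 1 - f y)"
    using IH[of c] Suc fx by (intro mult_left_mono) auto
   then show "(\<Prod>y\<in>insert x R. 1 - f y) \<ge> psum (\<lambda>x. - f x) (insert x R) b"
    unfolding rec pr using IH[of "Suc c"] \<open>even b\<close> Suc by auto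
  qed
 qed
qed

lemma bonferroni_error:
 assumes "finite R" "\<And>x. x \<in> R \<Longrightarrow> 0 \<le> f x \<and> f x \<le> 1"
 shows "\<bar>psum (\<lambda>x. - f x) R b - (\<Prod>x\<in>R. 1 - f x)\<bar> \<le> esym f R b"
 using assms
proof (induction R arbitrary: b rule: finite_induct)
 case empty
 then show ?case by (cases b) (auto simp: psum_empty_Suc esym_0 esym_empty_Suc)
next
 case (insert x R)
 show ?case
 proof (cases b)
  case 0
  have "0 \<le> (\<Prod>y\<in>insert x R. 1 - f y)" "(\<Prod>y\<in>insert x R. 1 - f y) \<le> 1"
   using insert.prems by (auto intro!: prod_nonneg prod_le_1 simp del: prod.insert)
  then show ?thesis using 0 insert by (simp add: esym_0 del: prod.insert)
 next
  case (Suc c)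
  let ?P = "\<Prod>y\<in>R. 1 - f y"
  have "psum (\<lambda>x. - f x) (insert x R) b - (\<Prod>y\<in>insert x R. 1 - f y)
    = (psum (\<lambda>x. - f x) R (Suc c) - ?P) - f x * (psum (\<lambda>x. - f x) R c - ?P)"
   using insert Suc by (simp add: psum_insert algebra_simps)
  also have "\<bar>\<dots>\<bar> \<le> \<bar>psum (\<lambda>x. - f x) R (Suc c) - ?P\<bar> + \<bar>f x * (psum (\<lambda>x. - f x) R c - ?P)\<bar>"
   by (rule abs_triangle_ineq4)
  also have "\<dots> = \<bar>psum (\<lambda>x. - f x) R (Suc c) - ?P\<bar> + f x * \<bar>psum (\<lambda>x. - f x) R c - ?P\<bar>"
   using insert by (simp add: abs_mult)
  also have "\<dots> \<le> esym f R (Suc c) + f x * esym f R c"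
   using insert by (intro add_mono mult_left_mono insert.IH) auto
  also have "\<dots> = esym f (insert x R) b" using insert Suc by (simp add: esym_insert)
  finally show ?thesis .
 qed
qed

lemma psum_const_le:
 assumes "finite R"
 shows "psum (\<lambda>_. 3) R b \<le> (1 + 3 * real (card R)) ^ b"
 using assms
proof (induction R arbitrary: b rule: finite_induct)
 case empty
 then show ?case by (cases b) (auto simp: psum_empty_Suc)
next
 case (insert x R)
 show ?case
 proof (cases b)
  case (Suc c)
  define a where "a = 1 + 3 * real (card R)"
  have a: "a \<ge> 1" by (simp add: a_def)
  have "psum (\<lambda>_. 3) (insert x R) b \<le> a ^ Suc c + 3 * a ^ c"
   using insert Suc by (simp add: psum_insert) (metis a_def add_mono insert.IH mult_left_mono power_Suc zero_le_numeral)
  also have "\<dots> = (a + 3) * a ^ c" by (simp add: algebra_simps)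
  also have "\<dots> \<le> (a + 3) * (a + 3) ^ c" using a by (intro mult_left_mono power_mono) auto
  finally show ?thesis using insert Suc by (simp add: a_def)
 qed auto
qed

lemma card_residue_class:
 assumes "q > (0::nat)"
 shows "\<bar>real (card {n\<in>{1..H}. [n = r] (mod q)}) - real H / real q\<bar> \<le> 1"
proof -
 define s where "s = r mod q"
 have s: "s < q" using assms by (simp add: s_def)
 have A: "{n\<in>{1..H}. [n = r] (mod q)} = (\<lambda>k. k * q + s) ` {k. 1 \<le> k * q + s \<and> k * q + s \<le> H}"
 proof (intro equalityI subsetI)
  fix n assume n: "n \<in> {n\<in>{1..H}. [n = r] (mod q)}"
  then have "n = (n div q) * q + s" by (auto simp: cong_def s_def) (metis div_mult_mod_eq)
  then show "n \<in> (\<lambda>k. k * q + s) ` {k. 1 \<le> k * q + s \<and> k * q + s \<le> H}"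
   using n by (intro image_eqI[of _ _ "n div q"]) auto
 next
  fix n assume "n \<in> (\<lambda>k. k * q + s) ` {k. 1 \<le> k * q + s \<and> k * q + s \<le> H}"
  then show "n \<in> {n\<in>{1..H}. [n = r] (mod q)}" using s by (auto simp: cong_def s_def)
 qed
 have "card {n\<in>{1..H}. [n = r] (mod q)} = card {k. 1 \<le> k * q + s \<and> k * q + s \<le> H}"
  unfolding A using assms by (intro card_image) (auto simp: inj_on_def)
 also have "\<bar>real \<dots> - real H / real q\<bar> \<le> 1"
 proof -
  have fl: "real (m div q) \<le> real m / real q" "real m / real q < real (m div q) + 1" for m
  proof -
   show "real (m div q) \<le> real m / real q" by (rule of_nat_div_le_of_nat)
   have "real m = real (m div q * q + m mod q)" by (simp only: div_mult_mod_eq)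
   then have "real m = real (m div q) * real q + real (m mod q)" by (simp only: of_nat_add of_nat_mult)
   moreover have "m mod q < q" using assms by simp
   ultimately have "real m < (real (m div q) + 1) * real q" unfolding distrib_right by simp
   then show "real m / real q < real (m div q) + 1" using assms by (simp add: divide_less_eq)
  qed
  consider "s = 0" | "s > 0" "H < s" | "s > 0" "s \<le> H" by linarith
  then show ?thesis
  proof cases
   case 1
   have "{k. 1 \<le> k * q + s \<and> k * q + s \<le> H} = {1..H div q}"
    using 1 assms by (auto simp: less_eq_div_iff_mult_less_eq Suc_le_eq)
   then show ?thesis using fl[of H] by auto
  next
   case 2
   then have "{k. 1 \<le> k * q + s \<and> k * q + s \<le> H} = {}" by auto
   then have "card {k. 1 \<le> k * q + s \<and> k * q + s \<le> H} = 0" by (simp only: card.empty)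
   moreover have "real H / real q \<le> 1" using 2 s by auto
   ultimately show ?thesis by simp
  next
   case 3
   have "{k. 1 \<le> k * q + s \<and> k * q + s \<le> H} = {..(H - s) div q}"
    using 3 assms by (auto simp: less_eq_div_iff_mult_less_eq)
   moreover have "real (H - s) / real q = real H / real q - real s / real q"
    using 3 by (simp add: of_nat_diff diff_divide_distrib)
   moreover have "real s / real q < 1" "real s / real q \<ge> 0" using s assms by auto
   moreover have "card {..(H - s) div q} = (H - s) div q + 1" by simp
   ultimately show ?thesis using fl[of "H - s"] by (simp only: of_nat_add of_nat_1 abs_le_iff) linarith
  qed
 qed
 finally show ?thesis .
qed

text \<open>The Chinese remainder theorem: the conditions select \<open>\<Prod> |\<Omega> l|\<close> classes modulo \<open>\<Prod> l\<close>.\<close>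

lemma card_residue_conditions:
 fixes \<Omega> :: "nat \<Rightarrow> nat set"
 assumes "finite S" "\<And>l. l \<in> S \<Longrightarrow> prime l" "\<And>l. l \<in> S \<Longrightarrow> \<Omega> l \<subseteq> {..<l}"
  and "q > 0" "\<And>l. l \<in> S \<Longrightarrow> coprime q l"
 shows "\<bar>real (card {n\<in>{1..H}. [n = r] (mod q) \<and> (\<forall>l\<in>S. n mod l \<in> \<Omega> l)})
     - real H / real q * (\<Prod>l\<in>S. real (card (\<Omega> l)) / real l)\<bar> \<le> (\<Prod>l\<in>S. real (card (\<Omega> l)))"
 using assms
proof (induction S arbitrary: q r rule: finite_induct)
 case empty
 then show ?case using card_residue_class[of q H r] by simp
next
 case (insert l S)
 let ?A = "\<lambda>q r. {n\<in>{1..H}. [n = r] (mod q) \<and> (\<forall>l\<in>S. n mod l \<in> \<Omega> l)}"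
 have l: "prime l" "l > 0" "\<Omega> l \<subseteq> {..<l}" "coprime q l" using insert by (auto intro: prime_gt_0_nat)
 have fin: "finite (\<Omega> l)" using l(3) finite_subset by blast
 have "\<exists>r'. \<forall>n. [n = r'] (mod q * l) \<longleftrightarrow> [n = r] (mod q) \<and> [n = c] (mod l)" for c
 proof -
  obtain r' where r': "[r' = r] (mod q)" "[r' = c] (mod l)"
   using binary_chinese_remainder_nat[OF l(4)] by blast
  have "[n = r'] (mod q * l) \<longleftrightarrow> [n = r] (mod q) \<and> [n = c] (mod l)" for n
  proof
   assume n: "[n = r'] (mod q * l)"
   have "[n = r'] (mod q)" using n by (rule cong_modulus_mult_nat)
   moreover have "[n = r'] (mod l)" using n by (subst (asm) mult.commute) (rule cong_modulus_mult_nat)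
   ultimately show "[n = r] (mod q) \<and> [n = c] (mod l)" using r' cong_trans by blast
  next
   assume "[n = r] (mod q) \<and> [n = c] (mod l)"
   then have "[n = r'] (mod q)" "[n = r'] (mod l)" using r' cong_trans cong_sym by blast+
   then show "[n = r'] (mod q * l)" using l(4) by (rule coprime_cong_mult_nat)
  qed
  then show ?thesis by blast
 qed
 then obtain r' where r': "\<And>c n. [n = r' c] (mod q * l) \<longleftrightarrow> [n = r] (mod q) \<and> [n = c] (mod l)" by metis
 have eq: "{n\<in>{1..H}. [n = r] (mod q) \<and> (\<forall>l\<in>insert l S. n mod l \<in> \<Omega> l)} = (\<Union>c\<in>\<Omega> l. ?A (q * l) (r' c))"
 proof -
  have "n mod l \<in> \<Omega> l \<longleftrightarrow> (\<exists>c\<in>\<Omega> l. [n = c] (mod l))" for n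
   using l(2,3) by (auto simp: cong_def intro!: bexI[of _ "n mod l"])
  then show ?thesis by (auto simp: r')
 qed
 have "card (\<Union>c\<in>\<Omega> l. ?A (q * l) (r' c)) = (\<Sum>c\<in>\<Omega> l. card (?A (q * l) (r' c)))"
 proof (rule card_UN_disjoint[OF fin])
  show "\<forall>i\<in>\<Omega> l. \<forall>j\<in>\<Omega> l. i \<noteq> j \<longrightarrow> ?A (q * l) (r' i) \<inter> ?A (q * l) (r' j) = {}"
  proof (intro ballI impI, rule ccontr)
   fix i j assume ij: "i \<in> \<Omega> l" "j \<in> \<Omega> l" "i \<noteq> j" "?A (q * l) (r' i) \<inter> ?A (q * l) (r' j) \<noteq> {}"
   then obtain n where "[n = r' i] (mod q * l)" "[n = r' j] (mod q * l)" by blast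
   then have "[n = i] (mod l)" "[n = j] (mod l)" using r' by blast+
   then have "i mod l = j mod l" by (simp add: cong_def)
   then show False using ij l(3) by (auto simp: subset_iff)
  qed
 qed auto
 then have e1: "real (card {n\<in>{1..H}. [n = r] (mod q) \<and> (\<forall>l\<in>insert l S. n mod l \<in> \<Omega> l)})
  = (\<Sum>c\<in>\<Omega> l. real (card (?A (q * l) (r' c))))" unfolding eq by simp
 have e2: "(\<Sum>c\<in>\<Omega> l. real (card (?A (q * l) (r' c)))) - real H / real q * (\<Prod>l\<in>insert l S. real (card (\<Omega> l)) / real l)
  = (\<Sum>c\<in>\<Omega> l. real (card (?A (q * l) (r' c))) - real H / real (q * l) * (\<Prod>l\<in>S. real (card (\<Omega> l)) / real l))"
 proof -
  have pe: "(\<Prod>l\<in>insert l S. real (card (\<Omega> l)) / real l)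
    = real (card (\<Omega> l)) / real l * (\<Prod>l\<in>S. real (card (\<Omega> l)) / real l)"
   using insert.hyps by (rule prod.insert)
  show ?thesis unfolding pe sum_subtractf sum_constant of_nat_mult by simp
 qed
 have e3: "\<bar>\<Sum>c\<in>\<Omega> l. real (card (?A (q * l) (r' c))) - real H / real (q * l) * (\<Prod>l\<in>S. real (card (\<Omega> l)) / real l)\<bar>
   \<le> (\<Sum>c\<in>\<Omega> l. \<Prod>l\<in>S. real (card (\<Omega> l)))"
 proof (rule order_trans[OF sum_abs], rule sum_mono)
  fix c
  show "\<bar>real (card (?A (q * l) (r' c))) - real H / real (q * l) * (\<Prod>l\<in>S. real (card (\<Omega> l)) / real l)\<bar>
    \<le> (\<Prod>l\<in>S. real (card (\<Omega> l)))"
  proof (rule insert.IH)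
   show "\<And>l'. l' \<in> S \<Longrightarrow> prime l'" "\<And>l'. l' \<in> S \<Longrightarrow> \<Omega> l' \<subseteq> {..<l'}"
    by (rule insert.prems, simp)+
   show "0 < q * l" using insert.prems(3) l(2) by simp
  next
   fix l' assume "l' \<in> S"
   then have "coprime q l'" "prime l'" "l' \<noteq> l" using insert.prems insert.hyps by auto
   moreover from this have "coprime l l'" using l(1) by (intro primes_coprime) auto
   ultimately show "coprime (q * l) l'" by (simp add: coprime_mult_left_iff)
  qed
 qed
 have "(\<Sum>c\<in>\<Omega> l. \<Prod>l\<in>S. real (card (\<Omega> l))) = (\<Prod>l\<in>insert l S. real (card (\<Omega> l)))"
  using insert.hyps by simp
 then show ?case using e3 unfolding e1 e2 by (simp only:)
qed

text \<open>Hooley's form of Brun's sieve: the primes are split into blocks \<open>R j\<close>, and inclusion--exclusion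
 is truncated in each block separately. The upper bounds for the single blocks are nonnegative, so
 that they may be multiplied.\<close>

lemma block_sieve_expansion:
 fixes \<Omega> :: "nat \<Rightarrow> nat set" and R :: "nat \<Rightarrow> nat set" and b :: "nat \<Rightarrow> nat" and H :: nat
 defines "g \<equiv> \<lambda>n l. of_bool (n mod l \<in> \<Omega> l) :: real"
 defines "\<rho> \<equiv> \<lambda>l. real (card (\<Omega> l)) / real l"
 assumes \<Omega>: "\<And>l. prime l \<Longrightarrow> \<Omega> l \<subseteq> {..<l} \<and> card (\<Omega> l) \<le> 3"
  and R: "\<And>j. j < J \<Longrightarrow> finite (R j) \<and> (\<forall>l\<in>R j. prime l)"
  and disj: "\<And>i j. i < j \<Longrightarrow> j < J \<Longrightarrow> R i \<inter> R j = {}"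
  and S0: "finite S0" "\<And>l. l \<in> S0 \<Longrightarrow> prime l" "\<And>j. j < J \<Longrightarrow> S0 \<inter> R j = {}"
 shows "\<bar>(\<Sum>n=1..H. (\<Prod>l\<in>S0. g n l) * (\<Prod>j<J. psum (\<lambda>l. - g n l) (R j) (b j)))
     - real H * (\<Prod>l\<in>S0. \<rho> l) * (\<Prod>j<J. psum (\<lambda>l. - \<rho> l) (R j) (b j))\<bar>
    \<le> 3 ^ card S0 * (\<Prod>j<J. psum (\<lambda>_. 3) (R j) (b j))"
 using R disj S0
proof (induction J arbitrary: S0)
 case 0
 have "(\<Prod>l\<in>S0. g n l) = of_bool (\<forall>l\<in>S0. n mod l \<in> \<Omega> l)" for n
  using 0 by (cases "\<forall>l\<in>S0. n mod l \<in> \<Omega> l") (auto simp: g_def)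
 then have "(\<Sum>n=1..H. \<Prod>l\<in>S0. g n l) = real (card {n\<in>{1..H}. [n = 0] (mod 1) \<and> (\<forall>l\<in>S0. n mod l \<in> \<Omega> l)})"
  by (simp add: of_bool_def sum.If_cases Int_def)
 moreover have "\<bar>real (card {n\<in>{1..H}. [n = 0] (mod 1) \<and> (\<forall>l\<in>S0. n mod l \<in> \<Omega> l)})
     - real H / real 1 * (\<Prod>l\<in>S0. real (card (\<Omega> l)) / real l)\<bar> \<le> (\<Prod>l\<in>S0. real (card (\<Omega> l)))"
  using 0 \<Omega> by (intro card_residue_conditions) auto
 moreover have "(\<Prod>l\<in>S0. real (card (\<Omega> l))) \<le> (\<Prod>l\<in>S0. 3)"
  using 0 \<Omega> by (intro prod_mono) auto
 ultimately show ?case by (simp add: \<rho>_def)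
next
 case (Suc J)
 let ?U = "\<lambda>n J. \<Prod>j<J. psum (\<lambda>l. - g n l) (R j) (b j)"
 let ?V = "\<lambda>J. \<Prod>j<J. psum (\<lambda>l. - \<rho> l) (R j) (b j)"
 let ?E = "\<lambda>J. \<Prod>j<J. psum (\<lambda>_. 3) (R j) (b j)"
 let ?SS = "subs (R J) (b J)"
 have finR: "finite (R J)" using Suc.prems by auto
 have S: "finite S \<and> S \<inter> S0 = {} \<and> S \<subseteq> R J" if "S \<in> ?SS" for S
  using that Suc.prems(5)[of J] finR finite_subset by (auto simp: subs_def)
 have pm: "(\<Prod>l\<in>S. - f l) = (-1) ^ card S * (\<Prod>l\<in>S. f l)" for f :: "nat \<Rightarrow> real" and S
  using prod.distrib[of "\<lambda>_. -1" f S] by simp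
 have 1: "(\<Sum>n=1..H. (\<Prod>l\<in>S0. g n l) * ?U n (Suc J))
   = (\<Sum>S\<in>?SS. (-1) ^ card S * (\<Sum>n=1..H. (\<Prod>l\<in>S0 \<union> S. g n l) * ?U n J))"
 proof -
  have "(\<Sum>n=1..H. (\<Prod>l\<in>S0. g n l) * ?U n (Suc J))
   = (\<Sum>n=1..H. \<Sum>S\<in>?SS. (-1) ^ card S * ((\<Prod>l\<in>S0 \<union> S. g n l) * ?U n J))"
  proof (rule sum.cong[OF refl])
   fix n
   have "(\<Prod>l\<in>S0. g n l) * ?U n (Suc J) = (\<Sum>S\<in>?SS. (\<Prod>l\<in>S0. g n l) * ?U n J * ((-1) ^ card S * (\<Prod>l\<in>S. g n l)))"
    by (simp add: psum_def pm sum_distrib_left mult.assoc)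
   also have "\<dots> = (\<Sum>S\<in>?SS. (-1) ^ card S * ((\<Prod>l\<in>S0 \<union> S. g n l) * ?U n J))"
    using S Suc.prems(3) by (intro sum.cong refl) (subst prod.union_disjoint, auto)
   finally show "(\<Prod>l\<in>S0. g n l) * ?U n (Suc J) = (\<Sum>S\<in>?SS. (-1) ^ card S * ((\<Prod>l\<in>S0 \<union> S. g n l) * ?U n J))" .
  qed
  then show ?thesis by (simp only: sum_distrib_left) (rule sum.swap)
 qed
 have 2: "real H * (\<Prod>l\<in>S0. \<rho> l) * ?V (Suc J) = (\<Sum>S\<in>?SS. (-1) ^ card S * (real H * (\<Prod>l\<in>S0 \<union> S. \<rho> l) * ?V J))"
 proof -
  have "real H * (\<Prod>l\<in>S0. \<rho> l) * ?V (Suc J) = (\<Sum>S\<in>?SS. real H * (\<Prod>l\<in>S0. \<rho> l) * ?V J * ((-1) ^ card S * (\<Prod>l\<in>S. \<rho> l)))"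
   by (simp add: psum_def pm sum_distrib_left mult.assoc)
  also have "\<dots> = (\<Sum>S\<in>?SS. (-1) ^ card S * (real H * (\<Prod>l\<in>S0 \<union> S. \<rho> l) * ?V J))"
   using S Suc.prems(3) by (intro sum.cong refl) (subst prod.union_disjoint, auto)
  finally show ?thesis .
 qed
 have 3: "3 ^ card S0 * ?E (Suc J) = (\<Sum>S\<in>?SS. 3 ^ card (S0 \<union> S) * ?E J)"
 proof -
  have "3 ^ card S0 * ?E (Suc J) = (\<Sum>S\<in>?SS. 3 ^ card S0 * ?E J * 3 ^ card S)"
   by (simp add: psum_def sum_distrib_left mult.assoc)
  also have "\<dots> = (\<Sum>S\<in>?SS. 3 ^ card (S0 \<union> S) * ?E J)"
   using S Suc.prems(3) by (intro sum.cong refl) (subst card_Un_disjoint, auto simp: power_add)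
  finally show ?thesis .
 qed
 have "\<bar>(\<Sum>S\<in>?SS. (-1) ^ card S * ((\<Sum>n=1..H. (\<Prod>l\<in>S0 \<union> S. g n l) * ?U n J) - real H * (\<Prod>l\<in>S0 \<union> S. \<rho> l) * ?V J))\<bar>
  \<le> (\<Sum>S\<in>?SS. 3 ^ card (S0 \<union> S) * ?E J)"
 proof (rule order_trans[OF sum_abs], rule sum_mono)
  fix T assume T: "T \<in> ?SS"
  have "\<bar>(\<Sum>n=1..H. (\<Prod>l\<in>S0 \<union> T. g n l) * ?U n J) - real H * (\<Prod>l\<in>S0 \<union> T. \<rho> l) * ?V J\<bar>
   \<le> 3 ^ card (S0 \<union> T) * ?E J"
  proof (rule Suc.IH)
   fix j assume j: "j < J"
   show "(S0 \<union> T) \<inter> R j = {}"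
    using S[OF T] Suc.prems(2)[of j J] Suc.prems(5)[of j] j by auto
  next
   fix l assume "l \<in> S0 \<union> T"
   then show "prime l" using S[OF T] Suc.prems(1)[of J] Suc.prems(4)[of l] by auto
  next
   fix j assume "j < J"
   then show "finite (R j) \<and> (\<forall>l\<in>R j. prime l)" using Suc.prems(1)[of j] by simp
  qed (use S[OF T] Suc.prems in auto)
  then show "\<bar>(-1) ^ card T * ((\<Sum>n=1..H. (\<Prod>l\<in>S0 \<union> T. g n l) * ?U n J) - real H * (\<Prod>l\<in>S0 \<union> T. \<rho> l) * ?V J)\<bar>
   \<le> 3 ^ card (S0 \<union> T) * ?E J" by (simp add: abs_mult)
 qed
 then show ?case unfolding 1 2 3 right_diff_distrib sum_subtractf .
qed

text \<open>For odd \<open>b j\<close> every truncated sum is an upper bound for the indicator of its block.\<close>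

lemma block_sieve_upper:
 fixes \<Omega> :: "nat \<Rightarrow> nat set" and R :: "nat \<Rightarrow> nat set" and b :: "nat \<Rightarrow> nat" and H :: nat
 assumes \<Omega>: "\<And>l. prime l \<Longrightarrow> \<Omega> l \<subseteq> {..<l} \<and> card (\<Omega> l) \<le> 3"
  and R: "\<And>j. j < J \<Longrightarrow> finite (R j) \<and> (\<forall>l\<in>R j. prime l)"
  and disj: "\<And>i j. i < j \<Longrightarrow> j < J \<Longrightarrow> R i \<inter> R j = {}"
  and b: "\<And>j. odd (b j)"
 shows "real (card {n\<in>{1..H}. \<forall>j<J. \<forall>l\<in>R j. n mod l \<notin> \<Omega> l})
    \<le> real H * (\<Prod>j<J. psum (\<lambda>l. - (real (card (\<Omega> l)) / real l)) (R j) (b j)) + (\<Prod>j<J. psum (\<lambda>_. 3) (R j) (b j))"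
proof -
 let ?g = "\<lambda>n l. of_bool (n mod l \<in> \<Omega> l) :: real"
 let ?U = "\<lambda>n. \<Prod>j<J. psum (\<lambda>l. - ?g n l) (R j) (b j)"
 have bon: "(\<Prod>l\<in>R j. 1 - ?g n l) \<le> psum (\<lambda>l. - ?g n l) (R j) (b j)" if "j < J" for j n
  using bonferroni_sign[of "R j" "?g n" "b j"] R[OF that] b by auto
 have nn: "(\<Prod>l\<in>R j. 1 - ?g n l) \<ge> 0" for j n by (intro prod_nonneg) auto
 have "real (card {n\<in>{1..H}. \<forall>j<J. \<forall>l\<in>R j. n mod l \<notin> \<Omega> l}) = (\<Sum>n=1..H. of_bool (\<forall>j<J. \<forall>l\<in>R j. n mod l \<notin> \<Omega> l))"
  by (simp add: of_bool_def sum.If_cases Int_def)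
 also have "\<dots> \<le> (\<Sum>n=1..H. ?U n)"
 proof (rule sum_mono)
  fix n
  show "of_bool (\<forall>j<J. \<forall>l\<in>R j. n mod l \<notin> \<Omega> l) \<le> ?U n"
  proof (cases "\<forall>j<J. \<forall>l\<in>R j. n mod l \<notin> \<Omega> l")
   case True
   have "(\<Prod>j<J. (1::real)) \<le> ?U n"
   proof (rule prod_mono)
    fix j assume j: "j \<in> {..<J}"
    have "(\<Prod>l\<in>R j. 1 - ?g n l) = 1" using True j by (intro prod.neutral) auto
    then show "0 \<le> (1::real) \<and> 1 \<le> psum (\<lambda>l. - ?g n l) (R j) (b j)" using bon[of j n] j by auto
   qed
   then show ?thesis using True by simp
  next
   case False
   have "0 \<le> ?U n"
   proof (rule prod_nonneg)
    fix j assume "j \<in> {..<J}"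
    then show "0 \<le> psum (\<lambda>l. - ?g n l) (R j) (b j)" using order_trans[OF nn[of n j] bon[of j n]] by simp
   qed
   then show ?thesis by (simp only: False of_bool_eq)
  qed
 qed
 also have "\<dots> \<le> real H * (\<Prod>j<J. psum (\<lambda>l. - (real (card (\<Omega> l)) / real l)) (R j) (b j)) + (\<Prod>j<J. psum (\<lambda>_. 3) (R j) (b j))"
 proof -
  have "\<bar>(\<Sum>n=1..H. (\<Prod>l\<in>{}. ?g n l) * ?U n)
     - real H * (\<Prod>l\<in>{}. real (card (\<Omega> l)) / real l) * (\<Prod>j<J. psum (\<lambda>l. - (real (card (\<Omega> l)) / real l)) (R j) (b j))\<bar>
    \<le> 3 ^ card ({} :: nat set) * (\<Prod>j<J. psum (\<lambda>_. 3) (R j) (b j))"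
   by (rule block_sieve_expansion) (use \<Omega> R disj in blast)+
  then show ?thesis by (simp only: prod.empty card.empty power_0 mult_1 mult_1_right abs_le_iff) linarith
 qed
 finally show ?thesis .
qed

lemma sum_Un_le:
 fixes f :: "'a \<Rightarrow> real"
 assumes "finite A" "finite B" "\<And>x. f x \<ge> 0"
 shows "sum f (A \<union> B) \<le> sum f A + sum f B"
 using sum.union_inter[OF assms(1,2), of f] sum_nonneg[of "A \<inter> B" f] assms(3) by simp

text \<open>A block from \<open>sqrt y\<close> to \<open>y\<close> has \<open>\<Sum> 1/l\<close> about \<open>ln 2\<close>, whatever \<open>y\<close> is; this lets the truncation
orders of successive blocks grow linearly.\<close>

lemma recip_primes_block:
 "\<exists>B\<ge>0. \<forall>y. (\<Sum>l | prime l \<and> 6 < l \<and> sqrt y < real l \<and> real l \<le> y. 1 / real l) \<le> B"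
proof -
 obtain C where C: "\<And>x. x \<ge> 2 \<Longrightarrow> (\<Sum>p\<in>primes_le x. 1 / real p) \<le> ln (ln x) + C"
  using mertens2_upper by auto
 obtain C' where C': "\<And>x. x \<ge> 2 \<Longrightarrow> (\<Sum>p\<in>primes_le x. 1 / real p) \<ge> ln (ln x) - C'"
  using mertens2_lower by auto
 show ?thesis
 proof (intro exI[of _ "max 0 (ln 2 + C + C')"] conjI allI)
  fix y :: real
  let ?A = "{l::nat. prime l \<and> 6 < l \<and> sqrt y < real l \<and> real l \<le> y}"
  show "(\<Sum>l\<in>?A. 1 / real l) \<le> max 0 (ln 2 + C + C')"
  proof (cases "y \<le> 6")
   case True
   then have "?A = {}" by auto
   then show ?thesis by (simp only: sum.empty)
  next
   case False
   have sq: "sqrt y \<ge> 2" "sqrt y \<le> y"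
    using False by (auto intro!: real_le_rsqrt real_le_lsqrt simp: power2_eq_square)
   have "(\<Sum>l\<in>?A. 1 / real l) \<le> (\<Sum>l\<in>primes_le y - primes_le (sqrt y). 1 / real l)"
    by (intro sum_mono2) (auto simp: primes_le_iff)
   also have "\<dots> = (\<Sum>l\<in>primes_le y. 1 / real l) - (\<Sum>l\<in>primes_le (sqrt y). 1 / real l)"
    by (intro sum_diff primes_le_mono sq finite_primes_le)
   also have "\<dots> \<le> (ln (ln y) + C) - (ln (ln (sqrt y)) - C')"
    using C[of y] C'[of "sqrt y"] sq False by simp
   also have "ln (ln (sqrt y)) = ln (ln y) - ln 2"
    using False by (simp add: ln_sqrt ln_div)
   finally show ?thesis by simp
  qed
 qed auto
qed

lemma exp_ge_cube: "t \<ge> 0 \<Longrightarrow> t ^ 3 \<le> 27 * exp (t::real)"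
proof -
 assume t: "t \<ge> 0"
 have "t / 3 \<le> exp (t / 3)" using exp_ge_add_one_self[of "t / 3"] by linarith
 then have "(t / 3) ^ 3 \<le> exp (t / 3) ^ 3" using t by (intro power_mono) auto
 also have "\<dots> = exp t" by (simp add: exp_of_nat_mult[symmetric])
 finally show ?thesis by (simp add: power_divide)
qed

text \<open>The blocks are \<open>(D^(1/2^(j+1)), D^(1/2^j)]\<close> with truncation order \<open>2 j + 1\<close>. The relative errors of the
blocks are at most \<open>B^(2 j + 1) / (2 j + 1)!\<close> up to a constant and have a finite sum. The product of
the remainder terms is a bounded power of \<open>D\<close> since \<open>\<Sum> (2 j + 1) / 2^j = 6\<close>; the condition \<open>D^13 \<le> H\<close> leaves room for it. Primes
up to \<open>6\<close> are left out so that \<open>|\<Omega> l| / l \<le> 1/2\<close>.\<close>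

theorem brun_hooley:
 "\<exists>C>0. \<forall>(H::nat) D \<Omega>. D \<ge> 2 \<longrightarrow> D ^ 13 \<le> real H \<longrightarrow>
  (\<forall>l. prime l \<longrightarrow> \<Omega> l \<subseteq> {..<l} \<and> card (\<Omega> l) \<le> 3) \<longrightarrow>
  real (card {n\<in>{1..H}. \<forall>l\<in>primes_le D. 6 < l \<longrightarrow> n mod l \<notin> \<Omega> l})
   \<le> C * real H * exp (- (\<Sum>l\<in>{l\<in>primes_le D. 6 < l}. real (card (\<Omega> l)) / real l))"
proof -
 obtain C where C: "\<And>x. x \<ge> 2 \<Longrightarrow> (\<Sum>p\<in>primes_le x. 1 / real p) \<le> ln (ln x) + C"
  using mertens2_upper by auto
 obtain B where B: "B \<ge> 0"
  "\<And>y. (\<Sum>l | prime l \<and> 6 < l \<and> sqrt y < real l \<and> real l \<le> y. 1 / real l) \<le> B"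
  using recip_primes_block by auto
 define B3 where "B3 = 3 * B"
 have B3: "B3 \<ge> 0" using B by (simp add: B3_def)
 show ?thesis
 proof (intro exI[of _ "exp (exp B3 * exp B3) + 27 * exp (3 * C)"] conjI allI impI)
  show "exp (exp B3 * exp B3) + 27 * exp (3 * C) > 0" by (intro add_pos_pos) auto
  fix H :: nat and D :: real and \<Omega> :: "nat \<Rightarrow> nat set"
  assume D: "D \<ge> 2" and H: "D ^ 13 \<le> real H"
   and \<Omega>: "\<forall>l. prime l \<longrightarrow> \<Omega> l \<subseteq> {..<l} \<and> card (\<Omega> l) \<le> 3"
  define d where "d = (\<lambda>j::nat. D powr ((1/2) ^ j))"
  have d_Suc: "d (Suc j) = sqrt (d j)" for j
   by (simp add: d_def powr_half_sqrt[symmetric] powr_powr mult.commute)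
  have d0: "d 0 = D" using D by (simp add: d_def)
  have d_ge1: "d j \<ge> 1" for j using D by (simp add: d_def ge_one_powr_ge_zero)
  have d_anti: "d j \<le> d i" if "i \<le> j" for i j
   unfolding d_def using D that by (intro powr_mono power_decreasing) auto
  define R where "R = (\<lambda>j. {l. prime l \<and> 6 < l \<and> d (Suc j) < real l \<and> real l \<le> d j})"
  have finR: "finite (R j)" for j
   by (rule finite_subset[OF _ finite_primes_le[of "d j"]]) (auto simp: R_def primes_le_iff)
  define b where "b = (\<lambda>j::nat. 2 * j + 1)"
  define \<rho> where "\<rho> = (\<lambda>l. real (card (\<Omega> l)) / real l)"
  define \<sigma> where "\<sigma> = (\<lambda>j. \<Sum>l\<in>R j. \<rho> l)"
  define Q where "Q = {l\<in>primes_le D. 6 < l}"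
  have finQ: "finite Q" by (simp add: Q_def)
  have \<rho>: "0 \<le> \<rho> l" "\<rho> l \<le> 3 * (1 / real l)" if "prime l" for l
   using \<Omega> that by (auto simp: \<rho>_def divide_right_mono)
  have \<sigma>: "0 \<le> \<sigma> j" "\<sigma> j \<le> B3" for j
  proof -
   show "0 \<le> \<sigma> j" unfolding \<sigma>_def by (intro sum_nonneg \<rho>) (auto simp: R_def)
   have "\<sigma> j \<le> (\<Sum>l\<in>R j. 3 * (1 / real l))" unfolding \<sigma>_def by (intro sum_mono \<rho>) (auto simp: R_def)
   also have "\<dots> = 3 * (\<Sum>l\<in>R j. 1 / real l)" by (simp only: sum_distrib_left)
   also have "\<dots> \<le> B3" using B(2)[of "d j"] unfolding B3_def R_def d_Suc by simp
   finally show "\<sigma> j \<le> B3" .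
  qed
  obtain J where J: "d J \<le> 6"
  proof -
   have "0 < ln 6 / ln D" using D by simp
   then obtain J where "(1/2) ^ J < ln 6 / ln D" using real_arch_pow_inv[of "ln 6 / ln D" "1/2"] by auto
   then have "(1/2) ^ J * ln D < ln 6" using D by (simp add: less_divide_eq)
   then have "exp ((1/2) ^ J * ln D) < exp (ln 6)" by (simp only: exp_less_mono)
   then have "d J \<le> 6" using D by (simp add: d_def powr_def)
   then show ?thesis by (rule that)
  qed
  have disj: "R i \<inter> R j = {}" if "i < j" for i j
   using d_anti[of "Suc i" j] that by (auto simp: R_def)
  have cover: "Q \<subseteq> (\<Union>j<J. R j)"
  proof
   fix l assume l: "l \<in> Q"
   define m where "m = (LEAST j. \<not> real l \<le> d j)"
   have notJ: "\<not> real l \<le> d J" using l J by (auto simp: Q_def)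
   have m: "\<not> real l \<le> d m" "m \<le> J" unfolding m_def using notJ by (rule LeastI) (rule Least_le, rule notJ)
   have m0: "m \<noteq> 0" using m(1) l d0 by (auto simp: Q_def primes_le_iff intro: ccontr)
   then have "m - 1 < m" by simp
   then have "real l \<le> d (m - 1)" using not_less_Least[of "m - 1" "\<lambda>j. \<not> real l \<le> d j"] by (auto simp: m_def)
   then have "l \<in> R (m - 1)" using l m m0 by (auto simp: R_def Q_def primes_le_iff)
   then show "l \<in> (\<Union>j<J. R j)" using m m0 by (intro UN_I[of "m - 1"]) auto
  qed
  have sumQ: "(\<Sum>l\<in>Q. \<rho> l) \<le> (\<Sum>j<J. \<sigma> j)"
  proof -
   have "(\<Sum>l\<in>Q. \<rho> l) \<le> (\<Sum>l\<in>(\<Union>j<J. R j). \<rho> l)"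
    using finR cover by (intro sum_mono2 \<rho>) (auto simp: R_def)
   also have "\<dots> = (\<Sum>j<J. \<sigma> j)" unfolding \<sigma>_def
   proof (rule sum.UNION_disjoint)
    show "\<forall>i\<in>{..<J}. \<forall>j\<in>{..<J}. i \<noteq> j \<longrightarrow> R i \<inter> R j = {}"
     using disj by (metis Int_commute linorder_neqE_nat)
   qed (use finR in auto)
   finally show ?thesis .
  qed
  have main: "(\<Prod>j<J. psum (\<lambda>l. - \<rho> l) (R j) (b j)) \<le> exp (exp B3 * exp B3) * exp (- (\<Sum>l\<in>Q. \<rho> l))"
  proof -
   define e where "e = (\<lambda>j. exp B3 * (B3 ^ b j / fact (b j)))"
   have e0: "e j \<ge> 0" for j using B3 by (simp add: e_def)
   have \<rho>1: "0 \<le> \<rho> l \<and> \<rho> l \<le> 1" if "l \<in> R j" for l j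
   proof -
    have "3 * (1 / real l) \<le> 1" using that by (auto simp: R_def)
    moreover have "prime l" using that by (simp add: R_def)
    ultimately show ?thesis using \<rho>[of l] by linarith
   qed
   have "(\<Prod>j<J. psum (\<lambda>l. - \<rho> l) (R j) (b j)) \<le> (\<Prod>j<J. exp (- \<sigma> j) * exp (e j))"
   proof (rule prod_mono)
    fix j assume "j \<in> {..<J}"
    let ?V = "\<Prod>l\<in>R j. 1 - \<rho> l"
    have "?V \<ge> 0" using \<rho>1 by (intro prod_nonneg) auto
    moreover have "?V \<le> psum (\<lambda>l. - \<rho> l) (R j) (b j)"
     using bonferroni_sign[of "R j" \<rho> "b j"] finR \<rho>1 by (auto simp: b_def)
    ultimately have nn: "0 \<le> psum (\<lambda>l. - \<rho> l) (R j) (b j)" by linarith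
    have "psum (\<lambda>l. - \<rho> l) (R j) (b j) \<le> ?V + esym \<rho> (R j) (b j)"
     using bonferroni_error[of "R j" \<rho> "b j"] finR \<rho>1 by force
    also have "?V \<le> (\<Prod>l\<in>R j. exp (- \<rho> l))"
     using \<rho>1 exp_ge_add_one_self[of "- \<rho> l" for l] by (intro prod_mono) (auto simp: algebra_simps)
    also have "\<dots> = exp (- \<sigma> j)" using finR by (simp add: \<sigma>_def exp_sum sum_negf[symmetric])
    also have "esym \<rho> (R j) (b j) \<le> \<sigma> j ^ b j / fact (b j)"
     using esym_le[of "R j" \<rho> "b j"] finR \<rho>1 by (auto simp: \<sigma>_def)
    also have "\<dots> \<le> B3 ^ b j / fact (b j)" using \<sigma> by (intro divide_right_mono power_mono) auto
    also have "\<dots> \<le> exp (- \<sigma> j) * e j"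
    proof -
     have "1 * (B3 ^ b j / fact (b j)) \<le> (exp (- \<sigma> j) * exp B3) * (B3 ^ b j / fact (b j))"
      using \<sigma>[of j] B3 by (intro mult_right_mono) (auto simp: exp_add[symmetric])
     then show ?thesis by (simp add: e_def)
    qed
    also have "exp (- \<sigma> j) + exp (- \<sigma> j) * e j \<le> exp (- \<sigma> j) * exp (e j)"
    proof -
     have "exp (- \<sigma> j) * (1 + e j) \<le> exp (- \<sigma> j) * exp (e j)"
      using exp_ge_add_one_self[of "e j"] by (intro mult_left_mono) auto
     then show ?thesis by (simp add: algebra_simps)
    qed
    finally show "0 \<le> psum (\<lambda>l. - \<rho> l) (R j) (b j) \<and> psum (\<lambda>l. - \<rho> l) (R j) (b j) \<le> exp (- \<sigma> j) * exp (e j)"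
     using nn by simp
   qed
   also have "\<dots> = exp (- (\<Sum>j<J. \<sigma> j)) * exp (\<Sum>j<J. e j)"
    by (simp add: prod.distrib exp_sum sum_negf[symmetric])
   also have "\<dots> \<le> exp (- (\<Sum>l\<in>Q. \<rho> l)) * exp (exp B3 * exp B3)"
   proof (intro mult_mono)
    have "(\<Sum>j<J. B3 ^ b j / fact (b j)) = (\<Sum>k\<in>b ` {..<J}. B3 ^ k / fact k)"
     by (subst sum.reindex) (auto simp: b_def inj_on_def)
    also have "\<dots> \<le> (\<Sum>k. B3 ^ k / fact k)"
     using summable_exp[of B3] B3 by (intro sum_le_suminf) (auto simp: field_simps)
    also have "\<dots> = exp B3" by (simp add: exp_def scaleR_conv_of_real divide_inverse mult.commute)
    finally have "(\<Sum>j<J. e j) \<le> exp B3 * exp B3"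
     unfolding e_def sum_distrib_left[symmetric] by (intro mult_left_mono) auto
    then show "exp (\<Sum>j<J. e j) \<le> exp (exp B3 * exp B3)" by simp
   qed (use sumQ in auto)
   finally show ?thesis by (simp add: mult.commute)
  qed
  have err: "(\<Prod>j<J. psum (\<lambda>_. 3) (R j) (b j)) \<le> D ^ 12"
  proof -
   have one: "psum (\<lambda>_. 3) (R j) (b j) \<le> D powr (2 * real (b j) * (1/2) ^ j)" for j
   proof -
    have "1 + 3 * real (card (R j)) \<le> d j ^ 2"
    proof (cases "R j = {}")
     case True
     then show ?thesis using d_ge1[of j] by simp
    next
     case False
     then have d6: "d j > 6" by (auto simp: R_def)
     have "R j \<subseteq> {1..nat \<lfloor>d j\<rfloor>}" by (auto simp: R_def le_nat_iff le_floor_iff)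
     then have "card (R j) \<le> nat \<lfloor>d j\<rfloor>" using card_mono[of "{1..nat \<lfloor>d j\<rfloor>}" "R j"] by simp
     then have "real (card (R j)) \<le> d j" using d6 by linarith
     moreover have "6 * d j \<le> d j ^ 2" using d6 unfolding power2_eq_square by (intro mult_right_mono) auto
     ultimately show ?thesis using d6 by linarith
    qed
    then have "(1 + 3 * real (card (R j))) ^ b j \<le> (d j ^ 2) ^ b j" by (intro power_mono) auto
    also have "\<dots> = d j powr (2 * real (b j))"
    proof -
     have "d j powr (2 * real (b j)) = d j powr real (2 * b j)" by simp
     also have "\<dots> = d j ^ (2 * b j)" using d_ge1[of j] by (intro powr_realpow) linarith
     finally show ?thesis by (simp only: power_mult)
    qed
    also have "\<dots> = D powr (2 * real (b j) * (1/2) ^ j)"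
     by (simp add: d_def powr_powr mult.commute)
    finally show ?thesis using psum_const_le[OF finR, of j "b j"] by linarith
   qed
   have nn: "0 \<le> psum (\<lambda>_. 3) (R j) (b j)" for j by (auto simp: psum_def intro!: sum_nonneg)
   have "(\<Prod>j<n. psum (\<lambda>_. 3) (R j) (b j)) \<le> D powr (12 - (8 * real n + 12) * (1/2) ^ n)" for n
   proof (induction n)
    case 0
    then show ?case using D by simp
   next
    case (Suc n)
    have "(\<Prod>j<Suc n. psum (\<lambda>_. 3) (R j) (b j))
     \<le> D powr (12 - (8 * real n + 12) * (1/2) ^ n) * D powr (2 * real (b n) * (1/2) ^ n)"
     unfolding prod.lessThan_Suc by (intro mult_mono Suc.IH one nn) auto
    also have "\<dots> = D powr (12 - (8 * real (Suc n) + 12) * (1/2) ^ Suc n)"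
     by (simp add: powr_add[symmetric] b_def algebra_simps)
    finally show ?case .
   qed
   also have "D powr (12 - (8 * real J + 12) * (1/2) ^ J) \<le> D powr 12" using D by (intro powr_mono) auto
   also have "\<dots> = D ^ 12" using D by (subst powr_realpow[symmetric]) auto
   finally show ?thesis .
  qed
  have err2: "D ^ 12 \<le> 27 * exp (3 * C) * real H * exp (- (\<Sum>l\<in>Q. \<rho> l))"
  proof -
   have lnD: "ln D > 0" using D by simp
   have "(\<Sum>l\<in>Q. \<rho> l) \<le> (\<Sum>l\<in>Q. 3 * (1 / real l))" by (intro sum_mono \<rho>) (auto simp: Q_def primes_le_iff)
   also have "\<dots> = 3 * (\<Sum>l\<in>Q. 1 / real l)" by (simp only: sum_distrib_left)
   also have "\<dots> \<le> 3 * (\<Sum>l\<in>primes_le D. 1 / real l)" by (intro mult_left_mono sum_mono2) (auto simp: Q_def)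
   also have "\<dots> \<le> 3 * (ln (ln D) + C)" using C[OF D] by simp
   finally have "exp (\<Sum>l\<in>Q. \<rho> l) \<le> exp (3 * (ln (ln D) + C))" by simp
   also have "\<dots> = exp (3 * C) * (ln D) ^ 3"
   proof -
    have "exp (3 * (ln (ln D) + C)) = exp (3 * ln (ln D)) * exp (3 * C)" by (simp only: distrib_left exp_add)
    also have "exp (3 * ln (ln D)) = exp (ln (ln D)) ^ 3" using exp_of_nat_mult[of 3 "ln (ln D)"] by simp
    also have "exp (ln (ln D)) = ln D" using lnD by simp
    finally show ?thesis by (simp only: mult.commute)
   qed
   also have "\<dots> \<le> exp (3 * C) * (27 * D)" using exp_ge_cube[of "ln D"] lnD D by (intro mult_left_mono) auto
   finally have "exp (\<Sum>l\<in>Q. \<rho> l) * exp (- (\<Sum>l\<in>Q. \<rho> l)) \<le> exp (3 * C) * (27 * D) * exp (- (\<Sum>l\<in>Q. \<rho> l))"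
    by (intro mult_right_mono) auto
   then have "1 \<le> 27 * exp (3 * C) * D * exp (- (\<Sum>l\<in>Q. \<rho> l))"
    by (simp add: exp_add[symmetric] mult_ac)
   then have "D ^ 12 * 1 \<le> D ^ 12 * (27 * exp (3 * C) * D * exp (- (\<Sum>l\<in>Q. \<rho> l)))"
    using D by (intro mult_left_mono) auto
   also have "\<dots> = D ^ 13 * (27 * exp (3 * C) * exp (- (\<Sum>l\<in>Q. \<rho> l)))"
   proof -
    have "D ^ 13 = D ^ (12 + 1)" by simp
    also have "\<dots> = D ^ 12 * D" by (simp only: power_add power_one_right)
    finally show ?thesis by (simp only: mult_ac)
   qed
   also have "\<dots> \<le> real H * (27 * exp (3 * C) * exp (- (\<Sum>l\<in>Q. \<rho> l)))"
    using H by (intro mult_right_mono) auto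
   finally show ?thesis by (simp only: mult_ac)
  qed
  have "card {n\<in>{1..H}. \<forall>l\<in>primes_le D. 6 < l \<longrightarrow> n mod l \<notin> \<Omega> l}
    \<le> card {n\<in>{1..H}. \<forall>j<J. \<forall>l\<in>R j. n mod l \<notin> \<Omega> l}"
  proof (rule card_mono)
   have "R j \<subseteq> Q" for j using d_anti[of 0 j] d0 by (auto simp: R_def Q_def primes_le_iff)
   then have "l \<in> primes_le D \<and> 6 < l" if "l \<in> R j" for l j using that unfolding Q_def by blast
   then show "{n\<in>{1..H}. \<forall>l\<in>primes_le D. 6 < l \<longrightarrow> n mod l \<notin> \<Omega> l} \<subseteq> {n\<in>{1..H}. \<forall>j<J. \<forall>l\<in>R j. n mod l \<notin> \<Omega> l}"
    by blast
  qed simp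
  then have "real (card {n\<in>{1..H}. \<forall>l\<in>primes_le D. 6 < l \<longrightarrow> n mod l \<notin> \<Omega> l})
    \<le> real (card {n\<in>{1..H}. \<forall>j<J. \<forall>l\<in>R j. n mod l \<notin> \<Omega> l})" by simp
  also have "\<dots> \<le> real H * (\<Prod>j<J. psum (\<lambda>l. - \<rho> l) (R j) (b j)) + (\<Prod>j<J. psum (\<lambda>_. 3) (R j) (b j))"
   unfolding \<rho>_def
  proof (rule block_sieve_upper)
   show "finite (R j) \<and> (\<forall>l\<in>R j. prime l)" for j using finR[of j] by (simp add: R_def)
   show "R i \<inter> R j = {}" if "i < j" for i j using that by (rule disj)
  qed (use \<Omega> in \<open>auto simp: b_def\<close>)
  also have "\<dots> \<le> real H * (exp (exp B3 * exp B3) * exp (- (\<Sum>l\<in>Q. \<rho> l))) + 27 * exp (3 * C) * real H * exp (- (\<Sum>l\<in>Q. \<rho> l))"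
   by (intro add_mono mult_left_mono main order_trans[OF err err2]) simp
  finally show "real (card {n\<in>{1..H}. \<forall>l\<in>primes_le D. 6 < l \<longrightarrow> n mod l \<notin> \<Omega> l})
   \<le> (exp (exp B3 * exp B3) + 27 * exp (3 * C)) * real H * exp (- (\<Sum>l\<in>{l\<in>primes_le D. 6 < l}. real (card (\<Omega> l)) / real l))"
   by (simp add: Q_def \<rho>_def algebra_simps)
 qed
qed

text \<open>Up to powers, this is the singular series of a sieve problem whose degenerate primes divide \<open>n\<close>.\<close>

definition gfac :: "nat \<Rightarrow> real" where
 "gfac n = exp (\<Sum>p\<in>prime_factors n. 1 / real p)"

lemma gfac_ge_1: "gfac n \<ge> 1"
 by (auto simp: gfac_def intro!: sum_nonneg)

lemma gfac_pos [simp]: "gfac n > 0"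
 by (simp add: gfac_def)

text \<open>Outside \<open>E\<close>, the forms \<open>\<alpha> i n + \<beta> i\<close> have distinct roots modulo \<open>l\<close>, one for each form.\<close>

abbreviation (input) forms_regular_outside :: "nat \<Rightarrow> nat \<Rightarrow> nat set \<Rightarrow> (nat \<Rightarrow> int) \<Rightarrow> (nat \<Rightarrow> int) \<Rightarrow> bool" where
 "forms_regular_outside l0 E I \<alpha> \<beta> \<equiv> \<forall>l. prime l \<longrightarrow> l > l0 \<longrightarrow> \<not> l dvd E \<longrightarrow>
  (\<forall>i\<in>I. \<not> int l dvd \<alpha> i) \<and> (\<forall>i\<in>I. \<forall>j\<in>I. i \<noteq> j \<longrightarrow> \<not> int l dvd \<alpha> i * \<beta> j - \<alpha> j * \<beta> i)"

abbreviation (input) forms_sifted :: "nat \<Rightarrow> nat set \<Rightarrow> (nat \<Rightarrow> int) \<Rightarrow> (nat \<Rightarrow> int) \<Rightarrow> (nat \<Rightarrow> real) \<Rightarrow> nat set \<Rightarrow> bool" where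
 "forms_sifted l0 I \<alpha> \<beta> t A \<equiv> \<forall>n\<in>A. \<forall>i\<in>I. \<forall>l. prime l \<longrightarrow> l > l0 \<longrightarrow> real l < t i \<longrightarrow> \<not> int l dvd \<alpha> i * int n + \<beta> i"

text \<open>Outside \<open>E\<close> a prime \<open>l\<close> removes as many classes as there are forms with \<open>l < t i\<close>, so that Mertens'
theorem gives one factor \<open>1 / ln (t i)\<close> for each form. The primes dividing \<open>E\<close> lose at most \<open>3 / l\<close> in
the exponent, which is \<open>gfac E ^ 3\<close>.\<close>

theorem linear_forms_sieve:
 "\<exists>C>0. \<forall>(H::nat) D (E::nat) (I::nat set) (\<alpha>::nat \<Rightarrow> int) (\<beta>::nat \<Rightarrow> int) (t::nat \<Rightarrow> real) A.
  finite I \<longrightarrow> card I \<le> 3 \<longrightarrow> D \<ge> 2 \<longrightarrow> D ^ 13 \<le> real H \<longrightarrow> E > 0 \<longrightarrow>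
  (\<forall>i\<in>I. 2 \<le> t i \<and> t i \<le> D) \<longrightarrow>
  forms_regular_outside l0 E I \<alpha> \<beta> \<longrightarrow>
  A \<subseteq> {1..H} \<longrightarrow>
  forms_sifted l0 I \<alpha> \<beta> t A \<longrightarrow>
  real (card A) \<le> C * real H * (\<Prod>i\<in>I. 1 / ln (t i)) * gfac E ^ 3"
proof -
 obtain C0 where C0: "C0 > 0" "\<And>(H::nat) D \<Omega>. D \<ge> 2 \<Longrightarrow> D ^ 13 \<le> real H \<Longrightarrow>
  (\<forall>l. prime l \<longrightarrow> \<Omega> l \<subseteq> {..<l} \<and> card (\<Omega> l) \<le> 3) \<Longrightarrow>
  real (card {n\<in>{1..H}. \<forall>l\<in>primes_le D. 6 < l \<longrightarrow> n mod l \<notin> \<Omega> l})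
   \<le> C0 * real H * exp (- (\<Sum>l\<in>{l\<in>primes_le D. 6 < l}. real (card (\<Omega> l)) / real l))"
  using brun_hooley by blast
 obtain C2' where C2': "\<And>x. x \<ge> 2 \<Longrightarrow> (\<Sum>p\<in>primes_le x. 1 / real p) \<ge> ln (ln x) - C2'"
  using mertens2_lower by auto
 define m0 where "m0 = max l0 6"
 define C2 where "C2 = \<bar>C2'\<bar> + 1 + (\<Sum>p\<in>primes_le (real m0). 1 / real p)"
 have C2_0: "C2 \<ge> 0" unfolding C2_def by (intro add_nonneg_nonneg sum_nonneg) auto
 show ?thesis
 proof (intro exI[of _ "C0 * exp (3 * C2)"] conjI allI impI)
  show "C0 * exp (3 * C2) > 0" using C0 by simp
  fix H :: nat and D :: real and E :: nat and I :: "nat set" and \<alpha> \<beta> :: "nat \<Rightarrow> int" and t :: "nat \<Rightarrow> real" and A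
  assume I: "finite I" "card I \<le> 3" and D: "D \<ge> 2" "D ^ 13 \<le> real H" and E: "E > 0"
   and t: "\<forall>i\<in>I. 2 \<le> t i \<and> t i \<le> D"
   and nd: "forms_regular_outside l0 E I \<alpha> \<beta>"
   and A: "A \<subseteq> {1..H}"
   and free: "\<forall>n\<in>A. \<forall>i\<in>I. \<forall>l. prime l \<longrightarrow> l > l0 \<longrightarrow> real l < t i \<longrightarrow> \<not> int l dvd \<alpha> i * int n + \<beta> i"
  define root where "root = (\<lambda>l i. SOME c. c < l \<and> int l dvd \<alpha> i * int c + \<beta> i)"
  define good where "good = (\<lambda>l. prime l \<and> l > l0 \<and> \<not> l dvd E)"
  have root: "root l i < l \<and> int l dvd \<alpha> i * int (root l i) + \<beta> i" if "good l" "i \<in> I" for l i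
  proof -
   have pl: "prime (int l)" "\<not> int l dvd \<alpha> i" using that nd by (auto simp: good_def)
   then have "coprime (\<alpha> i) (int l)" by (simp add: prime_imp_coprime coprime_commute)
   then obtain x where x: "[\<alpha> i * x = 1] (mod int l)" using cong_solve_coprime_int by blast
   define c where "c = nat ((- \<beta> i * x) mod int l)"
   have l0: "int l > 0" using pl(1) prime_gt_0_int by blast
   have ic: "int c = (- \<beta> i * x) mod int l" using l0 by (simp add: c_def)
   have "[\<alpha> i * int c + \<beta> i = \<alpha> i * (- \<beta> i * x) + \<beta> i] (mod int l)"
    unfolding ic by (intro cong_add cong_mult cong_refl) (simp add: cong_def)
   also have "\<alpha> i * (- \<beta> i * x) + \<beta> i = - \<beta> i * (\<alpha> i * x) + \<beta> i" by (simp add: algebra_simps)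
   also have "[- \<beta> i * (\<alpha> i * x) + \<beta> i = - \<beta> i * 1 + \<beta> i] (mod int l)"
    using x by (intro cong_add cong_mult cong_refl)
   finally have "int l dvd \<alpha> i * int c + \<beta> i" by (simp add: cong_0_iff)
   moreover have "c < l" using ic l0 pos_mod_bound[of "int l" "- \<beta> i * x"] by linarith
   ultimately have "c < l \<and> int l dvd \<alpha> i * int c + \<beta> i" by simp
   then show ?thesis unfolding root_def by (rule someI)
  qed
  have inj: "inj_on (root l) I" if g: "good l" for l
  proof (rule inj_onI, rule ccontr)
   fix i j assume ij: "i \<in> I" "j \<in> I" "root l i = root l j" "i \<noteq> j"
   have "int l dvd \<alpha> i * (\<alpha> j * int (root l j) + \<beta> j) - \<alpha> j * (\<alpha> i * int (root l i) + \<beta> i)"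
    using root[OF g ij(1)] root[OF g ij(2)] by (intro dvd_diff dvd_mult) simp_all
   also have "\<dots> = \<alpha> i * \<beta> j - \<alpha> j * \<beta> i" using ij by (simp add: algebra_simps)
   finally show False using nd g ij by (auto simp: good_def)
  qed
  define \<Omega> where "\<Omega> = (\<lambda>l. if good l then root l ` {i\<in>I. real l < t i} else {})"
  have card\<Omega>: "card (\<Omega> l) = (if good l then card {i\<in>I. real l < t i} else 0)" for l
   using inj[of l] by (auto simp: \<Omega>_def intro!: card_image intro: inj_on_subset)
  have \<Omega>: "\<forall>l. prime l \<longrightarrow> \<Omega> l \<subseteq> {..<l} \<and> card (\<Omega> l) \<le> 3"
  proof (intro allI impI conjI)
   fix l :: nat
   show "\<Omega> l \<subseteq> {..<l}" using root by (auto simp: \<Omega>_def)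
   have "card {i\<in>I. real l < t i} \<le> card I" using I by (intro card_mono) auto
   then show "card (\<Omega> l) \<le> 3" using I by (auto simp: card\<Omega>)
  qed
  have "A \<subseteq> {n\<in>{1..H}. \<forall>l\<in>primes_le D. 6 < l \<longrightarrow> n mod l \<notin> \<Omega> l}"
  proof (intro subsetI CollectI conjI ballI impI notI)
   fix n l assume n: "n \<in> A" and l: "l \<in> primes_le D" "n mod l \<in> \<Omega> l"
   then obtain i where i: "good l" "i \<in> I" "real l < t i" "n mod l = root l i"
    by (auto simp: \<Omega>_def split: if_splits)
   have "int l dvd \<alpha> i * int (n mod l) + \<beta> i" using root[OF i(1,2)] i(4) by simp
   moreover have "[\<alpha> i * int (n mod l) + \<beta> i = \<alpha> i * int n + \<beta> i] (mod int l)"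
    by (intro cong_add cong_mult cong_refl) (simp add: cong_def zmod_int)
   ultimately have "int l dvd \<alpha> i * int n + \<beta> i" using cong_dvd_iff by blast
   then show False using free n i by (auto simp: good_def)
  qed (use A in auto)
  then have "card A \<le> card {n\<in>{1..H}. \<forall>l\<in>primes_le D. 6 < l \<longrightarrow> n mod l \<notin> \<Omega> l}"
   by (intro card_mono) auto
  then have "real (card A) \<le> real (card {n\<in>{1..H}. \<forall>l\<in>primes_le D. 6 < l \<longrightarrow> n mod l \<notin> \<Omega> l})" by simp
  also have "\<dots> \<le> C0 * real H * exp (- (\<Sum>l\<in>{l\<in>primes_le D. 6 < l}. real (card (\<Omega> l)) / real l))"
   using D \<Omega> by (intro C0)
  also have "\<dots> \<le> C0 * real H * (exp (3 * C2) * (\<Prod>i\<in>I. 1 / ln (t i)) * gfac E ^ 3)"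
  proof (intro mult_left_mono)
   define G where "G = (\<Sum>p\<in>prime_factors E. 1 / real p)"
   have G: "G \<ge> 0" by (auto simp: G_def intro!: sum_nonneg)
   have each: "(\<Sum>l | l \<in> primes_le D \<and> m0 < l \<and> good l \<and> real l < t i. 1 / real l) \<ge> ln (ln (t i)) - C2 - G"
    if i: "i \<in> I" for i
   proof -
    let ?X = "{l. l \<in> primes_le D \<and> m0 < l \<and> good l \<and> real l < t i}"
    let ?Z = "if t i = real (nat \<lfloor>t i\<rfloor>) then {nat \<lfloor>t i\<rfloor>} else {}"
    have "primes_le (t i) \<subseteq> ?X \<union> primes_le (real m0) \<union> prime_factors E \<union> ?Z"
    proof
     fix l assume l: "l \<in> primes_le (t i)"
     have "l \<in> ?Z" if "t i = real l" using that by auto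
     then show "l \<in> ?X \<union> primes_le (real m0) \<union> prime_factors E \<union> ?Z"
     proof -
      have l': "prime l" "real l \<le> t i" "real l \<le> D" using l i t by (force simp: primes_le_iff)+
      consider "l \<le> m0" | "l dvd E" | "t i = real l" | "m0 < l" "\<not> l dvd E" "real l < t i" using l' by linarith
      then show ?thesis
      proof cases
       case 2
       then show ?thesis using l' E by (simp add: in_prime_factors_iff)
      next
       case 4
       then show ?thesis using l' by (simp add: good_def primes_le_iff m0_def)
      qed (use l' \<open>t i = real l \<Longrightarrow> l \<in> ?Z\<close> in \<open>auto simp: primes_le_iff\<close>)
     qed
    qed
    then have "(\<Sum>l\<in>primes_le (t i). 1 / real l) \<le> (\<Sum>l\<in>?X \<union> primes_le (real m0) \<union> prime_factors E \<union> ?Z. 1 / real l)"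
     by (intro sum_mono2) auto
    also have "\<dots> \<le> (\<Sum>l\<in>?X. 1 / real l) + (\<Sum>l\<in>primes_le (real m0). 1 / real l) + G + (\<Sum>l\<in>?Z. 1 / real l)"
     unfolding G_def by (intro order_trans[OF sum_Un_le] add_mono finite_UnI) (auto simp: sum_nonneg)
    also have "(\<Sum>l\<in>?Z. 1 / real l) \<le> 1" using t i by force
    finally have "(\<Sum>l\<in>?X. 1 / real l) \<ge> (\<Sum>l\<in>primes_le (t i). 1 / real l) - (\<Sum>l\<in>primes_le (real m0). 1 / real l) - G - 1"
     by simp
    then show ?thesis using C2'[of "t i"] t i unfolding C2_def by force
   qed
   have "(\<Sum>i\<in>I. ln (ln (t i)) - C2 - G) \<le> (\<Sum>i\<in>I. \<Sum>l | l \<in> primes_le D \<and> m0 < l \<and> good l \<and> real l < t i. 1 / real l)"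
    by (intro sum_mono each)
   also have "\<dots> = (\<Sum>i\<in>I. \<Sum>l | l \<in> primes_le D \<and> m0 < l. if good l \<and> real l < t i then 1 / real l else 0)"
    by (intro sum.cong refl sum.mono_neutral_cong_left) auto
   also have "\<dots> = (\<Sum>l | l \<in> primes_le D \<and> m0 < l. \<Sum>i\<in>I. if good l \<and> real l < t i then 1 / real l else 0)"
    by (rule sum.swap)
   also have "\<dots> = (\<Sum>l | l \<in> primes_le D \<and> m0 < l. real (card (\<Omega> l)) / real l)"
    using I by (intro sum.cong refl) (auto simp: card\<Omega> sum.If_cases Int_def)
   also have "\<dots> \<le> (\<Sum>l\<in>{l\<in>primes_le D. 6 < l}. real (card (\<Omega> l)) / real l)"
    by (intro sum_mono2) (auto simp: m0_def)
   finally have "exp (- (\<Sum>l\<in>{l\<in>primes_le D. 6 < l}. real (card (\<Omega> l)) / real l))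
     \<le> exp (\<Sum>i\<in>I. - (ln (ln (t i)) - C2 - G))"
    by (simp only: sum_negf exp_le_cancel_iff neg_le_iff_le)
   also have "(\<Sum>i\<in>I. - (ln (ln (t i)) - C2 - G)) = (\<Sum>i\<in>I. - ln (ln (t i))) + real (card I) * (C2 + G)"
    by (simp add: sum.distrib sum_subtractf sum_negf algebra_simps)
   also have "\<dots> \<le> (\<Sum>i\<in>I. - ln (ln (t i))) + 3 * (C2 + G)"
    using I G C2_0 by (intro add_left_mono mult_right_mono) auto
   also have "exp ((\<Sum>i\<in>I. - ln (ln (t i))) + 3 * (C2 + G)) = (\<Prod>i\<in>I. exp (- ln (ln (t i)))) * exp (3 * (C2 + G))"
    using I by (simp add: exp_add exp_sum)
   also have "(\<Prod>i\<in>I. exp (- ln (ln (t i)))) = (\<Prod>i\<in>I. 1 / ln (t i))"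
   proof (intro prod.cong refl)
    fix i assume "i \<in> I"
    then have "ln (t i) > 0" using t by force
    then show "exp (- ln (ln (t i))) = 1 / ln (t i)" by (simp add: exp_minus divide_inverse)
   qed
   also have "exp (3 * (C2 + G)) = exp (3 * C2) * gfac E ^ 3"
    by (simp add: gfac_def G_def[symmetric] distrib_left exp_add exp_of_nat_mult[symmetric])
   finally show "exp (- (\<Sum>l\<in>{l\<in>primes_le D. 6 < l}. real (card (\<Omega> l)) / real l))
    \<le> exp (3 * C2) * (\<Prod>i\<in>I. 1 / ln (t i)) * gfac E ^ 3" by (simp add: mult_ac)
  qed (use C0 in auto)
  finally show "real (card A) \<le> C0 * exp (3 * C2) * real H * (\<Prod>i\<in>I. 1 / ln (t i)) * gfac E ^ 3"
   by (simp add: mult_ac)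
 qed
qed

section \<open>Integers without large prime factors\<close>

lemma nat_eq_of_multiplicity_on:
 fixes a b :: nat
 assumes "a > 0" "b > 0" "prime_factors a \<subseteq> S" "prime_factors b \<subseteq> S"
  and "\<And>p. p \<in> S \<Longrightarrow> prime p \<Longrightarrow> multiplicity p a = multiplicity p b"
 shows "a = b"
proof (rule multiplicity_eq_nat)
 fix p :: nat assume p: "prime p"
 show "multiplicity p a = multiplicity p b"
 proof (cases "p \<in> S")
  case False
  then have "\<not> p dvd a" "\<not> p dvd b" using assms p by (auto simp: in_prime_factors_iff subset_iff)
  then show ?thesis by (simp add: not_dvd_imp_multiplicity_0)
 qed (use assms p in auto)
qed (use assms in auto)

text \<open>A multiplicative weight on pairs \<open>(d, m)\<close> is determined by its local factors \<open>f p i j\<close>, where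
 \<open>i\<close> and \<open>j\<close> are the exponents of \<open>p\<close> in \<open>d\<close> and \<open>m\<close>. Sorting the pairs by the set of primes
 dividing \<open>d m\<close> turns the sum over pairs with \<open>k\<close> primes into an elementary symmetric function.\<close>

lemma pair_sum_le_power_fact:
 fixes f :: "nat \<Rightarrow> nat \<Rightarrow> nat \<Rightarrow> real" and P :: "(nat \<times> nat) set"
 assumes fin: "finite P" and Q: "finite Q"
  and P: "\<And>d m. (d, m) \<in> P \<Longrightarrow> d > 0 \<and> m > 0 \<and> prime_factors (d * m) \<subseteq> Q"
  and f: "\<And>p i j. f p i j \<ge> 0"
  and lam: "\<And>p B. p \<in> Q \<Longrightarrow> (\<Sum>(i, j)\<in>{..B} \<times> {..B} - {(0, 0)}. f p i j) \<le> lam p"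
 shows "(\<Sum>(d, m)\<in>{(d, m) \<in> P. card (prime_factors (d * m)) = k}.
      \<Prod>p\<in>prime_factors (d * m). f p (multiplicity p d) (multiplicity p m)) \<le> sum lam Q ^ k / fact k"
proof -
 define w where "w = (\<lambda>(d, m). \<Prod>p\<in>prime_factors (d * m). f p (multiplicity p d) (multiplicity p m))"
 define B where "B = (\<Sum>(d, m)\<in>P. d + m)"
 define X where "X = {..B} \<times> {..B} - {(0::nat, 0::nat)}"
 have finX: "finite X" by (simp add: X_def)
 have multB: "multiplicity p d \<le> B" "multiplicity p m \<le> B" if "(d, m) \<in> P" "prime p" for d m p
 proof -
  have "d + m \<le> B" unfolding B_def using member_le_sum[of "(d, m)" P "\<lambda>(d, m). d + m"] that fin by auto
  moreover have "multiplicity p n \<le> n" if n: "n > 0" for n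
  proof -
   have "multiplicity p n < p ^ multiplicity p n"
    using prime_gt_1_nat[OF \<open>prime p\<close>] by (intro power_gt_expt) simp
   also have "\<dots> \<le> n" using n by (intro dvd_imp_le multiplicity_dvd)
   finally show ?thesis by simp
  qed
  ultimately show "multiplicity p d \<le> B" "multiplicity p m \<le> B" using P[OF that(1)] by (meson add_leD1 add_leD2 order_trans)+
 qed
 have block: "(\<Sum>x\<in>{x\<in>P. prime_factors (fst x * snd x) = S}. w x) \<le> (\<Prod>p\<in>S. lam p)" if S: "S \<subseteq> Q" for S
 proof -
  let ?PS = "{x\<in>P. prime_factors (fst x * snd x) = S}"
  define h where "h = (\<lambda>x. restrict (\<lambda>p. (multiplicity p (fst x), multiplicity p (snd x))) S)"
  have finS: "finite S" using S Q finite_subset by blast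
  have pos: "fst x > 0 \<and> snd x > 0" if "x \<in> ?PS" for x using P[of "fst x" "snd x"] that by auto
  have inj: "inj_on h ?PS"
  proof (rule inj_onI)
   fix x y assume xy: "x \<in> ?PS" "y \<in> ?PS" "h x = h y"
   have eq: "multiplicity p (fst x) = multiplicity p (fst y) \<and> multiplicity p (snd x) = multiplicity p (snd y)"
    if "p \<in> S" for p using fun_cong[OF xy(3), of p] that by (simp add: h_def)
   have sub: "prime_factors (fst z) \<subseteq> S \<and> prime_factors (snd z) \<subseteq> S" if "z \<in> ?PS" for z
    using that pos[OF that] by (auto simp: prime_factors_product)
   have "fst x = fst y"
    by (rule nat_eq_of_multiplicity_on[where S = S]) (use pos[OF xy(1)] pos[OF xy(2)] sub[OF xy(1)] sub[OF xy(2)] eq in blast)+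
   moreover have "snd x = snd y"
    by (rule nat_eq_of_multiplicity_on[where S = S]) (use pos[OF xy(1)] pos[OF xy(2)] sub[OF xy(1)] sub[OF xy(2)] eq in blast)+
   ultimately show "x = y" by (rule prod_eqI)
  qed
  have im: "h ` ?PS \<subseteq> PiE S (\<lambda>_. X)"
  proof
   fix g assume "g \<in> h ` ?PS"
   then obtain x where x: "x \<in> ?PS" "g = h x" by auto
   show "g \<in> PiE S (\<lambda>_. X)" unfolding x(2) h_def
   proof (intro restrict_PiE_iff[THEN iffD2] ballI)
    fix p assume p: "p \<in> S"
    then have pp: "prime p" "p dvd fst x * snd x" using x pos[OF x(1)] by (auto simp: in_prime_factors_iff)
    then have "p dvd fst x \<or> p dvd snd x" by (simp add: prime_dvd_mult_iff)
    then have "multiplicity p (fst x) > 0 \<or> multiplicity p (snd x) > 0"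
     using pos[OF x(1)] pp by (auto simp: prime_multiplicity_gt_zero_iff)
    then show "(multiplicity p (fst x), multiplicity p (snd x)) \<in> X"
     using multB[of "fst x" "snd x" p] x pp by (auto simp: X_def)
   qed
  qed
  have "(\<Sum>x\<in>?PS. w x) = (\<Sum>x\<in>?PS. \<Prod>p\<in>S. f p (fst (h x p)) (snd (h x p)))"
   by (intro sum.cong refl) (auto simp: w_def h_def intro!: prod.cong)
  also have "\<dots> = (\<Sum>g\<in>h ` ?PS. \<Prod>p\<in>S. f p (fst (g p)) (snd (g p)))"
   using inj by (simp add: sum.reindex)
  also have "\<dots> \<le> (\<Sum>g\<in>PiE S (\<lambda>_. X). \<Prod>p\<in>S. f p (fst (g p)) (snd (g p)))"
   using im f finS finX by (intro sum_mono2 finite_PiE prod_nonneg) auto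
  also have "\<dots> = (\<Prod>p\<in>S. \<Sum>x\<in>X. f p (fst x) (snd x))"
   using finS finX by (subst prod_sum_PiE) auto
  also have "\<dots> \<le> (\<Prod>p\<in>S. lam p)"
   using lam[of _ B] S f by (intro prod_mono) (auto simp: X_def case_prod_unfold intro!: sum_nonneg)
  finally show ?thesis .
 qed
 have lam0: "lam p \<ge> 0" if "p \<in> Q" for p
  using lam[OF that, of 0] by simp
 have eqs: "{(d, m) \<in> P. card (prime_factors (d * m)) = k} = {x\<in>P. card (prime_factors (fst x * snd x)) = k}" by auto
 let ?Pk = "{x\<in>P. card (prime_factors (fst x * snd x)) = k}"
 have finS: "finite {S. S \<subseteq> Q \<and> card S = k}" by (rule finite_subset[of _ "Pow Q"]) (use Q in auto)
 have "(\<Sum>x\<in>?Pk. w x) = (\<Sum>S\<in>{S. S \<subseteq> Q \<and> card S = k}. \<Sum>x\<in>{x\<in>?Pk. prime_factors (fst x * snd x) = S}. w x)"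
 proof (rule sum.group[symmetric])
  show "(\<lambda>x. prime_factors (fst x * snd x)) ` ?Pk \<subseteq> {S. S \<subseteq> Q \<and> card S = k}"
  proof (rule image_subsetI)
   fix x assume "x \<in> ?Pk"
   then show "prime_factors (fst x * snd x) \<in> {S. S \<subseteq> Q \<and> card S = k}" using P[of "fst x" "snd x"] by simp
  qed
 qed (use fin finS in auto)
 also have "\<dots> = (\<Sum>S\<in>{S. S \<subseteq> Q \<and> card S = k}. \<Sum>x\<in>{x\<in>P. prime_factors (fst x * snd x) = S}. w x)"
  by (intro sum.cong) auto
 also have "\<dots> \<le> (\<Sum>S\<in>{S. S \<subseteq> Q \<and> card S = k}. \<Prod>p\<in>S. lam p)" using block by (intro sum_mono) auto
 also have "\<dots> = esym lam Q k" by (simp add: esym_def)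
 also have "\<dots> \<le> sum lam Q ^ k / fact k" using Q lam0 by (intro esym_le) auto
 finally show ?thesis unfolding eqs w_def by (simp only: case_prod_unfold)
qed

lemma pair_sum_le:
 fixes f :: "nat \<Rightarrow> nat \<Rightarrow> nat \<Rightarrow> real" and P :: "(nat \<times> nat) set"
 assumes fin: "finite P" and Q: "finite Q" and K: "finite K"
  and P: "\<And>d m. (d, m) \<in> P \<Longrightarrow> d > 0 \<and> m > 0 \<and> prime_factors (d * m) \<subseteq> Q \<and> card (prime_factors (d * m)) \<in> K"
  and f: "\<And>p i j. f p i j \<ge> 0"
  and lam: "\<And>p B. p \<in> Q \<Longrightarrow> (\<Sum>(i, j)\<in>{..B} \<times> {..B} - {(0, 0)}. f p i j) \<le> lam p"
 shows "(\<Sum>(d, m)\<in>P. \<Prod>p\<in>prime_factors (d * m). f p (multiplicity p d) (multiplicity p m))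
    \<le> (\<Sum>k\<in>K. sum lam Q ^ k / fact k)"
proof -
 let ?w = "\<lambda>x. \<Prod>p\<in>prime_factors (fst x * snd x). f p (multiplicity p (fst x)) (multiplicity p (snd x))"
 have "(\<Sum>x\<in>P. ?w x) = (\<Sum>k\<in>K. \<Sum>x\<in>{x\<in>P. card (prime_factors (fst x * snd x)) = k}. ?w x)"
 proof (rule sum.group[symmetric])
  show "(\<lambda>x. card (prime_factors (fst x * snd x))) ` P \<subseteq> K"
  proof (rule image_subsetI)
   fix x assume "x \<in> P"
   then show "card (prime_factors (fst x * snd x)) \<in> K" using P[of "fst x" "snd x"] by simp
  qed
 qed (use fin K in auto)
 also have "\<dots> \<le> (\<Sum>k\<in>K. sum lam Q ^ k / fact k)"
 proof (rule sum_mono)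
  fix k
  show "(\<Sum>x\<in>{x\<in>P. card (prime_factors (fst x * snd x)) = k}. ?w x) \<le> sum lam Q ^ k / fact k"
  proof -
   have "(\<Sum>(d, m)\<in>{(d, m) \<in> P. card (prime_factors (d * m)) = k}.
      \<Prod>p\<in>prime_factors (d * m). f p (multiplicity p d) (multiplicity p m)) \<le> sum lam Q ^ k / fact k"
    by (rule pair_sum_le_power_fact[OF fin Q _ f lam]) (use P in blast)+
   moreover have "{(d, m) \<in> P. card (prime_factors (d * m)) = k} = {x\<in>P. card (prime_factors (fst x * snd x)) = k}"
    by auto
   ultimately show ?thesis by (simp only: case_prod_unfold)
  qed
 qed
 finally show ?thesis by (simp only: case_prod_unfold)
qed

lemma sum_power_fact_le_exp:
 assumes "(x::real) \<ge> 0" "finite K"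
 shows "(\<Sum>k\<in>K. x ^ k / fact k) \<le> exp x"
proof -
 have "(\<Sum>k\<in>K. x ^ k / fact k) \<le> (\<Sum>k. x ^ k / fact k)"
  using summable_exp[of x] assms by (intro sum_le_suminf) (auto simp: field_simps)
 also have "\<dots> = exp x" by (simp add: exp_def scaleR_conv_of_real divide_inverse mult.commute)
 finally show ?thesis .
qed

text \<open>The weight \<open>gfac(n)^6 n^(\<beta> - 1)\<close> for \<open>n = d m\<close>: the powers of \<open>gfac\<close> absorb the arithmetic factors
 that the sieve produces, and a positive \<open>\<beta>\<close> serves for Rankin's trick.\<close>

definition wt :: "real \<Rightarrow> nat \<Rightarrow> real" where
 "wt \<beta> n = gfac n ^ 6 * real n powr (\<beta> - 1)"

text \<open>The factor of \<open>wt \<beta> n\<close> at a prime \<open>p\<close> that divides \<open>n\<close> exactly \<open>e > 0\<close> times.\<close>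

definition lwt :: "real \<Rightarrow> nat \<Rightarrow> nat \<Rightarrow> real" where
 "lwt \<beta> p e = exp (6 / real p) * (real p powr (\<beta> - 1)) ^ e"

lemma wt_nonneg: "wt \<beta> n \<ge> 0" by (simp add: wt_def)

lemma lwt_nonneg: "lwt \<beta> p e \<ge> 0" by (simp add: lwt_def)

lemma wt_eq_prod:
 assumes "n > 0"
 shows "wt \<beta> n = (\<Prod>p\<in>prime_factors n. lwt \<beta> p (multiplicity p n))"
proof -
 have g: "gfac n ^ 6 = (\<Prod>p\<in>prime_factors n. exp (6 / real p))"
  unfolding gfac_def by (simp add: exp_of_nat_mult[symmetric] exp_sum[symmetric] sum_distrib_left)
 have "real n = (\<Prod>p\<in>prime_factors n. real p ^ multiplicity p n)"
  using prime_factorization_nat[OF assms] by (metis (mono_tags, lifting) of_nat_power of_nat_prod prod.cong)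
 then have "real n powr (\<beta> - 1) = (\<Prod>p\<in>prime_factors n. real p ^ multiplicity p n) powr (\<beta> - 1)"
  by (rule arg_cong)
 also have "\<dots> = (\<Prod>p\<in>prime_factors n. (real p ^ multiplicity p n) powr (\<beta> - 1))"
  by (rule prod_powr_distrib)
 also have "\<dots> = (\<Prod>p\<in>prime_factors n. (real p powr (\<beta> - 1)) ^ multiplicity p n)"
 proof (intro prod.cong refl)
  fix p assume "p \<in> prime_factors n"
  then have "real p > 0" by (metis in_prime_factors_imp_prime of_nat_0_less_iff prime_gt_0_nat)
  then show "(real p ^ multiplicity p n) powr (\<beta> - 1) = (real p powr (\<beta> - 1)) ^ multiplicity p n"
   by (simp add: powr_realpow[symmetric] powr_powr mult.commute)
 qed
 finally show ?thesis unfolding wt_def g lwt_def by (simp add: prod.distrib)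
qed

lemma wt_mult_eq_prod:
 assumes "d > 0" "m > 0"
 shows "wt \<beta> (d * m) = (\<Prod>p\<in>prime_factors (d * m). lwt \<beta> p (multiplicity p d + multiplicity p m))"
proof -
 have "wt \<beta> (d * m) = (\<Prod>p\<in>prime_factors (d * m). lwt \<beta> p (multiplicity p (d * m)))"
  using assms by (intro wt_eq_prod) simp
 also have "\<dots> = (\<Prod>p\<in>prime_factors (d * m). lwt \<beta> p (multiplicity p d + multiplicity p m))"
 proof (intro prod.cong refl)
  fix p assume "p \<in> prime_factors (d * m)"
  then have "prime p" by (rule in_prime_factors_imp_prime)
  then have "multiplicity p (d * m) = multiplicity p d + multiplicity p m"
   using assms by (intro prime_elem_multiplicity_mult_distrib) auto
  then show "lwt \<beta> p (multiplicity p (d * m)) = lwt \<beta> p (multiplicity p d + multiplicity p m)" by simp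
 qed
 finally show ?thesis .
qed

lemma sum_powers_le:
 fixes x :: real
 assumes "0 \<le> x" "x \<le> 3/5"
 shows "(\<Sum>k\<le>B. x ^ k) \<le> 1 / (1 - x)" and "(\<Sum>j=1..B. x ^ j) \<le> x + 19 * x\<^sup>2"
  and "(\<Sum>(i, j)\<in>{..B} \<times> {..B} - {(0::nat, 0::nat)}. x ^ (i + j)) \<le> 2 * x + 19 * x\<^sup>2"
proof -
 have g: "(\<Sum>k\<le>B. x ^ k) \<le> 1 / (1 - x)" for B
 proof -
  have "(\<Sum>k\<le>B. x ^ k) = (1 - x ^ Suc B) / (1 - x)" using sum_gp_basic[of x B] assms by (simp add: field_simps)
  also have "\<dots> \<le> 1 / (1 - x)" using assms by (intro divide_right_mono) auto
  finally show ?thesis .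
 qed
 show "(\<Sum>k\<le>B. x ^ k) \<le> 1 / (1 - x)" by (rule g)
 have split: "(\<Sum>k\<le>B. x ^ k) = 1 + (\<Sum>j=1..B. x ^ j)"
  by (simp add: sum.atMost_shift atLeast0AtMost[symmetric] sum.atLeast_Suc_atMost)
 have i: "1 / (1 - x) \<le> 1 + x + 5/2 * x\<^sup>2"
 proof -
  have "0 \<le> x\<^sup>2 * (3/2 - 5/2 * x)" using assms by (intro mult_nonneg_nonneg) auto
  also have "\<dots> = (1 + x + 5/2 * x\<^sup>2) * (1 - x) - 1" by (simp add: power2_eq_square algebra_simps)
  finally show ?thesis using assms by (simp add: divide_le_eq)
 qed
 then show "(\<Sum>j=1..B. x ^ j) \<le> x + 19 * x\<^sup>2" using split g[of B] zero_le_power2[of x] by linarith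
 have "(\<Sum>(i, j)\<in>{..B} \<times> {..B}. x ^ (i + j)) = (\<Sum>k\<le>B. x ^ k) * (\<Sum>k\<le>B. x ^ k)"
  by (simp add: sum_product sum.cartesian_product power_add)
 also have "\<dots> \<le> (1 + x + 5/2 * x\<^sup>2) * (1 + x + 5/2 * x\<^sup>2)"
  using assms g[of B] i by (intro mult_mono sum_nonneg add_nonneg_nonneg) auto
 also have "\<dots> \<le> 1 + 2 * x + 19 * x\<^sup>2"
 proof -
  have b: "x * (x * x) \<le> 1 * (x * x)" "x * (x * (x * x)) \<le> 1 * (1 * (x * x))"
   using assms by (intro mult_mono mult_nonneg_nonneg; simp)+
  have "(1 + x + 5/2 * x\<^sup>2) * (1 + x + 5/2 * x\<^sup>2) = 1 + 2 * x + 6 * (x * x) + 5 * (x * (x * x)) + 25/4 * (x * (x * (x * x)))"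
   by (simp add: power2_eq_square algebra_simps)
  also have "\<dots> \<le> 1 + 2 * x + 19 * (x * x)" using b zero_le_square[of x] by linarith
  finally show ?thesis by (simp only: power2_eq_square)
 qed
 finally have "(\<Sum>(i, j)\<in>{..B} \<times> {..B}. x ^ (i + j)) \<le> 1 + 2 * x + 19 * x\<^sup>2" .
 moreover have "(\<Sum>(i, j)\<in>{..B} \<times> {..B}. x ^ (i + j))
  = (\<Sum>(i, j)\<in>{..B} \<times> {..B} - {(0::nat, 0::nat)}. x ^ (i + j)) + 1"
  by (subst sum.remove[of _ "(0,0)"]) auto
 ultimately show "(\<Sum>(i, j)\<in>{..B} \<times> {..B} - {(0::nat, 0::nat)}. x ^ (i + j)) \<le> 2 * x + 19 * x\<^sup>2"
  by linarith
qed

lemma prime_powr_le: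
 assumes "prime p" "\<beta> \<le> 1/4"
 shows "real p powr (\<beta> - 1) \<le> 3/5"
proof -
 have p: "real p \<ge> 2" using assms prime_ge_2_nat[of p] by simp
 have "real p powr (\<beta> - 1) \<le> real p powr (-3/4)" using assms p by (intro powr_mono) auto
 also have "\<dots> \<le> 2 powr (-3/4)" using p by (intro powr_mono2') auto
 also have "\<dots> \<le> 3/5"
 proof -
  have "(2 powr (-3/4)) ^ 4 = (2::real) powr (-3)" by (simp add: powr_realpow[symmetric] powr_powr)
  also have "\<dots> = 1/8" by (simp add: powr_minus)
  also have "\<dots> \<le> (3/5::real) ^ 4" by (simp add: power_divide)
  finally show ?thesis by (subst (asm) power_mono_iff) auto
 qed
 finally show ?thesis .
qed

text \<open>An upper bound for the local sums: \<open>c\<close> is the number of ways in which one factor \<open>p\<close> can occur, and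
the square takes care of higher powers, with \<open>19\<close> sufficient for \<open>p powr (\<beta> - 1) \<le> 3/5\<close>.\<close>

definition lam :: "real \<Rightarrow> real \<Rightarrow> nat \<Rightarrow> real" where
 "lam c \<beta> p = exp (6 / real p) * (c * real p powr (\<beta> - 1) + 19 * (real p powr (\<beta> - 1))\<^sup>2)"

text \<open>For \<open>p \<le> w\<close> and \<open>\<beta> ln w \<le> A\<close> the factor \<open>p^\<beta>\<close> is \<open>1 + O(\<beta> ln p)\<close>, and \<open>\<Sum> \<beta> ln p / p \<le> \<beta> ln w + O(1)\<close>
is bounded.\<close>

lemma sum_lam_le:
 assumes "c \<ge> 0" "A \<ge> 0"
 shows "\<exists>C\<ge>0. \<forall>w \<beta>. w \<ge> 2 \<longrightarrow> 0 \<le> \<beta> \<longrightarrow> \<beta> \<le> 1/4 \<longrightarrow> \<beta> * ln w \<le> A \<longrightarrow>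
  sum (lam c \<beta>) (primes_le w) \<le> c * ln (ln w) + C"
proof -
 obtain C2 where C2: "\<And>x. x \<ge> 2 \<Longrightarrow> (\<Sum>p\<in>primes_le x. 1 / real p) \<le> ln (ln x) + C2"
  using mertens2_upper by auto
 have "summable (\<lambda>n::nat. real n powr (-3/2))" by (simp add: summable_real_powr_iff)
 then obtain C3 where C3: "C3 \<ge> 0" "\<And>F. finite F \<Longrightarrow> (\<Sum>n\<in>F. real n powr (-3/2)) \<le> C3"
  using bounded_sums_of_summable[of "\<lambda>n. real n powr (-3/2)"] by auto
 define M where "M = c * A * exp A"
 define M2 where "M2 = exp 6 * 6 * c + exp 6 * 19"
 have M: "M \<ge> 0" "M2 \<ge> 0" using assms by (auto simp: M_def M2_def)
 define C where "C = c * \<bar>C2\<bar> + M * (1 + ln 4 / ln 2) + M2 * C3"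
 have "C \<ge> 0" using assms M C3 by (auto simp: C_def intro!: add_nonneg_nonneg mult_nonneg_nonneg)
 moreover have "sum (lam c \<beta>) (primes_le w) \<le> c * ln (ln w) + C"
  if w: "w \<ge> 2" and \<beta>: "0 \<le> \<beta>" "\<beta> \<le> 1/4" "\<beta> * ln w \<le> A" for w \<beta>
 proof -
  have lw: "ln w > 0" using w by simp
  have "lam c \<beta> p \<le> c * (1 / real p) + M / ln w * (ln (real p) / real p) + M2 * real p powr (-3/2)"
   if p: "p \<in> primes_le w" for p
  proof -
   have p2: "real p \<ge> 2" "real p \<le> w" using p prime_ge_2_nat[of p] by (auto simp: primes_le_iff)
   define x where "x = real p powr (\<beta> - 1)"
   have x0: "x \<ge> 0" by (simp add: x_def)
   have x1: "x \<le> 1 / real p + A * exp A / ln w * (ln (real p) / real p)"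
   proof -
    define y where "y = A * (ln (real p) / ln w)"
    have lp: "0 \<le> ln (real p)" "ln (real p) \<le> ln w" using p2 by auto
    have "ln (real p) / ln w \<le> 1" "0 \<le> ln (real p) / ln w" using lp lw by auto
    then have y: "0 \<le> y" "y \<le> A" using assms mult_left_mono[of "ln (real p) / ln w" 1 A] by (auto simp: y_def simp del: times_divide_eq_right)
    have "\<beta> * ln (real p) = \<beta> * ln w * (ln (real p) / ln w)" using lw by simp
    also have "\<dots> \<le> y" unfolding y_def using \<beta> lp lw by (intro mult_right_mono) auto
    finally have "exp (\<beta> * ln (real p)) \<le> exp y" by simp
    also have "\<dots> \<le> 1 + y * exp A"
    proof -
     have "1 - y \<le> exp (- y)" using exp_ge_add_one_self[of "- y"] by simp
     then have "(1 - y) * exp y \<le> exp (- y) * exp y" by (intro mult_right_mono) auto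
     then have "exp y \<le> 1 + y * exp y" by (simp add: exp_add[symmetric] algebra_simps)
     moreover have "y * exp y \<le> y * exp A" using y by (intro mult_left_mono) auto
     ultimately show ?thesis by linarith
    qed
    finally have "real p powr \<beta> \<le> 1 + y * exp A" using p2 by (simp add: powr_def)
    then have "real p powr \<beta> / real p \<le> (1 + y * exp A) / real p" by (intro divide_right_mono) auto
    moreover have "real p powr \<beta> / real p = x" using p2 by (simp add: x_def powr_diff)
    ultimately show ?thesis by (simp add: y_def add_divide_distrib mult_ac)
   qed
   have x34: "x \<le> real p powr (-3/4)" unfolding x_def using \<beta> p2 by (intro powr_mono) auto
   have xx: "x\<^sup>2 \<le> real p powr (-3/2)"
   proof -
    have "x\<^sup>2 \<le> (real p powr (-3/4))\<^sup>2" using x34 x0 by (intro power_mono)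
    also have "\<dots> = real p powr (-3/2)" using p2 by (simp add: powr_realpow[symmetric] powr_powr)
    finally show ?thesis .
   qed
   have xp: "x / real p \<le> real p powr (-3/2)"
   proof -
    have "x / real p = x * real p powr (-1)" using p2 by (simp add: powr_minus divide_inverse)
    also have "\<dots> \<le> real p powr (-3/4) * real p powr (-1)" by (rule mult_right_mono[OF x34]) simp
    also have "\<dots> = real p powr (-3/4 + -1)" by (simp only: powr_add)
    also have "\<dots> \<le> real p powr (-3/2)" using p2 by (intro powr_mono) simp_all
    finally show ?thesis .
   qed
   have e1: "exp (6 / real p) \<le> 1 + exp 6 * 6 / real p"
   proof -
    let ?y = "6 / real p"
    have "1 - ?y \<le> exp (- ?y)" using exp_ge_add_one_self[of "- ?y"] by simp
    then have "(1 - ?y) * exp ?y \<le> exp (- ?y) * exp ?y" by (intro mult_right_mono) auto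
    then have "exp ?y \<le> 1 + ?y * exp ?y" by (simp add: exp_add[symmetric] algebra_simps)
    moreover have "?y * exp ?y \<le> ?y * exp 6" using p2 by (intro mult_left_mono) (auto simp: divide_le_eq)
    ultimately show ?thesis by (simp add: mult_ac)
   qed
   have e2: "exp (6 / real p) \<le> exp 6" using p2 by (simp add: divide_le_eq)
   have "lam c \<beta> p = exp (6 / real p) * (c * x) + exp (6 / real p) * (19 * x\<^sup>2)"
    by (simp add: lam_def x_def algebra_simps)
   also have "\<dots> \<le> (1 + exp 6 * 6 / real p) * (c * x) + exp 6 * (19 * real p powr (-3/2))"
    using e1 e2 x0 xx assms by (intro add_mono mult_mono) auto
   also have "\<dots> = c * x + exp 6 * 6 * c * (x / real p) + exp 6 * 19 * real p powr (-3/2)"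
    by (simp add: algebra_simps)
   also have "\<dots> \<le> c * (1 / real p + A * exp A / ln w * (ln (real p) / real p))
     + exp 6 * 6 * c * real p powr (-3/2) + exp 6 * 19 * real p powr (-3/2)"
    using x1 xp assms by (intro add_mono mult_left_mono) auto
   also have "\<dots> = c * (1 / real p) + M / ln w * (ln (real p) / real p) + M2 * real p powr (-3/2)"
    by (simp add: M_def M2_def algebra_simps)
   finally show ?thesis .
  qed
  then have "sum (lam c \<beta>) (primes_le w)
   \<le> (\<Sum>p\<in>primes_le w. c * (1 / real p) + M / ln w * (ln (real p) / real p) + M2 * real p powr (-3/2))"
   by (rule sum_mono)
  also have "\<dots> = c * (\<Sum>p\<in>primes_le w. 1 / real p) + M / ln w * (\<Sum>p\<in>primes_le w. ln (real p) / real p)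
    + M2 * (\<Sum>p\<in>primes_le w. real p powr (-3/2))"
   by (simp only: sum.distrib sum_distrib_left)
  also have "\<dots> \<le> c * (ln (ln w) + C2) + M / ln w * (ln w + ln 4) + M2 * C3"
   using C2[OF w] mertens1_upper[of w] C3(2)[of "primes_le w"] w lw M assms
   by (intro add_mono mult_left_mono) auto
  also have "M / ln w * (ln w + ln 4) = M * (1 + ln 4 / ln w)" using lw by (simp add: field_simps)
  also have "\<dots> \<le> M * (1 + ln 4 / ln 2)" using w M by (intro mult_left_mono add_left_mono divide_left_mono) auto
  also have "c * (ln (ln w) + C2) \<le> c * ln (ln w) + c * \<bar>C2\<bar>"
   using assms mult_left_mono[of C2 "\<bar>C2\<bar>" c] by (simp add: distrib_left)
  finally show ?thesis unfolding C_def by linarith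
 qed
 ultimately show ?thesis by blast
qed

definition smooth_pairs :: "real \<Rightarrow> real \<Rightarrow> (nat \<times> nat) set" where
 "smooth_pairs w Y = {(d, m). d > 0 \<and> m > 0 \<and> real (d * m) \<le> Y \<and> prime_factors (d * m) \<subseteq> primes_le w}"

definition smooth :: "real \<Rightarrow> real \<Rightarrow> nat set" where
 "smooth w Y = {m. m > 0 \<and> real m \<le> Y \<and> prime_factors m \<subseteq> primes_le w}"

lemma smooth_pairsD:
 "(d, m) \<in> smooth_pairs w Y \<Longrightarrow> d > 0 \<and> m > 0 \<and> prime_factors (d * m) \<subseteq> primes_le w"
 by (simp add: smooth_pairs_def)

lemma smoothD: "m \<in> smooth w Y \<Longrightarrow> m > 0 \<and> prime_factors m \<subseteq> primes_le w"
 by (simp add: smooth_def)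

lemma finite_smooth [simp]: "finite (smooth w Y)"
 by (rule finite_subset[OF _ finite_nat_le_real[of Y]]) (auto simp: smooth_def)

lemma finite_smooth_pairs [simp]: "finite (smooth_pairs w Y)"
proof (rule finite_subset)
 show "smooth_pairs w Y \<subseteq> {n. real n \<le> Y} \<times> {n. real n \<le> Y}"
 proof
  fix x assume "x \<in> smooth_pairs w Y"
  then obtain d m where x: "x = (d, m)" "d > 0" "m > 0" "real (d * m) \<le> Y" by (auto simp: smooth_pairs_def)
  have "d \<le> d * m" "m \<le> d * m" using x by simp_all
  then have "real d \<le> real (d * m)" "real m \<le> real (d * m)" by (simp_all only: of_nat_le_iff)
  then have "real d \<le> Y" "real m \<le> Y" using x(4) by linarith+
  then show "x \<in> {n. real n \<le> Y} \<times> {n. real n \<le> Y}" using x(1) by simp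
 qed
qed auto

abbreviation (input) smooth_pairs_few :: "real \<Rightarrow> real \<Rightarrow> nat \<Rightarrow> (nat \<times> nat) set" where
 "smooth_pairs_few w Y K \<equiv> {(d, m) \<in> smooth_pairs w Y. card (prime_factors (d * m)) < K}"

text \<open>A prime can divide \<open>d\<close> or \<open>m\<close>, which gives \<open>c = 2\<close> in \<open>lam\<close> and the mean \<open>2 L\<close>.\<close>

lemma sum_smooth_pairs:
 assumes "A \<ge> 0"
 shows "\<exists>C\<ge>0. \<forall>w \<beta> Y L K. w \<ge> 2 \<longrightarrow> 0 \<le> \<beta> \<longrightarrow> \<beta> \<le> 1/4 \<longrightarrow> \<beta> * ln w \<le> A \<longrightarrow> ln (ln w) \<le> L \<longrightarrow>
  (\<Sum>(d, m)\<in>smooth_pairs_few w Y K. wt \<beta> (d * m))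
   \<le> (\<Sum>k<K. (2 * L + C) ^ k / fact k)"
proof -
 obtain C where C: "C \<ge> 0" "\<And>w \<beta>. w \<ge> 2 \<Longrightarrow> 0 \<le> \<beta> \<Longrightarrow> \<beta> \<le> 1/4 \<Longrightarrow> \<beta> * ln w \<le> A \<Longrightarrow>
  sum (lam 2 \<beta>) (primes_le w) \<le> 2 * ln (ln w) + C"
  using sum_lam_le[of 2 A] assms by auto
 show ?thesis
 proof (intro exI[of _ C] conjI allI impI)
  fix w \<beta> Y L :: real and K :: nat
  assume w: "w \<ge> 2" and \<beta>: "0 \<le> \<beta>" "\<beta> \<le> 1/4" "\<beta> * ln w \<le> A" and L: "ln (ln w) \<le> L"
  let ?P = "smooth_pairs_few w Y K"
  have "(\<Sum>(d, m)\<in>?P. wt \<beta> (d * m)) = (\<Sum>(d, m)\<in>?P. \<Prod>p\<in>prime_factors (d * m). lwt \<beta> p (multiplicity p d + multiplicity p m))"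
  proof (intro sum.cong refl, clarify)
   fix d m assume "(d, m) \<in> smooth_pairs w Y"
   then show "wt \<beta> (d * m) = (\<Prod>p\<in>prime_factors (d * m). lwt \<beta> p (multiplicity p d + multiplicity p m))"
    by (intro wt_mult_eq_prod) (simp_all add: smooth_pairsD)
  qed
  also have "\<dots> \<le> (\<Sum>k\<in>{..<K}. sum (lam 2 \<beta>) (primes_le w) ^ k / fact k)"
  proof (rule pair_sum_le[where f = "\<lambda>p i j. lwt \<beta> p (i + j)"])
   show "finite ?P" by (rule finite_subset[OF _ finite_smooth_pairs[of w Y]]) auto
   fix p B assume p: "p \<in> primes_le w"
   have "(\<Sum>(i, j)\<in>{..B} \<times> {..B} - {(0, 0)}. lwt \<beta> p (i + j))
    = exp (6 / real p) * (\<Sum>(i, j)\<in>{..B} \<times> {..B} - {(0, 0)}. (real p powr (\<beta> - 1)) ^ (i + j))"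
    by (simp add: lwt_def sum_distrib_left case_prod_unfold)
   also have "\<dots> \<le> lam 2 \<beta> p" unfolding lam_def
    using p \<beta> prime_powr_le[of p \<beta>] by (intro mult_left_mono sum_powers_le) (auto simp: primes_le_iff)
   finally show "(\<Sum>(i, j)\<in>{..B} \<times> {..B} - {(0, 0)}. lwt \<beta> p (i + j)) \<le> lam 2 \<beta> p" .
  next
   fix d m assume "(d, m) \<in> ?P"
   then show "d > 0 \<and> m > 0 \<and> prime_factors (d * m) \<subseteq> primes_le w \<and> card (prime_factors (d * m)) \<in> {..<K}"
    using smooth_pairsD[of d m w Y] by simp
  qed (simp_all add: lwt_nonneg)
  also have "\<dots> \<le> (\<Sum>k<K. (2 * L + C) ^ k / fact k)"
  proof (intro sum_mono divide_right_mono power_mono)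
   show "sum (lam 2 \<beta>) (primes_le w) \<le> 2 * L + C" using C(2)[OF w \<beta>] L by linarith
   show "0 \<le> sum (lam 2 \<beta>) (primes_le w)" by (auto intro!: sum_nonneg simp: lam_def)
  qed auto
  finally show "(\<Sum>(d, m)\<in>?P. wt \<beta> (d * m)) \<le> (\<Sum>k<K. (2 * L + C) ^ k / fact k)" .
 qed (use C in auto)
qed

abbreviation (input) smooth_many :: "real \<Rightarrow> real \<Rightarrow> nat \<Rightarrow> nat set" where
 "smooth_many w Y K \<equiv> {m \<in> smooth w Y. card (prime_factors m) \<ge> K}"

lemma sum_smooth:
 assumes "A \<ge> 0"
 shows "\<exists>C\<ge>0. \<forall>w \<beta> Y L K. w \<ge> 2 \<longrightarrow> 0 \<le> \<beta> \<longrightarrow> \<beta> \<le> 1/4 \<longrightarrow> \<beta> * ln w \<le> A \<longrightarrow> ln (ln w) \<le> L \<longrightarrow>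
  (\<exists>N. (\<Sum>m\<in>smooth_many w Y K. wt \<beta> m)
   \<le> (\<Sum>k\<in>{K..N}. (L + C) ^ k / fact k))"
proof -
 obtain C where C: "C \<ge> 0" "\<And>w \<beta>. w \<ge> 2 \<Longrightarrow> 0 \<le> \<beta> \<Longrightarrow> \<beta> \<le> 1/4 \<Longrightarrow> \<beta> * ln w \<le> A \<Longrightarrow>
  sum (lam 1 \<beta>) (primes_le w) \<le> 1 * ln (ln w) + C"
  using sum_lam_le[of 1 A] assms by auto
 show ?thesis
 proof (intro exI[of _ C] conjI allI impI)
  fix w \<beta> Y L :: real and K :: nat
  assume w: "w \<ge> 2" and \<beta>: "0 \<le> \<beta>" "\<beta> \<le> 1/4" "\<beta> * ln w \<le> A" and L: "ln (ln w) \<le> L"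
  let ?M = "smooth_many w Y K"
  let ?P = "(\<lambda>m. (1::nat, m)) ` ?M"
  let ?f = "\<lambda>p i j. if i = 0 then lwt \<beta> p j else 0"
  let ?N = "card (primes_le w)"
  have "(\<Sum>m\<in>?M. wt \<beta> m) = (\<Sum>m\<in>?M. \<Prod>p\<in>prime_factors (1 * m). ?f p (multiplicity p (1::nat)) (multiplicity p m))"
  proof (intro sum.cong refl)
   fix m assume "m \<in> ?M"
   then show "wt \<beta> m = (\<Prod>p\<in>prime_factors (1 * m). ?f p (multiplicity p (1::nat)) (multiplicity p m))"
    using smoothD[of m w Y] wt_eq_prod[of m \<beta>] by simp
  qed
  also have "\<dots> = (\<Sum>(d, m)\<in>?P. \<Prod>p\<in>prime_factors (d * m). ?f p (multiplicity p d) (multiplicity p m))"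
   by (subst sum.reindex) (auto simp: inj_on_def)
  also have "\<dots> \<le> (\<Sum>k\<in>{K..?N}. sum (lam 1 \<beta>) (primes_le w) ^ k / fact k)"
  proof (rule pair_sum_le[where f = ?f])
   show "finite ?P" by simp
   fix d m assume "(d, m) \<in> ?P"
   then have "d = 1" "m \<in> ?M" by auto
   then show "d > 0 \<and> m > 0 \<and> prime_factors (d * m) \<subseteq> primes_le w \<and> card (prime_factors (d * m)) \<in> {K..?N}"
    using smoothD[of m w Y] by (auto intro!: card_mono)
  next
   fix p B assume p: "p \<in> primes_le w"
   let ?x = "real p powr (\<beta> - 1)"
   have "(\<Sum>(i, j)\<in>{..B} \<times> {..B} - {(0, 0)}. ?f p i j) = (\<Sum>(i, j)\<in>(\<lambda>j. (0::nat, j)) ` {1..B}. lwt \<beta> p j)"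
    by (rule sum.mono_neutral_cong_right) (auto split: if_splits)
   also have "\<dots> = exp (6 / real p) * (\<Sum>j=1..B. ?x ^ j)"
    by (subst sum.reindex) (auto simp: inj_on_def lwt_def sum_distrib_left)
   also have "\<dots> \<le> exp (6 / real p) * (?x + 19 * ?x\<^sup>2)"
    using p \<beta> prime_powr_le[of p \<beta>] by (intro mult_left_mono sum_powers_le) (auto simp: primes_le_iff)
   also have "\<dots> = lam 1 \<beta> p" by (simp add: lam_def)
   finally show "(\<Sum>(i, j)\<in>{..B} \<times> {..B} - {(0, 0)}. ?f p i j) \<le> lam 1 \<beta> p" .
  qed (simp_all add: lwt_nonneg)
  also have "\<dots> \<le> (\<Sum>k\<in>{K..?N}. (L + C) ^ k / fact k)"
  proof (intro sum_mono divide_right_mono power_mono)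
   show "sum (lam 1 \<beta>) (primes_le w) \<le> L + C" using C(2)[OF w \<beta>] L by linarith
   show "0 \<le> sum (lam 1 \<beta>) (primes_le w)" by (auto intro!: sum_nonneg simp: lam_def)
  qed auto
  finally show "\<exists>N. (\<Sum>m\<in>?M. wt \<beta> m) \<le> (\<Sum>k\<in>{K..N}. (L + C) ^ k / fact k)" ..
 qed (use C in auto)
qed

text \<open>Pairs \<open>(d, m)\<close> for which few primes \<open>p > T\<close> divide \<open>m\<close> exactly once and \<open>d\<close> not at all are
 detected by giving each such prime the weight \<open>1/4\<close>.\<close>

definition single_primes :: "real \<Rightarrow> nat \<Rightarrow> nat \<Rightarrow> nat set" where
 "single_primes T d m = {p \<in> prime_factors (d * m). real p > T \<and> multiplicity p d = 0 \<and> multiplicity p m = 1}"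

lemma finite_single_primes [simp]: "finite (single_primes T d m)"
 by (simp add: single_primes_def)

text \<open>The weight replaces the local mean \<open>2 / p\<close> by \<open>(1 + 1/4) / p\<close> for \<open>p > T\<close>.\<close>

lemma sum_smooth_pairs_few_single:
 assumes "A \<ge> 0"
 shows "\<exists>C\<ge>0. \<forall>w \<beta> Y L T. w \<ge> 2 \<longrightarrow> 0 \<le> \<beta> \<longrightarrow> \<beta> \<le> 1/4 \<longrightarrow> \<beta> * ln w \<le> A \<longrightarrow> ln (ln w) \<le> L \<longrightarrow> T \<ge> 3 \<longrightarrow> L \<ge> 0 \<longrightarrow>
  (\<Sum>(d, m)\<in>smooth_pairs w Y. wt \<beta> (d * m) * (1/4) ^ card (single_primes T d m))
   \<le> exp (5/4 * L + 2 * ln (ln T) + C)"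
proof -
 obtain C where C: "C \<ge> 0" "\<And>w \<beta>. w \<ge> 2 \<Longrightarrow> 0 \<le> \<beta> \<Longrightarrow> \<beta> \<le> 1/4 \<Longrightarrow> \<beta> * ln w \<le> A \<Longrightarrow>
  sum (lam 2 \<beta>) (primes_le w) \<le> 2 * ln (ln w) + C"
  using sum_lam_le[of 2 A] assms by auto
 obtain C2 where C2: "\<And>x. x \<ge> 2 \<Longrightarrow> (\<Sum>p\<in>primes_le x. 1 / real p) \<le> ln (ln x) + C2"
  using mertens2_upper by auto
 obtain C3 where C3: "\<And>x. x \<ge> 2 \<Longrightarrow> (\<Sum>p\<in>primes_le x. 1 / real p) \<ge> ln (ln x) - C3"
  using mertens2_lower by auto
 show ?thesis
 proof (intro exI[of _ "C + \<bar>C2\<bar> + \<bar>C3\<bar>"] conjI allI impI)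
  fix w \<beta> Y L T :: real
  assume w: "w \<ge> 2" and \<beta>: "0 \<le> \<beta>" "\<beta> \<le> 1/4" "\<beta> * ln w \<le> A" and L: "ln (ln w) \<le> L" "L \<ge> 0" and T: "T \<ge> 3"
  let ?f = "\<lambda>p i j. lwt \<beta> p (i + j) * (if real p > T \<and> i = 0 \<and> j = (1::nat) then 1/4 else 1)"
  let ?lam = "\<lambda>p. lam 2 \<beta> p - (if real p > T then 3/4 * (1 / real p) else 0)"
  have lnT: "ln (ln T) \<ge> 0"
  proof -
   have "exp 1 \<le> T" using exp_le T by linarith
   then have "1 \<le> ln T" using T by (subst ln_ge_iff) auto
   then show ?thesis by simp
  qed
  have "(\<Sum>(d, m)\<in>smooth_pairs w Y. wt \<beta> (d * m) * (1/4) ^ card (single_primes T d m))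
   = (\<Sum>(d, m)\<in>smooth_pairs w Y. \<Prod>p\<in>prime_factors (d * m). ?f p (multiplicity p d) (multiplicity p m))"
  proof (intro sum.cong refl, clarify)
   fix d m assume dm: "(d, m) \<in> smooth_pairs w Y"
   have "(1/4::real) ^ card (single_primes T d m)
    = (\<Prod>p\<in>prime_factors (d * m). if real p > T \<and> multiplicity p d = 0 \<and> multiplicity p m = 1 then 1/4 else 1)"
    by (subst prod.If_cases) (auto simp: single_primes_def Int_def)
   then show "wt \<beta> (d * m) * (1/4) ^ card (single_primes T d m)
    = (\<Prod>p\<in>prime_factors (d * m). ?f p (multiplicity p d) (multiplicity p m))"
    using smooth_pairsD[OF dm] by (simp only: wt_mult_eq_prod prod.distrib)
  qed
  also have "\<dots> \<le> (\<Sum>k\<in>{..card (primes_le w)}. sum ?lam (primes_le w) ^ k / fact k)"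
  proof (rule pair_sum_le[where f = ?f])
   fix d m assume "(d, m) \<in> smooth_pairs w Y"
   then show "d > 0 \<and> m > 0 \<and> prime_factors (d * m) \<subseteq> primes_le w \<and> card (prime_factors (d * m)) \<in> {..card (primes_le w)}"
    using smooth_pairsD[of d m w Y] by (auto intro!: card_mono)
  next
   fix p B assume p: "p \<in> primes_le w"
   then have p2: "real p \<ge> 2" using prime_ge_2_nat[of p] by (simp add: primes_le_iff)
   let ?X = "{..B} \<times> {..B} - {(0::nat, 0::nat)}"
   have full: "(\<Sum>(i, j)\<in>{..B} \<times> {..B} - {(0, 0)}. lwt \<beta> p (i + j)) \<le> lam 2 \<beta> p" for B :: nat
   proof -
    have "(\<Sum>(i, j)\<in>{..B} \<times> {..B} - {(0, 0)}. lwt \<beta> p (i + j))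
    = exp (6 / real p) * (\<Sum>(i, j)\<in>{..B} \<times> {..B} - {(0, 0)}. (real p powr (\<beta> - 1)) ^ (i + j))"
     by (simp add: lwt_def sum_distrib_left case_prod_unfold)
    also have "\<dots> \<le> lam 2 \<beta> p" unfolding lam_def
     using p \<beta> prime_powr_le[of p \<beta>] by (intro mult_left_mono sum_powers_le) (auto simp: primes_le_iff)
    finally show ?thesis .
   qed
   have small: "1 / real p \<le> lwt \<beta> p 1"
   proof -
    have "1 / real p = 1 * real p powr (-1)" using p2 by (simp add: powr_minus divide_inverse)
    also have "\<dots> \<le> exp (6 / real p) * real p powr (\<beta> - 1)" using p2 \<beta> by (intro mult_mono powr_mono) auto
    finally show ?thesis by (simp add: lwt_def)
   qed
   show "(\<Sum>(i, j)\<in>?X. ?f p i j) \<le> ?lam p"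
   proof (cases "real p > T")
    case False
    then show ?thesis using full[of B] by simp
   next
    case True
    have bnd: "(\<Sum>(i, j)\<in>?X. ?f p i j) \<le> lam 2 \<beta> p - 3/4 * (1 / real p)" if B: "B \<ge> 1"
    proof -
     have mem: "(0, 1) \<in> {..B} \<times> {..B} - {(0::nat, 0::nat)}" using B by auto
     let ?Y = "{..B} \<times> {..B} - {(0::nat, 0::nat)}"
     have "(\<Sum>(i, j)\<in>?Y. ?f p i j) = (\<Sum>x\<in>?Y. lwt \<beta> p (fst x + snd x) - (if x = (0, 1) then 3/4 * lwt \<beta> p 1 else 0))"
      using True by (intro sum.cong refl) (auto split: if_splits)
     also have "\<dots> = (\<Sum>x\<in>?Y. lwt \<beta> p (fst x + snd x)) - 3/4 * lwt \<beta> p 1"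
      using mem by (simp add: sum_subtractf)
     also have "\<dots> \<le> lam 2 \<beta> p - 3/4 * (1 / real p)"
      using full[of B] small by (simp add: case_prod_unfold)
     finally show ?thesis .
    qed
    show ?thesis
    proof (cases "B \<ge> 1")
     case False
     then have "B = 0" by simp
     have "3/4 * (1 / real p) \<le> lam 2 \<beta> p"
     proof -
      have "lwt \<beta> p 1 \<le> lam 2 \<beta> p"
       by (simp add: lwt_def lam_def distrib_left)
      moreover have "3/4 * (1 / real p) \<le> 1 * (1 / real p)" by (intro mult_right_mono) auto
      ultimately show ?thesis using small by linarith
     qed
     then show ?thesis using True \<open>B = 0\<close> by simp
    qed (use bnd True in simp)
   qed
  qed (simp_all add: lwt_nonneg)
  also have "\<dots> \<le> exp (sum ?lam (primes_le w))"
  proof (rule sum_power_fact_le_exp)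
   show "0 \<le> sum ?lam (primes_le w)"
   proof (rule sum_nonneg)
    fix p assume p: "p \<in> primes_le w"
    then have p2: "real p \<ge> 2" using prime_ge_2_nat[of p] by (simp add: primes_le_iff)
    have "1 / real p = 1 * (1 * real p powr (-1))" using p2 by (simp add: powr_minus divide_inverse)
    also have "\<dots> \<le> exp (6 / real p) * (2 * real p powr (\<beta> - 1) + 19 * (real p powr (\<beta> - 1))\<^sup>2)"
    proof (rule mult_mono)
     have "1 * real p powr (-1) \<le> 2 * real p powr (\<beta> - 1)" using p2 \<beta> by (intro mult_mono powr_mono) auto
     then show "1 * real p powr (-1) \<le> 2 * real p powr (\<beta> - 1) + 19 * (real p powr (\<beta> - 1))\<^sup>2"
      using zero_le_power2[of "real p powr (\<beta> - 1)"] by linarith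
    qed auto
    finally have "1 / real p \<le> lam 2 \<beta> p" by (simp add: lam_def)
    moreover have "3/4 * (1 / real p) \<le> 1 * (1 / real p)" by (intro mult_right_mono) auto
    moreover have "0 \<le> 1 / real p" by simp
    ultimately have "0 \<le> lam 2 \<beta> p" "3/4 * (1 / real p) \<le> lam 2 \<beta> p" by linarith+
    then show "0 \<le> ?lam p" by simp
   qed
  qed auto
  also have "\<dots> \<le> exp (5/4 * L + 2 * ln (ln T) + (C + \<bar>C2\<bar> + \<bar>C3\<bar>))"
  proof -
   have s: "sum ?lam (primes_le w) = sum (lam 2 \<beta>) (primes_le w) - 3/4 * (\<Sum>p\<in>{p\<in>primes_le w. real p > T}. 1 / real p)"
    by (simp add: sum_subtractf sum_distrib_left sum.If_cases Int_def)
   have "sum ?lam (primes_le w) \<le> 5/4 * L + 2 * ln (ln T) + (C + \<bar>C2\<bar> + \<bar>C3\<bar>)"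
   proof (cases "w \<ge> T")
    case True
    have "(\<Sum>p\<in>primes_le w. 1 / real p) \<le> (\<Sum>p\<in>primes_le T \<union> {p\<in>primes_le w. real p > T}. 1 / real p)"
     by (intro sum_mono2) (auto simp: primes_le_iff)
    also have "\<dots> \<le> (\<Sum>p\<in>primes_le T. 1 / real p) + (\<Sum>p\<in>{p\<in>primes_le w. real p > T}. 1 / real p)"
     by (intro sum_Un_le) auto
    finally have "(\<Sum>p\<in>{p\<in>primes_le w. real p > T}. 1 / real p) \<ge> (ln (ln w) - C3) - (ln (ln T) + C2)"
     using C2[of T] C3[OF w] T by linarith
    then show ?thesis unfolding s using C(2)[OF w \<beta>] L lnT by linarith
   next
    case False
    have "ln w \<le> ln T" using False w by simp
    then have "ln (ln w) \<le> ln (ln T)" by (subst ln_le_cancel_iff) (use w T in auto)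
    moreover have "(\<Sum>p\<in>{p\<in>primes_le w. real p > T}. 1 / real p) \<ge> 0" by (intro sum_nonneg) auto
    ultimately show ?thesis unfolding s using C(2)[OF w \<beta>] L lnT by linarith
   qed
   then show ?thesis by simp
  qed
  finally show "(\<Sum>(d, m)\<in>smooth_pairs w Y. wt \<beta> (d * m) * (1/4) ^ card (single_primes T d m))
   \<le> exp (5/4 * L + 2 * ln (ln T) + (C + \<bar>C2\<bar> + \<bar>C3\<bar>))" .
 qed (use C in auto)
qed

text \<open>The prime factors of \<open>N\<close>, taken in increasing order, are collected in \<open>M\<close> until either all those
 up to \<open>w\<close> are used or \<open>M\<close> exceeds \<open>Y\<close>.\<close>

lemma prefix_decomposition:
 fixes N :: nat and Y w :: real
 assumes "N > 0" "Y \<ge> 1"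
 obtains M r where "N = M * r" "real M \<le> Y" "\<And>p. prime p \<Longrightarrow> p dvd M \<Longrightarrow> real p \<le> w" "\<And>p. prime p \<Longrightarrow> p dvd r \<Longrightarrow> real p > w"
 | M r P where "N = P * M * r" "prime P" "real P \<le> w" "real M \<le> Y" "real (P * M) > Y"
   "\<And>p. prime p \<Longrightarrow> p dvd M \<Longrightarrow> p \<le> P" "\<And>p. prime p \<Longrightarrow> p dvd r \<Longrightarrow> P \<le> p"
proof -
 define G where "G = {m. m dvd N \<and> real m \<le> Y \<and> (\<forall>p. prime p \<longrightarrow> p dvd m \<longrightarrow> real p \<le> w)
   \<and> (\<forall>p q. prime p \<longrightarrow> prime q \<longrightarrow> p dvd m \<longrightarrow> q dvd N div m \<longrightarrow> p \<le> q)}"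
 have finG: "finite G" by (rule finite_subset[of _ "{..N}"]) (use assms in \<open>auto simp: G_def dest: dvd_imp_le\<close>)
 have "1 \<in> G" using assms by (auto simp: G_def)
 then have "Max G \<in> G" using finG by (intro Max_in) auto
 define M where "M = Max G"
 have M: "M \<in> G" and Mmax: "\<And>m. m \<in> G \<Longrightarrow> m \<le> M" using \<open>Max G \<in> G\<close> finG by (auto simp: M_def)
 have MN: "M dvd N" using M by (simp add: G_def)
 define s where "s = N div M"
 have N: "N = M * s" using MN by (simp add: s_def)
 have s0: "s > 0" "M > 0" using N assms by auto
 show ?thesis
 proof (cases "\<forall>p. prime p \<longrightarrow> p dvd s \<longrightarrow> real p > w")
  case True
  show ?thesis
  proof (rule that(1))
   show "N = M * s" by (rule N)
   show "real M \<le> Y" "\<And>p. prime p \<Longrightarrow> p dvd M \<Longrightarrow> real p \<le> w" using M unfolding G_def by blast+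
   show "\<And>p. prime p \<Longrightarrow> p dvd s \<Longrightarrow> real p > w" using True by blast
  qed
 next
  case False
  define P where "P = (LEAST p. prime p \<and> p dvd s)"
  obtain p0 where p0: "prime p0 \<and> p0 dvd s" "real p0 \<le> w" using False by (auto simp: not_less)
  have "prime P \<and> P dvd s" unfolding P_def using p0(1) by (rule LeastI)
  then have P: "prime P" "P dvd s" by blast+
  have Pmin: "P \<le> p" if "prime p" "p dvd s" for p unfolding P_def using that by (intro Least_le conjI)
  have Pw: "real P \<le> w" using Pmin[of p0] p0 by linarith
  obtain r where r: "s = P * r" using P(2) by (rule dvdE)
  have Pge: "p \<le> P" if "prime p" "p dvd M" for p
   using M that P unfolding G_def s_def by blast
  have "real (P * M) > Y"
  proof (rule ccontr)
   assume "\<not> real (P * M) > Y"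
   have "P * M \<in> G" unfolding G_def
   proof (intro CollectI conjI allI impI)
    show "P * M dvd N" unfolding N r by simp
    show "real (P * M) \<le> Y" using \<open>\<not> real (P * M) > Y\<close> by simp
    fix p assume p: "prime p" "p dvd P * M"
    then have "p dvd P \<or> p dvd M" by (simp add: prime_dvd_mult_iff)
    then have pP: "p \<le> P" using p P Pge dvd_imp_le[of p P] prime_gt_0_nat by blast
    then show "real p \<le> w" using Pw by linarith
    fix q assume q: "prime q" "q dvd N div (P * M)"
    have "N div (P * M) = r" unfolding N r using s0 P prime_gt_0_nat[of P] by (simp add: mult.left_commute mult.assoc[symmetric])
    then have "q dvd s" using q r by simp
    then show "p \<le> q" using Pmin[of q] q pP by linarith
   qed
   then have "P * M \<le> M" by (rule Mmax)
   then show False using prime_gt_1_nat[OF P(1)] s0 by (simp add: mult_le_cancel2)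
  qed
  moreover have "N = P * M * r" unfolding N r by simp
  moreover have "P \<le> p" if "prime p" "p dvd r" for p using Pmin[of p] that r by simp
  moreover have "real M \<le> Y" using M unfolding G_def by blast
  ultimately show ?thesis using P(1) Pw Pge by (intro that(2)[of P M r])
 qed
qed

section \<open>Tails of the Poisson distribution\<close>

lemma eta0_pos: "eta0 > 0" and eta0_le: "eta0 \<le> 3/10" and ln_ln_2_ge: "ln (ln 2) \<ge> - (1/2 :: real)"
proof -
 have l2: "2/3 \<le> ln (2::real)" "ln (2::real) \<le> 25/36" by (rule ln2_ge_two_thirds, rule ln2_le_25_over_36)
 have "ln (5/6::real) \<noteq> 5/6 - 1" using ln_eq_minus_one[of "5/6"] by auto
 moreover have "ln (5/6::real) \<le> 5/6 - 1" by (rule ln_le_minus_one) simp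
 ultimately have a: "ln (5/6::real) < - 1/6" by simp
 have "ln (ln 2) \<le> ln ((5/6)^2 :: real)" using l2 by (subst ln_le_cancel_iff) (auto simp: power2_eq_square)
 also have "\<dots> = 2 * ln (5/6)" by (subst ln_realpow) auto
 finally have "1 + ln (ln 2) < ln (2::real)" using a l2 by linarith
 then show "eta0 > 0" using l2 by (simp add: eta0_def)
 have "ln (1 / ln 2) \<le> 1 / ln 2 - (1::real)" using l2 by (intro ln_le_minus_one) auto
 moreover have "1 / ln 2 \<le> (3/2::real)" using l2 by (simp add: divide_le_eq)
 ultimately show b: "ln (ln 2) \<ge> - (1/2 :: real)" using l2 by (simp add: ln_div)
 have "7/10 * ln 2 \<le> 1 + ln (ln 2 :: real)" using b l2 by linarith
 then have "7/10 \<le> (1 + ln (ln 2)) / ln (2::real)" using l2 by (simp add: le_divide_eq)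
 then show "eta0 \<le> 3/10" by (simp add: eta0_def)
qed

lemma ln_le_half_diff:
 assumes "u \<ge> (1::real)"
 shows "ln u \<le> (u - 1 / u) / 2"
proof -
 have "(\<lambda>u. (u - 1 / u) / 2 - ln u) 1 \<le> (\<lambda>u. (u - 1 / u) / 2 - ln u) u"
 proof (rule DERIV_nonneg_imp_nondecreasing[OF assms])
  fix x :: real assume x: "1 \<le> x" "x \<le> u"
  have "((\<lambda>u. (u - 1 / u) / 2 - ln u) has_real_derivative ((1 + 1 / x\<^sup>2) / 2 - 1 / x)) (at x)"
   using x by (auto intro!: derivative_eq_intros simp: power2_eq_square field_simps)
  moreover have "(1 + 1 / x\<^sup>2) / 2 - 1 / x \<ge> 0"
  proof -
   have "0 \<le> (1 - 1 / x)\<^sup>2 / 2" by simp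
   also have "\<dots> = (1 + 1 / x\<^sup>2) / 2 - 1 / x" using x by (simp add: power2_eq_square field_simps)
   finally show ?thesis .
  qed
  ultimately show "\<exists>y. ((\<lambda>u. (u - 1 / u) / 2 - ln u) has_real_derivative y) (at x) \<and> 0 \<le> y" by blast
 qed
 then show ?thesis by simp
qed

text \<open>The factor \<open>sqrt n\<close> in Stirling's formula is what produces the \<open>sqrt L\<close> in \<open>tau L\<close>.\<close>

lemma ln_fact_stirling_lower:
 assumes "n \<ge> (1::nat)"
 shows "(real n + 1/2) * ln (real n) - real n \<le> ln (fact n)"
proof -
 have "(real n + 1/2) * ln (real n) - real n + 1 / real n \<le> ln (fact n)"
  using assms
 proof (induction n rule: dec_induct)
  case (step n)
  have n: "real n \<ge> 1" using step by simp
  define x where "x = real n"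
  have x: "x \<ge> 1" using n by (simp add: x_def)
  have "ln ((x + 1) / x) \<le> ((x + 1) / x - 1 / ((x + 1) / x)) / 2" using x by (intro ln_le_half_diff) auto
  then have "(x + 1/2) * ln ((x + 1) / x) \<le> (x + 1/2) * (((x + 1) / x - 1 / ((x + 1) / x)) / 2)"
   using x by (intro mult_left_mono) auto
  also have "\<dots> = 1 + 1 / (4 * (x * (x + 1)))"
  proof -
   have "x \<noteq> 0" "x + 1 \<noteq> 0" using x by auto
   then show ?thesis by (simp add: divide_simps) (simp add: algebra_simps)
  qed
  also have "\<dots> \<le> 1 + 1 / x - 1 / (x + 1)"
  proof -
   have "1 / x - 1 / (x + 1) = 1 / (x * (x + 1))" using x by (simp add: field_simps)
   moreover have "1 / (4 * (x * (x + 1))) \<le> 1 / (x * (x + 1))" using x by (intro divide_left_mono) auto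
   ultimately show ?thesis by linarith
  qed
  finally have *: "(x + 1/2) * (ln (x + 1) - ln x) \<le> 1 + 1 / x - 1 / (x + 1)"
   using x by (simp add: ln_div)
  have "ln (fact (Suc n) :: real) = ln (x + 1) + ln (fact n)"
   using x by (simp add: ln_mult x_def add.commute)
  moreover have "real (Suc n) = x + 1" by (simp add: x_def)
  ultimately show ?case using step.IH * unfolding x_def[symmetric] by (simp add: algebra_simps)
 qed simp
 then show ?thesis using assms by (smt (verit) divide_nonneg_nonneg of_nat_0_le_iff)
qed

definition tau :: "real \<Rightarrow> real" where
 "tau L = exp (- eta0 * L) / sqrt L"

definition omega_cut :: "real \<Rightarrow> nat" where
 "omega_cut L = nat \<lfloor>L / ln 2\<rfloor>"

lemma omega_cut_bounds:
 assumes "L \<ge> 0"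
 shows "real (omega_cut L) \<le> L / ln 2" "L / ln 2 < real (omega_cut L) + 1"
proof -
 have "L / ln 2 \<ge> 0" using assms by simp
 then show "real (omega_cut L) \<le> L / ln 2" "L / ln 2 < real (omega_cut L) + 1" unfolding omega_cut_def by linarith+
qed

lemma tau_pos: "L > 0 \<Longrightarrow> tau L > 0"
 by (simp add: tau_def)

text \<open>With \<open>K = L / ln 2\<close>, Stirling's formula turns \<open>L^K / K!\<close> into \<open>(e ln 2)^K / sqrt K\<close>, and
\<open>(1 + ln ln 2) / ln 2 = 1 - eta0\<close>.\<close>

lemma poisson_term_at_cut:
 assumes "C \<ge> 0"
 shows "\<exists>C'>0. \<forall>L\<ge>1. (L + C) ^ omega_cut L / fact (omega_cut L) \<le> C' * exp L * tau L"
proof (intro exI[of _ "exp (2 * C + 2)"] conjI allI impI)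
 fix L :: real assume L: "L \<ge> 1"
 define K where "K = real (omega_cut L)"
 define K0 where "K0 = L / ln 2"
 have l2: "2/3 \<le> ln (2::real)" "ln (2::real) \<le> 25/36" by (rule ln2_ge_two_thirds, rule ln2_le_25_over_36)
 have K0: "K0 * ln 2 = L" using l2 by (simp add: K0_def)
 have K: "K \<le> K0" "K0 < K + 1" using omega_cut_bounds[of L] L by (auto simp: K_def K0_def)
 have K0L: "36/25 * L \<le> K0" "K0 \<le> 3/2 * L"
 proof -
  have "36/25 * L * ln 2 \<le> L" using l2 L mult_left_mono[OF l2(2), of "36/25 * L"] by simp
  then show "36/25 * L \<le> K0" unfolding K0_def using l2 by (simp add: le_divide_eq)
  have "L \<le> 3/2 * L * ln 2" using l2 L mult_left_mono[OF l2(1), of "3/2 * L"] by simp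
  then show "K0 \<le> 3/2 * L" unfolding K0_def using l2 by (simp add: divide_le_eq)
 qed
 have "K > 0" using K K0L L by linarith
 then have cut1: "omega_cut L \<ge> 1" by (simp add: K_def)
 then have K1: "K \<ge> 1" by (simp add: K_def)
 have K3: "K \<ge> L / 3" using K K0L L by linarith
 have st: "(K + 1/2) * ln K - K \<le> ln (fact (omega_cut L))" using ln_fact_stirling_lower[OF cut1] by (simp add: K_def)
 have "ln ((L + C) ^ omega_cut L / fact (omega_cut L)) = K * ln (L + C) - ln (fact (omega_cut L))"
  using L assms by (simp add: ln_div ln_realpow K_def)
 also have "\<dots> \<le> K * (ln L + C / L) - ((K + 1/2) * ln K - K)"
 proof (rule diff_mono[OF mult_left_mono st])
  have "L + C = L * (1 + C / L)" using L by (simp add: field_simps)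
  then have "ln (L + C) = ln (L * (1 + C / L))" by (rule arg_cong)
  also have "\<dots> = ln L + ln (1 + C / L)"
  proof (rule ln_mult_pos)
   show "0 < 1 + C / L" using L assms by (intro add_pos_nonneg) auto
  qed (use L in simp)
  also have "ln (1 + C / L) \<le> C / L" using L assms by (intro ln_add_one_self_le_self) auto
  finally show "ln (L + C) \<le> ln L + C / L" by simp
 qed (use K1 in simp)
 also have "\<dots> = K * (C / L) + (K * (1 + ln L - ln K)) - 1/2 * ln K" by (simp add: algebra_simps)
 also have "\<dots> \<le> 2 * C + (L * (1 - eta0) + 1/2) - (1/2 * ln L - 1)"
 proof (intro diff_mono add_mono)
  have "K * (C / L) \<le> (2 * L) * (C / L)" using K K0L L assms by (intro mult_right_mono) auto
  then show "K * (C / L) \<le> 2 * C" using L by simp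
  have "ln (K0 / K) \<le> K0 / K - 1" using K1 K by (intro ln_le_minus_one) auto
  then have "K * ln (K0 / K) \<le> K * (K0 / K - 1)" using K1 by (intro mult_left_mono) auto
  then have a: "K * (ln K0 - ln K) \<le> K0 - K" using K1 K by (simp add: ln_div algebra_simps)
  have b: "ln L = ln K0 + ln (ln 2)" using K0 L l2 K0L by (subst K0[symmetric]) (auto simp: ln_mult)
  have "K * (1 + ln L - ln K) = K * (1 + ln (ln 2)) + K * (ln K0 - ln K)" unfolding b by (simp add: algebra_simps)
  also have "\<dots> \<le> K * (1 + ln (ln 2)) + (K0 - K)" using a by simp
  also have "\<dots> = K0 * (1 + ln (ln 2)) + (K0 - K) * (- ln (ln 2))" by (simp add: algebra_simps)
  also have "(K0 - K) * (- ln (ln 2)) \<le> 1 * (1/2)"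
  proof (rule mult_mono)
   have "ln (ln 2) \<le> ln (1::real)" using l2 by (subst ln_le_cancel_iff) auto
   then show "0 \<le> - ln (ln (2::real))" by simp
  qed (use K ln_ln_2_ge in auto)
  also have "K0 * (1 + ln (ln 2)) = L * (1 - eta0)" by (simp add: K0_def eta0_def)
  finally show "K * (1 + ln L - ln K) \<le> L * (1 - eta0) + 1/2" by simp
  have "ln L - ln 3 = ln (L / 3)" using L by (simp add: ln_div)
  also have "\<dots> \<le> ln K" using K3 K1 L by (subst ln_le_cancel_iff) auto
  finally have "ln L - ln 3 \<le> ln K" .
  moreover have "ln 3 \<le> (2::real)" using ln_le_minus_one[of "3::real"] by simp
  ultimately show "1/2 * ln L - 1 \<le> 1/2 * ln K" by linarith
 qed
 also have "\<dots> \<le> (2 * C + 2) + L + (- eta0 * L - 1/2 * ln L)" by (simp add: algebra_simps)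
 finally have "exp (ln ((L + C) ^ omega_cut L / fact (omega_cut L))) \<le> exp ((2 * C + 2) + L + (- eta0 * L - 1/2 * ln L))" by simp
 moreover have "(L + C) ^ omega_cut L / fact (omega_cut L) > 0" using L assms by (intro divide_pos_pos zero_less_power) auto
 moreover have "exp ((2 * C + 2) + L + (- eta0 * L - 1/2 * ln L)) = exp (2 * C + 2) * exp L * (exp (- eta0 * L) * exp (- (1/2 * ln L)))"
  by (simp only: exp_add diff_conv_add_uminus)
 moreover have "exp (- eta0 * L) * exp (- (1/2 * ln L)) = tau L"
 proof -
  have sq: "exp (1/2 * ln L) = sqrt L" using L powr_half_sqrt[of L] by (simp add: powr_def)
  show ?thesis unfolding tau_def exp_minus[of "1/2 * ln L"] sq by (simp only: divide_inverse)
 qed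
 ultimately show "(L + C) ^ omega_cut L / fact (omega_cut L) \<le> exp (2 * C + 2) * exp L * tau L" by simp
qed auto

text \<open>Below \<open>K\<close> the terms decrease geometrically because \<open>K / (2 L)\<close> is about \<open>1 / (2 ln 2) < 1\<close>. The last of them
is \<open>2^K \<le> exp L\<close> times a term of mean \<open>L\<close>.\<close>

lemma poisson_lower_tail:
 assumes "C \<ge> 0"
 shows "\<exists>C'>0. \<forall>L\<ge>1. (\<Sum>k<omega_cut L. (2 * L + C) ^ k / fact k) \<le> C' * exp (2 * L) * tau L"
proof -
 obtain C1 where C1: "C1 > 0" "\<And>L. L \<ge> 1 \<Longrightarrow> (L + C / 2) ^ omega_cut L / fact (omega_cut L) \<le> C1 * exp L * tau L"
  using poisson_term_at_cut[of "C / 2"] assms by auto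
 have l2: "2/3 \<le> ln (2::real)" by (rule ln2_ge_two_thirds)
 show ?thesis
 proof (intro exI[of _ "3 * C1"] conjI allI impI)
  fix L :: real assume L: "L \<ge> 1"
  define b where "b = 2 * L + C"
  have b: "b > 0" using L assms by (simp add: b_def)
  have "(\<Sum>k<n. b ^ k / fact k) \<le> 3 * (b ^ n / fact n)" if "n \<le> omega_cut L" for n
   using that
  proof (induction n)
   case (Suc n)
   have "real (Suc n) \<le> L / ln 2" using Suc.prems omega_cut_bounds[of L] L by linarith
   also have "\<dots> \<le> 3/2 * L"
    using l2 L mult_left_mono[OF l2, of "3/2 * L"] by (simp add: divide_le_eq)
   also have "\<dots> \<le> 3/4 * b" using assms by (simp add: b_def)
   finally have "real (Suc n) * b ^ n \<le> (3/4 * b) * b ^ n" using b by (intro mult_right_mono) auto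
   then have "real (Suc n) * b ^ n / fact (Suc n) \<le> (3/4 * b) * b ^ n / fact (Suc n)"
    by (intro divide_right_mono) auto
   moreover have "real (Suc n) * b ^ n / fact (Suc n) = b ^ n / fact n"
    unfolding fact_Suc of_nat_mult by (simp del: of_nat_Suc)
   ultimately have "b ^ n / fact n \<le> 3/4 * (b ^ Suc n / fact (Suc n))" by simp
   moreover have "(\<Sum>k<n. b ^ k / fact k) \<le> 3 * (b ^ n / fact n)" using Suc by simp
   ultimately show ?case unfolding sum.lessThan_Suc by linarith
  qed simp
  then have "(\<Sum>k<omega_cut L. b ^ k / fact k) \<le> 3 * (b ^ omega_cut L / fact (omega_cut L))" by simp
  also have "b ^ omega_cut L = 2 ^ omega_cut L * (L + C / 2) ^ omega_cut L" by (simp add: b_def power_mult_distrib[symmetric] algebra_simps)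
  also have "3 * (2 ^ omega_cut L * (L + C / 2) ^ omega_cut L / fact (omega_cut L)) = 3 * (2 ^ omega_cut L * ((L + C / 2) ^ omega_cut L / fact (omega_cut L)))" by simp
  also have "\<dots> \<le> 3 * (exp L * (C1 * exp L * tau L))"
  proof (intro mult_left_mono mult_mono C1)
   have "(2::real) ^ omega_cut L = exp (real (omega_cut L) * ln 2)" by (simp add: exp_of_nat_mult)
   also have "\<dots> \<le> exp L" using omega_cut_bounds(1)[of L] L l2 by (simp add: le_divide_eq)
   finally show "(2::real) ^ omega_cut L \<le> exp L" .
  qed (use L assms in auto)
  also have "\<dots> = 3 * C1 * exp (2 * L) * tau L" by (simp add: exp_double power2_eq_square)
  finally show "(\<Sum>k<omega_cut L. (2 * L + C) ^ k / fact k) \<le> 3 * C1 * exp (2 * L) * tau L" by (simp add: b_def)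
 qed (use C1 in simp)
qed

text \<open>Here \<open>L / K\<close> is about \<open>ln 2 < 1\<close>. Lowering the starting point by \<open>b\<close> costs at most a factor \<open>K / (L + C) \<le> 2\<close>
for each step.\<close>

lemma poisson_upper_tail:
 assumes "C \<ge> 0"
 shows "\<exists>C' L0. C' > 0 \<and> L0 \<ge> 1 \<and> (\<forall>L\<ge>L0. \<forall>b N. (\<Sum>k\<in>{omega_cut L - b..N}. (L + C) ^ k / fact k) \<le> C' * 2 ^ b * exp L * tau L)"
proof -
 obtain C1 where C1: "C1 > 0" "\<And>L. L \<ge> 1 \<Longrightarrow> (L + C) ^ omega_cut L / fact (omega_cut L) \<le> C1 * exp L * tau L"
  using poisson_term_at_cut[of C] assms by auto
 have l2: "2/3 \<le> ln (2::real)" "ln (2::real) \<le> 25/36" by (rule ln2_ge_two_thirds, rule ln2_le_25_over_36)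
 show ?thesis
 proof (rule exI[of _ "6 * C1"], rule exI[of _ "max 1 (13 * C)"], intro conjI allI impI)
  fix L :: real and b N assume "L \<ge> max 1 (13 * C)"
  then have L: "L \<ge> 1" "L \<ge> 13 * C" by auto
  define x where "x = L + C"
  define a where "a = (\<lambda>k. x ^ k / fact k)"
  define K where "K = omega_cut L"
  have x: "x > 0" using L assms by (simp add: x_def)
  have a0: "a k \<ge> 0" for k using x by (simp add: a_def)
  have rat: "a (Suc k) = x / real (Suc k) * a k" for k
   unfolding a_def fact_Suc of_nat_mult by (simp del: of_nat_Suc)
  have KL: "real K \<le> 2 * x" "4/3 * x \<le> real K + 1"
  proof -
   have "real K * ln 2 \<le> L" using omega_cut_bounds[of L] L l2 by (simp add: K_def le_divide_eq)
   moreover have "real K * (2/3) \<le> real K * ln 2" using l2 by (intro mult_left_mono) auto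
   ultimately have "real K \<le> 2 * L" using L by linarith
   then show "real K \<le> 2 * x" using assms by (simp add: x_def)
   have "L < (real K + 1) * ln 2" using omega_cut_bounds[of L] L l2 by (simp add: K_def divide_less_eq)
   also have "\<dots> \<le> (real K + 1) * (25/36)" using l2 by (intro mult_left_mono) auto
   finally have "36/25 * L < real K + 1" by simp
   moreover have "4/3 * x \<le> 36/25 * L" using L unfolding x_def by simp
   ultimately show "4/3 * x \<le> real K + 1" by linarith
  qed
  have up: "a (K + i) \<le> (3/4) ^ i * a K" for i
  proof (induction i)
   case (Suc i)
   have "x / real (Suc (K + i)) \<le> 3/4" using KL x by (simp add: divide_le_eq)
   then have "x / real (Suc (K + i)) * a (K + i) \<le> 3/4 * ((3/4) ^ i * a K)"
    using Suc a0 x by (intro mult_mono) auto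
   then show ?case using rat[of "K + i"] by simp
  qed simp
  have down: "a (K - i) \<le> 2 ^ i * a K" if "i \<le> K" for i
   using that
  proof (induction i)
   case (Suc i)
   have e: "K - i = Suc (K - Suc i)" using Suc.prems by simp
   have "a (K - Suc i) = real (K - i) / x * a (K - i)" using rat[of "K - Suc i"] x unfolding e by simp
   also have "\<dots> \<le> 2 * (2 ^ i * a K)"
   proof (rule mult_mono)
    show "real (K - i) / x \<le> 2" using KL x by (simp add: divide_le_eq)
   qed (use Suc a0 in auto)
   finally show ?case by simp
  qed simp
  have fin: "finite {K - b..N}" by simp
  have "(\<Sum>k\<in>{K - b..N}. a k) \<le> (\<Sum>k\<in>((\<lambda>i. K + i) ` {..N}) \<union> ((\<lambda>i. K - i) ` {1..min b K}). a k)"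
  proof (intro sum_mono2 a0)
   show "{K - b..N} \<subseteq> ((\<lambda>i. K + i) ` {..N}) \<union> ((\<lambda>i. K - i) ` {1..min b K})"
   proof
    fix k assume k: "k \<in> {K - b..N}"
    show "k \<in> ((\<lambda>i. K + i) ` {..N}) \<union> ((\<lambda>i. K - i) ` {1..min b K})"
    proof (cases "k \<ge> K")
     case True
     then show ?thesis using k by (intro UnI1 image_eqI[of _ _ "k - K"]) auto
    next
     case False
     then show ?thesis using k by (intro UnI2 image_eqI[of _ _ "K - k"]) auto
    qed
   qed
  qed auto
  also have "\<dots> \<le> (\<Sum>k\<in>(\<lambda>i. K + i) ` {..N}. a k) + (\<Sum>k\<in>(\<lambda>i. K - i) ` {1..min b K}. a k)"
   using a0 by (intro sum_Un_le) auto
  also have "(\<Sum>k\<in>(\<lambda>i. K + i) ` {..N}. a k) = (\<Sum>i\<le>N. a (K + i))" by (subst sum.reindex) (auto simp: inj_on_def)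
  also have "\<dots> \<le> (\<Sum>i\<le>N. (3/4) ^ i * a K)" by (intro sum_mono up)
  also have "\<dots> \<le> 4 * a K"
  proof -
   have "(\<Sum>i\<le>N. (3/4::real) ^ i) \<le> 4"
    using sum_gp_basic[of "3/4::real" N] zero_le_power[of "3/4::real" "Suc N"] by simp
   then have "(\<Sum>i\<le>N. (3/4::real) ^ i) * a K \<le> 4 * a K" using a0 by (intro mult_right_mono) auto
   then show ?thesis by (simp only: sum_distrib_right)
  qed
  also have "(\<Sum>k\<in>(\<lambda>i. K - i) ` {1..min b K}. a k) = (\<Sum>i\<in>{1..min b K}. a (K - i))" by (subst sum.reindex) (auto simp: inj_on_def)
  also have "\<dots> \<le> (\<Sum>i\<in>{1..min b K}. 2 ^ i * a K)" by (intro sum_mono down) auto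
  also have "\<dots> \<le> (\<Sum>i\<le>b. 2 ^ i * a K)" using a0 by (intro sum_mono2) auto
  also have "\<dots> = (2 ^ Suc b - 1) * a K"
  proof -
   have "(\<Sum>i\<le>b. (2::real) ^ i) = 2 ^ Suc b - 1" using sum_gp_basic[of "2::real" b] by simp
   then show ?thesis by (simp only: sum_distrib_right[symmetric])
  qed
  finally have "(\<Sum>k\<in>{K - b..N}. a k) \<le> (3 + 2 * 2 ^ b) * a K" by (simp add: algebra_simps)
  also have "\<dots> \<le> (6 * 2 ^ b) * a K"
  proof (rule mult_right_mono)
   have "(1::real) \<le> 2 ^ b" by simp
   then show "(3::real) + 2 * 2 ^ b \<le> 6 * 2 ^ b" by linarith
  qed (rule a0)
  also have "\<dots> \<le> (6 * 2 ^ b) * (C1 * exp L * tau L)"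
   using C1(2)[OF L(1)] by (intro mult_left_mono) (auto simp: a_def x_def K_def)
  finally show "(\<Sum>k\<in>{omega_cut L - b..N}. (L + C) ^ k / fact k) \<le> 6 * C1 * 2 ^ b * exp L * tau L"
   by (simp add: a_def x_def K_def mult_ac)
 qed (use C1 in auto)
qed

section \<open>Arithmetic factors\<close>

lemma gfac_mult_le: "a > 0 \<Longrightarrow> b > 0 \<Longrightarrow> gfac (a * b) \<le> gfac a * gfac b"
 unfolding gfac_def exp_add[symmetric] prime_factors_product
 by (simp add: prime_factors_product sum_Un_le)

lemma gfac_dvd_mono:
 assumes "a dvd b" "b > 0"
 shows "gfac a \<le> gfac b"
proof -
 have "prime_factors a \<subseteq> prime_factors b" using assms by (intro dvd_prime_factors) auto
 then have "(\<Sum>p\<in>prime_factors a. 1 / real p) \<le> (\<Sum>p\<in>prime_factors b. 1 / real p)" by (intro sum_mono2) auto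
 then show ?thesis by (simp add: gfac_def)
qed

lemma card_prime_factors_rough:
 assumes "n > 0" "t \<ge> 2" "\<And>p. prime p \<Longrightarrow> p dvd n \<Longrightarrow> real p \<ge> t"
 shows "real (card (prime_factors n)) \<le> ln (real n) / ln t"
proof -
 have "t ^ card (prime_factors n) = (\<Prod>p\<in>prime_factors n. t)" by simp
 also have "\<dots> \<le> (\<Prod>p\<in>prime_factors n. real p)"
  using assms by (intro prod_mono) (auto simp: in_prime_factors_iff)
 also have "\<dots> = real (\<Prod>(prime_factors n))" by simp
 also have "\<dots> \<le> real n"
 proof -
  have "\<Prod>(prime_factors n) dvd n" by (intro prod_primes_dvd) (auto simp: in_prime_factors_iff)
  then show ?thesis using assms by (simp only: of_nat_le_iff) (rule dvd_imp_le)
 qed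
 finally have "ln (t ^ card (prime_factors n)) \<le> ln (real n)" using assms by (subst ln_le_cancel_iff) auto
 then have "real (card (prime_factors n)) * ln t \<le> ln (real n)" using assms by (simp add: ln_realpow)
 then show ?thesis using assms by (simp add: le_divide_eq)
qed

lemma gfac_rough_le:
 assumes "n > 0" "t \<ge> 2" "\<And>p. prime p \<Longrightarrow> p dvd n \<Longrightarrow> real p \<ge> t" "real n \<le> X"
 shows "gfac n \<le> exp (ln X / ln t)"
proof -
 have "(\<Sum>p\<in>prime_factors n. 1 / real p) \<le> (\<Sum>p\<in>prime_factors n. 1)"
 proof (rule sum_mono)
  fix p assume "p \<in> prime_factors n"
  then have "p \<ge> 1" by (metis in_prime_factors_imp_prime prime_ge_1_nat)
  then show "1 / real p \<le> 1" by simp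
 qed
 also have "\<dots> \<le> ln (real n) / ln t" using card_prime_factors_rough[OF assms(1-3)] by simp
 also have "\<dots> \<le> ln X / ln t" using assms by (intro divide_right_mono) auto
 finally show ?thesis by (simp add: gfac_def)
qed

lemma gfac_prime_le: "prime p \<Longrightarrow> gfac p \<le> exp 1"
 using prime_ge_1_nat[of p] by (simp add: gfac_def prime_prime_factors)

text \<open>Adding the primes of a finite set in increasing order, one sees that \<open>exp (3 \<Sum> 1/p)\<close> increases
 at \<open>p\<close> by at most a constant times \<open>(ln p)^3 / p\<close>.\<close>

lemma exp_recip_sum_le:
 "\<exists>C>0. \<forall>F. finite F \<longrightarrow> (\<forall>p\<in>F. prime p) \<longrightarrow>
  exp (3 * (\<Sum>p\<in>F. 1 / real p)) \<le> 1 + C * (\<Sum>p\<in>F. ln (real p) ^ 3 / real p)"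
proof -
 obtain C2 where C2: "\<And>x. x \<ge> 2 \<Longrightarrow> (\<Sum>p\<in>primes_le x. 1 / real p) \<le> ln (ln x) + C2"
  using mertens2_upper by auto
 define C where "C = exp (3 * C2) * (3 * exp 3)"
 have C: "C > 0" by (simp add: C_def)
 have "exp (3 * (\<Sum>p\<in>F. 1 / real p)) \<le> 1 + C * (\<Sum>p\<in>F. ln (real p) ^ 3 / real p)"
  if "finite F" "\<forall>p\<in>F. prime p" for F
  using that
 proof (induction F rule: finite_linorder_max_induct)
  case (insert q F)
  have q: "prime q" "real q \<ge> 2" using insert.prems prime_ge_2_nat[of q] by auto
  let ?S = "\<Sum>p\<in>F. 1 / real p"
  have qF: "q \<notin> F" using insert.hyps by auto
  have "?S \<le> (\<Sum>p\<in>primes_le (real q). 1 / real p)"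
   using insert by (intro sum_mono2) (auto simp: primes_le_iff less_imp_le)
  also have "\<dots> \<le> ln (ln (real q)) + C2" using C2 q by simp
  finally have "exp (3 * ?S) \<le> exp (3 * (ln (ln (real q)) + C2))" by simp
  also have "\<dots> = exp (3 * C2) * ln (real q) ^ 3"
  proof -
   have "exp (3 * (ln (ln (real q)) + C2)) = exp (3 * ln (ln (real q))) * exp (3 * C2)" by (simp only: distrib_left exp_add)
   also have "exp (3 * ln (ln (real q))) = exp (ln (ln (real q))) ^ 3" using exp_of_nat_mult[of 3 "ln (ln (real q))"] by simp
   also have "exp (ln (ln (real q))) = ln (real q)" using q by simp
   finally show ?thesis by (simp only: mult.commute)
  qed
  finally have a: "exp (3 * ?S) \<le> exp (3 * C2) * ln (real q) ^ 3" .
  have b: "exp (3 / real q) - 1 \<le> 3 * exp 3 / real q"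
  proof -
   let ?y = "3 / real q"
   have "1 - ?y \<le> exp (- ?y)" using exp_ge_add_one_self[of "- ?y"] by simp
   then have "(1 - ?y) * exp ?y \<le> exp (- ?y) * exp ?y" by (intro mult_right_mono) auto
   then have "exp ?y \<le> 1 + ?y * exp ?y" by (simp add: exp_add[symmetric] algebra_simps)
   moreover have "?y * exp ?y \<le> ?y * exp 3" using q by (intro mult_left_mono) (auto simp: divide_le_eq)
   ultimately show ?thesis by (simp add: mult_ac)
  qed
  have "exp (3 * (\<Sum>p\<in>insert q F. 1 / real p)) = exp (3 * ?S) + exp (3 * ?S) * (exp (3 / real q) - 1)"
   using insert.hyps qF by (simp add: distrib_left exp_add algebra_simps)
  also have "\<dots> \<le> (1 + C * (\<Sum>p\<in>F. ln (real p) ^ 3 / real p)) + (exp (3 * C2) * ln (real q) ^ 3) * (3 * exp 3 / real q)"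
   using insert a b q by (intro add_mono mult_mono insert.IH) auto
  also have "\<dots> = 1 + C * (\<Sum>p\<in>insert q F. ln (real p) ^ 3 / real p)"
   using insert.hyps qF by (simp add: C_def algebra_simps)
  finally show ?case .
 qed simp
 then show ?thesis using C by blast
qed

lemma sum_ln_cube_bounds:
 "\<exists>C. \<forall>F. finite F \<longrightarrow> (\<Sum>n\<in>F. ln (real n) ^ 3 / real n ^ 2) \<le> C"
 "\<exists>C>0. \<forall>n\<ge>1. ln (real n) ^ 3 / real n \<le> C * real n powr (-1/2)"
proof -
 have "summable (\<lambda>n::nat. ln (real n) ^ 3 / real n ^ 2)"
 proof (rule summable_comparison_test_bigo)
  show "summable (\<lambda>n. norm (real n powr (-3/2)))" by (simp add: summable_real_powr_iff)
  show "(\<lambda>n. ln (real n) ^ 3 / real n ^ 2) \<in> O(\<lambda>n. real n powr (-3/2))" by real_asymp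
 qed
 moreover have "ln (real n) ^ 3 / real n ^ 2 \<ge> 0" for n by (cases "n = 0") auto
 ultimately show "\<exists>C. \<forall>F. finite F \<longrightarrow> (\<Sum>n\<in>F. ln (real n) ^ 3 / real n ^ 2) \<le> C"
  using bounded_sums_of_summable[of "\<lambda>n. ln (real n) ^ 3 / real n ^ 2"] by auto
 show "\<exists>C>0. \<forall>n\<ge>1. ln (real n) ^ 3 / real n \<le> C * real n powr (-1/2)"
 proof (intro exI[of _ "27 * 8"] conjI allI impI)
  fix n :: nat assume n: "n \<ge> 1"
  have "(ln (real n) / 2) ^ 3 \<le> 27 * exp (ln (real n) / 2)" using n by (intro exp_ge_cube) auto
  also have "exp (ln (real n) / 2) = real n powr (1/2)" using n by (simp add: powr_def)
  finally have "ln (real n) ^ 3 \<le> 27 * 8 * real n powr (1/2)" by (simp add: power_divide)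
  then have "ln (real n) ^ 3 * real n powr (-1) \<le> 27 * 8 * real n powr (1/2) * real n powr (-1)" by (intro mult_right_mono) auto
  also have "\<dots> = 27 * 8 * real n powr (1/2 + -1)" by (simp only: powr_add mult.assoc)
  also have "real n powr (1/2 + -1) = real n powr (-1/2)" by simp
  finally have *: "ln (real n) ^ 3 * real n powr (-1) \<le> 27 * 8 * real n powr (-1/2)" .
  have m1: "real n powr (-1) = 1 / real n" using n powr_minus_divide[of "real n" 1] by simp
  show "ln (real n) ^ 3 / real n \<le> 27 * 8 * real n powr (-1/2)"
   using * unfolding m1 by (simp only: times_divide_eq_right mult_1_right)
 qed simp
qed

text \<open>The primes above \<open>(ln x)^2\<close> contribute a bounded amount to \<open>\<Sum> 1/p\<close>, as \<open>E\<close> has \<open>O(ln x)\<close> prime factors.\<close>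

lemma gfac_cube_le:
 "\<exists>C>0. \<forall>x E. x \<ge> 3 \<longrightarrow> E > 0 \<longrightarrow> real E \<le> x ^ 3 \<longrightarrow>
  gfac E ^ 3 \<le> C * (1 + (\<Sum>p\<in>{p\<in>prime_factors E. real p \<le> (ln x)\<^sup>2}. ln (real p) ^ 3 / real p))"
proof -
 obtain C where C: "C > 0" "\<And>F. finite F \<Longrightarrow> (\<forall>p\<in>F. prime p) \<Longrightarrow>
  exp (3 * (\<Sum>p\<in>F. 1 / real p)) \<le> 1 + C * (\<Sum>p\<in>F. ln (real p) ^ 3 / real p)"
  using exp_recip_sum_le by blast
 obtain C1 where C1: "C1 > 0" "\<And>n. n \<ge> 1 \<Longrightarrow> ln (real n) ^ 3 / real n \<le> C1 * real n powr (-1/2)"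
  using sum_ln_cube_bounds(2) by blast
 show ?thesis
 proof (intro exI[of _ "1 + C + 5 * C * C1"] conjI allI impI)
  show "0 < 1 + C + 5 * C * C1" using C C1 by (intro add_pos_pos) auto
  fix x :: real and E :: nat assume x: "x \<ge> 3" and E: "E > 0" "real E \<le> x ^ 3"
  let ?s = "{p\<in>prime_factors E. real p \<le> (ln x)\<^sup>2}" and ?b = "{p\<in>prime_factors E. \<not> real p \<le> (ln x)\<^sup>2}"
  let ?f = "\<lambda>p::nat. ln (real p) ^ 3 / real p"
  have lx: "ln x > 0" using x by simp
  have "(\<Sum>p\<in>?b. ?f p) \<le> (\<Sum>p\<in>?b. C1 / ln x)"
  proof (rule sum_mono)
   fix p assume p: "p \<in> ?b"
   then have pp: "prime p" by (auto dest: in_prime_factors_imp_prime)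
   then have pp1: "p \<ge> 1" by (rule prime_ge_1_nat)
   have "ln x = ((ln x)\<^sup>2) powr (1/2)" using lx by (simp add: powr_half_sqrt)
   also have "\<dots> \<le> real p powr (1/2)" using p by (intro powr_mono2) auto
   finally have "1 / real p powr (1/2) \<le> 1 / ln x" using lx by (intro divide_left_mono mult_pos_pos) linarith+
   then have "real p powr (-1/2) \<le> 1 / ln x" using powr_minus_divide[of "real p" "1/2"] by simp
   then have "C1 * real p powr (-1/2) \<le> C1 * (1 / ln x)" using C1 by (intro mult_left_mono) auto
   then show "?f p \<le> C1 / ln x" using C1(2)[OF pp1] by simp
  qed
  also have "\<dots> = real (card ?b) * (C1 / ln x)" by simp
  also have "\<dots> \<le> (5 * ln x) * (C1 / ln x)"
  proof (rule mult_right_mono)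
   have "real (card ?b) \<le> real (card (prime_factors E))" by (intro of_nat_mono card_mono) auto
   also have "\<dots> \<le> ln (real E) / ln 2" using E prime_ge_2_nat by (intro card_prime_factors_rough) auto
   also have "\<dots> \<le> ln (x ^ 3) / ln 2" using E x by (intro divide_right_mono) auto
   also have "\<dots> = 3 * ln x / ln 2" using x by (simp add: ln_realpow)
   also have "\<dots> \<le> 5 * ln x"
    using lx ln2_ge_two_thirds mult_left_mono[OF ln2_ge_two_thirds, of "5 * ln x"] by (simp add: divide_le_eq)
   finally show "real (card ?b) \<le> 5 * ln x" .
  qed (use C1 lx in auto)
  finally have big: "(\<Sum>p\<in>?b. ?f p) \<le> 5 * C1" using lx by simp
  have s0: "(\<Sum>p\<in>?s. ?f p) \<ge> 0"
  proof (rule sum_nonneg)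
   fix p assume "p \<in> ?s"
   then have "prime p" by (auto dest: in_prime_factors_imp_prime)
   then have "p \<ge> 1" by (rule prime_ge_1_nat)
   then show "0 \<le> ?f p" by simp
  qed
  have "gfac E ^ 3 = exp (3 * (\<Sum>p\<in>prime_factors E. 1 / real p))" by (simp add: gfac_def exp_of_nat_mult[symmetric])
  also have "\<dots> \<le> 1 + C * (\<Sum>p\<in>prime_factors E. ?f p)" by (intro C) (auto dest: in_prime_factors_imp_prime)
  also have "(\<Sum>p\<in>prime_factors E. ?f p) = (\<Sum>p\<in>?s \<union> ?b. ?f p)" by (intro sum.cong) auto
  also have "\<dots> = (\<Sum>p\<in>?s. ?f p) + (\<Sum>p\<in>?b. ?f p)" by (intro sum.union_disjoint) auto
  also have "1 + C * ((\<Sum>p\<in>?s. ?f p) + (\<Sum>p\<in>?b. ?f p)) \<le> 1 + C * ((\<Sum>p\<in>?s. ?f p) + 5 * C1)"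
   using big C by simp
  also have "\<dots> \<le> (1 + C + 5 * C * C1) * (1 + (\<Sum>p\<in>?s. ?f p))"
  proof -
   have "0 \<le> C + (1 + 5 * C * C1) * (\<Sum>p\<in>?s. ?f p)" using s0 C C1 by (intro add_nonneg_nonneg mult_nonneg_nonneg) auto
   then show ?thesis by (simp add: algebra_simps)
  qed
  finally show "gfac E ^ 3 \<le> (1 + C + 5 * C * C1) * (1 + (\<Sum>p\<in>?s. ?f p))" .
 qed
qed

lemma gfac_cube_le_ln_ln:
 "\<exists>C>0. \<forall>x E. x \<ge> 16 \<longrightarrow> E > 0 \<longrightarrow> real E \<le> x ^ 3 \<longrightarrow> gfac E ^ 3 \<le> C * (ln (ln x)) ^ 3"
proof -
 obtain C2' where C2': "\<And>x. x \<ge> 2 \<Longrightarrow> (\<Sum>p\<in>primes_le x. 1 / real p) \<le> ln (ln x) + C2'"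
  using mertens2_upper by auto
 define C2 where "C2 = \<bar>C2'\<bar>"
 have C2: "(\<Sum>p\<in>primes_le x. 1 / real p) \<le> ln (ln x) + C2" if "x \<ge> 2" for x
  using C2'[OF that] by (simp add: C2_def)
 show ?thesis
 proof (intro exI[of _ "exp (3 * (ln 2 + C2 + 5))"] conjI allI impI)
  fix x :: real and E :: nat assume x: "x \<ge> 16" and E: "E > 0" "real E \<le> x ^ 3"
  let ?s = "{p\<in>prime_factors E. real p \<le> (ln x)\<^sup>2}" and ?b = "{p\<in>prime_factors E. \<not> real p \<le> (ln x)\<^sup>2}"
  have lx2: "ln x \<ge> 2"
  proof -
   have "2 \<le> 4 * ln (2::real)" using ln2_ge_two_thirds by simp
   also have "\<dots> = ln (2 ^ 4)" by (subst ln_realpow) auto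
   also have "\<dots> \<le> ln x" using x by (subst ln_le_cancel_iff) auto
   finally show ?thesis .
  qed
  have "(\<Sum>p\<in>?b. 1 / real p) \<le> (\<Sum>p\<in>?b. 1 / ln x)"
  proof (rule sum_mono)
   fix p assume p: "p \<in> ?b"
   have "ln x * 1 \<le> ln x * ln x" using lx2 by (intro mult_left_mono) auto
   then have "ln x \<le> real p" using p by (simp add: power2_eq_square)
   then show "1 / real p \<le> 1 / ln x" using lx2 by (intro divide_left_mono) auto
  qed
  also have "\<dots> = real (card ?b) * (1 / ln x)" by simp
  also have "\<dots> \<le> (5 * ln x) * (1 / ln x)"
  proof (rule mult_right_mono)
   have "real (card ?b) \<le> real (card (prime_factors E))" by (intro of_nat_mono card_mono) auto
   also have "\<dots> \<le> ln (real E) / ln 2" using E prime_ge_2_nat by (intro card_prime_factors_rough) auto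
   also have "\<dots> \<le> ln (x ^ 3) / ln 2" using E x by (intro divide_right_mono) auto
   also have "\<dots> = 3 * ln x / ln 2" using x by (simp add: ln_realpow)
   also have "\<dots> \<le> 5 * ln x"
    using lx2 ln2_ge_two_thirds mult_left_mono[OF ln2_ge_two_thirds, of "5 * ln x"] by (simp add: divide_le_eq)
   finally show "real (card ?b) \<le> 5 * ln x" .
  qed (use lx2 in auto)
  finally have b: "(\<Sum>p\<in>?b. 1 / real p) \<le> 5" using lx2 by simp
  have four: "(ln x)\<^sup>2 \<ge> 2" using lx2 power_mono[of 2 "ln x" 2] by simp
  have "(\<Sum>p\<in>?s. 1 / real p) \<le> (\<Sum>p\<in>primes_le ((ln x)\<^sup>2). 1 / real p)"
   by (intro sum_mono2) (auto simp: primes_le_iff dest: in_prime_factors_imp_prime)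
  also have "\<dots> \<le> ln (ln ((ln x)\<^sup>2)) + C2" by (rule C2[OF four])
  also have "ln (ln ((ln x)\<^sup>2)) = ln 2 + ln (ln (ln x))"
  proof -
   have "ln ((ln x)\<^sup>2) = 2 * ln (ln x)" using lx2 by (subst ln_realpow) auto
   moreover have "ln (ln x) > 0" using lx2 by simp
   ultimately show ?thesis by (simp add: ln_mult_pos)
  qed
  finally have s: "(\<Sum>p\<in>?s. 1 / real p) \<le> ln 2 + ln (ln (ln x)) + C2" .
  have "(\<Sum>p\<in>prime_factors E. 1 / real p) = (\<Sum>p\<in>?s \<union> ?b. 1 / real p)" by (intro sum.cong) auto
  also have "\<dots> = (\<Sum>p\<in>?s. 1 / real p) + (\<Sum>p\<in>?b. 1 / real p)" by (intro sum.union_disjoint) auto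
  also have "\<dots> \<le> ln (ln (ln x)) + (ln 2 + C2 + 5)" using s b by linarith
  finally have "exp (3 * (\<Sum>p\<in>prime_factors E. 1 / real p)) \<le> exp (3 * (ln (ln (ln x)) + (ln 2 + C2 + 5)))" by simp
  also have "\<dots> = exp (3 * (ln 2 + C2 + 5)) * ln (ln x) ^ 3"
  proof -
   define A B where "A = ln (ln (ln x))" and "B = ln 2 + C2 + 5"
   have "exp (3 * (A + B)) = exp (3 * A) * exp (3 * B)" by (simp only: distrib_left exp_add)
   also have "exp (3 * A) = exp A ^ 3" using exp_of_nat_mult[of 3 A] by simp
   also have "exp A = ln (ln x)" unfolding A_def using lx2 by simp
   finally show ?thesis by (simp only: A_def B_def mult.commute)
  qed
  finally show "gfac E ^ 3 \<le> exp (3 * (ln 2 + C2 + 5)) * (ln (ln x)) ^ 3"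
   by (simp add: gfac_def exp_of_nat_mult[symmetric])
 qed simp
qed

section \<open>Reciprocal sums over rough integers and over primes in residue classes\<close>

text \<open>Partial summation for reciprocals, in terms of a majorant of the counting function.\<close>

lemma recip_sum_le:
 fixes g :: "nat \<Rightarrow> real"
 assumes "\<And>n. 1 \<le> n \<Longrightarrow> n \<le> N \<Longrightarrow> real (card (S \<inter> {1..n})) \<le> (\<Sum>k=1..n. g k)"
 shows "(\<Sum>n\<in>S \<inter> {1..N}. 1 / real n) \<le> (\<Sum>k=1..N. g k / real k)"
proof (cases N)
 case (Suc M)
 have card_eq: "real (card (S \<inter> {1..Suc n})) = (\<Sum>k\<le>n. of_bool (Suc k \<in> S))" for n
 proof -
  have "real (card (S \<inter> {1..Suc n})) = (\<Sum>k=1..Suc n. of_bool (k \<in> S))"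
  proof -
   have "real (card (S \<inter> {1..Suc n})) = (\<Sum>k\<in>S \<inter> {1..Suc n}. 1)" by simp
   also have "\<dots> = (\<Sum>k=1..Suc n. of_bool (k \<in> S))" by (rule sum.mono_neutral_cong_left) auto
   finally show ?thesis .
  qed
  also have "\<dots> = (\<Sum>k\<le>n. of_bool (Suc k \<in> S))"
   by (simp only: One_nat_def sum.atLeast1_atMost_eq lessThan_Suc_atMost)
  finally show ?thesis .
 qed
 have g_eq: "(\<Sum>k=1..Suc n. f k) = (\<Sum>k\<le>n. f (Suc k))" for f :: "nat \<Rightarrow> real" and n
  by (simp only: One_nat_def sum.atLeast1_atMost_eq lessThan_Suc_atMost)
 have "(\<Sum>k\<le>M. of_bool (Suc k \<in> S) * (1 / real (Suc k))) \<le> (\<Sum>k\<le>M. g (Suc k) * (1 / real (Suc k)))"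
 proof (rule abel_domination)
  fix n assume "n \<le> M"
  then show "(\<Sum>k\<le>n. of_bool (Suc k \<in> S)) \<le> (\<Sum>k\<le>n. g (Suc k))"
   using assms[of "Suc n"] Suc unfolding card_eq g_eq by simp
 qed (auto simp: field_simps)
 moreover have "(\<Sum>n\<in>S \<inter> {1..N}. 1 / real n) = (\<Sum>k\<le>M. of_bool (Suc k \<in> S) * (1 / real (Suc k)))"
 proof -
  have "(\<Sum>n\<in>S \<inter> {1..N}. 1 / real n) = (\<Sum>n=1..Suc M. of_bool (n \<in> S) * (1 / real n))"
   unfolding Suc by (intro sum.mono_neutral_cong_left) auto
  then show ?thesis by (simp only: g_eq)
 qed
 ultimately show ?thesis unfolding Suc g_eq by simp
qed simp

definition rough :: "real \<Rightarrow> nat \<Rightarrow> bool" where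
 "rough t n \<longleftrightarrow> (\<forall>p. prime p \<longrightarrow> p dvd n \<longrightarrow> t \<le> real p)"

text \<open>Rough numbers have density \<open>O(1 / ln t)\<close>, as the sieve shows.\<close>

lemma sum_rough_recip:
 "\<exists>C>0. \<forall>t X. 2 \<le> t \<longrightarrow> t \<le> X \<longrightarrow>
  (\<Sum>m\<in>{m. m > 0 \<and> real m \<le> X \<and> rough t m}. 1 / real m) \<le> C * (ln X / ln t)"
proof -
 obtain C2 where C2: "\<And>x. x \<ge> 2 \<Longrightarrow> (\<Sum>p\<in>primes_le x. 1 / real p) \<le> ln (ln x) + C2"
  using mertens2_upper by auto
 obtain C3 where C3: "\<And>x. x \<ge> 2 \<Longrightarrow> (\<Sum>p\<in>primes_le x. 1 / real p) \<ge> ln (ln x) - C3"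
  using mertens2_lower by auto
 have "summable (\<lambda>n::nat. inverse (real n ^ 2))" by (rule inverse_power_summable) simp
 then obtain C4 where C4: "\<And>F. finite F \<Longrightarrow> (\<Sum>n\<in>F. inverse (real n ^ 2)) \<le> C4"
  using bounded_sums_of_summable[of "\<lambda>n. inverse (real n ^ 2)"] by auto
 show ?thesis
 proof (intro exI[of _ "exp (C2 + C3 + 1 + 19 * C4)"] conjI allI impI)
  fix t X :: real assume t: "2 \<le> t" "t \<le> X"
  let ?R = "{m. m > 0 \<and> real m \<le> X \<and> rough t m}"
  let ?Q = "{p\<in>primes_le X. t \<le> real p}"
  let ?f = "\<lambda>p i j. if i = (0::nat) then (1 / real p) ^ j else 0"
  let ?lam = "\<lambda>p::nat. 1 / real p + 19 * (1 / real p)\<^sup>2"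
  have finR: "finite ?R" by (rule finite_subset[OF _ finite_nat_le_real[of X]]) auto
  have "(\<Sum>m\<in>?R. 1 / real m) = (\<Sum>m\<in>?R. \<Prod>p\<in>prime_factors (1 * m). ?f p (multiplicity p (1::nat)) (multiplicity p m))"
  proof (intro sum.cong refl)
   fix m assume m: "m \<in> ?R"
   then have "m = (\<Prod>p\<in>prime_factors m. p ^ multiplicity p m)" using prime_factorization_nat[of m] by simp
   then have "real m = real (\<Prod>p\<in>prime_factors m. p ^ multiplicity p m)" by (rule arg_cong)
   then have "1 / real m = 1 / (\<Prod>p\<in>prime_factors m. real p ^ multiplicity p m)" by simp
   also have "\<dots> = (\<Prod>p\<in>prime_factors m. (1 / real p) ^ multiplicity p m)"
    by (simp add: prod_dividef power_one_over)
   finally show "1 / real m = (\<Prod>p\<in>prime_factors (1 * m). ?f p (multiplicity p (1::nat)) (multiplicity p m))" by simp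
  qed
  also have "\<dots> = (\<Sum>(d, m)\<in>(\<lambda>m. (1::nat, m)) ` ?R. \<Prod>p\<in>prime_factors (d * m). ?f p (multiplicity p d) (multiplicity p m))"
   by (subst sum.reindex) (auto simp: inj_on_def)
  also have "\<dots> \<le> (\<Sum>k\<in>{..card ?Q}. sum ?lam ?Q ^ k / fact k)"
  proof (rule pair_sum_le[where f = ?f])
   show "finite ((\<lambda>m. (1::nat, m)) ` ?R)" using finR by simp
   fix d m assume "(d, m) \<in> (\<lambda>m. (1::nat, m)) ` ?R"
   then have dm: "d = 1" "m > 0" "real m \<le> X" "rough t m" by auto
   have "prime_factors m \<subseteq> ?Q"
   proof
    fix p assume "p \<in> prime_factors m"
    then have p: "prime p" "p dvd m" by (auto simp: in_prime_factors_iff)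
    then have "p \<le> m" using dm by (intro dvd_imp_le)
    then show "p \<in> ?Q" using p dm by (auto simp: primes_le_iff rough_def)
   qed
   moreover from this have "card (prime_factors m) \<le> card ?Q" by (intro card_mono) auto
   ultimately show "d > 0 \<and> m > 0 \<and> prime_factors (d * m) \<subseteq> ?Q \<and> card (prime_factors (d * m)) \<in> {..card ?Q}"
    using dm by simp
  next
   fix p B assume "p \<in> ?Q"
   then have "p \<ge> 2" using prime_ge_2_nat by (auto simp: primes_le_iff)
   then have p2: "real p \<ge> 2" by simp
   have "(\<Sum>(i, j)\<in>{..B} \<times> {..B} - {(0, 0)}. ?f p i j) = (\<Sum>(i, j)\<in>(\<lambda>j. (0::nat, j)) ` {1..B}. (1 / real p) ^ j)"
    by (rule sum.mono_neutral_cong_right) (auto split: if_splits)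
   also have "\<dots> = (\<Sum>j=1..B. (1 / real p) ^ j)" by (subst sum.reindex) (auto simp: inj_on_def)
   also have "\<dots> \<le> ?lam p" using p2 by (intro sum_powers_le(2)) (auto simp: divide_le_eq)
   finally show "(\<Sum>(i, j)\<in>{..B} \<times> {..B} - {(0, 0)}. ?f p i j) \<le> ?lam p" .
  qed simp_all
  also have "\<dots> \<le> exp (sum ?lam ?Q)" by (intro sum_power_fact_le_exp sum_nonneg) auto
  also have "\<dots> \<le> exp (ln (ln X) - ln (ln t) + (C2 + C3 + 1 + 19 * C4))"
  proof -
   have a: "(\<Sum>p\<in>?Q. (1 / real p)\<^sup>2) \<le> C4" using C4[of ?Q] by (simp add: power_one_over inverse_eq_divide)
   let ?Z = "if t = real (nat \<lfloor>t\<rfloor>) then {nat \<lfloor>t\<rfloor>} else {}"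
   have "(\<Sum>p\<in>?Q. 1 / real p) \<le> (\<Sum>p\<in>(primes_le X - primes_le t) \<union> ?Z. 1 / real p)"
   proof (intro sum_mono2 subsetI)
    fix p assume p: "p \<in> ?Q"
    show "p \<in> (primes_le X - primes_le t) \<union> ?Z"
    proof (cases "t = real p")
     case False
     then show ?thesis using p by (simp add: primes_le_iff)
    qed simp
   qed auto
   also have "\<dots> \<le> (\<Sum>p\<in>primes_le X - primes_le t. 1 / real p) + (\<Sum>p\<in>?Z. 1 / real p)"
    by (intro sum_Un_le) auto
   also have "(\<Sum>p\<in>?Z. 1 / real p) \<le> 1" using t by simp
   also have "(\<Sum>p\<in>primes_le X - primes_le t. 1 / real p) = (\<Sum>p\<in>primes_le X. 1 / real p) - (\<Sum>p\<in>primes_le t. 1 / real p)"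
    using t by (intro sum_diff primes_le_mono) auto
   finally have "(\<Sum>p\<in>?Q. 1 / real p) \<le> ln (ln X) - ln (ln t) + C2 + C3 + 1"
    using C2[of X] C3[of t] t by linarith
   moreover have "sum ?lam ?Q = (\<Sum>p\<in>?Q. 1 / real p) + 19 * (\<Sum>p\<in>?Q. (1 / real p)\<^sup>2)"
    by (simp only: sum.distrib sum_distrib_left)
   ultimately show ?thesis using a by simp
  qed
  also have "\<dots> = exp (C2 + C3 + 1 + 19 * C4) * (ln X / ln t)"
   using t by (simp add: exp_add exp_diff)
  finally show "(\<Sum>m\<in>?R. 1 / real m) \<le> exp (C2 + C3 + 1 + 19 * C4) * (ln X / ln t)" .
 qed simp
qed

text \<open>A Brun--Titchmarsh inequality: the single form \<open>l n + c\<close> is sieved for \<open>n\<close> up to about \<open>B / l\<close>.\<close>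

lemma card_primes_in_class_le:
 "\<exists>C B0. C > 0 \<and> B0 \<ge> 3 \<and> (\<forall>l c B. prime l \<longrightarrow> B \<ge> B0 \<longrightarrow> real l ^ 2 \<le> B \<longrightarrow> \<not> l dvd c \<longrightarrow>
  real (card {p. prime p \<and> l < p \<and> real p \<le> B \<and> [p = c] (mod l)}) \<le> C * (B / (real l * ln B)))"
proof -
 obtain C where C: "C > 0" "\<And>(H::nat) D (E::nat) (I::nat set) (\<alpha>::nat \<Rightarrow> int) (\<beta>::nat \<Rightarrow> int) (t::nat \<Rightarrow> real) A.
  finite I \<Longrightarrow> card I \<le> 3 \<Longrightarrow> D \<ge> 2 \<Longrightarrow> D ^ 13 \<le> real H \<Longrightarrow> E > 0 \<Longrightarrow>
  (\<forall>i\<in>I. 2 \<le> t i \<and> t i \<le> D) \<Longrightarrow>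
  forms_regular_outside 0 E I \<alpha> \<beta> \<Longrightarrow>
  A \<subseteq> {1..H} \<Longrightarrow>
  forms_sifted 0 I \<alpha> \<beta> t A \<Longrightarrow>
  real (card A) \<le> C * real H * (\<Prod>i\<in>I. 1 / ln (t i)) * gfac E ^ 3"
  using linear_forms_sieve[of 0] by blast
 let ?P = "\<lambda>B::real. B powr (1/2) - 1 \<ge> B powr (13/30) \<and> ln B \<le> sqrt B \<and> B powr (1/30) \<ge> 2"
 have "eventually ?P at_top" by ((intro eventually_conj)?; (real_asymp | rule eventually_ge_at_top))
 then obtain B1 where B1: "\<And>B. B \<ge> B1 \<Longrightarrow> ?P B" by (auto simp: eventually_at_top_linorder)
 show ?thesis
 proof (rule exI[of _ "30 * C * exp 3 + 1"], rule exI[of _ "max B1 3"], intro conjI allI impI)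
  show "30 * C * exp 3 + 1 > 0" using C by (intro add_pos_pos) auto
  show "max B1 3 \<ge> 3" by simp
  fix l c :: nat and B :: real
  assume l: "prime l" and B: "B \<ge> max B1 3" and lB: "real l ^ 2 \<le> B" and lc: "\<not> l dvd c"
  have b: "B powr (1/2) - 1 \<ge> B powr (13/30)" "ln B \<le> sqrt B" "B powr (1/30) \<ge> 2" using B1[of B] B by auto
  have B3: "B \<ge> 3" using B by simp
  have l0: "real l > 0" using l prime_gt_0_nat by simp
  define D where "D = B powr (1/30)"
  define H where "H = nat \<lfloor>B / real l\<rfloor>"
  define S where "S = {p. prime p \<and> l < p \<and> real p \<le> B \<and> [p = c] (mod l)}"
  have finS: "finite S" by (rule finite_subset[OF _ finite_primes_le[of B]]) (auto simp: S_def primes_le_iff)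
  define c' where "c' = c mod l"
  have peq: "p = l * (p div l) + c'" if "p \<in> S" for p
  proof -
   have "p mod l = c'" using that by (simp add: S_def cong_def c'_def)
   then show ?thesis by (metis mult_div_mod_eq)
  qed
  define A where "A = (\<lambda>p. p div l) ` {p\<in>S. real p > sqrt B}"
  have "card {p\<in>S. real p > sqrt B} = card A" unfolding A_def
  proof (rule card_image[symmetric], rule inj_onI)
   fix p q assume "p \<in> {p\<in>S. real p > sqrt B}" "q \<in> {p\<in>S. real p > sqrt B}" "p div l = q div l"
   then show "p = q" using peq[of p] peq[of q] by simp
  qed
  moreover have "real (card A) \<le> C * real H * (\<Prod>i\<in>{0::nat}. 1 / ln D) * gfac l ^ 3"
  proof (rule C(2)[where D = D and \<alpha> = "\<lambda>_. int l" and \<beta> = "\<lambda>_. int c'" and t = "\<lambda>_. D"])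
   show "D \<ge> 2" using b by (simp add: D_def)
   have "sqrt B * real l \<le> B"
   proof -
    have "real l \<le> sqrt B" using lB l0 by (simp add: real_le_rsqrt)
    then have "sqrt B * real l \<le> sqrt B * sqrt B" using B3 by (intro mult_left_mono) auto
    then show ?thesis using B3 by simp
   qed
   then have "sqrt B \<le> B / real l" using l0 by (simp add: le_divide_eq)
   moreover have "B / real l - 1 \<le> real H" unfolding H_def by linarith
   moreover have "B powr (1/2) = sqrt B" using B3 by (simp add: powr_half_sqrt)
   ultimately have "B powr (13/30) \<le> real H" using b by linarith
   moreover have "D ^ 13 = B powr (13/30)" unfolding D_def using B3 by (simp add: powr_realpow[symmetric] powr_powr)
   ultimately show "D ^ 13 \<le> real H" by simp
   show "A \<subseteq> {1..H}"
   proof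
    fix n assume "n \<in> A"
    then obtain p where p: "p \<in> S" "n = p div l" by (auto simp: A_def)
    then have "l < p" "real p \<le> B" by (auto simp: S_def)
    have "n \<ge> 1" using p \<open>l < p\<close> l prime_gt_0_nat[of l] by (simp add: div_greater_zero_iff Suc_le_eq)
    moreover have "real n \<le> B / real l"
    proof -
     have "real n \<le> real p / real l" unfolding p(2) by (rule of_nat_div_le_of_nat)
     also have "\<dots> \<le> B / real l" using \<open>real p \<le> B\<close> by (intro divide_right_mono) auto
     finally show ?thesis .
    qed
    then have "n \<le> H" unfolding H_def by (simp add: le_nat_floor)
    ultimately show "n \<in> {1..H}" by simp
   qed
   show "\<forall>n\<in>A. \<forall>i\<in>{0::nat}. \<forall>l'. prime l' \<longrightarrow> l' > 0 \<longrightarrow> real l' < D \<longrightarrow> \<not> int l' dvd int l * int n + int c'"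
   proof (intro ballI allI impI notI)
    fix n l' and i :: nat assume n: "n \<in> A" and l': "prime l'" "real l' < D" "int l' dvd int l * int n + int c'"
    obtain p where p: "p \<in> S" "real p > sqrt B" "n = p div l" using n by (auto simp: A_def)
    have "int l * int n + int c' = int p" using peq[OF p(1)] p(3) by (metis of_nat_add of_nat_mult)
    then have "l' dvd p" using l'(3) by (metis int_dvd_int_iff)
    then have "l' = p" using l'(1) p(1) primes_dvd_imp_eq by (auto simp: S_def)
    moreover have "D \<le> sqrt B" unfolding D_def using B3 by (subst powr_half_sqrt[symmetric]) (auto intro!: powr_mono)
    ultimately show False using l'(2) p(2) by simp
   qed
   show "\<forall>l'. prime l' \<longrightarrow> l' > 0 \<longrightarrow> \<not> l' dvd l \<longrightarrow>
    (\<forall>i\<in>{0::nat}. \<not> int l' dvd int l) \<and> (\<forall>i\<in>{0::nat}. \<forall>j\<in>{0::nat}. i \<noteq> j \<longrightarrow> \<not> int l' dvd int l * int c' - int l * int c')"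
    by simp
  qed (use b l prime_gt_0_nat in \<open>auto simp: D_def\<close>)
  also have "\<dots> \<le> C * (B / real l) * (30 / ln B) * exp 3"
  proof (intro mult_mono)
   show "real H \<le> B / real l" unfolding H_def using B3 l0 by (simp add: of_nat_floor)
   show "(\<Prod>i\<in>{0::nat}. 1 / ln D) \<le> 30 / ln B" using B3 by (simp add: D_def ln_powr)
   have "gfac l ^ 3 \<le> exp 1 ^ 3" using gfac_prime_le[OF l] by (intro power_mono) (auto simp: less_imp_le)
   then show "gfac l ^ 3 \<le> exp 3" by (simp add: exp_of_nat_mult[symmetric])
   show "0 \<le> gfac l ^ 3" using gfac_pos[of l] by (intro zero_le_power less_imp_le)
  qed (use C(1) B3 l0 in \<open>auto simp: D_def ln_powr intro!: mult_nonneg_nonneg divide_nonneg_nonneg\<close>)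
  ultimately have big: "real (card {p\<in>S. real p > sqrt B}) \<le> C * (B / real l) * (30 / ln B) * exp 3" by simp
  have small: "real (card {p\<in>S. real p \<le> sqrt B}) \<le> B / (real l * ln B)"
  proof -
   have "inj_on (\<lambda>p. p div l) {p\<in>S. real p \<le> sqrt B}"
   proof (rule inj_onI)
    fix p q assume "p \<in> {p\<in>S. real p \<le> sqrt B}" "q \<in> {p\<in>S. real p \<le> sqrt B}" "p div l = q div l"
    then show "p = q" using peq[of p] peq[of q] by simp
   qed
   moreover have sub: "(\<lambda>p. p div l) ` {p\<in>S. real p \<le> sqrt B} \<subseteq> {1..nat \<lfloor>sqrt B / real l\<rfloor>}"
   proof
    fix n assume "n \<in> (\<lambda>p. p div l) ` {p\<in>S. real p \<le> sqrt B}"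
    then obtain p where p: "p \<in> S" "real p \<le> sqrt B" "n = p div l" by auto
    then have "l < p" by (auto simp: S_def)
    have "n \<ge> 1" using p \<open>l < p\<close> l prime_gt_0_nat[of l] by (simp add: div_greater_zero_iff Suc_le_eq)
    moreover have "real n \<le> sqrt B / real l"
    proof -
     have "real n \<le> real p / real l" unfolding p(3) by (rule of_nat_div_le_of_nat)
     also have "\<dots> \<le> sqrt B / real l" using p(2) by (intro divide_right_mono) auto
     finally show ?thesis .
    qed
    ultimately show "n \<in> {1..nat \<lfloor>sqrt B / real l\<rfloor>}" by (simp add: le_nat_floor)
   qed
   ultimately have "card {p\<in>S. real p \<le> sqrt B} \<le> nat \<lfloor>sqrt B / real l\<rfloor>"
    using card_inj_on_le[of "\<lambda>p. p div l" "{p\<in>S. real p \<le> sqrt B}" "{1..nat \<lfloor>sqrt B / real l\<rfloor>}"] by simp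
   then have "real (card {p\<in>S. real p \<le> sqrt B}) \<le> sqrt B / real l"
   proof -
    assume le: "card {p\<in>S. real p \<le> sqrt B} \<le> nat \<lfloor>sqrt B / real l\<rfloor>"
    have "real (nat \<lfloor>sqrt B / real l\<rfloor>) \<le> sqrt B / real l" using B3 l0 by (intro of_nat_floor divide_nonneg_nonneg) auto
    then show ?thesis using le by linarith
   qed
   also have "\<dots> \<le> B / (real l * ln B)"
   proof -
    have "sqrt B * ln B \<le> sqrt B * sqrt B" using b B3 by (intro mult_left_mono) auto
    then have "sqrt B * ln B \<le> B" using B3 by simp
    then have "sqrt B \<le> B / ln B" using B3 by (simp add: le_divide_eq)
    then have "sqrt B / real l \<le> (B / ln B) / real l" using l0 by (intro divide_right_mono) auto
    then show ?thesis by (simp add: mult.commute)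
   qed
   finally show ?thesis .
  qed
  have "S = {p\<in>S. real p > sqrt B} \<union> {p\<in>S. real p \<le> sqrt B}" by auto
  then have "card S \<le> card {p\<in>S. real p > sqrt B} + card {p\<in>S. real p \<le> sqrt B}"
   using card_Un_le[of "{p\<in>S. real p > sqrt B}" "{p\<in>S. real p \<le> sqrt B}"] by (simp only:)
  then have "real (card S) \<le> real (card {p\<in>S. real p > sqrt B}) + real (card {p\<in>S. real p \<le> sqrt B})" by linarith
  also have "\<dots> \<le> C * (B / real l) * (30 / ln B) * exp 3 + B / (real l * ln B)" using big small by linarith
  also have "\<dots> = (30 * C * exp 3 + 1) * (B / (real l * ln B))" by (simp add: algebra_simps)
  finally show "real (card {p. prime p \<and> l < p \<and> real p \<le> B \<and> [p = c] (mod l)}) \<le> (30 * C * exp 3 + 1) * (B / (real l * ln B))"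
   by (simp add: S_def)
 qed
qed

lemma sum_recip_n_ln_n_le:
 "n \<ge> 2 \<Longrightarrow> (\<Sum>k=2..n. 1 / (real k * ln (real k))) \<le> ln (ln (real n)) + 2"
proof (induction n rule: dec_induct)
 case base
 have "1 / (2 * ln 2) \<le> (3/4::real)" using ln2_ge_two_thirds by (simp add: divide_le_eq)
 then show ?case using ln_ln_2_ge by simp
next
 case (step n)
 have n: "real n \<ge> 2" using step by simp
 have a: "1 / real (Suc n) \<le> ln (real (Suc n)) - ln (real n)"
 proof -
  have "ln (real n / real (Suc n)) \<le> real n / real (Suc n) - 1" using n by (intro ln_le_minus_one) auto
  then show ?thesis using n by (simp add: ln_div field_simps)
 qed
 have l: "ln (real (Suc n)) > 0" using n by simp
 have "1 / (real (Suc n) * ln (real (Suc n))) = 1 / real (Suc n) / ln (real (Suc n))" by simp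
 also have "\<dots> \<le> (ln (real (Suc n)) - ln (real n)) / ln (real (Suc n))" using a l by (intro divide_right_mono) auto
 also have "\<dots> \<le> ln (ln (real (Suc n))) - ln (ln (real n))"
  using ln_diff_div_ln_bounds(1)[of "real (Suc n)"] n by simp
 finally show ?case using step by (simp add: sum.nat_ivl_Suc')
qed

lemma sum_primes_in_class_recip:
 "\<exists>C T0. C > 0 \<and> T0 \<ge> 3 \<and> (\<forall>l c T W L. prime l \<longrightarrow> T \<ge> T0 \<longrightarrow> real l ^ 2 \<le> T \<longrightarrow> \<not> l dvd c \<longrightarrow> L \<ge> 1 \<longrightarrow> W \<ge> 2 \<longrightarrow> ln (ln W) \<le> L \<longrightarrow>
  (\<Sum>p\<in>{p. prime p \<and> T < real p \<and> real p \<le> W \<and> [p = c] (mod l)}. 1 / real p) \<le> C * L / real l)"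
proof -
 obtain C T0 where C: "C > 0" "T0 \<ge> 3" "\<And>l c B. prime l \<Longrightarrow> B \<ge> T0 \<Longrightarrow> real l ^ 2 \<le> B \<Longrightarrow> \<not> l dvd c \<Longrightarrow>
  real (card {p. prime p \<and> l < p \<and> real p \<le> B \<and> [p = c] (mod l)}) \<le> C * (B / (real l * ln B))"
  using card_primes_in_class_le by blast
 show ?thesis
 proof (rule exI[of _ "6 * C"], rule exI[of _ T0], intro conjI allI impI)
  fix l c :: nat and T W L :: real
  assume l: "prime l" and T: "T \<ge> T0" "real l ^ 2 \<le> T" and c: "\<not> l dvd c" and L: "L \<ge> 1" and W: "W \<ge> 2" "ln (ln W) \<le> L"
  define S where "S = {p. prime p \<and> T < real p \<and> [p = c] (mod l)}"
  define N where "N = nat \<lfloor>W\<rfloor>"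
  have N: "N \<ge> 2" "real N \<le> W" using W unfolding N_def by linarith+
  have l1: "real l \<ge> 1" using prime_ge_1_nat[OF l] by simp
  define M where "M = 2 * C / real l"
  have M: "M > 0" using C l1 by (simp add: M_def)
  define g where "g = (\<lambda>k::nat. if k \<ge> 2 then M / ln (real k) else 0)"
  have g0: "g k \<ge> 0" for k using M by (simp add: g_def)
  have eq: "{p. prime p \<and> T < real p \<and> real p \<le> W \<and> [p = c] (mod l)} = S \<inter> {1..N}"
  proof -
   have iff: "real p \<le> W \<longleftrightarrow> p \<le> N" for p :: nat using W unfolding N_def by (simp add: le_nat_iff le_floor_iff)
   have "p \<in> {p. prime p \<and> T < real p \<and> real p \<le> W \<and> [p = c] (mod l)} \<longleftrightarrow> p \<in> S \<inter> {1..N}" for p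
    unfolding S_def mem_Collect_eq Int_iff atLeastAtMost_iff iff using prime_ge_1_nat[of p] by blast
   then show ?thesis by blast
  qed
  have "(\<Sum>n\<in>S \<inter> {1..N}. 1 / real n) \<le> (\<Sum>k=1..N. g k / real k)"
  proof (rule recip_sum_le)
   fix n assume n: "1 \<le> n" "n \<le> N"
   show "real (card (S \<inter> {1..n})) \<le> (\<Sum>k=1..n. g k)"
   proof (cases "real n \<le> T")
    case True
    then have "S \<inter> {1..n} = {}" by (auto simp: S_def)
    then have "card (S \<inter> {1..n}) = 0" by (simp only: card.empty)
    then show ?thesis using g0 by (simp add: sum_nonneg)
   next
    case False
    then have nT: "real n > T" by simp
    then have n3: "real n \<ge> 3" using T C by linarith
    have ln0: "ln (real n) > 0" using n3 by simp
    have "S \<inter> {1..n} \<subseteq> {p. prime p \<and> l < p \<and> real p \<le> real n \<and> [p = c] (mod l)}"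
    proof
     fix p assume p: "p \<in> S \<inter> {1..n}"
     have "real l * 1 \<le> real l * real l" using l1 by (intro mult_left_mono) auto
     then have "real l \<le> T" using T by (simp add: power2_eq_square)
     then have "l < p" using p by (auto simp: S_def)
     then show "p \<in> {p. prime p \<and> l < p \<and> real p \<le> real n \<and> [p = c] (mod l)}" using p by (auto simp: S_def)
    qed
    then have "card (S \<inter> {1..n}) \<le> card {p. prime p \<and> l < p \<and> real p \<le> real n \<and> [p = c] (mod l)}"
     by (intro card_mono finite_subset[OF _ finite_nat_le_real[of "real n"]]) auto
    then have "real (card (S \<inter> {1..n})) \<le> C * (real n / (real l * ln (real n)))"
     using C(3)[OF l _ _ c, of "real n"] T nT by linarith
    also have "\<dots> = M * (real n / 2) / ln (real n)" by (simp add: M_def)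
    also have "\<dots> \<le> M * (real n - 1) / ln (real n)" using n3 M ln0 by (intro divide_right_mono mult_left_mono) auto
    also have "\<dots> = (\<Sum>k=2..n. M / ln (real n))" using n3 by (simp add: of_nat_diff)
    also have "\<dots> \<le> (\<Sum>k=2..n. g k)"
    proof (rule sum_mono)
     fix k assume k: "k \<in> {2..n}"
     have "ln (real k) \<le> ln (real n)" using k by simp
     then have "M / ln (real n) \<le> M / ln (real k)" using k M ln0 by (intro divide_left_mono) auto
     then show "M / ln (real n) \<le> g k" using k by (simp add: g_def)
    qed
    also have "\<dots> \<le> (\<Sum>k=1..n. g k)" using g0 by (intro sum_mono2) auto
    finally show ?thesis .
   qed
  qed
  also have "\<dots> = (\<Sum>k=2..N. M * (1 / (real k * ln (real k))))"
   by (rule sum.mono_neutral_cong_right) (auto simp: g_def)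
  also have "\<dots> = M * (\<Sum>k=2..N. 1 / (real k * ln (real k)))" by (simp only: sum_distrib_left)
  also have "\<dots> \<le> M * (3 * L)"
  proof (rule mult_left_mono)
   have "ln (real N) \<le> ln W" using N by simp
   then have "ln (ln (real N)) \<le> ln (ln W)" using N by (subst ln_le_cancel_iff) auto
   then show "(\<Sum>k=2..N. 1 / (real k * ln (real k))) \<le> 3 * L" using sum_recip_n_ln_n_le[OF N(1)] W L by linarith
  qed (use M in simp)
  also have "\<dots> = 6 * C * L / real l" by (simp add: M_def)
  finally show "(\<Sum>p\<in>{p. prime p \<and> T < real p \<and> real p \<le> W \<and> [p = c] (mod l)}. 1 / real p) \<le> 6 * C * L / real l"
   unfolding eq .
 qed (use C in auto)
qed

section \<open>Weighted averages over shifted smooth numbers\<close>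

lemma wt_mult_prime_le:
 assumes "n > 0" "prime p" "real p \<le> w" "0 \<le> \<beta>" "\<beta> * ln w \<le> A"
 shows "wt \<beta> (n * p) \<le> exp (A + 6) * (wt \<beta> n / real p)"
proof -
 have p: "p > 0" "real p \<ge> 1" using prime_gt_0_nat[OF assms(2)] prime_ge_1_nat[OF assms(2)] by auto
 have "gfac (n * p) \<le> gfac n * exp 1"
  using gfac_mult_le[OF assms(1) p(1)] mult_left_mono[OF gfac_prime_le[OF assms(2)], of "gfac n"] gfac_pos[of n] by linarith
 then have "gfac (n * p) ^ 6 \<le> (gfac n * exp 1) ^ 6" by (intro power_mono) (simp_all add: less_imp_le)
 also have "\<dots> = gfac n ^ 6 * exp 6" using exp_of_nat_mult[of 6 "1::real"] by (simp add: power_mult_distrib)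
 finally have g: "gfac (n * p) ^ 6 \<le> gfac n ^ 6 * exp 6" .
 have "real p powr \<beta> = exp (\<beta> * ln (real p))" using p by (simp add: powr_def)
 also have "\<dots> \<le> exp A"
 proof -
  have "\<beta> * ln (real p) \<le> \<beta> * ln w" using assms p by (intro mult_left_mono) auto
  then show ?thesis using assms by simp
 qed
 finally have "real p powr \<beta> \<le> exp A" .
 then have "real p powr \<beta> / real p \<le> exp A / real p" by (intro divide_right_mono) auto
 moreover have "real p powr (\<beta> - 1) = real p powr \<beta> / real p" using p by (simp add: powr_diff)
 ultimately have q: "real p powr (\<beta> - 1) \<le> exp A / real p" by simp
 have "wt \<beta> (n * p) = gfac (n * p) ^ 6 * (real n powr (\<beta> - 1) * real p powr (\<beta> - 1))"
  by (simp add: wt_def powr_mult)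
 also have "\<dots> \<le> (gfac n ^ 6 * exp 6) * (real n powr (\<beta> - 1) * (exp A / real p))"
  using g q gfac_pos[of n] by (intro mult_mono mult_left_mono) auto
 also have "\<dots> = exp (A + 6) * (wt \<beta> n / real p)" by (simp add: wt_def exp_add)
 finally show ?thesis .
qed

lemma single_primes_remove:
 assumes "(d, m) \<in> smooth_pairs w Y" "p \<in> single_primes T d m"
 obtains m' where "m = m' * p" "(d, m') \<in> smooth_pairs w Y" "prime p" "real p \<le> w" "T < real p"
  "card (prime_factors (d * m')) \<le> card (prime_factors (d * m))"
proof -
 have p: "prime p" "p dvd d * m" "multiplicity p m = 1" "T < real p" "p \<in> prime_factors (d * m)"
  using assms(2) by (auto simp: single_primes_def in_prime_factors_iff)
 have dm: "d > 0" "m > 0" "real (d * m) \<le> Y" "prime_factors (d * m) \<subseteq> primes_le w"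
  using assms(1) by (auto simp: smooth_pairs_def)
 have "p dvd m" using p(3) by (metis not_dvd_imp_multiplicity_0 zero_neq_one)
 then obtain m' where m': "m = m' * p" by (metis dvd_def mult.commute)
 have m'0: "m' > 0" using m' dm by (cases m') auto
 have sub: "prime_factors (d * m') \<subseteq> prime_factors (d * m)"
  using dm m' by (intro dvd_prime_factors) auto
 have "d * m' \<le> d * m" using m' prime_gt_0_nat[OF p(1)] by simp
 then have "real (d * m') \<le> real (d * m)" by (simp only: of_nat_le_iff)
 then have "real (d * m') \<le> Y" using dm(3) by linarith
 then have "(d, m') \<in> smooth_pairs w Y" using dm(1,4) sub m'0 by (auto simp: smooth_pairs_def simp del: of_nat_mult)
 moreover have "real p \<le> w" using p(5) dm(4) by (auto simp: primes_le_iff)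
 moreover have "card (prime_factors (d * m')) \<le> card (prime_factors (d * m))" using sub by (intro card_mono) auto
 ultimately show ?thesis using that m' p by blast
qed

text \<open>Averaging over \<open>m\<close>, the factor \<open>gfac(a c m + v)^3\<close> costs only a constant. It is dominated by a
sum over prime divisors \<open>l \<le> (ln x)^2\<close> of \<open>a c m + v\<close>. If \<open>m\<close> has more than \<open>L / 100\<close> primes \<open>p > (ln x)^4\<close> that
divide it exactly once and do not divide \<open>d\<close>, then any of them may be varied in the residue class
modulo \<open>l\<close> prescribed by the condition \<open>l dvd a c m + v\<close>, which gains a factor \<open>1/l\<close>. For the remaining pairs,
counted with the weight \<open>1/4\<close>, the trivial bound \<open>(ln ln x)^3\<close> suffices, because \<open>exp (5/4 L + L ln 4 / 100)\<close> is much
smaller than \<open>exp (2 L) tau L\<close>.\<close>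

lemma shifted_weight_average:
 fixes a v :: int
 assumes "v \<noteq> 0" "A \<ge> 0"
 shows "\<exists>C L0 x0. C > 0 \<and> L0 \<ge> 1 \<and> (\<forall>L w \<beta> Y x c. L \<ge> L0 \<longrightarrow> w \<ge> 2 \<longrightarrow> ln (ln w) \<le> L \<longrightarrow> 0 \<le> \<beta> \<longrightarrow> \<beta> \<le> 1/4 \<longrightarrow>
   \<beta> * ln w \<le> A \<longrightarrow> x \<ge> x0 \<longrightarrow> ln (ln x) \<le> L + 2 \<longrightarrow>
   (\<forall>m. real m \<le> Y \<longrightarrow> real_of_int \<bar>a * int c * int m + v\<bar> \<le> x ^ 3) \<longrightarrow>
   (\<Sum>(d, m)\<in>{(d, m) \<in> smooth_pairs w Y. card (prime_factors (d * m)) < omega_cut L \<and> a * int c * int m + v \<noteq> 0}.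
     wt \<beta> (d * m) * gfac (nat \<bar>a * int c * int m + v\<bar>) ^ 3) \<le> C * exp (2 * L) * tau L)"
proof -
 obtain Cs where Cs: "Cs \<ge> 0" "\<And>w \<beta> Y L K. w \<ge> 2 \<Longrightarrow> 0 \<le> \<beta> \<Longrightarrow> \<beta> \<le> 1/4 \<Longrightarrow> \<beta> * ln w \<le> A \<Longrightarrow> ln (ln w) \<le> L \<Longrightarrow>
  (\<Sum>(d, m)\<in>smooth_pairs_few w Y K. wt \<beta> (d * m))
   \<le> (\<Sum>k<K. (2 * L + Cs) ^ k / fact k)"
  using sum_smooth_pairs[OF assms(2)] by blast
 obtain Cp where Cp: "Cp > 0" "\<And>L. L \<ge> 1 \<Longrightarrow> (\<Sum>k<omega_cut L. (2 * L + Cs) ^ k / fact k) \<le> Cp * exp (2 * L) * tau L"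
  using poisson_lower_tail[OF Cs(1)] by blast
 obtain Cf where Cf: "Cf \<ge> 0" "\<And>w \<beta> Y L T. w \<ge> 2 \<Longrightarrow> 0 \<le> \<beta> \<Longrightarrow> \<beta> \<le> 1/4 \<Longrightarrow> \<beta> * ln w \<le> A \<Longrightarrow> ln (ln w) \<le> L \<Longrightarrow> T \<ge> 3 \<Longrightarrow> L \<ge> 0 \<Longrightarrow>
  (\<Sum>(d, m)\<in>smooth_pairs w Y. wt \<beta> (d * m) * (1/4) ^ card (single_primes T d m))
   \<le> exp (5/4 * L + 2 * ln (ln T) + Cf)"
  using sum_smooth_pairs_few_single[OF assms(2)] by blast
 obtain Cg where Cg: "Cg > 0" "\<And>x E. x \<ge> 3 \<Longrightarrow> E > 0 \<Longrightarrow> real E \<le> x ^ 3 \<Longrightarrow>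
  gfac E ^ 3 \<le> Cg * (1 + (\<Sum>p\<in>{p\<in>prime_factors E. real p \<le> (ln x)\<^sup>2}. ln (real p) ^ 3 / real p))"
  using gfac_cube_le by blast
 obtain Cl where Cl: "Cl > 0" "\<And>x E. x \<ge> 16 \<Longrightarrow> E > 0 \<Longrightarrow> real E \<le> x ^ 3 \<Longrightarrow> gfac E ^ 3 \<le> Cl * (ln (ln x)) ^ 3"
  using gfac_cube_le_ln_ln by blast
 obtain Cc T0 where Cc: "Cc > 0" "T0 \<ge> 3" "\<And>l c T W L. prime l \<Longrightarrow> T \<ge> T0 \<Longrightarrow> real l ^ 2 \<le> T \<Longrightarrow> \<not> l dvd c \<Longrightarrow> L \<ge> 1 \<Longrightarrow> W \<ge> 2 \<Longrightarrow> ln (ln W) \<le> L \<Longrightarrow>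
  (\<Sum>p\<in>{p. prime p \<and> T < real p \<and> real p \<le> W \<and> [p = c] (mod l)}. 1 / real p) \<le> Cc * L / real l"
  using sum_primes_in_class_recip by blast
 obtain Cq where Cq: "\<And>F. finite F \<Longrightarrow> (\<Sum>n\<in>F. ln (real n) ^ 3 / real n ^ 2) \<le> Cq"
  using sum_ln_cube_bounds(1) by blast
 define f where "f = (\<lambda>p::nat. ln (real p) ^ 3 / real p)"
 have f0: "f p \<ge> 0" if "prime p" for p using prime_ge_1_nat[OF that] by (simp add: f_def)
 define Cv where "Cv = (\<Sum>p\<in>primes_le (real_of_int \<bar>v\<bar>). f p)"
 have Cv: "Cv \<ge> 0" unfolding Cv_def by (intro sum_nonneg f0) (simp add: primes_le_iff)
 let ?P = "\<lambda>x::real. x \<ge> 16 \<and> (ln x) ^ 4 \<ge> T0"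
 have "eventually ?P at_top" by ((intro eventually_conj)?; (real_asymp | rule eventually_ge_at_top))
 then obtain x0 where x0: "\<And>x. x \<ge> x0 \<Longrightarrow> ?P x" by (auto simp: eventually_at_top_linorder)
 have "((\<lambda>L::real. (L + 2) ^ 3 * exp (L / 50) * exp (5/4 * L + 2 * ln (4 * (L + 2))) / (exp (17/10 * L) / sqrt L)) \<longlongrightarrow> 0) at_top"
  by real_asymp
 moreover have "1 / (Cl * exp Cf) > 0" using Cl by simp
 ultimately have "eventually (\<lambda>L::real. (L + 2) ^ 3 * exp (L / 50) * exp (5/4 * L + 2 * ln (4 * (L + 2))) / (exp (17/10 * L) / sqrt L) < 1 / (Cl * exp Cf)) at_top"
  by (rule order_tendstoD(2))
 then obtain L1 where L1: "\<And>L. L \<ge> L1 \<Longrightarrow> (L + 2) ^ 3 * exp (L / 50) * exp (5/4 * L + 2 * ln (4 * (L + 2))) / (exp (17/10 * L) / sqrt L) < 1 / (Cl * exp Cf)"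
  by (auto simp: eventually_at_top_linorder)
 define C where "C = 1 + Cg * (1 + Cv) * Cp + Cg * (\<bar>Cq\<bar> * (100 * exp (A + 6) * Cc)) * Cp"
 show ?thesis
 proof (rule exI[of _ C], rule exI[of _ "max 1 L1"], rule exI[of _ x0], intro conjI allI impI)
  show "C > 0" unfolding C_def using Cg Cv Cp Cc by (intro add_pos_nonneg add_nonneg_nonneg mult_nonneg_nonneg) auto
  show "max 1 L1 \<ge> 1" by simp
  fix L w \<beta> Y x :: real and c :: nat
  assume L: "L \<ge> max 1 L1" and w: "w \<ge> 2" "ln (ln w) \<le> L" and \<beta>: "0 \<le> \<beta>" "\<beta> \<le> 1/4" "\<beta> * ln w \<le> A"
   and x: "x \<ge> x0" "ln (ln x) \<le> L + 2"
   and size: "\<forall>m. real m \<le> Y \<longrightarrow> real_of_int \<bar>a * int c * int m + v\<bar> \<le> x ^ 3"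
  have x16: "x \<ge> 16" and xT: "(ln x) ^ 4 \<ge> T0" using x0[OF x(1)] by auto
  have L1': "L \<ge> 1" "L \<ge> L1" using L by auto
  define T where "T = (ln x) ^ 4"
  have lnx: "ln x \<ge> 2"
  proof -
   have "2 \<le> 4 * ln (2::real)" using ln2_ge_two_thirds by simp
   also have "\<dots> = ln (2 ^ 4)" by (subst ln_realpow) auto
   also have "\<dots> \<le> ln x" using x16 by (subst ln_le_cancel_iff) auto
   finally show ?thesis .
  qed
  have T: "T \<ge> T0" "T \<ge> 3" using xT Cc by (auto simp: T_def)
  define val where "val = (\<lambda>y :: nat \<times> nat. a * int c * int (snd y) + v)"
  define E where "E = (\<lambda>y. nat \<bar>val y\<bar>)"
  define W where "W = (\<lambda>y :: nat \<times> nat. wt \<beta> (fst y * snd y))"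
  define sg where "sg = (\<lambda>y :: nat \<times> nat. single_primes T (fst y) (snd y))"
  define P0 where "P0 = {y \<in> smooth_pairs w Y. card (prime_factors (fst y * snd y)) < omega_cut L}"
  define PP where "PP = {y \<in> P0. val y \<noteq> 0}"
  define exc where "exc = {y \<in> PP. real (card (sg y)) \<le> L / 100}"
  define non where "non = {y \<in> PP. real (card (sg y)) > L / 100}"
  have finP0: "finite P0" unfolding P0_def by (rule finite_subset[OF _ finite_smooth_pairs[of w Y]]) auto
  then have fins: "finite PP" "finite exc" "finite non" by (auto simp: PP_def exc_def non_def)
  have W0: "W y \<ge> 0" for y by (simp add: W_def wt_nonneg)
  have PPs: "y \<in> smooth_pairs w Y" if "y \<in> PP" for y using that by (simp add: PP_def P0_def)
  have Epos: "E y > 0" "real (E y) \<le> x ^ 3" if "y \<in> PP" for y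
  proof -
   show "E y > 0" using that by (simp add: E_def PP_def)
   have "(fst y, snd y) \<in> smooth_pairs w Y" using PPs[OF that] by simp
   then have fs: "fst y > 0" "real (fst y * snd y) \<le> Y" by (simp_all only: smooth_pairs_def mem_Collect_eq case_prod_conv)
   have "snd y \<le> fst y * snd y" using fs by simp
   then have "real (snd y) \<le> Y" using fs(2) by (meson of_nat_mono order_trans)
   then have "real_of_int \<bar>val y\<bar> \<le> x ^ 3" using size unfolding val_def by blast
   then show "real (E y) \<le> x ^ 3" by (simp add: E_def)
  qed
  define S where "S = (\<Sum>y\<in>P0. W y)"
  have S: "S \<le> Cp * exp (2 * L) * tau L"
  proof -
   have "P0 = smooth_pairs_few w Y (omega_cut L)" by (auto simp: P0_def)
   then have "S = (\<Sum>(d, m)\<in>smooth_pairs_few w Y (omega_cut L). wt \<beta> (d * m))"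
    by (simp only: S_def W_def case_prod_unfold)
   also have "\<dots> \<le> (\<Sum>k<omega_cut L. (2 * L + Cs) ^ k / fact k)" using w \<beta> by (intro Cs(2))
   also have "\<dots> \<le> Cp * exp (2 * L) * tau L" by (rule Cp(2)[OF L1'(1)])
   finally show ?thesis .
  qed
  have S0: "S \<ge> 0" unfolding S_def by (intro sum_nonneg W0)
  have exc_part: "(\<Sum>y\<in>exc. W y * gfac (E y) ^ 3) \<le> exp (2 * L) * tau L"
  proof -
   have "(\<Sum>y\<in>exc. W y * gfac (E y) ^ 3) \<le> (\<Sum>y\<in>exc. (Cl * (L + 2) ^ 3 * exp (L / 50)) * (W y * (1/4) ^ card (sg y)))"
   proof (rule sum_mono)
    fix y assume y: "y \<in> exc"
    then have yP: "y \<in> PP" by (simp add: exc_def)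
    have "gfac (E y) ^ 3 \<le> Cl * (ln (ln x)) ^ 3" using Epos[OF yP] x16 by (intro Cl(2))
    also have "\<dots> \<le> Cl * (L + 2) ^ 3" using x lnx Cl by (intro mult_left_mono power_mono) auto
    finally have g: "gfac (E y) ^ 3 \<le> Cl * (L + 2) ^ 3" .
    have one: "1 \<le> exp (L / 50) * (1/4) ^ card (sg y)"
    proof -
     have "ln 4 = 2 * ln (2::real)" using ln_realpow[of "2::real" 2] by simp
     then have l4: "ln 4 \<le> (2::real)" using ln_2_less_1 by simp
     have "real (card (sg y)) * ln 4 \<le> (L / 100) * 2"
      using y l4 L1' by (intro mult_mono) (auto simp: exc_def)
     then have "0 \<le> L / 50 - real (card (sg y)) * ln 4" by simp
     then have "1 \<le> exp (L / 50 - real (card (sg y)) * ln 4)" by simp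
     also have "\<dots> = exp (L / 50) / exp (ln 4) ^ card (sg y)" by (simp only: exp_diff exp_of_nat_mult)
     also have "\<dots> = exp (L / 50) * (1/4) ^ card (sg y)" by (simp add: power_one_over)
     finally show ?thesis .
    qed
    have "W y * gfac (E y) ^ 3 \<le> W y * (Cl * (L + 2) ^ 3)" using g W0 by (intro mult_left_mono)
    also have "\<dots> \<le> W y * (Cl * (L + 2) ^ 3) * (exp (L / 50) * (1/4) ^ card (sg y))"
     using mult_left_mono[OF one, of "W y * (Cl * (L + 2) ^ 3)"] W0[of y] Cl L1' by simp
    finally show "W y * gfac (E y) ^ 3 \<le> (Cl * (L + 2) ^ 3 * exp (L / 50)) * (W y * (1/4) ^ card (sg y))"
     by (simp only: mult_ac)
   qed
   also have "\<dots> = (Cl * (L + 2) ^ 3 * exp (L / 50)) * (\<Sum>y\<in>exc. W y * (1/4) ^ card (sg y))"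
    by (simp only: sum_distrib_left)
   also have "\<dots> \<le> (Cl * (L + 2) ^ 3 * exp (L / 50)) * exp (5/4 * L + 2 * ln (4 * (L + 2)) + Cf)"
   proof (rule mult_left_mono)
    have "(\<Sum>y\<in>exc. W y * (1/4) ^ card (sg y)) \<le> (\<Sum>y\<in>smooth_pairs w Y. W y * (1/4) ^ card (sg y))"
     using W0 by (intro sum_mono2) (auto simp: exc_def PP_def P0_def)
    also have "\<dots> \<le> exp (5/4 * L + 2 * ln (ln T) + Cf)"
     using Cf(2)[OF w(1) \<beta> w(2) T(2), of Y] L1' by (simp add: W_def sg_def case_prod_unfold)
    also have "\<dots> \<le> exp (5/4 * L + 2 * ln (4 * (L + 2)) + Cf)"
    proof -
     have "ln T = 4 * ln (ln x)" unfolding T_def using lnx by (subst ln_realpow) auto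
     also have "\<dots> \<le> 4 * (L + 2)" using x by simp
     finally have "ln (ln T) \<le> ln (4 * (L + 2))"
      using T L1' by (subst ln_le_cancel_iff) auto
     then show ?thesis by simp
    qed
    finally show "(\<Sum>y\<in>exc. W y * (1/4) ^ card (sg y)) \<le> exp (5/4 * L + 2 * ln (4 * (L + 2)) + Cf)" .
   qed (use Cl L1' in auto)
   also have "\<dots> = (Cl * exp Cf) * ((L + 2) ^ 3 * exp (L / 50) * exp (5/4 * L + 2 * ln (4 * (L + 2))))"
    by (simp only: exp_add mult_ac)
   also have "\<dots> \<le> exp (17/10 * L) / sqrt L"
   proof -
    define N where "N = (L + 2) ^ 3 * exp (L / 50) * exp (5/4 * L + 2 * ln (4 * (L + 2)))"
    define D where "D = exp (17/10 * L) / sqrt L"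
    have "D > 0" using L1' by (simp add: D_def)
    moreover have "N / D < 1 / (Cl * exp Cf)" unfolding N_def D_def by (rule L1[OF L1'(2)])
    ultimately have "(Cl * exp Cf) * N \<le> D" using Cl by (simp add: field_simps)
    then show ?thesis by (simp only: N_def D_def)
   qed
   also have "\<dots> \<le> exp (2 * L) * tau L"
   proof -
    have "17/10 * L \<le> 2 * L + - eta0 * L" using mult_right_mono[OF eta0_le, of L] L1' by simp
    then have "exp (17/10 * L) \<le> exp (2 * L) * exp (- eta0 * L)" by (simp only: exp_add[symmetric] exp_le_cancel_iff)
    then have "exp (17/10 * L) / sqrt L \<le> exp (2 * L) * exp (- eta0 * L) / sqrt L" using L1' by (intro divide_right_mono) auto
    then show ?thesis by (simp add: tau_def)
   qed
   finally show ?thesis .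
  qed
  define R where "R = {l \<in> primes_le ((ln x)\<^sup>2). real_of_int \<bar>v\<bar> < real l}"
  have finR: "finite R" by (simp add: R_def)
  define ind where "ind = (\<lambda>l y. if int l dvd val y then 1 else (0::real))"
  have class_part: "(\<Sum>y\<in>non. W y * ind l y) \<le> 100 * exp (A + 6) * Cc / real l * S" if l: "l \<in> R" for l
  proof -
   have lp: "prime l" "real l \<le> (ln x)\<^sup>2" "int l > \<bar>v\<bar>" using l by (auto simp: R_def primes_le_iff)
   have l2: "real l ^ 2 \<le> T"
   proof -
    have "real l ^ 2 \<le> ((ln x)\<^sup>2)\<^sup>2" using lp by (intro power_mono) auto
    then show ?thesis by (simp add: T_def)
   qed
   have nv: "\<not> int l dvd v" using lp(3) assms(1) zdvd_imp_le[of "int l" "\<bar>v\<bar>"] by auto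
   define Pl where "Pl = {y \<in> non. int l dvd val y}"
   define V where "V = (\<lambda>y :: nat \<times> nat. {p. prime p \<and> T < real p \<and> real p \<le> w \<and> int l dvd a * int c * int (snd y * p) + v})"
   have finV: "finite (V y)" for y
    by (rule finite_subset[OF _ finite_primes_le[of w]]) (auto simp: V_def primes_le_iff)
   have sumV: "(\<Sum>p\<in>V y. 1 / real p) \<le> Cc * L / real l" for y
   proof (cases "V y = {}")
    case True
    then show ?thesis using Cc L1' by simp
   next
    case False
    then obtain q where q: "q \<in> V y" by auto
    have "\<not> l dvd q"
    proof
     assume "l dvd q"
     then have "l = q" using q lp primes_dvd_imp_eq by (auto simp: V_def)
     then have "real l > T" using q by (simp add: V_def)
     moreover have "real l * 1 \<le> real l * real l" using prime_ge_1_nat[OF lp(1)] by (intro mult_left_mono) auto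
     ultimately show False using l2 by (simp add: power2_eq_square)
    qed
    moreover have "V y \<subseteq> {p. prime p \<and> T < real p \<and> real p \<le> w \<and> [p = q] (mod l)}"
    proof
     fix p assume p: "p \<in> V y"
     define b where "b = a * int c * int (snd y)"
     have dp: "int l dvd b * int p + v" "int l dvd b * int q + v" using p q by (auto simp: V_def b_def mult.assoc)
     have nb: "\<not> int l dvd b"
     proof
      assume "int l dvd b"
      then have "int l dvd b * int p" by simp
      then have "int l dvd v" using dp(1) dvd_add_right_iff by blast
      then show False using nv by simp
     qed
     have "int l dvd (b * int p + v) - (b * int q + v)" using dp by (rule dvd_diff)
     then have "int l dvd b * (int p - int q)" by (simp add: algebra_simps)
     then have "int l dvd int p - int q" using nb lp(1) by (simp add: prime_dvd_mult_iff)
     then have "[int p = int q] (mod int l)" by (simp add: cong_iff_dvd_diff)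
     then have "[p = q] (mod l)" by (simp add: cong_int_iff)
     then show "p \<in> {p. prime p \<and> T < real p \<and> real p \<le> w \<and> [p = q] (mod l)}" using p by (simp add: V_def)
    qed
    moreover have "finite {p. prime p \<and> T < real p \<and> real p \<le> w \<and> [p = q] (mod l)}"
     by (rule finite_subset[OF _ finite_primes_le[of w]]) (auto simp: primes_le_iff)
    ultimately have "(\<Sum>p\<in>V y. 1 / real p) \<le> (\<Sum>p\<in>{p. prime p \<and> T < real p \<and> real p \<le> w \<and> [p = q] (mod l)}. 1 / real p)"
     by (intro sum_mono2) auto
    also have "\<dots> \<le> Cc * L / real l" using \<open>\<not> l dvd q\<close> lp l2 T L1' w by (intro Cc(3))
    finally show ?thesis .
   qed
   have "(\<Sum>y\<in>non. W y * ind l y) = (\<Sum>y\<in>Pl. W y)"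
    unfolding Pl_def using fins by (intro sum.mono_neutral_cong_right) (auto simp: ind_def)
   also have "\<dots> \<le> (\<Sum>y\<in>Pl. 100 / L * (\<Sum>p\<in>sg y. W y))"
   proof (rule sum_mono)
    fix y assume "y \<in> Pl"
    then have "L / 100 \<le> real (card (sg y))" by (simp add: Pl_def non_def)
    then have "1 \<le> 100 / L * real (card (sg y))" using L1' by (simp add: field_simps)
    then have "1 * W y \<le> 100 / L * real (card (sg y)) * W y" using W0 by (rule mult_right_mono)
    then show "W y \<le> 100 / L * (\<Sum>p\<in>sg y. W y)" by simp
   qed
   also have "\<dots> = 100 / L * (\<Sum>y\<in>Pl. \<Sum>p\<in>sg y. W y)" by (simp only: sum_distrib_left)
   finally have c1: "(\<Sum>y\<in>non. W y * ind l y) \<le> 100 / L * (\<Sum>y\<in>Pl. \<Sum>p\<in>sg y. W y)" .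
   have "(\<Sum>y\<in>Pl. \<Sum>p\<in>sg y. W y) = (\<Sum>(y, p)\<in>Sigma Pl sg. W y)"
    using fins by (intro sum.Sigma) (auto simp: Pl_def sg_def)
   also have "\<dots> \<le> (\<Sum>(y, p)\<in>Sigma P0 V. exp (A + 6) * (W y / real p))"
   proof (rule sum_le_included[where i = "\<lambda>(y, p). ((fst y, snd y * p), p)"])
    show "finite (Sigma Pl sg)" using fins by (auto simp: Pl_def sg_def)
    show "finite (Sigma P0 V)" using finP0 finV by auto
    show "\<forall>y\<in>Sigma P0 V. 0 \<le> (case y of (y, p) \<Rightarrow> exp (A + 6) * (W y / real p))" using W0 by auto
    show "\<forall>z\<in>Sigma Pl sg. \<exists>z'\<in>Sigma P0 V. (case z' of (y, p) \<Rightarrow> ((fst y, snd y * p), p)) = z \<and>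
     (case z of (y, p) \<Rightarrow> W y) \<le> (case z' of (y, p) \<Rightarrow> exp (A + 6) * (W y / real p))"
    proof
     fix z assume "z \<in> Sigma Pl sg"
     then obtain d m p where z: "z = ((d, m), p)" "(d, m) \<in> Pl" "p \<in> single_primes T d m"
      by (auto simp: sg_def)
     have dm: "(d, m) \<in> smooth_pairs w Y" "card (prime_factors (d * m)) < omega_cut L" "int l dvd a * int c * int m + v"
      using z(2) by (auto simp: Pl_def non_def PP_def P0_def val_def)
     obtain m' where m': "m = m' * p" "(d, m') \<in> smooth_pairs w Y" "prime p" "real p \<le> w" "T < real p"
      "card (prime_factors (d * m')) \<le> card (prime_factors (d * m))"
      using single_primes_remove[OF dm(1) z(3)] by metis
     have "(d, m') \<in> P0" using m' dm(2) by (simp add: P0_def)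
     moreover have "p \<in> V (d, m')" using m' dm(3) by (simp add: V_def)
     moreover have "wt \<beta> (d * m' * p) \<le> exp (A + 6) * (wt \<beta> (d * m') / real p)"
      using m' \<beta> smooth_pairsD[OF m'(2)] by (intro wt_mult_prime_le[where w = w]) auto
     ultimately show "\<exists>z'\<in>Sigma P0 V. (case z' of (y, p) \<Rightarrow> ((fst y, snd y * p), p)) = z \<and>
      (case z of (y, p) \<Rightarrow> W y) \<le> (case z' of (y, p) \<Rightarrow> exp (A + 6) * (W y / real p))"
      using m'(1) z(1) by (intro bexI[of _ "((d, m'), p)"]) (auto simp: W_def mult.assoc)
    qed
   qed
   also have "\<dots> = (\<Sum>y\<in>P0. \<Sum>p\<in>V y. exp (A + 6) * (W y / real p))"
    using finP0 finV by (intro sum.Sigma[symmetric]) auto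
   also have "\<dots> = (\<Sum>y\<in>P0. exp (A + 6) * W y * (\<Sum>p\<in>V y. 1 / real p))"
    by (simp add: sum_distrib_left)
   also have "\<dots> \<le> (\<Sum>y\<in>P0. exp (A + 6) * W y * (Cc * L / real l))"
    using W0 sumV by (intro sum_mono mult_left_mono) auto
   also have "\<dots> = (\<Sum>y\<in>P0. (exp (A + 6) * (Cc * L / real l)) * W y)"
    by (intro sum.cong refl) (simp only: mult_ac)
   also have "\<dots> = exp (A + 6) * (Cc * L / real l) * S" unfolding S_def sum_distrib_left ..
   finally have "100 / L * (\<Sum>y\<in>Pl. \<Sum>p\<in>sg y. W y) \<le> 100 / L * (exp (A + 6) * (Cc * L / real l) * S)"
    using L1' by (intro mult_left_mono) auto
   also have "\<dots> = 100 * exp (A + 6) * Cc / real l * S" using L1' by simp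
   finally show ?thesis using c1 by linarith
  qed
  have non_part: "(\<Sum>y\<in>non. W y * gfac (E y) ^ 3) \<le> Cg * (1 + Cv) * S + Cg * (\<bar>Cq\<bar> * (100 * exp (A + 6) * Cc)) * S"
  proof -
   have "(\<Sum>y\<in>non. W y * gfac (E y) ^ 3) \<le> (\<Sum>y\<in>non. Cg * (1 + Cv) * W y + Cg * (\<Sum>l\<in>R. f l * (W y * ind l y)))"
   proof (rule sum_mono)
    fix y assume y: "y \<in> non"
    then have yP: "y \<in> PP" by (simp add: non_def)
    let ?Q = "{p\<in>prime_factors (E y). real p \<le> (ln x)\<^sup>2}"
    have "(\<Sum>p\<in>?Q. f p) \<le> (\<Sum>p\<in>primes_le (real_of_int \<bar>v\<bar>) \<union> {p \<in> R. int p dvd val y}. f p)"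
    proof (rule sum_mono2)
     show "finite (primes_le (real_of_int \<bar>v\<bar>) \<union> {p \<in> R. int p dvd val y})" using finR by simp
     show "?Q \<subseteq> primes_le (real_of_int \<bar>v\<bar>) \<union> {p \<in> R. int p dvd val y}"
     proof
      fix p assume p: "p \<in> ?Q"
      then have "prime p" "p dvd E y" by (auto simp: in_prime_factors_iff)
      moreover from this have "int p dvd int (E y)" by (simp only: int_dvd_int_iff)
      then have "int p dvd val y" by (simp add: E_def)
      ultimately show "p \<in> primes_le (real_of_int \<bar>v\<bar>) \<union> {p \<in> R. int p dvd val y}"
       using p by (auto simp: R_def primes_le_iff)
     qed
     fix p assume "p \<in> primes_le (real_of_int \<bar>v\<bar>) \<union> {p \<in> R. int p dvd val y} - ?Q"
     then show "0 \<le> f p" by (intro f0) (auto simp: R_def primes_le_iff)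
    qed
    also have "\<dots> \<le> Cv + (\<Sum>p\<in>{p \<in> R. int p dvd val y}. f p)"
    proof -
     have "(\<Sum>p\<in>primes_le (real_of_int \<bar>v\<bar>) \<union> {p \<in> R. int p dvd val y}. f p)
      = (\<Sum>p\<in>primes_le (real_of_int \<bar>v\<bar>). f p) + (\<Sum>p\<in>{p \<in> R. int p dvd val y}. f p)"
      using finR by (intro sum.union_disjoint) (auto simp: R_def primes_le_iff)
     then show ?thesis by (simp add: Cv_def)
    qed
    also have "(\<Sum>p\<in>{p \<in> R. int p dvd val y}. f p) = (\<Sum>l\<in>R. f l * ind l y)"
     using finR by (intro sum.mono_neutral_cong_left) (auto simp: ind_def)
    finally have q: "(\<Sum>p\<in>?Q. f p) \<le> Cv + (\<Sum>l\<in>R. f l * ind l y)" .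
    have "gfac (E y) ^ 3 \<le> Cg * (1 + (\<Sum>p\<in>?Q. f p))"
     using Cg(2)[of x "E y"] Epos[OF yP] x16 by (simp add: f_def)
    also have "\<dots> \<le> Cg * (1 + (Cv + (\<Sum>l\<in>R. f l * ind l y)))" using q Cg by (intro mult_left_mono add_left_mono) auto
    finally have "W y * gfac (E y) ^ 3 \<le> W y * (Cg * (1 + (Cv + (\<Sum>l\<in>R. f l * ind l y))))"
     using W0 by (rule mult_left_mono)
    also have "\<dots> = Cg * (1 + Cv) * W y + Cg * (W y * (\<Sum>l\<in>R. f l * ind l y))" by (simp add: algebra_simps)
    also have "W y * (\<Sum>l\<in>R. f l * ind l y) = (\<Sum>l\<in>R. f l * (W y * ind l y))"
     by (simp add: sum_distrib_left mult_ac)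
    finally show "W y * gfac (E y) ^ 3 \<le> Cg * (1 + Cv) * W y + Cg * (\<Sum>l\<in>R. f l * (W y * ind l y))" .
   qed
   also have "\<dots> = Cg * (1 + Cv) * (\<Sum>y\<in>non. W y) + Cg * (\<Sum>y\<in>non. \<Sum>l\<in>R. f l * (W y * ind l y))"
    by (simp only: sum.distrib sum_distrib_left)
   also have "(\<Sum>y\<in>non. \<Sum>l\<in>R. f l * (W y * ind l y)) = (\<Sum>l\<in>R. \<Sum>y\<in>non. f l * (W y * ind l y))" by (rule sum.swap)
   also have "\<dots> = (\<Sum>l\<in>R. f l * (\<Sum>y\<in>non. W y * ind l y))" by (simp only: sum_distrib_left)
   also have "\<dots> \<le> (\<Sum>l\<in>R. f l * (100 * exp (A + 6) * Cc / real l * S))"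
    using class_part f0 by (intro sum_mono mult_left_mono) (auto simp: R_def primes_le_iff)
   also have "\<dots> = (\<Sum>l\<in>R. ln (real l) ^ 3 / real l ^ 2) * (100 * exp (A + 6) * Cc * S)"
    by (simp add: f_def sum_distrib_right power2_eq_square)
   also have "\<dots> \<le> \<bar>Cq\<bar> * (100 * exp (A + 6) * Cc * S)"
    using Cq[OF finR] Cc S0 by (intro mult_right_mono) auto
   also have "(\<Sum>y\<in>non. W y) \<le> S" unfolding S_def using finP0 W0 by (intro sum_mono2) (auto simp: non_def PP_def)
   finally show ?thesis using Cg Cv by (simp add: mult_left_mono mult_ac)
  qed
  have eqPP: "{(d, m) \<in> smooth_pairs w Y. card (prime_factors (d * m)) < omega_cut L \<and> a * int c * int m + v \<noteq> 0} = exc \<union> non"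
   by (auto simp: exc_def non_def PP_def P0_def val_def)
  have "(\<Sum>(d, m)\<in>{(d, m) \<in> smooth_pairs w Y. card (prime_factors (d * m)) < omega_cut L \<and> a * int c * int m + v \<noteq> 0}.
     wt \<beta> (d * m) * gfac (nat \<bar>a * int c * int m + v\<bar>) ^ 3) = (\<Sum>y\<in>exc \<union> non. W y * gfac (E y) ^ 3)"
   unfolding eqPP by (intro sum.cong refl) (auto simp: W_def E_def val_def)
  also have "\<dots> \<le> (\<Sum>y\<in>exc. W y * gfac (E y) ^ 3) + (\<Sum>y\<in>non. W y * gfac (E y) ^ 3)"
   using fins W0 gfac_pos by (intro sum_Un_le mult_nonneg_nonneg zero_le_power) (auto simp: less_imp_le)
  also have "\<dots> \<le> exp (2 * L) * tau L + (Cg * (1 + Cv) * S + Cg * (\<bar>Cq\<bar> * (100 * exp (A + 6) * Cc)) * S)"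
   by (rule add_mono[OF exc_part non_part])
  also have "\<dots> \<le> exp (2 * L) * tau L + (Cg * (1 + Cv) * (Cp * exp (2 * L) * tau L) + Cg * (\<bar>Cq\<bar> * (100 * exp (A + 6) * Cc)) * (Cp * exp (2 * L) * tau L))"
   using S Cg Cv Cc by (intro add_left_mono add_mono mult_left_mono) auto
  also have "\<dots> = C * exp (2 * L) * tau L" by (simp add: C_def algebra_simps)
  finally show "(\<Sum>(d, m)\<in>{(d, m) \<in> smooth_pairs w Y. card (prime_factors (d * m)) < omega_cut L \<and> a * int c * int m + v \<noteq> 0}.
     wt \<beta> (d * m) * gfac (nat \<bar>a * int c * int m + v\<bar>) ^ 3) \<le> C * exp (2 * L) * tau L" .
 qed
qed

section \<open>Sieve bounds for shifted primes\<close>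

abbreviation (input) cofactor_primes :: "nat \<Rightarrow> int \<Rightarrow> real \<Rightarrow> real \<Rightarrow> nat \<Rightarrow> nat set" where
 "cofactor_primes u v x t M \<equiv> {p. prime p \<and> x powr (1/2) < real p \<and> real p \<le> x \<and>
  (\<exists>r. r > 0 \<and> int u * int p + v = int (M * r) \<and> rough t r)}"

text \<open>Two forms in \<open>r\<close>: \<open>r\<close> itself, and \<open>M r - v = u p\<close>.\<close>

lemma count_cofactor_rough:
 fixes u :: nat and v :: int
 assumes "u \<ge> 1" "v \<noteq> 0"
 shows "\<exists>C x0. C > 0 \<and> (\<forall>x t M. x \<ge> x0 \<longrightarrow> M \<ge> 1 \<longrightarrow> real M \<le> x powr (3/4) \<longrightarrow> 2 \<le> t \<longrightarrow> t \<le> x powr (1/60) \<longrightarrow>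
  real (card (cofactor_primes u v x t M))
   \<le> C * (x / (ln t * ln x)) * (gfac M ^ 3 / real M))"
proof -
 define l0 where "l0 = max u (nat \<bar>v\<bar>)"
 obtain C where C: "C > 0" "\<And>(H::nat) D (E::nat) (I::nat set) (\<alpha>::nat \<Rightarrow> int) (\<beta>::nat \<Rightarrow> int) (t::nat \<Rightarrow> real) A.
  finite I \<Longrightarrow> card I \<le> 3 \<Longrightarrow> D \<ge> 2 \<Longrightarrow> D ^ 13 \<le> real H \<Longrightarrow> E > 0 \<Longrightarrow>
  (\<forall>i\<in>I. 2 \<le> t i \<and> t i \<le> D) \<Longrightarrow>
  forms_regular_outside l0 E I \<alpha> \<beta> \<Longrightarrow>
  A \<subseteq> {1..H} \<Longrightarrow>
  forms_sifted l0 I \<alpha> \<beta> t A \<Longrightarrow>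
  real (card A) \<le> C * real H * (\<Prod>i\<in>I. 1 / ln (t i)) * gfac E ^ 3"
  using linear_forms_sieve[of l0] by blast
 define k where "k = real u + real_of_int \<bar>v\<bar>"
 have k1: "k \<ge> 1" using assms by (simp add: k_def)
 let ?P = "\<lambda>x::real. x powr (1/4) - 1 \<ge> x powr (13/60) \<and> x powr (1/60) \<ge> 2 \<and> x \<ge> 3"
 have "eventually ?P at_top" by ((intro eventually_conj)?; (real_asymp | rule eventually_ge_at_top))
 then obtain x0 where x0: "\<And>x. x \<ge> x0 \<Longrightarrow> ?P x" by (auto simp: eventually_at_top_linorder)
 show ?thesis
 proof (rule exI[of _ "60 * C * k"], rule exI[of _ x0], intro conjI allI impI)
  show "60 * C * k > 0" using C k1 by simp
  fix x t :: real and M :: nat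
  assume x: "x \<ge> x0" and M: "M \<ge> 1" "real M \<le> x powr (3/4)" and t: "2 \<le> t" "t \<le> x powr (1/60)"
  have xb: "x powr (1/4) - 1 \<ge> x powr (13/60)" "x powr (1/60) \<ge> 2" "x \<ge> 3" using x0[OF x] by auto
  define D where "D = x powr (1/60)"
  define H where "H = nat \<lfloor>k * x / real M\<rfloor>"
  define S where "S = cofactor_primes u v x t M"
  define g where "g = (\<lambda>p. nat ((int u * int p + v) div int M))"
  have M0: "real M > 0" using M by simp
  have gS: "int u * int p + v = int (M * g p) \<and> g p > 0 \<and> rough t (g p)" if pS: "p \<in> S" for p
  proof -
   obtain r where r: "r > 0" "int u * int p + v = int (M * r)" "rough t r" using pS by (auto simp: S_def)
   have "g p = r" unfolding g_def r(2) using M by simp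
   then show ?thesis using r by simp
  qed
  have inj: "inj_on g S"
  proof (rule inj_onI)
   fix p q assume pq: "p \<in> S" "q \<in> S" "g p = g q"
   then have "int u * int p + v = int u * int q + v" using gS[OF pq(1)] gS[OF pq(2)] by simp
   then show "p = q" using assms by simp
  qed
  have "real (card (g ` S)) \<le> C * real H * (\<Prod>i\<in>{0::nat,1}. 1 / ln (if i = 0 then t else D)) * gfac M ^ 3"
  proof (rule C(2)[where D = D and \<alpha> = "\<lambda>i. if i = 0 then 1 else int M" and \<beta> = "\<lambda>i. if i = 0 then 0 else - v"])
   show "D \<ge> 2" using xb by (simp add: D_def)
   show "D ^ 13 \<le> real H"
   proof -
    have "x powr (1/4) * real M \<le> x powr (1/4) * x powr (3/4)" using M by (intro mult_left_mono) auto
    also have "\<dots> = x powr (1/4 + 3/4)" by (simp only: powr_add)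
    also have "\<dots> = x" using xb by simp
    also have "\<dots> \<le> k * x" using k1 xb by simp
    finally have "x powr (1/4) \<le> k * x / real M" using M0 by (simp add: le_divide_eq)
    moreover have "k * x / real M - 1 \<le> real H" unfolding H_def by linarith
    ultimately have "x powr (13/60) \<le> real H" using xb by linarith
    moreover have "D ^ 13 = x powr (13/60)" unfolding D_def using xb by (simp add: powr_realpow[symmetric] powr_powr)
    ultimately show ?thesis by simp
   qed
   show "\<forall>i\<in>{0::nat,1}. 2 \<le> (if i = 0 then t else D) \<and> (if i = 0 then t else D) \<le> D"
    using t xb by (auto simp: D_def)
   show "\<forall>l. prime l \<longrightarrow> l > l0 \<longrightarrow> \<not> l dvd M \<longrightarrow>
    (\<forall>i\<in>{0::nat,1}. \<not> int l dvd (if i = 0 then 1 else int M)) \<and>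
    (\<forall>i\<in>{0::nat,1}. \<forall>j\<in>{0::nat,1}. i \<noteq> j \<longrightarrow> \<not> int l dvd (if i = 0 then 1 else int M) * (if j = 0 then 0 else - v)
      - (if j = 0 then 1 else int M) * (if i = 0 then 0 else - v))"
   proof (intro allI impI)
    fix l assume l: "prime l" "l > l0" "\<not> l dvd M"
    have "\<not> int l dvd 1" using l(1) prime_gt_1_nat[of l] by (simp add: zdvd_not_zless)
    moreover have "\<not> int l dvd v"
    proof
     assume "int l dvd v"
     then have "int l \<le> \<bar>v\<bar>" using assms(2) dvd_imp_le_int[of v "int l"] by simp
     then show False using l(2) by (simp add: l0_def nat_less_iff)
    qed
    ultimately show "(\<forall>i\<in>{0::nat,1}. \<not> int l dvd (if i = 0 then 1 else int M)) \<and>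
     (\<forall>i\<in>{0::nat,1}. \<forall>j\<in>{0::nat,1}. i \<noteq> j \<longrightarrow> \<not> int l dvd (if i = 0 then 1 else int M) * (if j = 0 then 0 else - v)
      - (if j = 0 then 1 else int M) * (if i = 0 then 0 else - v))"
     using l(3) by auto
   qed
   show "g ` S \<subseteq> {1..H}"
   proof (rule image_subsetI)
    fix p assume p: "p \<in> S"
    have px: "real p \<le> x" using p by (simp add: S_def)
    have "real_of_int (int (M * g p)) = real_of_int (int u * int p + v)" using gS[OF p] by simp
    then have "real M * real (g p) = real u * real p + real_of_int v" by simp
    also have "\<dots> \<le> real u * x + real_of_int \<bar>v\<bar> * x"
    proof (rule add_mono)
     show "real u * real p \<le> real u * x" using px by (intro mult_left_mono) auto
     have "real_of_int v \<le> real_of_int \<bar>v\<bar> * 1" by simp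
     also have "\<dots> \<le> real_of_int \<bar>v\<bar> * x" using xb by (intro mult_left_mono) auto
     finally show "real_of_int v \<le> real_of_int \<bar>v\<bar> * x" .
    qed
    also have "\<dots> = k * x" by (simp add: k_def algebra_simps)
    finally have "real (g p) \<le> k * x / real M" using M0 by (simp add: le_divide_eq mult.commute)
    then have "g p \<le> H" unfolding H_def by (simp add: le_nat_floor)
    then show "g p \<in> {1..H}" using gS[OF p] by simp
   qed
   show "\<forall>n\<in>g ` S. \<forall>i\<in>{0::nat,1}. \<forall>l. prime l \<longrightarrow> l > l0 \<longrightarrow> real l < (if i = 0 then t else D) \<longrightarrow>
     \<not> int l dvd (if i = 0 then 1 else int M) * int n + (if i = 0 then 0 else - v)"
   proof (intro ballI allI impI)
    fix n l and i :: nat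
    assume n: "n \<in> g ` S" and i: "i \<in> {0,1}" and l: "prime l" "l > l0" "real l < (if i = 0 then t else D)"
    then obtain p where p: "p \<in> S" "n = g p" by auto
    show "\<not> int l dvd (if i = 0 then 1 else int M) * int n + (if i = 0 then 0 else - v)"
    proof (cases "i = 0")
     case True
     have "\<not> l dvd n" using gS[OF p(1)] p(2) l True by (auto simp: rough_def)
     then show ?thesis using True by simp
    next
     case False
     have "int M * int n + - v = int (u * p)" using gS[OF p(1)] p(2) by simp
     moreover have "\<not> l dvd u * p"
     proof
      assume "l dvd u * p"
      then have "l dvd u \<or> l dvd p" using l(1) by (simp add: prime_dvd_mult_iff)
      then show False
      proof
       assume "l dvd u"
       then have "l \<le> u" using assms(1) by (intro dvd_imp_le) auto
       then show False using l(2) by (simp add: l0_def)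
      next
       assume "l dvd p"
       then have "l = p" using l(1) p(1) primes_dvd_imp_eq by (auto simp: S_def)
       moreover have "D \<le> x powr (1/2)" unfolding D_def using xb by (intro powr_mono) auto
       ultimately show False using l(3) p(1) False by (simp add: S_def)
      qed
     qed
     ultimately show ?thesis using False by (simp only: if_False int_dvd_int_iff) simp
    qed
   qed
  qed (use M in auto)
  also have "(\<Prod>i\<in>{0::nat,1}. 1 / ln (if i = 0 then t else D)) = 60 / (ln t * ln x)"
   using xb by (simp add: D_def ln_powr)
  also have "C * real H * (60 / (ln t * ln x)) * gfac M ^ 3 \<le> C * (k * x / real M) * (60 / (ln t * ln x)) * gfac M ^ 3"
  proof (intro mult_right_mono mult_left_mono)
   show "real H \<le> k * x / real M" unfolding H_def using k1 xb by (intro of_nat_floor) auto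
  qed (use C(1) t xb in \<open>auto simp: less_imp_le\<close>)
  also have "\<dots> = 60 * C * k * (x / (ln t * ln x)) * (gfac M ^ 3 / real M)" by (simp add: mult_ac)
  also have "card (g ` S) = card S" using inj by (rule card_image)
  finally show "real (card (cofactor_primes u v x t M))
   \<le> 60 * C * k * (x / (ln t * ln x)) * (gfac M ^ 3 / real M)" by (simp only: S_def)
 qed
qed

lemma harmonic_sum_le: "n \<ge> 1 \<Longrightarrow> (\<Sum>k=1..n. 1 / real k) \<le> ln (real n) + 1"
proof (induction n rule: dec_induct)
 case (step n)
 have n: "real n \<ge> 1" using step by simp
 have "ln (real n / real (Suc n)) \<le> real n / real (Suc n) - 1" using n by (intro ln_le_minus_one) auto
 then have "1 / real (Suc n) \<le> ln (real (Suc n)) - ln (real n)" using n by (simp add: ln_div field_simps)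
 then show ?case using step by simp
qed simp

abbreviation (input) rough_shifted_primes :: "int \<Rightarrow> real \<Rightarrow> real \<Rightarrow> nat \<Rightarrow> nat set" where
 "rough_shifted_primes a z t d \<equiv> {n. n > 0 \<and> rough t n \<and> z < real (d * n) \<and> real (d * n) \<le> z\<^sup>2 \<and> (\<exists>q::nat. prime q \<and> int q = int (d * n) + a)}"

text \<open>Two forms in \<open>n\<close>: \<open>n\<close> itself and \<open>d n + a\<close>. The sum of \<open>1 / n\<close> over the
range of \<open>n\<close> supplies the factor \<open>ln z\<close>.\<close>

lemma sum_rough_shifted_prime_recip:
 fixes a :: int
 assumes "a \<noteq> 0"
 shows "\<exists>C z0. C > 0 \<and> (\<forall>z t d. z \<ge> z0 \<longrightarrow> d \<ge> 1 \<longrightarrow> real d \<le> sqrt z \<longrightarrow> 2 \<le> t \<longrightarrow> t \<le> z powr (1/60) \<longrightarrow>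
  (\<Sum>n\<in>rough_shifted_primes a z t d. 1 / real n)
   \<le> C * (ln z / (ln t)\<^sup>2) * gfac d ^ 3)"
proof -
 define l0 where "l0 = nat \<bar>a\<bar>"
 obtain C where C: "C > 0" "\<And>(H::nat) D (E::nat) (I::nat set) (\<alpha>::nat \<Rightarrow> int) (\<beta>::nat \<Rightarrow> int) (t::nat \<Rightarrow> real) A.
  finite I \<Longrightarrow> card I \<le> 3 \<Longrightarrow> D \<ge> 2 \<Longrightarrow> D ^ 13 \<le> real H \<Longrightarrow> E > 0 \<Longrightarrow>
  (\<forall>i\<in>I. 2 \<le> t i \<and> t i \<le> D) \<Longrightarrow>
  forms_regular_outside l0 E I \<alpha> \<beta> \<Longrightarrow>
  A \<subseteq> {1..H} \<Longrightarrow>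
  forms_sifted l0 I \<alpha> \<beta> t A \<Longrightarrow>
  real (card A) \<le> C * real H * (\<Prod>i\<in>I. 1 / ln (t i)) * gfac E ^ 3"
  using linear_forms_sieve[of l0] by blast
 let ?P = "\<lambda>z::real. z - z powr (1/60) \<ge> real_of_int \<bar>a\<bar> \<and> z powr (1/60) \<ge> 2 \<and> z \<ge> 3"
 have "eventually ?P at_top" by ((intro eventually_conj)?; (real_asymp | rule eventually_ge_at_top))
 then obtain z0 where z0: "\<And>z. z \<ge> z0 \<Longrightarrow> ?P z" by (auto simp: eventually_at_top_linorder)
 show ?thesis
 proof (rule exI[of _ "3 * C"], rule exI[of _ z0], intro conjI allI impI)
  show "3 * C > 0" using C by simp
  fix z t :: real and d :: nat
  assume z: "z \<ge> z0" and d: "d \<ge> 1" "real d \<le> sqrt z" and t: "2 \<le> t" "t \<le> z powr (1/60)"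
  have zb: "z - z powr (1/60) \<ge> real_of_int \<bar>a\<bar>" "z powr (1/60) \<ge> 2" "z \<ge> 3" using z0[OF z] by auto
  have lnz: "ln z \<ge> 1"
  proof -
   have "exp 1 \<le> z" using exp_le zb by linarith
   then show ?thesis using zb by (subst ln_ge_iff) auto
  qed
  define S where "S = rough_shifted_primes a z t d"
  define N where "N = nat \<lfloor>z\<^sup>2\<rfloor>"
  define V where "V = C * (1 / (ln t)\<^sup>2) * gfac d ^ 3"
  have V: "V > 0" using C t by (simp add: V_def)
  have z2: "z\<^sup>2 \<ge> 9" using zb power_mono[of 3 z 2] by simp
  have N: "N \<ge> 1" "real N \<le> z\<^sup>2" using z2 unfolding N_def by linarith+
  have SN: "S \<subseteq> {1..N}"
  proof
   fix n assume n: "n \<in> S"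
   have "n \<le> d * n" using d by simp
   then have "real n \<le> real (d * n)" by (simp only: of_nat_le_iff)
   also have "\<dots> \<le> z\<^sup>2" using n by (simp add: S_def)
   finally show "n \<in> {1..N}" using n by (simp add: S_def N_def le_nat_floor)
  qed
  have "(\<Sum>n\<in>S \<inter> {1..N}. 1 / real n) \<le> (\<Sum>k=1..N. V / real k)"
  proof (rule recip_sum_le)
   fix n assume n: "1 \<le> n" "n \<le> N"
   show "real (card (S \<inter> {1..n})) \<le> (\<Sum>k=1..n. V)"
   proof (cases "S \<inter> {1..n} = {}")
    case True
    then show ?thesis using V by simp
   next
    case False
    then obtain n' where n': "n' \<in> S" "n' \<le> n" by auto
    have szn: "sqrt z \<le> real n"
    proof -
     have "sqrt z * sqrt z < real d * real n'" using n' zb by (simp add: S_def)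
     also have "\<dots> \<le> sqrt z * real n'" using d by (intro mult_right_mono) auto
     finally have "sqrt z * sqrt z < sqrt z * real n'" .
     then have "sqrt z < real n'" by (rule mult_left_less_imp_less) (use zb in simp)
     then show ?thesis using n' by simp
    qed
    have "real (card (S \<inter> {1..n})) \<le> C * real n * (\<Prod>i\<in>{0::nat,1}. 1 / ln t) * gfac d ^ 3"
    proof (rule C(2)[where D = "z powr (1/60)" and \<alpha> = "\<lambda>i. if i = 0 then 1 else int d" and \<beta> = "\<lambda>i. if i = 0 then 0 else a"])
     have "(z powr (1/60)) ^ 13 = z powr (13/60)" using zb by (simp add: powr_realpow[symmetric] powr_powr)
     also have "\<dots> \<le> z powr (1/2)" using zb by (intro powr_mono) auto
     also have "\<dots> = sqrt z" using zb by (simp add: powr_half_sqrt)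
     finally show "(z powr (1/60)) ^ 13 \<le> real n" using szn by simp
     show "\<forall>l. prime l \<longrightarrow> l > l0 \<longrightarrow> \<not> l dvd d \<longrightarrow>
      (\<forall>i\<in>{0::nat,1}. \<not> int l dvd (if i = 0 then 1 else int d)) \<and>
      (\<forall>i\<in>{0::nat,1}. \<forall>j\<in>{0::nat,1}. i \<noteq> j \<longrightarrow> \<not> int l dvd (if i = 0 then 1 else int d) * (if j = 0 then 0 else a)
        - (if j = 0 then 1 else int d) * (if i = 0 then 0 else a))"
     proof (intro allI impI)
      fix l assume l: "prime l" "l > l0" "\<not> l dvd d"
      have "\<not> int l dvd 1" using l(1) prime_gt_1_nat[of l] by (simp add: zdvd_not_zless)
      moreover have "\<not> int l dvd a"
      proof
       assume "int l dvd a"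
       then have "int l \<le> \<bar>a\<bar>" using assms dvd_imp_le_int[of a "int l"] by simp
       then show False using l(2) by (simp add: l0_def nat_less_iff)
      qed
      ultimately show "(\<forall>i\<in>{0::nat,1}. \<not> int l dvd (if i = 0 then 1 else int d)) \<and>
       (\<forall>i\<in>{0::nat,1}. \<forall>j\<in>{0::nat,1}. i \<noteq> j \<longrightarrow> \<not> int l dvd (if i = 0 then 1 else int d) * (if j = 0 then 0 else a)
        - (if j = 0 then 1 else int d) * (if i = 0 then 0 else a))"
       using l(3) by auto
     qed
     show "\<forall>m\<in>S \<inter> {1..n}. \<forall>i\<in>{0::nat,1}. \<forall>l. prime l \<longrightarrow> l > l0 \<longrightarrow> real l < t \<longrightarrow>
       \<not> int l dvd (if i = 0 then 1 else int d) * int m + (if i = 0 then 0 else a)"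
     proof (intro ballI allI impI)
      fix m l and i :: nat
      assume m: "m \<in> S \<inter> {1..n}" and i: "i \<in> {0,1}" and l: "prime l" "l > l0" "real l < t"
      show "\<not> int l dvd (if i = 0 then 1 else int d) * int m + (if i = 0 then 0 else a)"
      proof (cases "i = 0")
       case True
       have "\<not> l dvd m" using m l by (auto simp: rough_def S_def)
       then show ?thesis using True by simp
      next
       case False
       obtain q :: nat where q: "prime q" "int q = int (d * m) + a" using m by (auto simp: S_def)
       have "\<not> l dvd q"
       proof
        assume "l dvd q"
        then have "l = q" using l(1) q(1) primes_dvd_imp_eq by auto
        have "real_of_int (int q) = real_of_int (int (d * m) + a)" by (simp only: q(2))
        then have "real q = real (d * m) + real_of_int a" by simp
        moreover have "real (d * m) > z" using m by (simp add: S_def)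
        ultimately have "real q > z powr (1/60)" using zb by linarith
        then show False using \<open>l = q\<close> l(3) t by simp
       qed
       then have "\<not> int l dvd int (d * m) + a" unfolding q(2)[symmetric] by (simp only: int_dvd_int_iff not_False_eq_True)
       then show ?thesis using False by simp
      qed
     qed
    qed (use d t zb in auto)
    also have "\<dots> = (\<Sum>k=1..n. V)" by (simp add: V_def power2_eq_square)
    finally show ?thesis .
   qed
  qed
  also have "\<dots> = V * (\<Sum>k=1..N. 1 / real k)" by (simp add: sum_distrib_left)
  also have "\<dots> \<le> V * (3 * ln z)"
  proof (rule mult_left_mono)
   have "ln (real N) \<le> ln (z\<^sup>2)" using N z2 by (subst ln_le_cancel_iff) linarith+
   also have "\<dots> = 2 * ln z" using zb by (subst ln_realpow) auto
   finally show "(\<Sum>k=1..N. 1 / real k) \<le> 3 * ln z" using harmonic_sum_le[OF N(1)] lnz by linarith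
  qed (use V in simp)
  also have "\<dots> = 3 * C * (ln z / (ln t)\<^sup>2) * gfac d ^ 3" by (simp add: V_def)
  also have "S \<inter> {1..N} = S" using SN by blast
  finally show "(\<Sum>n\<in>rough_shifted_primes a z t d. 1 / real n)
   \<le> 3 * C * (ln z / (ln t)\<^sup>2) * gfac d ^ 3" by (simp only: S_def)
 qed
qed

abbreviation (input) shifted_divisor_primes :: "nat \<Rightarrow> int \<Rightarrow> int \<Rightarrow> real \<Rightarrow> real \<Rightarrow> real \<Rightarrow> nat \<Rightarrow> nat \<Rightarrow> nat \<Rightarrow> nat set" where
 "shifted_divisor_primes u a v x z t d1 m1 m2 \<equiv> {p. prime p \<and> x powr (1/2) < real p \<and> real p \<le> x \<and>
  (\<exists>d2. d2 > 0 \<and> int u * int p + v = int (d1 * m1 * m2 * d2) \<and> rough t d2 \<and> z < real (d1 * d2) \<and>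
   (\<exists>q::nat. prime q \<and> int q = int (d1 * d2) + a))}"

text \<open>Three forms in \<open>d2\<close>: \<open>d2\<close>, \<open>d1 d2 + a = q\<close> and \<open>d1 m1 m2 d2 - v = u p\<close>. The last two share a root modulo \<open>l\<close>
exactly when \<open>l\<close> divides \<open>a m1 m2 + v\<close>, up to divisors of \<open>d1\<close>.\<close>

lemma count_shifted_divisor_rough:
 fixes u :: nat and a v :: int
 assumes "u \<ge> 1" "v \<noteq> 0" "a \<noteq> 0"
 shows "\<exists>C x0. C > 0 \<and> (\<forall>x z t d1 m1 m2. x \<ge> x0 \<longrightarrow> d1 \<ge> 1 \<longrightarrow> m1 \<ge> 1 \<longrightarrow> m2 \<ge> 1 \<longrightarrow> real (d1 * m1 * m2) \<le> x powr (3/4) \<longrightarrow>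
  2 \<le> t \<longrightarrow> t \<le> x powr (1/60) \<longrightarrow> x powr (1/5) \<le> z \<longrightarrow> a * int (m1 * m2) + v \<noteq> 0 \<longrightarrow>
  real (card (shifted_divisor_primes u a v x z t d1 m1 m2))
   \<le> C * (x / (ln t) ^ 3) * (gfac (d1 * m1 * m2) ^ 3 * gfac (nat \<bar>a * int (m1 * m2) + v\<bar>) ^ 3 / real (d1 * m1 * m2)))"
proof -
 define l0 where "l0 = max u (max (nat \<bar>v\<bar>) (nat \<bar>a\<bar>))"
 obtain C where C: "C > 0" "\<And>(H::nat) D (E::nat) (I::nat set) (\<alpha>::nat \<Rightarrow> int) (\<beta>::nat \<Rightarrow> int) (t::nat \<Rightarrow> real) A.
  finite I \<Longrightarrow> card I \<le> 3 \<Longrightarrow> D \<ge> 2 \<Longrightarrow> D ^ 13 \<le> real H \<Longrightarrow> E > 0 \<Longrightarrow>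
  (\<forall>i\<in>I. 2 \<le> t i \<and> t i \<le> D) \<Longrightarrow>
  forms_regular_outside l0 E I \<alpha> \<beta> \<Longrightarrow>
  A \<subseteq> {1..H} \<Longrightarrow>
  forms_sifted l0 I \<alpha> \<beta> t A \<Longrightarrow>
  real (card A) \<le> C * real H * (\<Prod>i\<in>I. 1 / ln (t i)) * gfac E ^ 3"
  using linear_forms_sieve[of l0] by blast
 define k where "k = real u + real_of_int \<bar>v\<bar>"
 have k1: "k \<ge> 1" using assms by (simp add: k_def)
 let ?P = "\<lambda>x::real. x powr (1/4) - 1 \<ge> x powr (13/60) \<and> x powr (1/60) \<ge> 2 \<and> x \<ge> 3
   \<and> x powr (1/5) - x powr (1/60) \<ge> real_of_int \<bar>a\<bar>"
 have "eventually ?P at_top" by ((intro eventually_conj)?; (real_asymp | rule eventually_ge_at_top))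
 then obtain x0 where x0: "\<And>x. x \<ge> x0 \<Longrightarrow> ?P x" by (auto simp: eventually_at_top_linorder)
 show ?thesis
 proof (rule exI[of _ "C * k"], rule exI[of _ x0], intro conjI allI impI)
  show "C * k > 0" using C k1 by simp
  fix x z t :: real and d1 m1 m2 :: nat
  assume x: "x \<ge> x0" and dm: "d1 \<ge> 1" "m1 \<ge> 1" "m2 \<ge> 1" and Mx: "real (d1 * m1 * m2) \<le> x powr (3/4)"
   and t: "2 \<le> t" "t \<le> x powr (1/60)" and z: "x powr (1/5) \<le> z" and nz: "a * int (m1 * m2) + v \<noteq> 0"
  have xb: "x powr (1/4) - 1 \<ge> x powr (13/60)" "x powr (1/60) \<ge> 2" "x \<ge> 3" "x powr (1/5) - x powr (1/60) \<ge> real_of_int \<bar>a\<bar>"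
   using x0[OF x] by auto
  define M where "M = d1 * m1 * m2"
  have M: "M \<ge> 1" "real M \<le> x powr (3/4)" using dm Mx by (auto simp: M_def)
  define N where "N = nat \<bar>a * int (m1 * m2) + v\<bar>"
  have N0: "N > 0" using nz by (simp add: N_def)
  define D where "D = x powr (1/60)"
  define H where "H = nat \<lfloor>k * x / real M\<rfloor>"
  define S where "S = shifted_divisor_primes u a v x z t d1 m1 m2"
  define g where "g = (\<lambda>p. nat ((int u * int p + v) div int M))"
  have M0: "real M > 0" using M by simp
  have gS: "int u * int p + v = int (M * g p) \<and> g p > 0 \<and> rough t (g p) \<and> z < real (d1 * g p) \<and> (\<exists>q::nat. prime q \<and> int q = int (d1 * g p) + a)"
   if pS: "p \<in> S" for p
  proof -
   have "\<exists>r. r > 0 \<and> int u * int p + v = int (M * r) \<and> rough t r \<and> z < real (d1 * r) \<and> (\<exists>q::nat. prime q \<and> int q = int (d1 * r) + a)"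
    using pS by (simp only: S_def M_def mem_Collect_eq)
   then obtain r where r: "r > 0" "int u * int p + v = int (M * r)" "rough t r" "z < real (d1 * r)" "\<exists>q::nat. prime q \<and> int q = int (d1 * r) + a"
    by blast
   have "g p = r" unfolding g_def r(2) using M by simp
   then show ?thesis using r by simp
  qed
  have inj: "inj_on g S"
  proof (rule inj_onI)
   fix p q assume pq: "p \<in> S" "q \<in> S" "g p = g q"
   then have "int u * int p + v = int u * int q + v" using gS[OF pq(1)] gS[OF pq(2)] by simp
   then show "p = q" using assms by simp
  qed
  let ?\<alpha> = "\<lambda>i. if i = 0 then 1 else if i = (1::nat) then int d1 else int M"
  let ?\<beta> = "\<lambda>i. if i = 0 then 0 else if i = (1::nat) then a else - v"
  have "real (card (g ` S)) \<le> C * real H * (\<Prod>i\<in>{0::nat,1,2}. 1 / ln t) * gfac (M * N) ^ 3"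
  proof (rule C(2)[where D = D and \<alpha> = ?\<alpha> and \<beta> = ?\<beta>])
   show "D \<ge> 2" using xb by (simp add: D_def)
   show "D ^ 13 \<le> real H"
   proof -
    have "x powr (1/4) * real M \<le> x powr (1/4) * x powr (3/4)" using M by (intro mult_left_mono) auto
    also have "\<dots> = x powr (1/4 + 3/4)" by (simp only: powr_add)
    also have "\<dots> = x" using xb by simp
    also have "\<dots> \<le> k * x" using k1 xb by simp
    finally have "x powr (1/4) \<le> k * x / real M" using M0 by (simp add: le_divide_eq)
    moreover have "k * x / real M - 1 \<le> real H" unfolding H_def by linarith
    ultimately have "x powr (13/60) \<le> real H" using xb by linarith
    moreover have "D ^ 13 = x powr (13/60)" unfolding D_def using xb by (simp add: powr_realpow[symmetric] powr_powr)
    ultimately show ?thesis by simp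
   qed
   show "\<forall>l. prime l \<longrightarrow> l > l0 \<longrightarrow> \<not> l dvd M * N \<longrightarrow>
    (\<forall>i\<in>{0::nat,1,2}. \<not> int l dvd ?\<alpha> i) \<and>
    (\<forall>i\<in>{0::nat,1,2}. \<forall>j\<in>{0::nat,1,2}. i \<noteq> j \<longrightarrow> \<not> int l dvd ?\<alpha> i * ?\<beta> j - ?\<alpha> j * ?\<beta> i)"
   proof (intro allI impI)
    fix l assume l: "prime l" "l > l0" "\<not> l dvd M * N"
    have pl: "prime (int l)" using l(1) by simp
    have lM: "\<not> int l dvd int M" using l(3) by (auto simp only: int_dvd_int_iff dvd_mult2)
    have lN: "\<not> int l dvd a * int (m1 * m2) + v"
    proof
     assume "int l dvd a * int (m1 * m2) + v"
     then have "int l dvd int N" by (simp add: N_def)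
     then have "l dvd N" by (simp only: int_dvd_int_iff)
     then show False using l(3) by simp
    qed
    have ld1: "\<not> int l dvd int d1" using lM by (auto simp: M_def mult.assoc)
    have l1: "\<not> int l dvd 1" using l(1) prime_gt_1_nat[of l] by (simp add: zdvd_not_zless)
    have lv: "\<not> int l dvd v"
    proof
     assume "int l dvd v"
     then have "int l \<le> \<bar>v\<bar>" using assms(2) dvd_imp_le_int[of v "int l"] by simp
     then show False using l(2) by (simp add: l0_def nat_less_iff)
    qed
    have la: "\<not> int l dvd a"
    proof
     assume "int l dvd a"
     then have "int l \<le> \<bar>a\<bar>" using assms(3) dvd_imp_le_int[of a "int l"] by simp
     then show False using l(2) by (simp add: l0_def nat_less_iff)
    qed
    have "int d1 * (- v) - int M * a = - (int d1 * (a * int (m1 * m2) + v))" by (simp add: M_def algebra_simps)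
    then have e1: "\<not> int l dvd int d1 * (- v) - int M * a"
     using ld1 lN pl by (simp only: dvd_minus_iff prime_dvd_mult_iff) simp
    have "int M * a - int d1 * (- v) = int d1 * (a * int (m1 * m2) + v)" by (simp add: M_def algebra_simps)
    then have e2: "\<not> int l dvd int M * a - int d1 * (- v)"
     using ld1 lN pl by (simp only: prime_dvd_mult_iff) simp
    have "\<not> int l dvd ?\<alpha> i" if "i \<in> {0::nat,1,2}" for i using that l1 ld1 lM by auto
    moreover have "\<not> int l dvd ?\<alpha> i * ?\<beta> j - ?\<alpha> j * ?\<beta> i" if ij: "i \<in> {0::nat,1,2}" "j \<in> {0::nat,1,2}" "i \<noteq> j" for i j
    proof -
     consider "i = 0" "j = 1" | "i = 0" "j = 2" | "i = 1" "j = 0" | "i = 1" "j = 2" | "i = 2" "j = 0" | "i = 2" "j = 1"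
      using ij by blast
     then show ?thesis
     proof cases
      case 4
      then show ?thesis using e1 by (simp only: refl if_True if_False) simp
     next
      case 6
      then show ?thesis using e2 by (simp only: refl if_True if_False) simp
     qed (use la lv in simp_all)
    qed
    ultimately show "(\<forall>i\<in>{0::nat,1,2}. \<not> int l dvd ?\<alpha> i) \<and>
     (\<forall>i\<in>{0::nat,1,2}. \<forall>j\<in>{0::nat,1,2}. i \<noteq> j \<longrightarrow> \<not> int l dvd ?\<alpha> i * ?\<beta> j - ?\<alpha> j * ?\<beta> i)" by blast
   qed
   show "g ` S \<subseteq> {1..H}"
   proof (rule image_subsetI)
    fix p assume p: "p \<in> S"
    have px: "real p \<le> x" using p by (simp add: S_def)
    have "real_of_int (int (M * g p)) = real_of_int (int u * int p + v)" using gS[OF p] by simp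
    then have "real M * real (g p) = real u * real p + real_of_int v" by simp
    also have "\<dots> \<le> real u * x + real_of_int \<bar>v\<bar> * x"
    proof (rule add_mono)
     show "real u * real p \<le> real u * x" using px by (intro mult_left_mono) auto
     have "real_of_int v \<le> real_of_int \<bar>v\<bar> * 1" by simp
     also have "\<dots> \<le> real_of_int \<bar>v\<bar> * x" using xb by (intro mult_left_mono) auto
     finally show "real_of_int v \<le> real_of_int \<bar>v\<bar> * x" .
    qed
    also have "\<dots> = k * x" by (simp add: k_def algebra_simps)
    finally have "real (g p) \<le> k * x / real M" using M0 by (simp add: le_divide_eq mult.commute)
    then have "g p \<le> H" unfolding H_def by (simp add: le_nat_floor)
    then show "g p \<in> {1..H}" using gS[OF p] by simp
   qed
   show "\<forall>n\<in>g ` S. \<forall>i\<in>{0::nat,1,2}. \<forall>l. prime l \<longrightarrow> l > l0 \<longrightarrow> real l < t \<longrightarrow> \<not> int l dvd ?\<alpha> i * int n + ?\<beta> i"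
   proof (intro ballI allI impI)
    fix n l and i :: nat
    assume n: "n \<in> g ` S" and i: "i \<in> {0,1,2}" and l: "prime l" "l > l0" "real l < t"
    then obtain p where p: "p \<in> S" "n = g p" by auto
    have lD: "real l < D" using l(3) t by (simp add: D_def)
    consider "i = 0" | "i = 1" | "i = 2" using i by blast
    then show "\<not> int l dvd ?\<alpha> i * int n + ?\<beta> i"
    proof cases
     case 1
     have "\<not> l dvd n" using gS[OF p(1)] p(2) l by (auto simp: rough_def)
     then show ?thesis using 1 by simp
    next
     case 2
     obtain q :: nat where q: "prime q" "int q = int (d1 * g p) + a" and zq: "z < real (d1 * g p)" using gS[OF p(1)] by blast
     have "\<not> l dvd q"
     proof
      assume "l dvd q"
      then have "l = q" using l(1) q(1) primes_dvd_imp_eq by auto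
      have "real_of_int (int q) = real_of_int (int (d1 * g p) + a)" by (simp only: q(2))
      then have "real q = real (d1 * g p) + real_of_int a" by simp
      then have "real q > x powr (1/60)" using zq z xb by linarith
      then show False using \<open>l = q\<close> lD by (simp add: D_def)
     qed
     then have "\<not> int l dvd int (d1 * g p) + a" unfolding q(2)[symmetric] by (simp only: int_dvd_int_iff not_False_eq_True)
     then show ?thesis using 2 p(2) by simp
    next
     case 3
     have "int M * int n + - v = int (u * p)" using gS[OF p(1)] p(2) by simp
     moreover have "\<not> l dvd u * p"
     proof
      assume "l dvd u * p"
      then have "l dvd u \<or> l dvd p" using l(1) by (simp add: prime_dvd_mult_iff)
      then show False
      proof
       assume "l dvd u"
       then have "l \<le> u" using assms(1) by (intro dvd_imp_le) auto
       then show False using l(2) by (simp add: l0_def)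
      next
       assume "l dvd p"
       then have "l = p" using l(1) p(1) primes_dvd_imp_eq by (auto simp: S_def)
       moreover have "D \<le> x powr (1/2)" unfolding D_def using xb by (intro powr_mono) auto
       ultimately show False using lD p(1) by (simp add: S_def)
      qed
     qed
     ultimately have "\<not> int l dvd int M * int n + - v" by (simp only: int_dvd_int_iff not_False_eq_True)
     then show ?thesis using 3 by simp
    qed
   qed
  qed (use M N0 t in \<open>auto simp: D_def\<close>)
  also have "(\<Prod>i\<in>{0::nat,1,2}. 1 / ln t) = 1 / (ln t) ^ 3" by (simp add: power3_eq_cube)
  also have "C * real H * (1 / (ln t) ^ 3) * gfac (M * N) ^ 3 \<le> C * (k * x / real M) * (1 / (ln t) ^ 3) * (gfac M ^ 3 * gfac N ^ 3)"
  proof (intro mult_mono mult_left_mono mult_nonneg_nonneg)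
   show "real H \<le> k * x / real M" unfolding H_def using k1 xb by (intro of_nat_floor) auto
   have "gfac (M * N) ^ 3 \<le> (gfac M * gfac N) ^ 3"
    using M N0 by (intro power_mono gfac_mult_le) (auto simp: less_imp_le)
   then show "gfac (M * N) ^ 3 \<le> gfac M ^ 3 * gfac N ^ 3" by (simp only: power_mult_distrib)
  qed (use C(1) t xb k1 in \<open>auto simp: less_imp_le\<close>)
  also have "\<dots> = C * k * (x / (ln t) ^ 3) * (gfac M ^ 3 * gfac N ^ 3 / real M)" by (simp add: mult_ac)
  also have "card (g ` S) = card S" using inj by (rule card_image)
  finally show "real (card (shifted_divisor_primes u a v x z t d1 m1 m2))
   \<le> C * k * (x / (ln t) ^ 3) * (gfac (d1 * m1 * m2) ^ 3 * gfac (nat \<bar>a * int (m1 * m2) + v\<bar>) ^ 3 / real (d1 * m1 * m2))"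
   by (simp only: S_def M_def N_def)
 qed
qed

lemma wt_zero: "wt 0 n = gfac n ^ 6 / real n"
 by (cases "n = 0") (simp_all add: wt_def powr_minus_divide)

lemma gfac_cube_div_le_wt: "gfac n ^ 3 / real n \<le> wt 0 n"
 unfolding wt_zero using gfac_ge_1[of n] by (intro divide_right_mono power_increasing) auto

text \<open>Rankin's trick.\<close>

lemma wt_rankin:
 assumes "n > 0" "0 < y" "y \<le> real n" "\<beta> \<ge> 0"
 shows "wt 0 n \<le> y powr (- \<beta>) * wt \<beta> n"
proof -
 have "real n powr (0 - 1) = real n powr (- \<beta>) * real n powr (\<beta> - 1)"
  by (simp add: powr_add[symmetric])
 also have "\<dots> \<le> y powr (- \<beta>) * real n powr (\<beta> - 1)"
  using assms by (intro mult_right_mono powr_mono2') auto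
 finally have "gfac n ^ 6 * real n powr (0 - 1) \<le> gfac n ^ 6 * (y powr (- \<beta>) * real n powr (\<beta> - 1))"
  by (intro mult_left_mono) (auto simp: less_imp_le)
 then show ?thesis by (simp add: wt_def mult_ac)
qed

lemma rough_dvd: "rough t n \<Longrightarrow> m dvd n \<Longrightarrow> rough t m"
 unfolding rough_def using dvd_trans by blast

lemma gfac_cube_rough_le:
 assumes "n > 0" "t \<ge> 2" "rough t n" "ln (real n) \<le> c * ln t"
 shows "gfac n ^ 3 \<le> exp (3 * c)"
proof -
 have "gfac n \<le> exp (ln (real n) / ln t)"
  using assms by (intro gfac_rough_le) (auto simp: rough_def)
 also have "\<dots> \<le> exp c" using assms by (simp add: divide_le_eq)
 finally have "gfac n ^ 3 \<le> exp c ^ 3" by (intro power_mono) (auto simp: less_imp_le)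
 then show ?thesis by (simp add: exp_of_nat_mult[symmetric])
qed

section \<open>Integers with a smooth divisor\<close>

definition shifted_primes :: "nat \<Rightarrow> int \<Rightarrow> real \<Rightarrow> nat set" where
 "shifted_primes u v x = {p. prime p \<and> x powr (1/2) < real p \<and> real p \<le> x \<and> int u * int p + v > 0}"

lemma finite_shifted_primes [simp]: "finite (shifted_primes u v x)"
 by (rule finite_subset[OF _ finite_primes_le[of x]]) (auto simp: shifted_primes_def primes_le_iff)

abbreviation (input) tau_large :: "real \<Rightarrow> bool" where
 "tau_large z \<equiv> z \<ge> 16 \<and> ln (ln z) \<ge> 1 \<and> tau (ln (ln z)) \<ge> 1 / ln z \<and> tau (ln (ln z)) \<ge> z powr (-1/32)"

text \<open>Contributions with a larger saving, such as those of small primes \<open>p\<close>, are absorbed by these bounds.\<close>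

lemma tau_lower:
 "\<exists>z0. \<forall>z\<ge>z0. tau_large z"
proof -
 let ?P = "\<lambda>z::real. z \<ge> 16 \<and> ln (ln z) \<ge> 1 \<and> 1 / ln z \<ge> z powr (-1/32) \<and> exp (- (3/10) * ln (ln z)) / sqrt (ln (ln z)) \<ge> 1 / ln z"
 have "eventually ?P at_top" by ((intro eventually_conj)?; (real_asymp | rule eventually_ge_at_top))
 then obtain z0 where z0: "\<And>z. z \<ge> z0 \<Longrightarrow> ?P z" by (auto simp: eventually_at_top_linorder)
 show ?thesis
 proof (intro exI[of _ z0] allI impI)
  fix z assume z: "z \<ge> z0"
  note zz = z0[OF z]
  have "- (3/10) * ln (ln z) \<le> - eta0 * ln (ln z)"
  proof -
   have "ln (ln z) \<ge> 0" using zz by linarith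
   from mult_right_mono[OF eta0_le this] show ?thesis by linarith
  qed
  then have "exp (- (3/10) * ln (ln z)) / sqrt (ln (ln z)) \<le> tau (ln (ln z))"
   unfolding tau_def using zz by (intro divide_right_mono real_sqrt_ge_zero order_trans[OF zero_le_one]) (simp_all only: exp_le_cancel_iff)
  then show "tau_large z"
   using zz by linarith
 qed
qed

abbreviation (input) smooth_divisor_primes :: "nat \<Rightarrow> int \<Rightarrow> real \<Rightarrow> real \<Rightarrow> real \<Rightarrow> nat set" where
 "smooth_divisor_primes u v x z t0 \<equiv> {p \<in> shifted_primes u v x. \<exists>M r. int u * int p + v = int (M * r) \<and>
  z powr (1/8) < real M \<and> real M \<le> x powr (3/4) \<and> prime_factors M \<subseteq> primes_le t0}"

text \<open>Integers composed of primes up to a constant \<open>t0\<close> are so sparse that Rankin's trick with \<open>\<beta> = 1/4\<close> saves a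
power of \<open>z\<close>.\<close>

lemma count_smooth_divisor:
 fixes u :: nat and v :: int
 assumes "u \<ge> 1" "v \<noteq> 0" "t0 \<ge> 2"
 shows "\<exists>C z0. C > 0 \<and> (\<forall>x z. z \<ge> z0 \<longrightarrow> x \<ge> z0 \<longrightarrow>
  real (card (smooth_divisor_primes u v x z t0)) \<le> C * (x / ln x * tau (ln (ln z))))"
proof -
 obtain C x0 where C: "C > 0" "\<And>x t M. x \<ge> x0 \<Longrightarrow> M \<ge> 1 \<Longrightarrow> real M \<le> x powr (3/4) \<Longrightarrow> 2 \<le> t \<Longrightarrow> t \<le> x powr (1/60) \<Longrightarrow>
  real (card (cofactor_primes u v x t M))
   \<le> C * (x / (ln t * ln x)) * (gfac M ^ 3 / real M)"
  using count_cofactor_rough[OF assms(1,2)] by blast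
 obtain Cs where Cs: "Cs \<ge> 0" "\<And>w \<beta> Y L K. w \<ge> 2 \<Longrightarrow> 0 \<le> \<beta> \<Longrightarrow> \<beta> \<le> 1/4 \<Longrightarrow> \<beta> * ln w \<le> \<bar>ln t0\<bar> \<Longrightarrow> ln (ln w) \<le> L \<Longrightarrow>
  (\<exists>N. (\<Sum>m\<in>smooth_many w Y K. wt \<beta> m) \<le> (\<Sum>k\<in>{K..N}. (L + Cs) ^ k / fact k))"
  using sum_smooth[of "\<bar>ln t0\<bar>"] by auto
 obtain z1 where z1: "\<And>z. z \<ge> z1 \<Longrightarrow> tau_large z"
  using tau_lower by auto
 let ?P = "\<lambda>x::real. x powr (1/60) \<ge> 2"
 have "eventually ?P at_top" by ((intro eventually_conj)?; (real_asymp | rule eventually_ge_at_top))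
 then obtain x1 where x1: "\<And>x. x \<ge> x1 \<Longrightarrow> ?P x" by (auto simp: eventually_at_top_linorder)
 define L where "L = \<bar>ln (ln t0)\<bar>"
 define C1 where "C1 = C / ln 2 * exp (L + Cs)"
 show ?thesis
 proof (rule exI[of _ C1], rule exI[of _ "max (max z1 x0) x1"], intro conjI allI impI)
  show "C1 > 0" using C by (simp add: C1_def)
  fix x z :: real assume z: "z \<ge> max (max z1 x0) x1" and x: "x \<ge> max (max z1 x0) x1"
  have zb: "z \<ge> 16" "tau (ln (ln z)) \<ge> z powr (-1/32)" using z1[of z] z by auto
  have xb: "x \<ge> 16" "x \<ge> x0" "x powr (1/60) \<ge> 2" using z1[of x] x x1[of x] by auto
  define Ms where "Ms = {M \<in> smooth t0 (x powr (3/4)). z powr (1/8) < real M}"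
  define B where "B = (\<lambda>M. cofactor_primes u v x 2 M)"
  have finMs: "finite Ms" by (simp add: Ms_def)
  have finB: "finite (B M)" for M
   by (rule finite_subset[OF _ finite_primes_le[of x]]) (auto simp: B_def primes_le_iff)
  have "smooth_divisor_primes u v x z t0 \<subseteq> (\<Union>M\<in>Ms. B M)"
  proof
   fix p assume p: "p \<in> smooth_divisor_primes u v x z t0"
   then obtain M r where Mr: "int u * int p + v = int (M * r)" "z powr (1/8) < real M" "real M \<le> x powr (3/4)" "prime_factors M \<subseteq> primes_le t0"
    by blast
   have ps: "p \<in> shifted_primes u v x" using p by simp
   have "int (M * r) > 0" using ps unfolding shifted_primes_def Mr(1)[symmetric] by blast
   then have pos: "M * r > 0" by (simp only: of_nat_0_less_iff)
   have "rough 2 r" unfolding rough_def using prime_ge_2_nat by force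
   then have "p \<in> B M" using ps Mr(1) pos by (auto simp: B_def shifted_primes_def)
   moreover have "M \<in> Ms" using Mr pos by (simp add: Ms_def smooth_def)
   ultimately show "p \<in> (\<Union>M\<in>Ms. B M)" by blast
  qed
  then have "card (smooth_divisor_primes u v x z t0) \<le> card (\<Union>M\<in>Ms. B M)" using finMs finB by (intro card_mono) auto
  also have "\<dots> \<le> (\<Sum>M\<in>Ms. card (B M))" using finMs by (rule card_UN_le)
  finally have "real (card (smooth_divisor_primes u v x z t0)) \<le> (\<Sum>M\<in>Ms. real (card (B M)))"
   using of_nat_mono by fastforce
  also have "\<dots> \<le> (\<Sum>M\<in>Ms. C * (x / (ln 2 * ln x)) * (z powr (-1/32) * wt (1/4) M))"
  proof (rule sum_mono)
   fix M assume M: "M \<in> Ms"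
   then have M1: "M \<ge> 1" "real M \<le> x powr (3/4)" "z powr (1/8) \<le> real M" by (auto simp: Ms_def smooth_def)
   have "real (card (B M)) \<le> C * (x / (ln 2 * ln x)) * (gfac M ^ 3 / real M)"
    unfolding B_def using xb M1 by (intro C(2)) auto
   also have "\<dots> \<le> C * (x / (ln 2 * ln x)) * (z powr (-1/32) * wt (1/4) M)"
   proof (rule mult_left_mono)
    have "gfac M ^ 3 / real M \<le> wt 0 M" by (rule gfac_cube_div_le_wt)
    also have "\<dots> \<le> (z powr (1/8)) powr (- (1/4)) * wt (1/4) M" using M1 zb by (intro wt_rankin) auto
    also have "(z powr (1/8)) powr (- (1/4)) = z powr (-1/32)" by (simp add: powr_powr)
    finally show "gfac M ^ 3 / real M \<le> z powr (-1/32) * wt (1/4) M" .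
   qed (use C(1) xb in auto)
   finally show "real (card (B M)) \<le> C * (x / (ln 2 * ln x)) * (z powr (-1/32) * wt (1/4) M)" .
  qed
  also have "\<dots> = C * (x / (ln 2 * ln x)) * (z powr (-1/32) * (\<Sum>M\<in>Ms. wt (1/4) M))"
   by (simp only: sum_distrib_left)
  also have "\<dots> \<le> C * (x / (ln 2 * ln x)) * (tau (ln (ln z)) * exp (L + Cs))"
  proof (intro mult_left_mono mult_mono)
   have lt: "ln t0 > 0" using assms(3) by simp
   have "1/4 * ln t0 \<le> \<bar>ln t0\<bar>" using lt by simp
   then obtain N where N: "(\<Sum>m\<in>{m \<in> smooth t0 (x powr (3/4)). card (prime_factors m) \<ge> 0}. wt (1/4) m) \<le> (\<Sum>k\<in>{0..N}. (L + Cs) ^ k / fact k)"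
    using Cs(2)[of t0 "1/4" L "x powr (3/4)" 0] assms(3) abs_ge_self[of "ln (ln t0)"] unfolding L_def by auto
   have "(\<Sum>M\<in>Ms. wt (1/4) M) \<le> (\<Sum>m\<in>{m \<in> smooth t0 (x powr (3/4)). card (prime_factors m) \<ge> 0}. wt (1/4) m)"
    by (intro sum_mono2 wt_nonneg) (auto simp: Ms_def)
   also note N
   also have "(\<Sum>k\<in>{0..N}. (L + Cs) ^ k / fact k) \<le> exp (L + Cs)" using Cs(1) by (intro sum_power_fact_le_exp) (auto simp: L_def)
   finally show "(\<Sum>M\<in>Ms. wt (1/4) M) \<le> exp (L + Cs)" .
  qed (use zb xb C(1) in \<open>auto intro!: sum_nonneg wt_nonneg order_trans[OF _ zb(2)]\<close>)
  also have "\<dots> = C1 * (x / ln x * tau (ln (ln z)))" by (simp add: C1_def)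
  finally show "real (card (smooth_divisor_primes u v x z t0)) \<le> C1 * (x / ln x * tau (ln (ln z)))" .
 qed
qed

section \<open>Shifted primes with prescribed smooth parts of the divisor and the codivisor\<close>

text \<open>The average of the correlation factor over the rough part \<open>m2\<close> of the codivisor. It enters only when \<open>d\<close> can
exceed \<open>sqrt x\<close>, hence the condition on \<open>z\<close>.\<close>

definition shift_average :: "int \<Rightarrow> int \<Rightarrow> real \<Rightarrow> real \<Rightarrow> real \<Rightarrow> nat \<Rightarrow> real" where
 "shift_average a v x z t m = (if x powr (1/5) \<le> z then
  (\<Sum>m2\<in>{m2. m2 > 0 \<and> real m2 \<le> x \<and> rough t m2}. (if a * int (m * m2) + v \<noteq> 0 then gfac (nat \<bar>a * int (m * m2) + v\<bar>) ^ 3 / real m2 else 0)) else 0)"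

lemma shift_average_nonneg: "shift_average a v x z t m \<ge> 0"
 unfolding shift_average_def by (auto intro!: sum_nonneg simp: less_imp_le)

text \<open>The primes for which the divisor \<open>d1 d2\<close> and the codivisor \<open>m1 m2\<close> have the smooth parts \<open>d1\<close> and \<open>m1\<close>.\<close>

definition split_set :: "nat \<Rightarrow> int \<Rightarrow> int \<Rightarrow> real \<Rightarrow> real \<Rightarrow> real \<Rightarrow> nat \<Rightarrow> nat \<Rightarrow> nat set" where
 "split_set u a v x z t d1 m1 = {p \<in> shifted_primes u v x. \<exists>d2 m2. d2 > 0 \<and> m2 > 0 \<and> int u * int p + v = int (d1 * m1 * d2 * m2)
  \<and> rough t d2 \<and> rough t m2 \<and> z < real (d1 * d2) \<and> real (d1 * d2) \<le> z\<^sup>2 \<and> (\<exists>q::nat. prime q \<and> int q = int (d1 * d2) + a)}"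

lemma gfac_cube_mult_le: "m > 0 \<Longrightarrow> n > 0 \<Longrightarrow> gfac (m * n) ^ 3 \<le> gfac m ^ 3 * gfac n ^ 3"
proof -
 assume "m > 0" "n > 0"
 then have "gfac (m * n) ^ 3 \<le> (gfac m * gfac n) ^ 3" by (intro power_mono gfac_mult_le) (auto simp: less_imp_le)
 then show ?thesis by (simp only: power_mult_distrib)
qed

text \<open>If the divisor \<open>d = d1 d2\<close> is at most \<open>x powr (1/2)\<close>, then \<open>d2\<close> is fixed and the codivisor is
 sieved; otherwise the rough part \<open>m2\<close> of the codivisor is fixed and \<open>d2\<close> is sieved.\<close>

lemma card_split_set_le:
 fixes u :: nat and a v :: int
 assumes "u \<ge> 1" "v \<noteq> 0" "a \<noteq> 0" "v \<noteq> - a * int u"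
 shows "\<exists>C z0. C > 0 \<and> (\<forall>x z t d1 m1. z \<ge> z0 \<longrightarrow> x \<ge> 1 \<longrightarrow> z \<le> x powr (11/10) \<longrightarrow> d1 \<ge> 1 \<longrightarrow> m1 \<ge> 1 \<longrightarrow> real (d1 * m1) \<le> z powr (1/5) \<longrightarrow>
  2 \<le> t \<longrightarrow> t \<le> z powr (1/100) \<longrightarrow>
  real (card (split_set u a v x z t d1 m1))
   \<le> C * (x / (ln x * (ln z)\<^sup>2)) * exp (16 * (ln z / ln t)) * (wt 0 (d1 * m1) * (1 + shift_average a v x z t m1)))"
proof -
 obtain C1 x1 where C1: "C1 > 0" "\<And>x t M. x \<ge> x1 \<Longrightarrow> M \<ge> 1 \<Longrightarrow> real M \<le> x powr (3/4) \<Longrightarrow> 2 \<le> t \<Longrightarrow> t \<le> x powr (1/60) \<Longrightarrow>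
  real (card (cofactor_primes u v x t M))
   \<le> C1 * (x / (ln t * ln x)) * (gfac M ^ 3 / real M)"
  using count_cofactor_rough[OF assms(1,2)] by blast
 obtain C2 z2 where C2: "C2 > 0" "\<And>z t d. z \<ge> z2 \<Longrightarrow> d \<ge> 1 \<Longrightarrow> real d \<le> sqrt z \<Longrightarrow> 2 \<le> t \<Longrightarrow> t \<le> z powr (1/60) \<Longrightarrow>
  (\<Sum>n\<in>rough_shifted_primes a z t d. 1 / real n)
   \<le> C2 * (ln z / (ln t)\<^sup>2) * gfac d ^ 3"
  using sum_rough_shifted_prime_recip[OF assms(3)] by blast
 obtain C3 x3 where C3: "C3 > 0" "\<And>x z t d1 m1 m2. x \<ge> x3 \<Longrightarrow> d1 \<ge> 1 \<Longrightarrow> m1 \<ge> 1 \<Longrightarrow> m2 \<ge> 1 \<Longrightarrow> real (d1 * m1 * m2) \<le> x powr (3/4) \<Longrightarrow>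
  2 \<le> t \<Longrightarrow> t \<le> x powr (1/60) \<Longrightarrow> x powr (1/5) \<le> z \<Longrightarrow> a * int (m1 * m2) + v \<noteq> 0 \<Longrightarrow>
  real (card (shifted_divisor_primes u a v x z t d1 m1 m2))
   \<le> C3 * (x / (ln t) ^ 3) * (gfac (d1 * m1 * m2) ^ 3 * gfac (nat \<bar>a * int (m1 * m2) + v\<bar>) ^ 3 / real (d1 * m1 * m2))"
  using count_shifted_divisor_rough[OF assms(1,2,3)] by blast
 define k where "k = real u + real_of_int \<bar>v\<bar>"
 have k1: "k \<ge> 1" using assms by (simp add: k_def)
 let ?P = "\<lambda>x::real. x powr (3/4) / x powr (18/25) \<ge> k \<and> x powr (1/2) \<ge> k \<and> x \<ge> 3"
 have "eventually ?P at_top" by ((intro eventually_conj)?; (real_asymp | rule eventually_ge_at_top))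
 then obtain x4 where x4: "\<And>x. x \<ge> x4 \<Longrightarrow> ?P x" by (auto simp: eventually_at_top_linorder)
 define X where "X = max (max x1 x3) (max x4 3)"
 define z0 where "z0 = max (max z2 (X powr 2)) (max 3 (real u + real_of_int \<bar>a\<bar> + 1))"
 define C where "C = 27 * C1 * C2 + 135 * C3"
 show ?thesis
 proof (rule exI[of _ C], rule exI[of _ z0], intro conjI allI impI)
  show "C > 0" using C1 C2 C3 by (auto simp: C_def intro!: add_pos_pos)
  fix x z t :: real and d1 m1 :: nat
  assume z: "z \<ge> z0" "z \<le> x powr (11/10)" and x1': "x \<ge> 1" and dm: "d1 \<ge> 1" "m1 \<ge> 1" "real (d1 * m1) \<le> z powr (1/5)" and t: "2 \<le> t" "t \<le> z powr (1/100)"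
  have zb: "z \<ge> z2" "z \<ge> X powr 2" "z \<ge> 3" "z \<ge> real u + real_of_int \<bar>a\<bar> + 1" using z by (auto simp: z0_def)
  have X3: "X \<ge> 3" by (simp add: X_def)
  have xX: "x \<ge> X"
  proof (rule ccontr)
   assume "\<not> x \<ge> X"
   then have "x < X" by simp
   have "x powr (11/10) < X powr (11/10)" using \<open>x < X\<close> x1' by (intro powr_less_mono2) auto
   also have "\<dots> \<le> X powr 2" using X3 by (intro powr_mono) auto
   finally have "x powr (11/10) < X powr 2" .
   then show False using z zb by linarith
  qed
  have xb: "x \<ge> x1" "x \<ge> x3" "x powr (3/4) / x powr (18/25) \<ge> k" "x powr (1/2) \<ge> k" "x \<ge> 3"
   using xX x4[of x] by (auto simp: X_def)
  have lnx: "ln x > 0" and lnz: "ln z > 0" and lnt: "ln t > 0" using xb zb t by auto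
  have zx5: "z powr (1/5) \<le> x powr (11/50)"
  proof -
   have "z powr (1/5) \<le> (x powr (11/10)) powr (1/5)" using z zb by (intro powr_mono2) auto
   then show ?thesis by (simp add: powr_powr)
  qed
  have tx: "t \<le> x powr (1/60)"
  proof -
   have "z powr (1/100) \<le> (x powr (11/10)) powr (1/100)" using z zb by (intro powr_mono2) auto
   also have "\<dots> = x powr (11/1000)" by (simp add: powr_powr)
   also have "\<dots> \<le> x powr (1/60)" using xb by (intro powr_mono) auto
   finally show ?thesis using t by simp
  qed
  have kx: "k * x powr (18/25) \<le> x powr (3/4)"
  proof -
   have "x powr (18/25) > 0" using xb by simp
   then show ?thesis using xb(3) by (simp add: le_divide_eq)
  qed
  define s where "s = ln z / ln t"
  have s0: "s > 0" using lnz lnt by (simp add: s_def)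
  have st: "s * ln t = ln z" using lnt by (simp add: s_def)
  have s1: "s \<ge> 1"
  proof -
   have "t \<le> z powr 1" using t zb powr_mono[of "1/100" 1 z] by linarith
   then have "ln t \<le> ln z" using t zb by simp
   then show ?thesis using lnt by (simp add: s_def)
  qed
  have lt: "1 / ln t = s / ln z" using lnt lnz by (simp add: s_def)
  define M where "M = d1 * m1"
  have M1: "M \<ge> 1" using dm by (simp add: M_def)
  define D2 where "D2 = rough_shifted_primes a z t d1"
  define D2' where "D2' = {n \<in> D2. real (d1 * n) \<le> x powr (1/2)}"
  define BA where "BA = (\<lambda>d2. cofactor_primes u v x t (M * d2))"
  define R where "R = {m2. m2 > 0 \<and> real m2 \<le> x \<and> rough t m2}"
  define R' where "R' = {m2 \<in> R. x powr (1/5) \<le> z \<and> a * int (m1 * m2) + v \<noteq> 0 \<and> real (M * m2) \<le> x powr (3/4)}"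
  define BB where "BB = (\<lambda>m2. shifted_divisor_primes u a v x z t d1 m1 m2)"
  have finD2: "finite D2"
  proof (rule finite_subset[OF _ finite_nat_le_real[of "z\<^sup>2"]], rule subsetI)
   fix n assume n: "n \<in> D2"
   have "n \<le> d1 * n" using dm by simp
   then have "real n \<le> real (d1 * n)" by (simp only: of_nat_le_iff)
   moreover have "real (d1 * n) \<le> z\<^sup>2" using n by (simp only: D2_def mem_Collect_eq)
   ultimately show "n \<in> {n. real n \<le> z\<^sup>2}" by simp
  qed
  have finR: "finite R" by (rule finite_subset[OF _ finite_nat_le_real[of x]]) (auto simp: R_def)
  have finBA: "finite (BA n)" and finBB: "finite (BB n)" for n
   by (rule finite_subset[OF _ finite_primes_le[of x]], auto simp: BA_def BB_def primes_le_iff)+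
  have cover: "split_set u a v x z t d1 m1 \<subseteq> (\<Union>n\<in>D2'. BA n) \<union> (\<Union>m2\<in>R'. BB m2)"
  proof
   fix p assume p: "p \<in> split_set u a v x z t d1 m1"
   then have ps: "p \<in> shifted_primes u v x" by (simp add: split_set_def)
   then have pp: "prime p" "x powr (1/2) < real p" "real p \<le> x" by (auto simp: shifted_primes_def)
   obtain d2 m2 where dm2: "d2 > 0" "m2 > 0" "int u * int p + v = int (d1 * m1 * d2 * m2)" "rough t d2" "rough t m2"
    "z < real (d1 * d2)" "real (d1 * d2) \<le> z\<^sup>2" "\<exists>q::nat. prime q \<and> int q = int (d1 * d2) + a"
    using p unfolding split_set_def by blast
   show "p \<in> (\<Union>n\<in>D2'. BA n) \<union> (\<Union>m2\<in>R'. BB m2)"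
   proof (cases "real (d1 * d2) \<le> x powr (1/2)")
    case True
    then have "d2 \<in> D2'" using dm2 by (simp add: D2'_def D2_def)
    moreover have "p \<in> BA d2" using dm2 pp unfolding BA_def M_def by blast
    ultimately show ?thesis by blast
   next
    case False
    have z14: "x powr (1/5) \<le> z"
    proof -
     have "x powr (1/2) < z\<^sup>2" using False dm2(7) by linarith
     moreover have "(x powr (1/4))\<^sup>2 = x powr (1/2)" by (simp add: power2_eq_square powr_add[symmetric])
     ultimately have "(x powr (1/4))\<^sup>2 < z\<^sup>2" by (simp only:)
     then have "x powr (1/4) < z" by (rule power_less_imp_less_base) (use zb in simp)
     moreover have "x powr (1/5) \<le> x powr (1/4)" using xb by (intro powr_mono) auto
     ultimately show ?thesis by linarith
    qed
    have "real_of_int (int (d1 * m1 * d2 * m2)) = real_of_int (int u * int p + v)" using dm2(3) by simp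
    then have "real (d1 * d2) * real (m1 * m2) = real u * real p + real_of_int v" by (simp add: mult_ac)
    also have "\<dots> \<le> real u * x + real_of_int \<bar>v\<bar> * x"
    proof (rule add_mono)
     show "real u * real p \<le> real u * x" using pp by (intro mult_left_mono) auto
     have "real_of_int v \<le> real_of_int \<bar>v\<bar> * 1" by simp
     also have "\<dots> \<le> real_of_int \<bar>v\<bar> * x" using xb by (intro mult_left_mono) auto
     finally show "real_of_int v \<le> real_of_int \<bar>v\<bar> * x" .
    qed
    also have "\<dots> = k * x" by (simp add: k_def algebra_simps)
    finally have dmk: "real (d1 * d2) * real (m1 * m2) \<le> k * x" .
    have mm: "real (m1 * m2) \<le> k * x powr (1/2)"
    proof -
     have "x powr (1/2) * real (m1 * m2) \<le> real (d1 * d2) * real (m1 * m2)" using False by (intro mult_right_mono) auto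
     also have "\<dots> \<le> k * x" by (rule dmk)
     also have "\<dots> = x powr (1/2) * (k * x powr (1/2))" using xb by (simp add: powr_half_sqrt)
     finally have "x powr (1/2) * real (m1 * m2) \<le> x powr (1/2) * (k * x powr (1/2))" .
     then show ?thesis by (rule mult_left_le_imp_le) (use xb in simp)
    qed
    have m2x: "real m2 \<le> x"
    proof -
     have "m2 \<le> m1 * m2" using dm by simp
     then have "real m2 \<le> real (m1 * m2)" by (simp only: of_nat_le_iff)
     also have "\<dots> \<le> k * x powr (1/2)" by (rule mm)
     also have "\<dots> \<le> x powr (1/2) * x powr (1/2)" using xb by (intro mult_right_mono) auto
     also have "\<dots> = x" using xb by (simp add: powr_half_sqrt)
     finally show ?thesis .
    qed
    have Mm2: "real (M * m2) \<le> x powr (3/4)"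
    proof -
     have "real d1 \<le> z powr (1/5)"
     proof -
      have "d1 \<le> d1 * m1" using dm by simp
      then have "real d1 \<le> real (d1 * m1)" by (simp only: of_nat_le_iff)
      then show ?thesis using dm by linarith
     qed
     then have "real d1 * real (m1 * m2) \<le> x powr (11/50) * (k * x powr (1/2))"
      using mm zx5 by (intro mult_mono) auto
     also have "\<dots> = k * (x powr (11/50) * x powr (1/2))" by simp
     also have "x powr (11/50) * x powr (1/2) = x powr (18/25)" by (simp add: powr_add[symmetric])
     finally show ?thesis using kx by (simp add: M_def mult_ac)
    qed
    have nz: "a * int (m1 * m2) + v \<noteq> 0"
    proof
     assume e: "a * int (m1 * m2) + v = 0"
     obtain q :: nat where q: "prime q" "int q = int (d1 * d2) + a" using dm2(8) by blast
     have "int (u * p) = int (d1 * d2) * int (m1 * m2) - v" using dm2(3) by (simp add: mult_ac)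
     also have "\<dots> = (int (d1 * d2) + a) * int (m1 * m2)" using e by (simp add: algebra_simps)
     also have "\<dots> = int (q * (m1 * m2))" using q(2) by simp
     finally have up: "u * p = q * (m1 * m2)" by (simp only: of_nat_eq_iff)
     have "real_of_int (int q) = real_of_int (int (d1 * d2) + a)" by (simp only: q(2))
     then have "real q = real (d1 * d2) + real_of_int a" by simp
     then have "real q > real u" using dm2(6) zb(4) by linarith
     then have "\<not> q dvd u" using assms(1) dvd_imp_le[of q u] by auto
     moreover have "q dvd u * p" unfolding up by simp
     ultimately have "q dvd p" using q(1) by (simp add: prime_dvd_mult_iff)
     then have "q = p" using q(1) pp(1) primes_dvd_imp_eq by blast
     then have "u = m1 * m2" using up pp(1) prime_gt_0_nat[of p] by simp
     then show False using e assms(4) by simp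
    qed
    have "m2 \<in> R'" using dm2 m2x z14 nz Mm2 by (simp add: R'_def R_def)
    moreover have "int u * int p + v = int (d1 * m1 * m2 * d2)" using dm2(3) by (simp add: mult_ac)
    then have "p \<in> BB m2" using dm2 pp unfolding BB_def by blast
    ultimately show ?thesis by blast
   qed
  qed
  have A: "(\<Sum>n\<in>D2'. real (card (BA n))) \<le> 27 * C1 * C2 * (x / (ln x * (ln z)\<^sup>2)) * exp (16 * s) * wt 0 M"
  proof -
   have "(\<Sum>n\<in>D2'. real (card (BA n))) \<le> (\<Sum>n\<in>D2'. C1 * (x / (ln t * ln x)) * (gfac M ^ 3 / real M) * exp (6 * s) * (1 / real n))"
   proof (rule sum_mono)
    fix n assume n: "n \<in> D2'"
    then have n0: "n > 0" and nr: "rough t n" and nz2: "real (d1 * n) \<le> z\<^sup>2" and nx: "real (d1 * n) \<le> x powr (1/2)"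
     by (auto simp: D2'_def D2_def)
    have Mn: "real (M * n) \<le> x powr (3/4)"
    proof -
     have "m1 \<le> d1 * m1" using dm by simp
     then have "real m1 \<le> real (d1 * m1)" by (simp only: of_nat_le_iff)
     then have "real m1 \<le> x powr (11/50)" using dm zx5 by linarith
     then have "real m1 * real (d1 * n) \<le> x powr (11/50) * x powr (1/2)" using nx by (intro mult_mono) auto
     also have "\<dots> = x powr (18/25)" by (simp add: powr_add[symmetric])
     also have "\<dots> \<le> x powr (3/4)" using xb by (intro powr_mono) auto
     finally show ?thesis by (simp add: M_def mult_ac)
    qed
    have "real (card (BA n)) \<le> C1 * (x / (ln t * ln x)) * (gfac (M * n) ^ 3 / real (M * n))"
     unfolding BA_def using xb M1 n0 Mn t tx by (intro C1(2)) auto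
    also have "\<dots> \<le> C1 * (x / (ln t * ln x)) * ((gfac M ^ 3 * exp (6 * s)) / real (M * n))"
    proof (intro mult_left_mono divide_right_mono)
     have "real n \<le> real (d1 * n)" using dm by (simp only: of_nat_le_iff) simp
     then have "real n \<le> z\<^sup>2" using nz2 by linarith
     then have "ln (real n) \<le> ln (z\<^sup>2)" using n0 zb by (subst ln_le_cancel_iff) auto
     also have "\<dots> = (2 * s) * ln t" using zb st by (subst ln_realpow) auto
     finally have "gfac n ^ 3 \<le> exp (3 * (2 * s))" using n0 t nr by (intro gfac_cube_rough_le) auto
     then have "gfac M ^ 3 * gfac n ^ 3 \<le> gfac M ^ 3 * exp (6 * s)" by (intro mult_left_mono) (auto simp: less_imp_le)
     moreover have "gfac (M * n) ^ 3 \<le> gfac M ^ 3 * gfac n ^ 3" using M1 n0 by (intro gfac_cube_mult_le) auto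
     ultimately show "gfac (M * n) ^ 3 \<le> gfac M ^ 3 * exp (6 * s)" by linarith
    qed (use C1(1) xb lnx lnt in auto)
    also have "\<dots> = C1 * (x / (ln t * ln x)) * (gfac M ^ 3 / real M) * exp (6 * s) * (1 / real n)" by simp
    finally show "real (card (BA n)) \<le> C1 * (x / (ln t * ln x)) * (gfac M ^ 3 / real M) * exp (6 * s) * (1 / real n)" .
   qed
   also have "\<dots> = C1 * (x / (ln t * ln x)) * (gfac M ^ 3 / real M) * exp (6 * s) * (\<Sum>n\<in>D2'. 1 / real n)"
    by (simp only: sum_distrib_left)
   also have "\<dots> \<le> C1 * (x / (ln t * ln x)) * (gfac M ^ 3 / real M) * exp (6 * s) * (C2 * (ln z / (ln t)\<^sup>2) * gfac M ^ 3)"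
   proof (rule mult_left_mono)
    have "(\<Sum>n\<in>D2'. 1 / real n) \<le> (\<Sum>n\<in>D2. 1 / real n)" using finD2 by (intro sum_mono2) (auto simp: D2'_def)
    also have "\<dots> \<le> C2 * (ln z / (ln t)\<^sup>2) * gfac d1 ^ 3" unfolding D2_def
    proof (rule C2(2))
     have "d1 \<le> d1 * m1" using dm by simp
     then have "real d1 \<le> real (d1 * m1)" by (simp only: of_nat_le_iff)
     also have "\<dots> \<le> z powr (1/5)" by (rule dm(3))
     also have "\<dots> \<le> z powr (1/2)" using zb by (intro powr_mono) auto
     finally show "real d1 \<le> sqrt z" using zb by (simp add: powr_half_sqrt)
     have "z powr (1/100) \<le> z powr (1/60)" using zb by (intro powr_mono) auto
     then show "t \<le> z powr (1/60)" using t by linarith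
    qed (use zb dm t in auto)
    also have "\<dots> \<le> C2 * (ln z / (ln t)\<^sup>2) * gfac M ^ 3"
    proof (intro mult_left_mono power_mono)
     show "gfac d1 \<le> gfac M" using dm by (intro gfac_dvd_mono) (auto simp: M_def)
    qed (use C2(1) lnz in \<open>auto simp: less_imp_le\<close>)
    finally show "(\<Sum>n\<in>D2'. 1 / real n) \<le> C2 * (ln z / (ln t)\<^sup>2) * gfac M ^ 3" .
   qed (use C1(1) xb lnx lnt in \<open>auto simp: less_imp_le\<close>)
   also have "\<dots> = C1 * C2 * (x / ln x * (ln z * (1 / ln t) ^ 3)) * exp (6 * s) * wt 0 M"
   proof -
    have "gfac M ^ 6 = gfac M ^ 3 * gfac M ^ 3" by (simp add: power_add[symmetric])
    then show ?thesis by (simp add: wt_zero power2_eq_square power3_eq_cube mult_ac)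
   qed
   also have "ln z * (1 / ln t) ^ 3 = s ^ 3 / (ln z)\<^sup>2"
    unfolding lt using lnz by (simp add: power2_eq_square power3_eq_cube)
   also have "C1 * C2 * (x / ln x * (s ^ 3 / (ln z)\<^sup>2)) * exp (6 * s) * wt 0 M
     \<le> C1 * C2 * (x / ln x * ((27 * exp s) / (ln z)\<^sup>2)) * exp (6 * s) * wt 0 M"
    using C1(1) C2(1) xb lnx s0 exp_ge_cube[of s] wt_nonneg[of 0 M]
    by (intro mult_right_mono mult_left_mono divide_right_mono) auto
   also have "\<dots> = 27 * C1 * C2 * (x / (ln x * (ln z)\<^sup>2)) * exp (7 * s) * wt 0 M"
   proof -
    have "exp (7 * s) = exp s * exp (6 * s)" by (simp add: exp_add[symmetric])
    then show ?thesis by simp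
   qed
   also have "\<dots> \<le> 27 * C1 * C2 * (x / (ln x * (ln z)\<^sup>2)) * exp (16 * s) * wt 0 M"
    using C1(1) C2(1) xb lnx s0 wt_nonneg[of 0 M] by (intro mult_right_mono mult_left_mono) auto
   finally show ?thesis .
  qed
  have B: "(\<Sum>m2\<in>R'. real (card (BB m2))) \<le> 135 * C3 * (x / (ln x * (ln z)\<^sup>2)) * exp (16 * s) * (wt 0 M * shift_average a v x z t m1)"
  proof (cases "x powr (1/5) \<le> z")
   case False
   then have "R' = {}" by (auto simp: R'_def)
   then show ?thesis using C3(1) xb lnx wt_nonneg[of 0 M] shift_average_nonneg[of a v x z t m1] by simp
  next
   case z15: True
   have lxz: "ln x \<le> 5 * ln z"
   proof -
    have "ln (x powr (1/5)) \<le> ln z" using z15 xb zb by (subst ln_le_cancel_iff) auto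
    then show ?thesis using xb by (simp add: ln_powr)
   qed
   let ?g = "\<lambda>m2. if a * int (m1 * m2) + v \<noteq> 0 then gfac (nat \<bar>a * int (m1 * m2) + v\<bar>) ^ 3 / real m2 else 0"
   have "(\<Sum>m2\<in>R'. real (card (BB m2))) \<le> (\<Sum>m2\<in>R'. C3 * (x / (ln t) ^ 3) * (gfac M ^ 3 / real M) * exp (15 * s) * ?g m2)"
   proof (rule sum_mono)
    fix m2 assume m2: "m2 \<in> R'"
    then have m20: "m2 > 0" "real m2 \<le> x" "rough t m2" "a * int (m1 * m2) + v \<noteq> 0" "real (M * m2) \<le> x powr (3/4)"
     by (auto simp: R'_def R_def)
    let ?E = "nat \<bar>a * int (m1 * m2) + v\<bar>"
    have "real (card (BB m2)) \<le> C3 * (x / (ln t) ^ 3) * (gfac (d1 * m1 * m2) ^ 3 * gfac ?E ^ 3 / real (d1 * m1 * m2))"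
     unfolding BB_def using xb dm m20 t tx z15 by (intro C3(2)) (auto simp: M_def)
    also have "\<dots> \<le> C3 * (x / (ln t) ^ 3) * ((gfac M ^ 3 * exp (15 * s)) * gfac ?E ^ 3 / real (d1 * m1 * m2))"
    proof (intro mult_left_mono divide_right_mono mult_right_mono)
     have "ln (real m2) \<le> ln x" using m20 by simp
     also have "\<dots> \<le> (5 * s) * ln t" using lxz st by simp
     finally have "gfac m2 ^ 3 \<le> exp (3 * (5 * s))" using m20 t by (intro gfac_cube_rough_le) auto
     then have "gfac M ^ 3 * gfac m2 ^ 3 \<le> gfac M ^ 3 * exp (15 * s)" by (intro mult_left_mono) (auto simp: less_imp_le)
     moreover have "gfac (M * m2) ^ 3 \<le> gfac M ^ 3 * gfac m2 ^ 3" using M1 m20 by (intro gfac_cube_mult_le) auto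
     ultimately show "gfac (d1 * m1 * m2) ^ 3 \<le> gfac M ^ 3 * exp (15 * s)" unfolding M_def by linarith
    qed (use C3(1) xb lnt in \<open>auto simp: less_imp_le\<close>)
    also have "\<dots> = C3 * (x / (ln t) ^ 3) * (gfac M ^ 3 / real M) * exp (15 * s) * ?g m2"
     using m20(4) by (simp add: M_def)
    finally show "real (card (BB m2)) \<le> C3 * (x / (ln t) ^ 3) * (gfac M ^ 3 / real M) * exp (15 * s) * ?g m2" .
   qed
   also have "\<dots> = C3 * (x / (ln t) ^ 3) * (gfac M ^ 3 / real M) * exp (15 * s) * (\<Sum>m2\<in>R'. ?g m2)"
    by (simp only: sum_distrib_left)
   also have "\<dots> \<le> C3 * (5 * 27 * exp s * (x / (ln x * (ln z)\<^sup>2))) * wt 0 M * exp (15 * s) * shift_average a v x z t m1"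
   proof (intro mult_mono)
    have "x / (ln t) ^ 3 = x * (1 / ln t) ^ 3" by (simp add: power_one_over)
    also have "\<dots> = (s ^ 3 / (ln z)\<^sup>2) * (x * (1 / ln z))"
     unfolding lt using lnz by (simp add: power2_eq_square power3_eq_cube)
    also have "\<dots> \<le> ((27 * exp s) / (ln z)\<^sup>2) * (x * (5 / ln x))"
    proof (intro mult_mono divide_right_mono mult_left_mono)
     show "1 / ln z \<le> 5 / ln x" using lxz lnx lnz by (simp add: field_simps)
    qed (use exp_ge_cube[of s] s0 xb lnz lnx in auto)
    also have "\<dots> = 5 * 27 * exp s * (x / (ln x * (ln z)\<^sup>2))" by (simp add: mult_ac)
    finally show "x / (ln t) ^ 3 \<le> 5 * 27 * exp s * (x / (ln x * (ln z)\<^sup>2))" .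
    show "gfac M ^ 3 / real M \<le> wt 0 M" by (rule gfac_cube_div_le_wt)
    have "(\<Sum>m2\<in>R'. ?g m2) \<le> (\<Sum>m2\<in>R. ?g m2)" using finR by (intro sum_mono2) (auto simp: R'_def less_imp_le)
    then show "(\<Sum>m2\<in>R'. ?g m2) \<le> shift_average a v x z t m1" using z15 by (simp add: shift_average_def R_def)
    show "0 \<le> (\<Sum>m2\<in>R'. ?g m2)" by (intro sum_nonneg) (auto simp: less_imp_le)
   qed (use C3(1) xb lnx lnt wt_nonneg[of 0 M] in \<open>auto simp: less_imp_le\<close>)
   also have "\<dots> = 135 * C3 * (x / (ln x * (ln z)\<^sup>2)) * exp (16 * s) * (wt 0 M * shift_average a v x z t m1)"
   proof -
    have "exp (16 * s) = exp s * exp (15 * s)" by (simp add: exp_add[symmetric])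
    then show ?thesis by simp
   qed
   finally show ?thesis .
  qed
  have finD2': "finite D2'" and finR': "finite R'" using finD2 finR by (auto simp: D2'_def R'_def)
  have "card (split_set u a v x z t d1 m1) \<le> card ((\<Union>n\<in>D2'. BA n) \<union> (\<Union>m2\<in>R'. BB m2))"
   using cover finD2' finR' finBA finBB by (intro card_mono) auto
  also have "\<dots> \<le> card (\<Union>n\<in>D2'. BA n) + card (\<Union>m2\<in>R'. BB m2)" by (rule card_Un_le)
  also have "\<dots> \<le> (\<Sum>n\<in>D2'. card (BA n)) + (\<Sum>m2\<in>R'. card (BB m2))"
   using finD2' finR' by (intro add_mono card_UN_le)
  finally have "real (card (split_set u a v x z t d1 m1)) \<le> real ((\<Sum>n\<in>D2'. card (BA n)) + (\<Sum>m2\<in>R'. card (BB m2)))"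
   by (simp only: of_nat_le_iff)
  also have "\<dots> = (\<Sum>n\<in>D2'. real (card (BA n))) + (\<Sum>m2\<in>R'. real (card (BB m2)))" by simp
  also have "\<dots> \<le> 27 * C1 * C2 * (x / (ln x * (ln z)\<^sup>2)) * exp (16 * s) * wt 0 M
   + 135 * C3 * (x / (ln x * (ln z)\<^sup>2)) * exp (16 * s) * (wt 0 M * shift_average a v x z t m1)"
   by (rule add_mono[OF A B])
  also have "\<dots> \<le> C * (x / (ln x * (ln z)\<^sup>2)) * exp (16 * s) * (wt 0 M * (1 + shift_average a v x z t m1))"
  proof -
   define Q where "Q = (x / (ln x * (ln z)\<^sup>2)) * exp (16 * s)"
   define sa where "sa = shift_average a v x z t m1"
   have Q: "Q \<ge> 0" using xb lnx by (simp add: Q_def)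
   have sa: "sa \<ge> 0" by (simp add: sa_def shift_average_nonneg)
   have W: "wt 0 M \<ge> 0" by (rule wt_nonneg)
   have "C * Q * (wt 0 M * (1 + sa)) - (27 * C1 * C2 * Q * wt 0 M + 135 * C3 * Q * (wt 0 M * sa))
    = 135 * C3 * (Q * wt 0 M) + 27 * C1 * C2 * (Q * wt 0 M * sa)"
    by (simp add: C_def algebra_simps)
   also have "\<dots> \<ge> 0" using C1(1) C2(1) C3(1) Q sa W by (intro add_nonneg_nonneg mult_nonneg_nonneg) auto
   finally have "27 * C1 * C2 * Q * wt 0 M + 135 * C3 * Q * (wt 0 M * sa) \<le> C * Q * (wt 0 M * (1 + sa))" by linarith
   then show ?thesis by (simp only: Q_def sa_def mult.assoc)
  qed
  finally show "real (card (split_set u a v x z t d1 m1))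
   \<le> C * (x / (ln x * (ln z)\<^sup>2)) * exp (16 * (ln z / ln t)) * (wt 0 (d1 * m1) * (1 + shift_average a v x z t m1))"
   by (simp only: s_def M_def)
 qed
qed

text \<open>For every fixed \<open>m2\<close> the sum over \<open>(d, m)\<close> is an instance of \<open>shifted_weight_average\<close> with the multiplier \<open>c m2\<close>;
the sum of \<open>1 / m2\<close> over rough \<open>m2\<close> costs a factor \<open>ln x / ln t\<close>.\<close>

lemma sum_shift_average_le:
 fixes a v :: int
 assumes "v \<noteq> 0" "A \<ge> 0"
 shows "\<exists>C z0. C > 0 \<and> (\<forall>x z t w \<beta> Y c. z \<ge> z0 \<longrightarrow> x \<ge> z0 \<longrightarrow> w \<ge> 2 \<longrightarrow> w \<le> z \<longrightarrow> 0 \<le> \<beta> \<longrightarrow> \<beta> \<le> 1/4 \<longrightarrow> \<beta> * ln w \<le> A \<longrightarrow>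
  2 \<le> t \<longrightarrow> t \<le> x \<longrightarrow> t \<le> z \<longrightarrow> real c * Y \<le> x \<longrightarrow>
  (\<Sum>(d, m)\<in>{(d, m) \<in> smooth_pairs w Y. card (prime_factors (d * m)) < omega_cut (ln (ln z))}. wt \<beta> (d * m) * (1 + shift_average a v x z t (c * m)))
   \<le> C * ((ln z)\<^sup>2 * tau (ln (ln z))) * exp (ln z / ln t))"
proof -
 obtain Cs where Cs: "Cs \<ge> 0" "\<And>w \<beta> Y L K. w \<ge> 2 \<Longrightarrow> 0 \<le> \<beta> \<Longrightarrow> \<beta> \<le> 1/4 \<Longrightarrow> \<beta> * ln w \<le> A \<Longrightarrow> ln (ln w) \<le> L \<Longrightarrow>
  (\<Sum>(d, m)\<in>smooth_pairs_few w Y K. wt \<beta> (d * m))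
   \<le> (\<Sum>k<K. (2 * L + Cs) ^ k / fact k)"
  using sum_smooth_pairs[OF assms(2)] by blast
 obtain Cp where Cp: "Cp > 0" "\<And>L. L \<ge> 1 \<Longrightarrow> (\<Sum>k<omega_cut L. (2 * L + Cs) ^ k / fact k) \<le> Cp * exp (2 * L) * tau L"
  using poisson_lower_tail[OF Cs(1)] by blast
 obtain Ca L0 x0 where Ca: "Ca > 0" "L0 \<ge> 1" "\<And>L w \<beta> Y x c. L \<ge> L0 \<Longrightarrow> w \<ge> 2 \<Longrightarrow> ln (ln w) \<le> L \<Longrightarrow> 0 \<le> \<beta> \<Longrightarrow> \<beta> \<le> 1/4 \<Longrightarrow>
   \<beta> * ln w \<le> A \<Longrightarrow> x \<ge> x0 \<Longrightarrow> ln (ln x) \<le> L + 2 \<Longrightarrow>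
   (\<forall>m. real m \<le> Y \<longrightarrow> real_of_int \<bar>a * int c * int m + v\<bar> \<le> x ^ 3) \<Longrightarrow>
   (\<Sum>(d, m)\<in>{(d, m) \<in> smooth_pairs w Y. card (prime_factors (d * m)) < omega_cut L \<and> a * int c * int m + v \<noteq> 0}.
     wt \<beta> (d * m) * gfac (nat \<bar>a * int c * int m + v\<bar>) ^ 3) \<le> Ca * exp (2 * L) * tau L"
  using shifted_weight_average[OF assms, of a] by blast
 obtain Cr where Cr: "Cr > 0" "\<And>t X. 2 \<le> t \<Longrightarrow> t \<le> X \<Longrightarrow>
  (\<Sum>m\<in>{m. m > 0 \<and> real m \<le> X \<and> rough t m}. 1 / real m) \<le> Cr * (ln X / ln t)"
  using sum_rough_recip by blast
 let ?P = "\<lambda>z::real. ln (ln z) \<ge> L0 \<and> z ^ 3 - real_of_int \<bar>a\<bar> * z\<^sup>2 \<ge> real_of_int \<bar>v\<bar> \<and> z \<ge> max x0 16"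
 have "eventually ?P at_top" by ((intro eventually_conj)?; (real_asymp | rule eventually_ge_at_top))
 then obtain z0 where z0: "\<And>z. z \<ge> z0 \<Longrightarrow> ?P z" by (auto simp: eventually_at_top_linorder)
 show ?thesis
 proof (rule exI[of _ "Cp + 5 * Ca * Cr"], rule exI[of _ z0], intro conjI allI impI)
  show "Cp + 5 * Ca * Cr > 0" using Cp Ca Cr by (intro add_pos_pos) auto
  fix x z t w \<beta> Y :: real and c :: nat
  assume z: "z \<ge> z0" and x: "x \<ge> z0" and w: "w \<ge> 2" "w \<le> z" and \<beta>: "0 \<le> \<beta>" "\<beta> \<le> 1/4" "\<beta> * ln w \<le> A"
   and t: "2 \<le> t" "t \<le> x" "t \<le> z" and cY: "real c * Y \<le> x"
  define L where "L = ln (ln z)"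
  have L: "L \<ge> L0" "L \<ge> 1" using z0[OF z] Ca(2) by (auto simp: L_def)
  have zb: "z \<ge> 16" using z0[OF z] by simp
  have xb: "x ^ 3 - real_of_int \<bar>a\<bar> * x\<^sup>2 \<ge> real_of_int \<bar>v\<bar>" "x \<ge> x0" "x \<ge> 16" using z0[OF x] by auto
  have lnz: "ln z > 0" and lnt: "ln t > 0" and lnx: "ln x > 0" using zb t xb by auto
  have eL: "exp (2 * L) = (ln z)\<^sup>2" using lnz by (simp add: L_def exp_double)
  have lw: "ln (ln w) \<le> L"
  proof -
   have "ln w \<le> ln z" using w by simp
   then show ?thesis unfolding L_def by (subst ln_le_cancel_iff) (use w zb in auto)
  qed
  have tau0: "tau L > 0" using L by (intro tau_pos) simp
  define s where "s = ln z / ln t"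
  have s1: "s \<ge> 1"
  proof -
   have "ln t \<le> ln z" using t zb by simp
   then show ?thesis using lnt by (simp add: s_def)
  qed
  define P where "P = smooth_pairs_few w Y (omega_cut L)"
  define W where "W = (\<lambda>y :: nat \<times> nat. wt \<beta> (fst y * snd y))"
  have finP: "finite P" unfolding P_def by (rule finite_subset[OF _ finite_smooth_pairs[of w Y]]) auto
  have first: "(\<Sum>y\<in>P. W y) \<le> Cp * exp (2 * L) * tau L"
  proof -
   have "(\<Sum>y\<in>P. W y) \<le> (\<Sum>k<omega_cut L. (2 * L + Cs) ^ k / fact k)"
    using Cs(2)[OF w(1) \<beta> lw, of Y "omega_cut L"] by (simp add: P_def W_def case_prod_unfold)
   also have "\<dots> \<le> Cp * exp (2 * L) * tau L" by (rule Cp(2)[OF L(2)])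
   finally show ?thesis .
  qed
  have second: "(\<Sum>y\<in>P. W y * shift_average a v x z t (c * snd y)) \<le> 5 * Ca * Cr * exp (2 * L) * tau L * s"
  proof (cases "x powr (1/5) \<le> z")
   case False
   then show ?thesis using Ca(1) Cr(1) tau0 s1 by (simp add: shift_average_def)
  next
   case True
   have lxz: "ln x \<le> 5 * ln z"
   proof -
    have "ln (x powr (1/5)) \<le> ln z" using True xb zb by (subst ln_le_cancel_iff) auto
    then show ?thesis using xb by (simp add: ln_powr)
   qed
   have llx: "ln (ln x) \<le> L + 2"
   proof -
    have "ln (ln x) \<le> ln (5 * ln z)" using lxz lnx lnz by (subst ln_le_cancel_iff) auto
    also have "\<dots> = ln 5 + L" using lnz by (simp add: ln_mult_pos L_def)
    also have "ln 5 \<le> (2::real)"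
    proof -
     have "(5/2::real) \<le> exp 1" using exp_lower_Taylor_quadratic[of "1::real"] by simp
     then have "(5/2) ^ 2 \<le> exp (1::real) ^ 2" by (intro power_mono) auto
     also have "exp (1::real) ^ 2 = exp 2" by (simp add: exp_of_nat_mult[symmetric])
     finally have "5 \<le> exp (2::real)" by (simp add: power2_eq_square)
     then have "ln 5 \<le> ln (exp (2::real))" by (subst ln_le_cancel_iff) auto
     then show ?thesis by simp
    qed
    finally show ?thesis by simp
   qed
   define R where "R = {m2. m2 > 0 \<and> real m2 \<le> x \<and> rough t m2}"
   have finR: "finite R" by (rule finite_subset[OF _ finite_nat_le_real[of x]]) (auto simp: R_def)
   let ?n = "\<lambda>(y :: nat \<times> nat) m2. a * int (c * m2) * int (snd y) + v"
   have "(\<Sum>y\<in>P. W y * shift_average a v x z t (c * snd y))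
     = (\<Sum>y\<in>P. \<Sum>m2\<in>R. (1 / real m2) * (if ?n y m2 \<noteq> 0 then W y * gfac (nat \<bar>?n y m2\<bar>) ^ 3 else 0))"
   proof (rule sum.cong[OF refl])
    fix y
    have e: "a * int (c * snd y * m2) + v = ?n y m2" for m2 by (simp add: mult_ac)
    have "W y * shift_average a v x z t (c * snd y) = W y * (\<Sum>m2\<in>R. (if ?n y m2 \<noteq> 0 then gfac (nat \<bar>?n y m2\<bar>) ^ 3 / real m2 else 0))"
     using True by (simp only: shift_average_def R_def e if_True)
    also have "\<dots> = (\<Sum>m2\<in>R. (1 / real m2) * (if ?n y m2 \<noteq> 0 then W y * gfac (nat \<bar>?n y m2\<bar>) ^ 3 else 0))"
     unfolding sum_distrib_left by (intro sum.cong refl) simp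
    finally show "W y * shift_average a v x z t (c * snd y) = (\<Sum>m2\<in>R. (1 / real m2) * (if ?n y m2 \<noteq> 0 then W y * gfac (nat \<bar>?n y m2\<bar>) ^ 3 else 0))" .
   qed
   also have "\<dots> = (\<Sum>m2\<in>R. \<Sum>y\<in>P. (1 / real m2) * (if ?n y m2 \<noteq> 0 then W y * gfac (nat \<bar>?n y m2\<bar>) ^ 3 else 0))"
    by (rule sum.swap)
   also have "\<dots> = (\<Sum>m2\<in>R. (1 / real m2) * (\<Sum>y\<in>P. if ?n y m2 \<noteq> 0 then W y * gfac (nat \<bar>?n y m2\<bar>) ^ 3 else 0))"
    by (simp only: sum_distrib_left)
   also have "\<dots> \<le> (\<Sum>m2\<in>R. (1 / real m2) * (Ca * exp (2 * L) * tau L))"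
   proof (intro sum_mono mult_left_mono)
    fix m2 assume m2: "m2 \<in> R"
    have "(\<Sum>y\<in>P. if ?n y m2 \<noteq> 0 then W y * gfac (nat \<bar>?n y m2\<bar>) ^ 3 else 0) = (\<Sum>y\<in>{y \<in> P. ?n y m2 \<noteq> 0}. W y * gfac (nat \<bar>?n y m2\<bar>) ^ 3)"
     using finP by (simp only: sum.inter_filter)
    also have "{y \<in> P. ?n y m2 \<noteq> 0} = {(d, m) \<in> smooth_pairs w Y. card (prime_factors (d * m)) < omega_cut L \<and> a * int (c * m2) * int m + v \<noteq> 0}"
     by (auto simp: P_def)
    also have "(\<Sum>y\<in>\<dots>. W y * gfac (nat \<bar>?n y m2\<bar>) ^ 3) \<le> Ca * exp (2 * L) * tau L"
    proof -
     have "\<forall>m. real m \<le> Y \<longrightarrow> real_of_int \<bar>a * int (c * m2) * int m + v\<bar> \<le> x ^ 3"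
     proof (intro allI impI)
      fix m assume m: "real m \<le> Y"
      have "real c * real m \<le> real c * Y" using m by (intro mult_left_mono) auto
      then have "real c * real m \<le> x" using cY by linarith
      then have "real m2 * (real c * real m) \<le> x * x" using m2 xb by (intro mult_mono) (auto simp: R_def)
      then have "real_of_int \<bar>a\<bar> * (real m2 * (real c * real m)) \<le> real_of_int \<bar>a\<bar> * (x * x)" by (intro mult_left_mono) auto
      moreover have "real_of_int \<bar>a * int (c * m2) * int m + v\<bar> \<le> real_of_int \<bar>a * int (c * m2) * int m\<bar> + real_of_int \<bar>v\<bar>"
       by linarith
      moreover have "real_of_int \<bar>a * int (c * m2) * int m\<bar> = real_of_int \<bar>a\<bar> * (real m2 * (real c * real m))"
       by (simp add: abs_mult mult_ac)
      ultimately show "real_of_int \<bar>a * int (c * m2) * int m + v\<bar> \<le> x ^ 3" using xb by (simp add: power2_eq_square)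
     qed
     then show ?thesis using Ca(3)[OF L(1) w(1) lw \<beta> xb(2) llx, of Y "c * m2"] by (simp add: W_def case_prod_unfold)
    qed
    finally show "(\<Sum>y\<in>P. if ?n y m2 \<noteq> 0 then W y * gfac (nat \<bar>?n y m2\<bar>) ^ 3 else 0) \<le> Ca * exp (2 * L) * tau L" .
   qed simp
   also have "\<dots> = (\<Sum>m2\<in>R. 1 / real m2) * (Ca * exp (2 * L) * tau L)" by (simp only: sum_distrib_right)
   also have "\<dots> \<le> (Cr * (5 * s)) * (Ca * exp (2 * L) * tau L)"
   proof (rule mult_right_mono)
    have "(\<Sum>m2\<in>R. 1 / real m2) \<le> Cr * (ln x / ln t)" unfolding R_def using t by (intro Cr(2))
    also have "\<dots> \<le> Cr * (5 * s)"
    proof (rule mult_left_mono)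
     have "ln x / ln t \<le> (5 * ln z) / ln t" using lxz lnt by (intro divide_right_mono) auto
     then show "ln x / ln t \<le> 5 * s" by (simp add: s_def)
    qed (use Cr in simp)
    finally show "(\<Sum>m2\<in>R. 1 / real m2) \<le> Cr * (5 * s)" .
   qed (use Ca tau0 in simp)
   finally show ?thesis by (simp add: mult_ac)
  qed
  have "(\<Sum>y\<in>P. W y * (1 + shift_average a v x z t (c * snd y))) = (\<Sum>y\<in>P. W y) + (\<Sum>y\<in>P. W y * shift_average a v x z t (c * snd y))"
   by (simp add: distrib_left sum.distrib)
  also have "\<dots> \<le> Cp * exp (2 * L) * tau L * exp s + 5 * Ca * Cr * exp (2 * L) * tau L * exp s"
  proof (rule add_mono)
   have es: "1 \<le> exp s" "s \<le> exp s" using s1 exp_ge_add_one_self[of s] by (auto intro: order_trans[of s "1 + s"])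
   have "Cp * exp (2 * L) * tau L * 1 \<le> Cp * exp (2 * L) * tau L * exp s" using es Cp(1) tau0 by (intro mult_left_mono) auto
   then show "(\<Sum>y\<in>P. W y) \<le> Cp * exp (2 * L) * tau L * exp s" using first by simp
   have "5 * Ca * Cr * exp (2 * L) * tau L * s \<le> 5 * Ca * Cr * exp (2 * L) * tau L * exp s"
    using es Ca(1) Cr(1) tau0 by (intro mult_left_mono) auto
   then show "(\<Sum>y\<in>P. W y * shift_average a v x z t (c * snd y)) \<le> 5 * Ca * Cr * exp (2 * L) * tau L * exp s" using second by simp
  qed
  also have "\<dots> = (Cp + 5 * Ca * Cr) * ((ln z)\<^sup>2 * tau L) * exp s" unfolding eL by (simp add: algebra_simps)
  finally show "(\<Sum>(d, m)\<in>{(d, m) \<in> smooth_pairs w Y. card (prime_factors (d * m)) < omega_cut (ln (ln z))}. wt \<beta> (d * m) * (1 + shift_average a v x z t (c * m)))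
   \<le> (Cp + 5 * Ca * Cr) * ((ln z)\<^sup>2 * tau (ln (ln z))) * exp (ln z / ln t)"
   by (simp add: P_def W_def L_def s_def case_prod_unfold)
 qed
qed

section \<open>Many small prime factors\<close>

lemma card_UN_le_sum:
 assumes "finite I" "\<And>i. i \<in> I \<Longrightarrow> real (card (A i)) \<le> f i"
 shows "real (card (\<Union>i\<in>I. A i)) \<le> (\<Sum>i\<in>I. f i)"
proof -
 have "real (card (\<Union>i\<in>I. A i)) \<le> real (\<Sum>i\<in>I. card (A i))" by (simp only: of_nat_le_iff card_UN_le[OF assms(1)])
 also have "\<dots> \<le> (\<Sum>i\<in>I. f i)" using assms(2) by (simp add: sum_mono)
 finally show ?thesis .
qed

lemma rankin_factor:
 fixes P Z c A :: real
 assumes "P > 1" "Z > 0"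
 shows "(Z powr c / P) powr (- (A / ln P)) = exp (- A * (c * (ln Z / ln P) - 1))"
proof -
 have l: "ln (Z powr c / P) = c * ln Z - ln P" using assms by (subst ln_div) (auto simp: ln_powr)
 have "Z powr c / P > 0" using assms by simp
 then have "(Z powr c / P) powr (- (A / ln P)) = exp (- (A / ln P) * (c * ln Z - ln P))"
  using assms by (simp add: powr_def[of "Z powr c / P"] l)
 also have "- (A / ln P) * (c * ln Z - ln P) = - A * (c * (ln Z / ln P) - 1)"
  using assms by (simp add: field_simps)
 finally show ?thesis .
qed

text \<open>The prime \<open>P\<close> at which the decomposition stops is split off, and Rankin's trick with \<open>\<beta> = A / ln P\<close> is applied
to the rest. Part of the exponent, \<open>h ln Z / ln P \<ge> 1\<close>, compensates for the missing factor \<open>P\<close>.\<close>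

lemma wt_prime_mult_rankin:
 assumes "prime P" "n > 0" "Z > 0" "Z powr c < real (P * n)" "A \<ge> 0" "h * (ln Z / ln (real P)) \<ge> 1"
 shows "wt 0 (n * P) \<le> exp 6 / real P * (exp (- A * ((c - h) * (ln Z / ln (real P)))) * wt (A / ln (real P)) n)"
proof -
 have P1: "real P > 1" using assms(1) prime_gt_1_nat by simp
 have "wt 0 (n * P) \<le> exp (0 + 6) * (wt 0 n / real P)" using assms(1,2) by (intro wt_mult_prime_le[where w = "real P"]) auto
 also have "\<dots> = exp 6 / real P * wt 0 n" by simp
 also have "\<dots> \<le> exp 6 / real P * (exp (- A * ((c - h) * (ln Z / ln (real P)))) * wt (A / ln (real P)) n)"
 proof (rule mult_left_mono)
  have "wt 0 n \<le> (Z powr c / real P) powr (- (A / ln (real P))) * wt (A / ln (real P)) n"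
  proof (rule wt_rankin)
   show "Z powr c / real P \<le> real n" using assms(4) P1 by (simp add: divide_le_eq mult.commute)
  qed (use assms P1 in auto)
  also have "\<dots> \<le> exp (- A * ((c - h) * (ln Z / ln (real P)))) * wt (A / ln (real P)) n"
  proof (rule mult_right_mono)
   have "A * ((c - h) * (ln Z / ln (real P))) \<le> A * (c * (ln Z / ln (real P)) - 1)"
    unfolding left_diff_distrib using assms(5,6) by (intro mult_left_mono) linarith+
   then show "(Z powr c / real P) powr (- (A / ln (real P))) \<le> exp (- A * ((c - h) * (ln Z / ln (real P))))"
    unfolding rankin_factor[OF P1 assms(3)] by simp
  qed (rule wt_nonneg)
  finally show "wt 0 n \<le> exp (- A * ((c - h) * (ln Z / ln (real P)))) * wt (A / ln (real P)) n" .
 qed simp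
 finally show ?thesis .
qed

text \<open>This sum over the stopping prime converges because of the factor \<open>ln P / ln Z\<close>, to which the Rankin saving
has been reduced.\<close>

lemma sum_prime_ln_ratio_le:
 assumes "finite Ps" "Ps \<subseteq> primes_le w" "1 \<le> w" "w \<le> Z" "Z \<ge> 4"
 shows "(\<Sum>P\<in>Ps. (1 / real P) * (ln (real P) / ln Z)) \<le> 2"
proof -
 have lz: "ln Z > 0" and wz: "ln w \<le> ln Z" and fz: "ln 4 \<le> ln Z" using assms by auto
 have "(\<Sum>P\<in>Ps. (1 / real P) * (ln (real P) / ln Z)) = (\<Sum>P\<in>Ps. ln (real P) / real P) / ln Z"
  unfolding sum_divide_distrib by (intro sum.cong) auto
 also have "\<dots> \<le> (\<Sum>P\<in>primes_le w. ln (real P) / real P) / ln Z"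
  using assms(2) lz by (intro divide_right_mono sum_mono2 finite_primes_le) (auto simp: primes_le_iff intro!: divide_nonneg_nonneg ln_ge_zero dest!: prime_ge_1_nat)
 also have "\<dots> \<le> (ln w + ln 4) / ln Z" using lz mertens1_upper[OF assms(3)] by (intro divide_right_mono) auto
 also have "\<dots> \<le> 2" using lz wz fz by (simp add: divide_le_eq)
 finally show ?thesis .
qed

lemma square_le_exp: "s \<ge> 0 \<Longrightarrow> s\<^sup>2 \<le> exp (2 * (s::real))"
proof -
 assume "s \<ge> 0"
 then have "s\<^sup>2 \<le> exp s ^ 2" using exp_ge_add_one_self[of s] by (intro power_mono) linarith
 then show ?thesis by (simp add: exp_of_nat_mult[symmetric])
qed

lemma two_power_le_exp: "s \<ge> 0 \<Longrightarrow> real b \<le> 1 + 2 * s \<Longrightarrow> (2::real) ^ b \<le> 2 * exp (2 * s)"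
proof -
 assume s: "s \<ge> 0" and b: "real b \<le> 1 + 2 * s"
 have "(2::real) ^ b = 2 powr real b" by (simp add: powr_realpow)
 also have "\<dots> \<le> 2 powr (1 + 2 * s)" using b by (intro powr_mono) auto
 also have "\<dots> = 2 * exp (2 * s * ln 2)" by (simp only: powr_add) (simp add: powr_def)
 also have "\<dots> \<le> 2 * exp (2 * s * 1)"
  using s ln_le_minus_one[of "2::real"] by (intro mult_left_mono, subst exp_le_cancel_iff) (auto intro!: mult_left_le)
 finally show ?thesis by simp
qed

definition many_small_primes :: "nat \<Rightarrow> int \<Rightarrow> real \<Rightarrow> real \<Rightarrow> nat set" where
 "many_small_primes u v x z = {p \<in> shifted_primes u v x.
  omega_cut (ln (ln z)) \<le> card {l \<in> prime_factors (nat (int u * int p + v)). real l \<le> z powr (1/100)}}"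

text \<open>If the decomposition stops at \<open>P\<close>, then at most \<open>b = 1 + 2 ln x / ln P\<close> of the primes counted do not divide \<open>M\<close>.
Lowering the threshold \<open>K\<close> by \<open>b\<close> costs \<open>2^b\<close>, and Rankin's trick with \<open>A = 20\<close> saves more than this.
The choice \<open>t0 = exp 80\<close> ensures \<open>\<beta> = A / ln P \<le> 1/4\<close>.\<close>

lemma card_many_small_primes_le:
 fixes u :: nat and v :: int
 assumes "u \<ge> 1" "v \<noteq> 0"
 shows "\<exists>C z0. C > 0 \<and> (\<forall>x z. z \<ge> z0 \<longrightarrow> x \<ge> z0 \<longrightarrow> z \<le> x powr (11/10) \<longrightarrow>
  real (card (many_small_primes u v x z)) \<le> C * (x / ln x * tau (ln (ln z))))"
proof -
 define t0 :: real where "t0 = exp 80"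
 obtain C1 x1 where C1: "C1 > 0" "\<And>x t M. x \<ge> x1 \<Longrightarrow> M \<ge> 1 \<Longrightarrow> real M \<le> x powr (3/4) \<Longrightarrow> 2 \<le> t \<Longrightarrow> t \<le> x powr (1/60) \<Longrightarrow>
  real (card (cofactor_primes u v x t M))
   \<le> C1 * (x / (ln t * ln x)) * (gfac M ^ 3 / real M)"
  using count_cofactor_rough[OF assms] by blast
 obtain C2 z2 where C2: "C2 > 0" "\<And>x z. z \<ge> z2 \<Longrightarrow> x \<ge> z2 \<Longrightarrow>
  real (card (smooth_divisor_primes u v x z t0)) \<le> C2 * (x / ln x * tau (ln (ln z)))"
  using count_smooth_divisor[OF assms, of t0] exp_ge_add_one_self[of "80::real"] unfolding t0_def by fastforce
 obtain Cs where Cs: "Cs \<ge> 0" "\<And>w \<beta> Y L K. w \<ge> 2 \<Longrightarrow> 0 \<le> \<beta> \<Longrightarrow> \<beta> \<le> 1/4 \<Longrightarrow> \<beta> * ln w \<le> 20 \<Longrightarrow> ln (ln w) \<le> L \<Longrightarrow>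
  (\<exists>N. (\<Sum>m\<in>smooth_many w Y K. wt \<beta> m) \<le> (\<Sum>k\<in>{K..N}. (L + Cs) ^ k / fact k))"
  using sum_smooth[of 20] by auto
 obtain Cp L0 where Cp: "Cp > 0" "L0 \<ge> 1" "\<And>L b N. L \<ge> L0 \<Longrightarrow> (\<Sum>k\<in>{omega_cut L - b..N}. (L + Cs) ^ k / fact k) \<le> Cp * 2 ^ b * exp L * tau L"
  using poisson_upper_tail[OF Cs(1)] by blast
 define k where "k = real u + real_of_int \<bar>v\<bar>"
 let ?P = "\<lambda>z::real. ln (ln z) \<ge> L0 \<and> z \<ge> k \<and> z \<ge> max x1 (max z2 16) \<and> z powr (1/100) \<ge> 2"
 have "eventually ?P at_top" by ((intro eventually_conj)?; (real_asymp | rule eventually_ge_at_top))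
 then obtain z0 where z0: "\<And>z. z \<ge> z0 \<Longrightarrow> ?P z" by (auto simp: eventually_at_top_linorder)
 define C3 where "C3 = 8 * C1 * Cp * exp 6"
 define C where "C = 100 * C1 * Cp + C2 + C3"
 show ?thesis
 proof (rule exI[of _ C], rule exI[of _ z0], intro conjI allI impI)
  show "C > 0" using C1 C2 Cp by (auto simp: C_def C3_def intro!: add_pos_pos)
  fix x z :: real assume z: "z \<ge> z0" "z \<le> x powr (11/10)" and x: "x \<ge> z0"
  define L where "L = ln (ln z)"
  define w where "w = z powr (1/100)"
  define K where "K = omega_cut L"
  define T where "T = x / ln x * tau L"
  have zb: "z \<ge> z2" "z \<ge> 16" "w \<ge> 2" "L \<ge> L0" using z0[OF z(1)] by (auto simp: w_def L_def)
  have xb: "x \<ge> x1" "x \<ge> z2" "x \<ge> 16" "x \<ge> k" using z0[OF x] by auto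
  have lnz: "ln z > 0" and lnx: "ln x > 0" using zb xb by auto
  have lnw: "ln w = ln z / 100" using zb by (simp add: w_def ln_powr)
  have lzx: "ln z \<le> 11/10 * ln x"
  proof -
   have "ln z \<le> ln (x powr (11/10))" using z zb xb by (subst ln_le_cancel_iff) auto
   then show ?thesis using xb by (simp add: ln_powr)
  qed
  have wx: "w \<le> x powr (11/1000)"
  proof -
   have "w \<le> (x powr (11/10)) powr (1/100)" unfolding w_def using z zb by (intro powr_mono2) auto
   then show ?thesis by (simp add: powr_powr)
  qed
  have wx60: "w \<le> x powr (1/60)" using order_trans[OF wx powr_mono[of "11/1000" "1/60" x]] xb by simp
  have wx1: "w \<le> x" using order_trans[OF wx powr_mono[of "11/1000" 1 x]] xb by simp
  have L1: "L \<ge> 1" using zb Cp(2) by simp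
  have tau0: "tau L > 0" using L1 by (intro tau_pos) simp
  have T0: "T > 0" using xb lnx tau0 by (simp add: T_def)
  have eL: "exp L = ln z" using lnz by (simp add: L_def)
  have lle: "ln (ln t) \<le> L" if "2 \<le> t" "t \<le> w" for t
  proof -
   have "w \<le> z" using powr_mono[of "1/100" 1 z] zb by (simp add: w_def)
   then have "ln t \<le> ln z" using that by simp
   then show ?thesis unfolding L_def using that lnz by (subst ln_le_cancel_iff) auto
  qed
  define Y where "Y = x powr (1/4)"
  have Y1: "Y \<ge> 1" using xb by (simp add: Y_def ge_one_powr_ge_zero)
  define B where "B = (\<lambda>M t. cofactor_primes u v x t M)"
  define S where "S = smooth_divisor_primes u v x z t0"
  define M1 where "M1 = smooth_many w Y K"
  define \<sigma> where "\<sigma> = (\<lambda>P::nat. ln x / ln (real P))"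
  define b where "b = (\<lambda>P. 1 + nat \<lfloor>2 * \<sigma> P\<rfloor>)"
  define M3 where "M3 = (\<lambda>P::nat. {m \<in> smooth (real P) Y. card (prime_factors m) \<ge> K - b P \<and> Y < real (P * m)})"
  define Ps where "Ps = {P. prime P \<and> t0 \<le> real P \<and> real P \<le> w}"
  have finB: "finite (B M t)" for M t
   by (rule finite_subset[OF _ finite_primes_le[of x]]) (auto simp: B_def primes_le_iff)
  have finM1: "finite M1" and finM3: "finite (M3 P)" for P by (auto simp: M1_def M3_def)
  have finPs: "finite Ps" by (rule finite_subset[OF _ finite_primes_le[of w]]) (auto simp: Ps_def primes_le_iff)
  have finS: "finite S" by (simp add: S_def)
  have Pfact: "real P \<ge> 2" "ln (real P) \<ge> 80" "\<sigma> P \<ge> 20" "\<sigma> P > 0" "ln z / ln (real P) \<le> 11/10 * \<sigma> P" if "P \<in> Ps" for P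
  proof -
   have P: "prime P" "exp 80 \<le> real P" "real P \<le> w" using that by (auto simp: Ps_def t0_def)
   show "real P \<ge> 2" using P(1) prime_ge_2_nat[of P] by simp
   have "ln (exp 80) \<le> ln (real P)" using P prime_gt_0_nat[OF P(1)] by (subst ln_le_cancel_iff) auto
   then show l80: "ln (real P) \<ge> 80" by simp
   have "ln (real P) \<le> ln w" using P prime_gt_0_nat[OF P(1)] zb(3) by (subst ln_le_cancel_iff) auto
   then have "ln (real P) * 20 \<le> ln x" using lnw lzx lnx by simp
   then show "\<sigma> P \<ge> 20" using l80 by (simp add: \<sigma>_def le_divide_eq mult.commute)
   then show "\<sigma> P > 0" by simp
   have "ln z / ln (real P) \<le> (11/10 * ln x) / ln (real P)" using lzx l80 by (intro divide_right_mono) auto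
   then show "ln z / ln (real P) \<le> 11/10 * \<sigma> P" by (simp add: \<sigma>_def)
  qed
  have cover: "many_small_primes u v x z \<subseteq> (\<Union>M\<in>M1. B M w) \<union> S \<union> (\<Union>P\<in>Ps. \<Union>m\<in>M3 P. B (P * m) (real P))"
  proof
   fix p assume p: "p \<in> many_small_primes u v x z"
   then have ps: "p \<in> shifted_primes u v x" by (simp add: many_small_primes_def)
   then have pp: "prime p" "x powr (1/2) < real p" "real p \<le> x" and Npos: "int u * int p + v > 0" by (auto simp: shifted_primes_def)
   define N where "N = nat (int u * int p + v)"
   have N: "int u * int p + v = int N" "N > 0" using Npos by (auto simp: N_def)
   define F where "F = {l \<in> prime_factors N. real l \<le> w}"
   have KF: "K \<le> card F" using p by (simp add: many_small_primes_def K_def L_def F_def N_def w_def)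
   show "p \<in> (\<Union>M\<in>M1. B M w) \<union> S \<union> (\<Union>P\<in>Ps. \<Union>m\<in>M3 P. B (P * m) (real P))"
   proof (rule prefix_decomposition[OF N(2) Y1, of w])
    fix M r assume h: "N = M * r" "real M \<le> Y" "\<And>p. prime p \<Longrightarrow> p dvd M \<Longrightarrow> real p \<le> w" "\<And>p. prime p \<Longrightarrow> p dvd r \<Longrightarrow> real p > w"
    have pos: "M > 0" "r > 0" using h(1) N(2) by auto
    have "F \<subseteq> prime_factors M"
    proof
     fix l assume "l \<in> F"
     then have l: "prime l" "l dvd M * r" "real l \<le> w" using h(1) by (auto simp: F_def in_prime_factors_iff)
     then have "\<not> l dvd r" using h(4)[of l] by auto
     then show "l \<in> prime_factors M" using l pos by (simp add: prime_dvd_mult_iff in_prime_factors_iff)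
    qed
    then have "card F \<le> card (prime_factors M)" by (intro card_mono) auto
    then have "M \<in> M1" using KF h(2,3) pos by (auto simp: M1_def smooth_def in_prime_factors_iff primes_le_iff)
    moreover have "rough w r" unfolding rough_def using h(4) by (auto simp: less_imp_le)
    then have "p \<in> B M w" using pp pos N(1) h(1) unfolding B_def by blast
    ultimately show ?thesis by blast
   next
    fix M r P assume h: "N = P * M * r" "prime P" "real P \<le> w" "real M \<le> Y" "real (P * M) > Y"
     "\<And>p. prime p \<Longrightarrow> p dvd M \<Longrightarrow> p \<le> P" "\<And>p. prime p \<Longrightarrow> p dvd r \<Longrightarrow> P \<le> p"
    have pos: "M > 0" "r > 0" "P > 0" using h(1) N(2) by auto
    show ?thesis
    proof (cases "t0 \<le> real P")
     case False
     have "z powr (1/8) < real (P * M)"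
     proof -
      have "z powr (1/8) \<le> (x powr (11/10)) powr (1/8)" using z zb by (intro powr_mono2) auto
      also have "\<dots> = x powr (11/80)" by (simp add: powr_powr)
      also have "\<dots> \<le> Y" unfolding Y_def using xb by (intro powr_mono) auto
      finally show ?thesis using h(5) by linarith
     qed
     moreover have "real (P * M) \<le> x powr (3/4)"
     proof -
      have "real P * real M \<le> x powr (11/1000) * x powr (1/4)" using h(3,4) wx by (intro mult_mono) (auto simp: Y_def)
      also have "\<dots> = x powr (261/1000)" by (simp add: powr_add[symmetric])
      also have "\<dots> \<le> x powr (3/4)" using xb by (intro powr_mono) auto
      finally show ?thesis by simp
     qed
     moreover have "prime_factors (P * M) \<subseteq> primes_le t0"
     proof
      fix l assume "l \<in> prime_factors (P * M)"
      then have l: "prime l" "l dvd P \<or> l dvd M" by (auto simp: in_prime_factors_iff prime_dvd_mult_iff)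
      then have "l \<le> P" using h(2,6) pos dvd_imp_le[of l P] by auto
      then have "real l \<le> real P" by simp
      then show "l \<in> primes_le t0" using l False by (simp add: primes_le_iff)
     qed
     moreover have "int u * int p + v = int ((P * M) * r)" using N(1) h(1) by simp
     ultimately have "p \<in> S" using ps unfolding S_def by blast
     then show ?thesis by blast
    next
     case True
     then have PPs: "P \<in> Ps" using h(2,3) by (simp add: Ps_def)
     note Pf = Pfact[OF PPs]
     have cr: "real (card (prime_factors r)) \<le> 2 * \<sigma> P"
     proof -
      have "real (card (prime_factors r)) \<le> ln (real r) / ln (real P)"
       using pos Pf h(7) by (intro card_prime_factors_rough) auto
      also have "\<dots> \<le> (2 * ln x) / ln (real P)"
      proof (rule divide_right_mono)
       have "real_of_int (int N) = real u * real p + real_of_int v" unfolding N(1)[symmetric] by simp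
       then have "real N \<le> real u * x + real_of_int \<bar>v\<bar> * x"
        using mult_left_mono[OF pp(3), of "real u"] mult_left_mono[of 1 x "real_of_int \<bar>v\<bar>"] xb by simp
       also have "\<dots> = k * x" by (simp add: k_def algebra_simps)
       also have "\<dots> \<le> x * x" using xb by (intro mult_right_mono) auto
       finally have "real N \<le> x\<^sup>2" by (simp add: power2_eq_square)
       moreover have "r \<le> N" using h(1) N(2) by (intro dvd_imp_le) auto
       ultimately have "real r \<le> x\<^sup>2" by (meson of_nat_le_iff order_trans)
       then have "ln (real r) \<le> ln (x\<^sup>2)" using pos xb by (subst ln_le_cancel_iff) auto
       then show "ln (real r) \<le> 2 * ln x" using xb by (simp add: ln_realpow)
      qed (use Pf in simp)
      finally show ?thesis by (simp add: \<sigma>_def)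
     qed
     have "F \<subseteq> prime_factors M \<union> ({P} \<union> prime_factors r)"
     proof
      fix l assume "l \<in> F"
      then have l: "prime l" "l dvd P * M * r" using h(1) by (auto simp: F_def in_prime_factors_iff)
      then have "l dvd P \<or> l dvd M \<or> l dvd r" by (simp add: prime_dvd_mult_iff)
      then show "l \<in> prime_factors M \<union> ({P} \<union> prime_factors r)"
       using l(1) h(2) pos by (auto simp: in_prime_factors_iff dest: primes_dvd_imp_eq)
     qed
     then have "card F \<le> card (prime_factors M \<union> ({P} \<union> prime_factors r))" by (intro card_mono) auto
     also have "\<dots> \<le> card (prime_factors M) + card ({P} \<union> prime_factors r)" by (rule card_Un_le)
     also have "card ({P} \<union> prime_factors r) \<le> 1 + card (prime_factors r)" using card_Un_le[of "{P}" "prime_factors r"] by simp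
     also have "card (prime_factors r) \<le> nat \<lfloor>2 * \<sigma> P\<rfloor>" using cr by (simp add: le_nat_floor)
     finally have "card F \<le> card (prime_factors M) + b P" by (simp add: b_def)
     then have "K - b P \<le> card (prime_factors M)" using KF by linarith
     moreover have "M \<in> smooth (real P) Y" using h(4,6) pos by (auto simp: smooth_def in_prime_factors_iff primes_le_iff)
     ultimately have "M \<in> M3 P" using h(5) by (simp add: M3_def)
     moreover have "rough (real P) r" unfolding rough_def using h(7) by auto
     then have "p \<in> B (P * M) (real P)" using pp pos N(1) h(1) unfolding B_def by blast
     ultimately show ?thesis using PPs by blast
    qed
   qed
  qed
  have U1: "real (card (\<Union>M\<in>M1. B M w)) \<le> 100 * C1 * Cp * T"
  proof -
   have "real (card (\<Union>M\<in>M1. B M w)) \<le> (\<Sum>M\<in>M1. C1 * (x / (ln w * ln x)) * wt 0 M)"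
   proof (rule card_UN_le_sum[OF finM1])
    fix M assume M: "M \<in> M1"
    then have M': "M \<ge> 1" "real M \<le> Y" by (auto simp: M1_def smooth_def)
    have "Y \<le> x powr (3/4)" unfolding Y_def using xb by (intro powr_mono) auto
    then have "real (card (B M w)) \<le> C1 * (x / (ln w * ln x)) * (gfac M ^ 3 / real M)"
     unfolding B_def using xb zb M' wx60 by (intro C1(2)) auto
    also have "\<dots> \<le> C1 * (x / (ln w * ln x)) * wt 0 M"
     using C1(1) xb lnx lnz lnw by (intro mult_left_mono gfac_cube_div_le_wt) auto
    finally show "real (card (B M w)) \<le> C1 * (x / (ln w * ln x)) * wt 0 M" .
   qed
   also have "\<dots> = C1 * (x / (ln w * ln x)) * (\<Sum>M\<in>M1. wt 0 M)" by (simp only: sum_distrib_left)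
   also have "\<dots> \<le> C1 * (x / (ln w * ln x)) * (Cp * 2 ^ 0 * exp L * tau L)"
   proof (rule mult_left_mono)
    obtain n where "(\<Sum>M\<in>M1. wt 0 M) \<le> (\<Sum>k\<in>{K..n}. (L + Cs) ^ k / fact k)"
     using Cs(2)[of w 0 L Y K] zb lle[of w] unfolding M1_def by auto
    also have "\<dots> \<le> Cp * 2 ^ 0 * exp L * tau L" using Cp(3)[OF zb(4), of 0 n] by (simp add: K_def)
    finally show "(\<Sum>M\<in>M1. wt 0 M) \<le> Cp * 2 ^ 0 * exp L * tau L" .
   qed (use C1(1) xb lnx lnz lnw in auto)
   also have "\<dots> = 100 * C1 * Cp * T" unfolding lnw eL T_def using lnz by simp
   finally show ?thesis .
  qed
  have U2: "real (card S) \<le> C2 * T"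
   unfolding S_def T_def L_def by (rule C2(2)[OF zb(1) xb(2)])
  have U3: "real (card (\<Union>P\<in>Ps. \<Union>m\<in>M3 P. B (P * m) (real P))) \<le> C3 * T"
  proof -
   have "real (card (\<Union>P\<in>Ps. \<Union>m\<in>M3 P. B (P * m) (real P)))
     \<le> (\<Sum>P\<in>Ps. 4 * C1 * Cp * exp 6 * T * ((1 / real P) * (ln (real P) / ln x)))"
   proof (rule card_UN_le_sum[OF finPs])
    fix P assume P: "P \<in> Ps"
    note Pf = Pfact[OF P]
    have Pp: "prime P" "real P \<le> w" using P by (auto simp: Ps_def)
    define lp where "lp = ln (real P)"
    define \<beta> where "\<beta> = 20 / lp"
    have lp: "lp \<ge> 80" using Pf by (simp add: lp_def)
    define D where "D = C1 * (x / (lp * ln x)) * (exp 6 / real P * exp (- 4 * \<sigma> P))"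
    have D0: "D \<ge> 0" using C1(1) xb lnx lp by (simp add: D_def)
    have "real (card (\<Union>m\<in>M3 P. B (P * m) (real P))) \<le> (\<Sum>m\<in>M3 P. D * wt \<beta> m)"
    proof (rule card_UN_le_sum[OF finM3])
     fix m assume m: "m \<in> M3 P"
     then have m': "m > 0" "real m \<le> Y" "Y < real (P * m)" by (auto simp: M3_def smooth_def)
     have mx: "real (P * m) \<le> x powr (3/4)"
     proof -
      have "real P * real m \<le> x powr (11/1000) * x powr (1/4)" using Pp(2) m'(2) wx by (intro mult_mono) (auto simp: Y_def)
      also have "\<dots> = x powr (261/1000)" by (simp add: powr_add[symmetric])
      also have "\<dots> \<le> x powr (3/4)" using xb by (intro powr_mono) auto
      finally show ?thesis by simp
     qed
     have "real (card (B (P * m) (real P))) \<le> C1 * (x / (lp * ln x)) * (gfac (P * m) ^ 3 / real (P * m))"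
      unfolding B_def lp_def using xb Pf Pp m' mx prime_gt_0_nat[OF Pp(1)] wx60 by (intro C1(2)) auto
     also have "\<dots> \<le> C1 * (x / (lp * ln x)) * (exp 6 / real P * (exp (- 4 * \<sigma> P) * wt \<beta> m))"
     proof (rule mult_left_mono)
      have "gfac (P * m) ^ 3 / real (P * m) \<le> wt 0 (m * P)" by (simp only: mult.commute[of m P] gfac_cube_div_le_wt)
      also have "\<dots> \<le> exp 6 / real P * (exp (- 20 * ((1/4 - 1/20) * (ln x / ln (real P)))) * wt (20 / ln (real P)) m)"
       using Pp m' xb Pf(3) by (intro wt_prime_mult_rankin) (auto simp: Y_def \<sigma>_def)
      finally show "gfac (P * m) ^ 3 / real (P * m) \<le> exp 6 / real P * (exp (- 4 * \<sigma> P) * wt \<beta> m)"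
       by (simp add: \<sigma>_def \<beta>_def lp_def)
     qed (use C1(1) xb lnx lp in auto)
     finally show "real (card (B (P * m) (real P))) \<le> D * wt \<beta> m" by (simp add: D_def mult_ac)
    qed
    also have "\<dots> = D * (\<Sum>m\<in>M3 P. wt \<beta> m)" by (simp only: sum_distrib_left)
    also have "\<dots> \<le> D * (Cp * (2 * exp (2 * \<sigma> P)) * exp L * tau L)"
    proof (rule mult_left_mono[OF _ D0])
     have "\<beta> \<le> 1/4" "0 \<le> \<beta>" "\<beta> * ln (real P) \<le> 20" using lp by (auto simp: \<beta>_def lp_def divide_le_eq)
     then obtain n where n: "(\<Sum>m\<in>smooth_many (real P) Y (K - b P). wt \<beta> m) \<le> (\<Sum>k\<in>{K - b P..n}. (L + Cs) ^ k / fact k)"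
      using Cs(2)[of "real P" \<beta> L Y "K - b P"] Pf(1) lle[OF Pf(1) Pp(2)] by auto
     have "(\<Sum>m\<in>M3 P. wt \<beta> m) \<le> (\<Sum>m\<in>smooth_many (real P) Y (K - b P). wt \<beta> m)"
      by (intro sum_mono2 wt_nonneg) (auto simp: M3_def)
     also note n
     also have "(\<Sum>k\<in>{K - b P..n}. (L + Cs) ^ k / fact k) \<le> Cp * 2 ^ b P * exp L * tau L"
      unfolding K_def by (rule Cp(3)[OF zb(4)])
     also have "\<dots> \<le> Cp * (2 * exp (2 * \<sigma> P)) * exp L * tau L"
     proof (intro mult_right_mono mult_left_mono)
      show "(2::real) ^ b P \<le> 2 * exp (2 * \<sigma> P)" using Pf(4) by (intro two_power_le_exp) (auto simp: b_def)
     qed (use Cp(1) tau0 in auto)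
     finally show "(\<Sum>m\<in>M3 P. wt \<beta> m) \<le> Cp * (2 * exp (2 * \<sigma> P)) * exp L * tau L" .
    qed
    also have "\<dots> = (2 * C1 * Cp * exp 6 * T) * ((1 / real P) * ((ln z / lp) * exp (- 2 * \<sigma> P)))"
    proof -
     have "exp (- 4 * \<sigma> P) * exp (2 * \<sigma> P) = exp (- 2 * \<sigma> P)" by (simp add: exp_add[symmetric])
     then have "D * (Cp * (2 * exp (2 * \<sigma> P)) * exp L * tau L)
      = C1 * (x / (lp * ln x)) * (exp 6 / real P) * (Cp * 2 * exp L * tau L) * exp (- 2 * \<sigma> P)"
      unfolding D_def by (simp only: mult_ac)
     then show ?thesis unfolding eL T_def by (simp add: mult_ac)
    qed
    also have "\<dots> \<le> (2 * C1 * Cp * exp 6 * T) * ((1 / real P) * (2 * (ln (real P) / ln x)))"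
    proof (intro mult_left_mono)
     have e: "exp (- 2 * \<sigma> P) \<le> 1 / (\<sigma> P)\<^sup>2"
     proof -
      have "(\<sigma> P)\<^sup>2 > 0" using Pf(4) by simp
      then have "1 / exp (2 * \<sigma> P) \<le> 1 / (\<sigma> P)\<^sup>2" using square_le_exp[of "\<sigma> P"] Pf(4) by (intro divide_left_mono) auto
      then show ?thesis by (simp add: exp_minus inverse_eq_divide)
     qed
     have "(ln z / lp) * exp (- 2 * \<sigma> P) \<le> (2 * \<sigma> P) * (1 / (\<sigma> P)\<^sup>2)"
     proof (intro mult_mono e)
      show "ln z / lp \<le> 2 * \<sigma> P" using Pf(4,5) unfolding lp_def by linarith
     qed (use Pf(4) in auto)
     also have "\<dots> = 2 * (ln (real P) / ln x)" using Pf(4) lp lnx by (simp add: \<sigma>_def power2_eq_square lp_def)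
     finally show "(ln z / lp) * exp (- 2 * \<sigma> P) \<le> 2 * (ln (real P) / ln x)" .
    qed (use C1(1) Cp(1) T0 in auto)
    finally show "real (card (\<Union>m\<in>M3 P. B (P * m) (real P))) \<le> 4 * C1 * Cp * exp 6 * T * ((1 / real P) * (ln (real P) / ln x))"
     by simp
   qed
   also have "\<dots> = 4 * C1 * Cp * exp 6 * T * (\<Sum>P\<in>Ps. (1 / real P) * (ln (real P) / ln x))" by (simp only: sum_distrib_left)
   also have "\<dots> \<le> 4 * C1 * Cp * exp 6 * T * 2"
    using C1(1) Cp(1) T0 finPs xb wx1 zb(3)
    by (intro mult_left_mono sum_prime_ln_ratio_le[of _ w]) (auto simp: Ps_def primes_le_iff)
   also have "\<dots> = C3 * T" by (simp add: C3_def)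
   finally show ?thesis .
  qed
  have "card (many_small_primes u v x z) \<le> card ((\<Union>M\<in>M1. B M w) \<union> S \<union> (\<Union>P\<in>Ps. \<Union>m\<in>M3 P. B (P * m) (real P)))"
   using cover finB finM1 finM3 finPs finS by (intro card_mono) auto
  also have "\<dots> \<le> card ((\<Union>M\<in>M1. B M w) \<union> S) + card (\<Union>P\<in>Ps. \<Union>m\<in>M3 P. B (P * m) (real P))" by (rule card_Un_le)
  also have "card ((\<Union>M\<in>M1. B M w) \<union> S) \<le> card (\<Union>M\<in>M1. B M w) + card S" by (rule card_Un_le)
  finally have "real (card (many_small_primes u v x z)) \<le> real (card (\<Union>M\<in>M1. B M w)) + real (card S) + real (card (\<Union>P\<in>Ps. \<Union>m\<in>M3 P. B (P * m) (real P)))"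
   by (simp only: of_nat_le_iff of_nat_add[symmetric] add_right_mono)
  also have "\<dots> \<le> 100 * C1 * Cp * T + C2 * T + C3 * T" using U1 U2 U3 by (intro add_mono)
  also have "\<dots> = C * T" by (simp add: C_def algebra_simps)
  finally show "real (card (many_small_primes u v x z)) \<le> C * (x / ln x * tau (ln (ln z)))" by (simp only: T_def L_def)
 qed
qed

section \<open>Few small prime factors\<close>

definition few_small_primes :: "nat \<Rightarrow> int \<Rightarrow> int \<Rightarrow> real \<Rightarrow> real \<Rightarrow> nat set" where
 "few_small_primes u a v x z = {p \<in> shifted_primes u v x.
  card {l \<in> prime_factors (nat (int u * int p + v)). real l \<le> z powr (1/100)} < omega_cut (ln (ln z)) \<and>
  (\<exists>d q :: nat. prime q \<and> int q = int d + a \<and> z < real d \<and> real d \<le> z\<^sup>2 \<and> int d dvd int u * int p + v)}"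

text \<open>If the decomposition stops at \<open>P\<close>, then \<open>P\<close> divides the smooth part of \<open>d\<close> or that of the codivisor, and it is
split off from there. The losses \<open>exp (17 ln z / ln P)\<close> of the sieve and of the average are compensated by
Rankin's trick with \<open>A = 200\<close>; \<open>t0 = exp 800\<close> ensures \<open>\<beta> = A / ln P \<le> 1/4\<close>.\<close>

lemma card_few_small_primes_le:
 fixes u :: nat and a v :: int
 assumes "u \<ge> 1" "v \<noteq> 0" "a \<noteq> 0" "v \<noteq> - a * int u"
 shows "\<exists>C z0. C > 0 \<and> (\<forall>x z. z \<ge> z0 \<longrightarrow> x \<ge> z0 \<longrightarrow> z \<le> x powr (11/10) \<longrightarrow>
  real (card (few_small_primes u a v x z)) \<le> C * (x / ln x * tau (ln (ln z))))"
proof -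
 define t0 :: real where "t0 = exp 800"
 obtain C1 z1 where C1: "C1 > 0" "\<And>x z t d1 m1. z \<ge> z1 \<Longrightarrow> x \<ge> 1 \<Longrightarrow> z \<le> x powr (11/10) \<Longrightarrow> d1 \<ge> 1 \<Longrightarrow> m1 \<ge> 1 \<Longrightarrow>
  real (d1 * m1) \<le> z powr (1/5) \<Longrightarrow> 2 \<le> t \<Longrightarrow> t \<le> z powr (1/100) \<Longrightarrow>
  real (card (split_set u a v x z t d1 m1))
   \<le> C1 * (x / (ln x * (ln z)\<^sup>2)) * exp (16 * (ln z / ln t)) * (wt 0 (d1 * m1) * (1 + shift_average a v x z t m1))"
  using card_split_set_le[OF assms] by blast
 obtain C2 z2 where C2: "C2 > 0" "\<And>x z. z \<ge> z2 \<Longrightarrow> x \<ge> z2 \<Longrightarrow>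
  real (card (smooth_divisor_primes u v x z t0)) \<le> C2 * (x / ln x * tau (ln (ln z)))"
  using count_smooth_divisor[OF assms(1,2), of t0] exp_ge_add_one_self[of "800::real"] unfolding t0_def by fastforce
 have A0: "(200::real) \<ge> 0" by simp
 obtain Ca z3 where Ca: "Ca > 0" "\<And>x z t w \<beta> Y c. z \<ge> z3 \<Longrightarrow> x \<ge> z3 \<Longrightarrow> w \<ge> 2 \<Longrightarrow> w \<le> z \<Longrightarrow> 0 \<le> \<beta> \<Longrightarrow> \<beta> \<le> 1/4 \<Longrightarrow> \<beta> * ln w \<le> 200 \<Longrightarrow>
  2 \<le> t \<Longrightarrow> t \<le> x \<Longrightarrow> t \<le> z \<Longrightarrow> real c * Y \<le> x \<Longrightarrow>
  (\<Sum>(d, m)\<in>{(d, m) \<in> smooth_pairs w Y. card (prime_factors (d * m)) < omega_cut (ln (ln z))}. wt \<beta> (d * m) * (1 + shift_average a v x z t (c * m)))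
   \<le> Ca * ((ln z)\<^sup>2 * tau (ln (ln z))) * exp (ln z / ln t)"
  using sum_shift_average_le[OF assms(2) A0, of a] by blast
 let ?P = "\<lambda>z::real. ln (ln z) \<ge> 1 \<and> z \<ge> max (max z1 z2) (max z3 16) \<and> z powr (1/100) \<ge> 2"
 have "eventually ?P at_top" by ((intro eventually_conj)?; (real_asymp | rule eventually_ge_at_top))
 then obtain z0 where z0: "\<And>z. z \<ge> z0 \<Longrightarrow> ?P z" by (auto simp: eventually_at_top_linorder)
 define C3 where "C3 = 4 * C1 * Ca * exp 6"
 define C0 where "C0 = C1 * exp 1600 * (Ca * exp 100)"
 show ?thesis
 proof (rule exI[of _ "C0 + C2 + C3"], rule exI[of _ z0], intro conjI allI impI)
  show "C0 + C2 + C3 > 0" using C1 C2 Ca by (auto simp: C0_def C3_def intro!: add_pos_pos)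
  fix x z :: real assume z: "z \<ge> z0" "z \<le> x powr (11/10)" and x: "x \<ge> z0"
  define L where "L = ln (ln z)"
  define w where "w = z powr (1/100)"
  define K where "K = omega_cut L"
  define T where "T = x / ln x * tau L"
  define Q where "Q = x / (ln x * (ln z)\<^sup>2)"
  have zb: "z \<ge> z1" "z \<ge> z2" "z \<ge> z3" "z \<ge> 16" "w \<ge> 2" "L \<ge> 1" using z0[OF z(1)] by (auto simp: w_def L_def)
  have xb: "x \<ge> z2" "x \<ge> z3" "x \<ge> 16" using z0[OF x] by auto
  have lnz: "ln z > 0" and lnx: "ln x > 0" using zb xb by auto
  have lnw: "ln w = ln z / 100" using zb by (simp add: w_def ln_powr)
  have zpow: "z powr c \<le> x powr (11/10 * c)" if "c \<ge> 0" for c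
  proof -
   have "z powr c \<le> (x powr (11/10)) powr c" using z zb that by (intro powr_mono2) auto
   then show ?thesis by (simp add: powr_powr)
  qed
  have xmono: "x powr c \<le> x powr c'" if "c \<le> c'" for c c' using that xb by (intro powr_mono) auto
  have wx1: "w \<le> x" using order_trans[OF zpow[of "1/100"] xmono[of "11/10 * (1/100)" 1]] xb by (simp add: w_def)
  have wz: "w \<le> z" using powr_mono[of "1/100" 1 z] zb by (simp add: w_def)
  have tau0: "tau L > 0" using zb by (intro tau_pos) simp
  have T0: "T > 0" using xb lnx tau0 by (simp add: T_def)
  have Q0: "Q > 0" using xb lnx lnz by (simp add: Q_def)
  have QT: "Q * ((ln z)\<^sup>2 * tau L) = T" using lnz by (simp add: Q_def T_def)
  define Y where "Y = z powr (1/8)"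
  have Y1: "Y \<ge> 1" using zb by (simp add: Y_def ge_one_powr_ge_zero)
  have wY: "w * Y = z powr (27/200)" by (simp add: w_def Y_def powr_add[symmetric])
  have Yz: "Y \<le> z powr (1/5)" unfolding Y_def using zb by (intro powr_mono) auto
  have wYz: "w * Y \<le> z powr (1/5)" unfolding wY using zb by (intro powr_mono) auto
  have wYx: "w * Y \<le> x powr (3/4)" unfolding wY using order_trans[OF zpow[of "27/200"] xmono[of _ "3/4"]] by simp
  have wYx1: "w * Y \<le> x" using order_trans[OF wYx xmono[of "3/4" 1]] xb by simp
  have Yx: "Y \<le> x" using order_trans[OF zpow[of "1/8"] xmono[of "11/10 * (1/8)" 1]] xb by (simp add: Y_def)
  define SP where "SP = (\<lambda>t. smooth_pairs_few t Y K)"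
  define SY where "SY = (\<lambda>P::nat. {y \<in> SP (real P). Y < real (P * (fst y * snd y))})"
  define S where "S = smooth_divisor_primes u v x z t0"
  define Ps where "Ps = {P. prime P \<and> t0 \<le> real P \<and> real P \<le> w}"
  define B where "B = split_set u a v x z"
  define B2 where "B2 = (\<lambda>P y. B (real P) (P * fst y) (snd y) \<union> B (real P) (fst y) (P * snd y))"
  define s where "s = (\<lambda>P::nat. ln z / ln (real P))"
  have finB: "finite (B t d m)" for t d m unfolding B_def split_set_def by simp
  have finB2: "finite (B2 P y)" for P y using finB by (simp add: B2_def)
  have finSP: "finite (SP t)" for t unfolding SP_def by (rule finite_subset[OF _ finite_smooth_pairs[of t Y]]) auto
  have finSY: "finite (SY P)" for P using finSP by (simp add: SY_def)
  have finPs: "finite Ps" by (rule finite_subset[OF _ finite_primes_le[of w]]) (auto simp: Ps_def primes_le_iff)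
  have finS: "finite S" by (simp add: S_def)
  have Pfact: "real P \<ge> 2" "ln (real P) \<ge> 800" "s P \<ge> 100" if "P \<in> Ps" for P
  proof -
   have P: "prime P" "exp 800 \<le> real P" "real P \<le> w" using that by (auto simp: Ps_def t0_def)
   show "real P \<ge> 2" using P(1) prime_ge_2_nat[of P] by simp
   have "ln (exp 800) \<le> ln (real P)" using P prime_gt_0_nat[OF P(1)] by (subst ln_le_cancel_iff) auto
   then show l80: "ln (real P) \<ge> 800" by simp
   have "ln (real P) \<le> ln w" using P prime_gt_0_nat[OF P(1)] zb(5) by (subst ln_le_cancel_iff) auto
   then have "ln (real P) * 100 \<le> ln z" using lnw by simp
   then show "s P \<ge> 100" using l80 by (simp add: s_def le_divide_eq mult.commute)
  qed
  have cover: "few_small_primes u a v x z \<subseteq> (\<Union>y\<in>SP w. B w (fst y) (snd y)) \<union> S \<union> (\<Union>P\<in>Ps. \<Union>y\<in>SY P. B2 P y)"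
  proof
   fix p assume p: "p \<in> few_small_primes u a v x z"
   then have ps: "p \<in> shifted_primes u v x" by (simp add: few_small_primes_def)
   then have Npos: "int u * int p + v > 0" by (auto simp: shifted_primes_def)
   define N where "N = nat (int u * int p + v)"
   have N: "int u * int p + v = int N" "N > 0" using Npos by (auto simp: N_def)
   define F where "F = {l \<in> prime_factors N. real l \<le> w}"
   have KF: "card F < K" using p by (simp add: few_small_primes_def K_def L_def F_def N_def w_def)
   have finF: "finite F" by (simp add: F_def)
   have "\<exists>d q :: nat. prime q \<and> int q = int d + a \<and> z < real d \<and> real d \<le> z\<^sup>2 \<and> int d dvd int u * int p + v"
    using p by (simp add: few_small_primes_def)
   then obtain d q :: nat where d: "prime q" "int q = int d + a" "z < real d" "real d \<le> z\<^sup>2" "int d dvd int u * int p + v" by blast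
   have dN: "d dvd N" using d(5) unfolding N(1) by simp
   have d0: "d > 0" using dN N(2) by (auto intro!: Nat.gr0I)
   \<comment> \<open>A factorisation \<open>N = M r\<close> with rough \<open>r\<close> splits \<open>d\<close> along it.\<close>
   have split: "p \<in> B t (gcd d M) (M div gcd d M)" if NM: "N = M * r" and tr: "rough t r" for M r t
   proof -
    have pos: "M > 0" "r > 0" using NM N(2) by auto
    define d1 where "d1 = gcd d M"
    have d1: "d1 > 0" using d0 by (simp add: d1_def)
    obtain d2 where d2: "d = d1 * d2" unfolding d1_def using gcd_dvd1 by (metis dvdE)
    obtain m1 where m1: "M = d1 * m1" unfolding d1_def using gcd_dvd2 by (metis dvdE)
    have "coprime d2 m1"
    proof -
     have "coprime (d div gcd d M) (M div gcd d M)" using d0 by (intro div_gcd_coprime) auto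
     then show ?thesis using d1 unfolding d1_def[symmetric] by (simp add: d2 m1)
    qed
    moreover have "d2 dvd m1 * r"
    proof -
     have "d1 * d2 dvd d1 * (m1 * r)" using dN NM d2 m1 by (simp add: mult_ac)
     then show ?thesis using d1 by simp
    qed
    ultimately have "d2 dvd r" by (simp add: coprime_dvd_mult_right_iff)
    then obtain m2 where m2: "r = d2 * m2" by (elim dvdE)
    have e: "M div gcd d M = m1" using d1 unfolding d1_def[symmetric] by (simp add: m1)
    have r2: "rough t d2" "rough t m2" using rough_dvd[OF tr] m2 by auto
    have pos2: "d2 > 0" "m2 > 0" using pos m2 by auto
    have eN: "int u * int p + v = int (d1 * m1 * d2 * m2)" using N(1) NM m1 m2 by (simp add: mult_ac)
    have d12: "z < real (d1 * d2)" "real (d1 * d2) \<le> z\<^sup>2" "\<exists>q::nat. prime q \<and> int q = int (d1 * d2) + a"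
     using d(1-4) unfolding d2[symmetric] by blast+
    have "p \<in> B t d1 m1" unfolding B_def split_set_def mem_Collect_eq
     by (rule conjI[OF ps], rule exI[of _ d2], rule exI[of _ m2], intro conjI pos2 eN r2 d12)
    then show ?thesis by (simp only: e d1_def)
   qed
   show "p \<in> (\<Union>y\<in>SP w. B w (fst y) (snd y)) \<union> S \<union> (\<Union>P\<in>Ps. \<Union>y\<in>SY P. B2 P y)"
   proof (rule prefix_decomposition[OF N(2) Y1, of w])
    fix M r assume h: "N = M * r" "real M \<le> Y" "\<And>p. prime p \<Longrightarrow> p dvd M \<Longrightarrow> real p \<le> w" "\<And>p. prime p \<Longrightarrow> p dvd r \<Longrightarrow> real p > w"
    have pos: "M > 0" "r > 0" using h(1) N(2) by auto
    have "rough w r" unfolding rough_def using h(4) by (auto simp: less_imp_le)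
    then have "p \<in> B w (gcd d M) (M div gcd d M)" by (rule split[OF h(1)])
    moreover have "(gcd d M, M div gcd d M) \<in> SP w"
    proof -
     have "prime_factors M \<subseteq> F" using h(1,3) N(2) by (auto simp: F_def in_prime_factors_iff)
     then have "card (prime_factors M) < K" using KF card_mono[OF finF] by (meson le_less_trans)
     moreover have "prime_factors M \<subseteq> primes_le w" using h(3) by (auto simp: in_prime_factors_iff primes_le_iff)
     moreover have "gcd d M * (M div gcd d M) = M" by simp
     then have "real (gcd d M) * real (M div gcd d M) = real M" by (simp only: of_nat_mult[symmetric])
     moreover have "gcd d M > 0" using pos by simp
     moreover have "M div gcd d M > 0" using pos by (simp add: div_greater_zero_iff dvd_imp_le)
     ultimately show ?thesis using h(2) unfolding SP_def smooth_pairs_def by simp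
    qed
    ultimately show ?thesis by force
   next
    fix M r P assume h: "N = P * M * r" "prime P" "real P \<le> w" "real M \<le> Y" "real (P * M) > Y"
     "\<And>p. prime p \<Longrightarrow> p dvd M \<Longrightarrow> p \<le> P" "\<And>p. prime p \<Longrightarrow> p dvd r \<Longrightarrow> P \<le> p"
    have pos: "M > 0" "r > 0" "P > 0" using h(1) N(2) by auto
    show ?thesis
    proof (cases "t0 \<le> real P")
     case False
     have "real P * real M \<le> w * Y" using h(3,4) zb by (intro mult_mono) auto
     then have "real (P * M) \<le> x powr (3/4)" using wYx by simp
     moreover have "prime_factors (P * M) \<subseteq> primes_le t0"
     proof
      fix l assume "l \<in> prime_factors (P * M)"
      then have l: "prime l" "l dvd P \<or> l dvd M" by (auto simp: in_prime_factors_iff prime_dvd_mult_iff)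
      then have "l \<le> P" using h(2,6) pos dvd_imp_le[of l P] by auto
      then have "real l \<le> real P" by simp
      then show "l \<in> primes_le t0" using l False by (simp add: primes_le_iff)
     qed
     moreover have "int u * int p + v = int ((P * M) * r)" using N(1) h(1) by simp
     moreover have "z powr (1/8) < real (P * M)" using h(5) by (simp only: Y_def)
     ultimately have "p \<in> S" using ps unfolding S_def by blast
     then show ?thesis by blast
    next
     case True
     then have PPs: "P \<in> Ps" using h(2,3) by (simp add: Ps_def)
     define d1 where "d1 = gcd d (P * M)"
     define m1 where "m1 = (P * M) div d1"
     have dm: "d1 * m1 = P * M" by (simp add: d1_def m1_def)
     have pos1: "d1 > 0" "m1 > 0" using pos dm by (auto intro!: Nat.gr0I)
     have "rough (real P) r" unfolding rough_def using h(7) by auto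
     then have pB: "p \<in> B (real P) d1 m1" unfolding d1_def m1_def using split[of "P * M" r] h(1) by simp
     have key: "(e, f) \<in> SY P" if ef: "e * f = M" for e f
     proof -
      have "prime_factors M \<subseteq> F"
      proof
       fix l assume l: "l \<in> prime_factors M"
       then have l': "prime l" "l dvd M" by (auto simp: in_prime_factors_iff)
       have "real l \<le> real P" using h(6)[OF l'] by simp
       then show "l \<in> F" using l' h(1,3) N(2) by (auto simp: F_def in_prime_factors_iff)
      qed
      then have "card (prime_factors M) < K" using KF card_mono[OF finF] by (meson le_less_trans)
      moreover have "prime_factors M \<subseteq> primes_le (real P)" using h(6) by (auto simp: in_prime_factors_iff primes_le_iff)
      moreover have "real e * real f = real M" by (simp only: of_nat_mult[symmetric] ef)
      moreover have "e > 0" "f > 0" using ef pos by (auto intro!: Nat.gr0I)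
      ultimately show ?thesis using h(4,5) unfolding SY_def SP_def smooth_pairs_def by (simp add: ef)
     qed
     have "P dvd d1 * m1" unfolding dm by simp
     then consider "P dvd d1" | "P dvd m1" using h(2) prime_dvd_mult_iff by blast
     then show ?thesis
     proof cases
      case 1
      then obtain e where e: "d1 = P * e" by (elim dvdE)
      have "e * m1 = M" using dm e pos by simp
      then have "(e, m1) \<in> SY P" by (rule key)
      moreover have "p \<in> B2 P (e, m1)" using pB e by (simp add: B2_def)
      ultimately show ?thesis using PPs by blast
     next
      case 2
      then obtain e where e: "m1 = P * e" by (elim dvdE)
      have "d1 * e = M" using dm e pos by simp
      then have "(d1, e) \<in> SY P" by (rule key)
      moreover have "p \<in> B2 P (d1, e)" using pB e by (simp add: B2_def)
      ultimately show ?thesis using PPs by blast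
     qed
    qed
   qed
  qed
  have U1: "real (card (\<Union>y\<in>SP w. B w (fst y) (snd y))) \<le> C0 * T"
  proof -
   define G where "G = (\<lambda>y. wt 0 (fst y * snd y) * (1 + shift_average a v x z w (1 * snd y)))"
   have "real (card (\<Union>y\<in>SP w. B w (fst y) (snd y))) \<le> (\<Sum>y\<in>SP w. C1 * Q * exp 1600 * G y)"
   proof (rule card_UN_le_sum[OF finSP])
    fix y assume y: "y \<in> SP w"
    have dm: "fst y \<ge> 1" "snd y \<ge> 1" "real (fst y * snd y) \<le> Y" using y by (auto simp: SP_def smooth_pairs_def)
    have "ln z / ln w = 100" using lnz by (simp add: lnw)
    then show "real (card (B w (fst y) (snd y))) \<le> C1 * Q * exp 1600 * G y"
     unfolding B_def Q_def G_def
     using C1(2)[OF zb(1) _ z(2) dm(1,2), of w] dm(3) Yz xb zb by (simp add: w_def)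
   qed
   also have "\<dots> = C1 * Q * exp 1600 * (\<Sum>y\<in>SP w. G y)" by (simp only: sum_distrib_left)
   also have "\<dots> \<le> C1 * Q * exp 1600 * (Ca * ((ln z)\<^sup>2 * tau L) * exp 100)"
   proof (rule mult_left_mono)
    have "ln z / ln w = 100" using lnz by (simp add: lnw)
    then show "(\<Sum>y\<in>SP w. G y) \<le> Ca * ((ln z)\<^sup>2 * tau L) * exp 100"
     using Ca(2)[of z x w 0 w 1 Y] zb xb wz wx1 Yx by (simp add: SP_def K_def L_def G_def case_prod_unfold)
   qed (use C1 Q0 in simp)
   also have "\<dots> = C0 * (Q * ((ln z)\<^sup>2 * tau L))" by (simp add: C0_def)
   finally show ?thesis by (simp only: QT)
  qed
  have U2: "real (card S) \<le> C2 * T"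
   unfolding S_def T_def L_def by (rule C2(2)[OF zb(2) xb(1)])
  have U3: "real (card (\<Union>P\<in>Ps. \<Union>y\<in>SY P. B2 P y)) \<le> C3 * T"
  proof -
   have "real (card (\<Union>P\<in>Ps. \<Union>y\<in>SY P. B2 P y)) \<le> (\<Sum>P\<in>Ps. 2 * C1 * Ca * exp 6 * T * ((1 / real P) * (ln (real P) / ln z)))"
   proof (rule card_UN_le_sum[OF finPs])
    fix P assume P: "P \<in> Ps"
    note Pf = Pfact[OF P]
    have Pp: "prime P" "real P \<le> w" using P by (auto simp: Ps_def)
    have P0: "P > 0" using Pp prime_gt_0_nat by blast
    define \<beta> where "\<beta> = 200 / ln (real P)"
    define D where "D = C1 * Q * exp (16 * s P) * (exp 6 / real P * exp (- 20 * s P))"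
    define G where "G = (\<lambda>c y. wt \<beta> (fst y * snd y) * (1 + shift_average a v x z (real P) (c * snd y)))"
    have D0: "D \<ge> 0" using C1(1) Q0 by (simp add: D_def)
    have "real (card (\<Union>y\<in>SY P. B2 P y)) \<le> (\<Sum>y\<in>SY P. D * (G 1 y + G P y))"
    proof (rule card_UN_le_sum[OF finSY])
     fix y assume y: "y \<in> SY P"
     define d where "d = fst y"
     define m where "m = snd y"
     have dm: "d > 0" "m > 0" "real (d * m) \<le> Y" "Y < real (P * (d * m))"
      using y by (auto simp: SY_def SP_def smooth_pairs_def d_def m_def)
     have Pdm: "real (P * (d * m)) \<le> z powr (1/5)"
     proof -
      have "real P * real (d * m) \<le> w * Y" using Pp dm(3) zb by (intro mult_mono) auto
      then show ?thesis using wYz by (simp only: of_nat_mult)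
     qed
     have W: "wt 0 (P * (d * m)) \<le> exp 6 / real P * (exp (- 20 * s P) * wt \<beta> (d * m))"
     proof -
      have "wt 0 ((d * m) * P) \<le> exp 6 / real P * (exp (- 200 * ((1/8 - 1/40) * (ln z / ln (real P)))) * wt (200 / ln (real P)) (d * m))"
       using Pp dm zb Pf(3) by (intro wt_prime_mult_rankin) (auto simp: Y_def s_def)
      then show ?thesis by (simp add: s_def \<beta>_def mult_ac)
     qed
     have one: "real (card (B (real P) e f)) \<le> D * (wt \<beta> (d * m) * (1 + shift_average a v x z (real P) f))"
      if ef: "e * f = P * (d * m)" for e f
     proof -
      have pos: "e \<ge> 1" "f \<ge> 1" using ef P0 dm by (auto intro!: Suc_leI Nat.gr0I)
      have "real (card (B (real P) e f)) \<le> C1 * Q * exp (16 * s P) * (wt 0 (e * f) * (1 + shift_average a v x z (real P) f))"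
       unfolding B_def Q_def s_def
       using Pdm Pf Pp xb by (intro C1(2)[OF zb(1) _ z(2) pos]) (auto simp: ef w_def simp del: of_nat_mult)
      also have "\<dots> \<le> C1 * Q * exp (16 * s P) * ((exp 6 / real P * (exp (- 20 * s P) * wt \<beta> (d * m))) * (1 + shift_average a v x z (real P) f))"
       unfolding ef using W C1(1) Q0 shift_average_nonneg[of a v x z "real P" f] by (intro mult_left_mono mult_right_mono) auto
      also have "\<dots> = D * (wt \<beta> (d * m) * (1 + shift_average a v x z (real P) f))" by (simp only: D_def mult_ac)
      finally show ?thesis .
     qed
     have "real (card (B2 P y)) \<le> real (card (B (real P) (P * d) m)) + real (card (B (real P) d (P * m)))"
      using card_Un_le[of "B (real P) (P * d) m" "B (real P) d (P * m)"] unfolding B2_def d_def m_def by linarith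
     also have "\<dots> \<le> D * (wt \<beta> (d * m) * (1 + shift_average a v x z (real P) m)) + D * (wt \<beta> (d * m) * (1 + shift_average a v x z (real P) (P * m)))"
      by (intro add_mono one) (simp_all add: mult_ac)
     also have "\<dots> = D * (G 1 y + G P y)" unfolding G_def d_def m_def distrib_left[of D] mult_1_left by (rule refl)
     finally show "real (card (B2 P y)) \<le> D * (G 1 y + G P y)" .
    qed
    also have "\<dots> = D * ((\<Sum>y\<in>SY P. G 1 y) + (\<Sum>y\<in>SY P. G P y))" by (simp only: sum_distrib_left[symmetric] sum.distrib)
    also have "\<dots> \<le> D * (Ca * ((ln z)\<^sup>2 * tau L) * exp (s P) + Ca * ((ln z)\<^sup>2 * tau L) * exp (s P))"
    proof (intro mult_left_mono add_mono)
     have G: "(\<Sum>y\<in>SY P. G c y) \<le> Ca * ((ln z)\<^sup>2 * tau L) * exp (s P)" if c: "real c * Y \<le> x" for c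
     proof -
      have "(\<Sum>y\<in>SY P. G c y) \<le> (\<Sum>y\<in>SP (real P). G c y)"
       using finSP by (intro sum_mono2) (auto simp: SY_def G_def intro!: mult_nonneg_nonneg add_nonneg_nonneg wt_nonneg shift_average_nonneg)
      also have "\<dots> \<le> Ca * ((ln z)\<^sup>2 * tau L) * exp (s P)"
       using Ca(2)[OF zb(3) xb(2), of "real P" \<beta> "real P" c Y] Pf Pp wz wx1 c
       by (simp add: SP_def K_def L_def G_def s_def \<beta>_def case_prod_unfold divide_le_eq)
      finally show ?thesis .
     qed
     show "(\<Sum>y\<in>SY P. G 1 y) \<le> Ca * ((ln z)\<^sup>2 * tau L) * exp (s P)" using Yx by (intro G) simp
     have "real P * Y \<le> w * Y" using Pp Y1 by (intro mult_right_mono) auto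
     then show "(\<Sum>y\<in>SY P. G P y) \<le> Ca * ((ln z)\<^sup>2 * tau L) * exp (s P)" using wYx1 by (intro G) simp
    qed (rule D0)
    also have "\<dots> = 2 * C1 * Ca * exp 6 * (Q * ((ln z)\<^sup>2 * tau L)) * ((1 / real P) * (exp (16 * s P) * exp (- 20 * s P) * exp (s P)))"
     unfolding D_def by (simp add: mult_ac)
    also have "exp (16 * s P) * exp (- 20 * s P) * exp (s P) = exp (- 3 * s P)" by (simp add: exp_add[symmetric])
    also have "2 * C1 * Ca * exp 6 * (Q * ((ln z)\<^sup>2 * tau L)) * ((1 / real P) * exp (- 3 * s P))
      \<le> 2 * C1 * Ca * exp 6 * T * ((1 / real P) * (ln (real P) / ln z))"
     unfolding QT
    proof (intro mult_left_mono)
     have "s P \<le> exp (3 * s P)" using Pf(3) exp_ge_add_one_self[of "3 * s P"] by linarith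
     then have "1 / exp (3 * s P) \<le> 1 / s P" using Pf(3) by (intro divide_left_mono) auto
     then show "exp (- 3 * s P) \<le> ln (real P) / ln z" by (simp add: exp_minus inverse_eq_divide s_def)
    qed (use C1(1) Ca(1) T0 in auto)
    finally show "real (card (\<Union>y\<in>SY P. B2 P y)) \<le> 2 * C1 * Ca * exp 6 * T * ((1 / real P) * (ln (real P) / ln z))" .
   qed
   also have "\<dots> = 2 * C1 * Ca * exp 6 * T * (\<Sum>P\<in>Ps. (1 / real P) * (ln (real P) / ln z))" by (simp only: sum_distrib_left)
   also have "\<dots> \<le> 2 * C1 * Ca * exp 6 * T * 2"
    using C1(1) Ca(1) T0 finPs zb wz
    by (intro mult_left_mono sum_prime_ln_ratio_le[of _ w]) (auto simp: Ps_def primes_le_iff)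
   also have "\<dots> = C3 * T" by (simp add: C3_def)
   finally show ?thesis .
  qed
  have "card (few_small_primes u a v x z) \<le> card ((\<Union>y\<in>SP w. B w (fst y) (snd y)) \<union> S \<union> (\<Union>P\<in>Ps. \<Union>y\<in>SY P. B2 P y))"
   using cover finB finB2 finSP finSY finPs finS by (intro card_mono) auto
  also have "\<dots> \<le> card ((\<Union>y\<in>SP w. B w (fst y) (snd y)) \<union> S) + card (\<Union>P\<in>Ps. \<Union>y\<in>SY P. B2 P y)" by (rule card_Un_le)
  also have "card ((\<Union>y\<in>SP w. B w (fst y) (snd y)) \<union> S) \<le> card (\<Union>y\<in>SP w. B w (fst y) (snd y)) + card S" by (rule card_Un_le)
  finally have "real (card (few_small_primes u a v x z)) \<le> real (card (\<Union>y\<in>SP w. B w (fst y) (snd y))) + real (card S) + real (card (\<Union>P\<in>Ps. \<Union>y\<in>SY P. B2 P y))"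
   by (simp only: of_nat_le_iff of_nat_add[symmetric] add_right_mono)
  also have "\<dots> \<le> C0 * T + C2 * T + C3 * T" using U1 U2 U3 by (intro add_mono)
  also have "\<dots> = (C0 + C2 + C3) * T" by (simp add: algebra_simps)
  finally show "real (card (few_small_primes u a v x z)) \<le> (C0 + C2 + C3) * (x / ln x * tau (ln (ln z)))" by (simp only: T_def L_def)
 qed
qed

section \<open>Summation over scales\<close>

definition scale_set :: "int \<Rightarrow> nat \<Rightarrow> int \<Rightarrow> real \<Rightarrow> real \<Rightarrow> nat set" where
 "scale_set a u v x z = {p. prime p \<and> real p \<le> x \<and> int u * int p + v \<noteq> 0 \<and>
  (\<exists>q::nat. prime q \<and> z < real_of_int (int q - a) \<and> real_of_int (int q - a) \<le> z\<^sup>2 \<and> (int q - a) dvd int u * int p + v)}"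

lemma finite_scale_set: "finite (scale_set a u v x z)"
 by (rule finite_subset[OF _ finite_primes_le[of x]]) (auto simp: scale_set_def primes_le_iff)

lemma linear_form_bound:
 fixes u :: nat and v :: int
 assumes "real p \<le> x" "x \<ge> 1" "int u * int p + v \<noteq> 0" "d dvd int u * int p + v"
 shows "real_of_int d \<le> (real u + real_of_int \<bar>v\<bar>) * x"
proof -
 have "\<bar>d\<bar> \<le> \<bar>int u * int p + v\<bar>" using assms(3,4) by (simp add: dvd_imp_le_int)
 then have "d \<le> int u * int p + \<bar>v\<bar>" using zero_le_mult_iff[of "int u" "int p"] by linarith
 then have "real_of_int d \<le> real_of_int (int u * int p + \<bar>v\<bar>)" by (simp only: of_int_le_iff)
 also have "\<dots> = real u * real p + real_of_int \<bar>v\<bar> * 1" by simp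
 also have "\<dots> \<le> real u * x + real_of_int \<bar>v\<bar> * x" using assms by (intro add_mono mult_left_mono) auto
 finally show ?thesis by (simp add: distrib_right)
qed

lemma card_primes_le_le: "y \<ge> 0 \<Longrightarrow> real (card (primes_le y)) \<le> y"
proof -
 assume y: "y \<ge> 0"
 have "primes_le y \<subseteq> {1..nat \<lfloor>y\<rfloor>}" using prime_ge_1_nat by (auto simp: primes_le_iff le_nat_floor)
 then have "card (primes_le y) \<le> card {1..nat \<lfloor>y\<rfloor>}" by (intro card_mono) auto
 then have "card (primes_le y) \<le> nat \<lfloor>y\<rfloor>" by simp
 then have "real (card (primes_le y)) \<le> real (nat \<lfloor>y\<rfloor>)" by (simp only: of_nat_le_iff)
 then show ?thesis using of_nat_floor[OF y] by linarith
qed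

text \<open>A divisor of \<open>u p + v\<close> is \<open>O(x)\<close>, so that the set is empty unless \<open>z\<close> is, and then \<open>z \<le> x^(11/10)\<close> for large \<open>z\<close>.
Negative values of \<open>u p + v\<close> are bounded and have no divisor above \<open>z\<close>.\<close>

lemma card_scale_set_le:
 fixes u :: nat and a v :: int
 assumes "u \<ge> 1" "v \<noteq> 0" "a \<noteq> 0" "v \<noteq> - a * int u"
 shows "\<exists>C z0. C > 0 \<and> (\<forall>x z. z \<ge> z0 \<longrightarrow> x \<ge> 3 \<longrightarrow> real (card (scale_set a u v x z)) \<le> C * (x / ln x * tau (ln (ln z))))"
proof -
 obtain C1 z1 where C1: "C1 > 0" "\<And>x z. z \<ge> z1 \<Longrightarrow> x \<ge> z1 \<Longrightarrow> z \<le> x powr (11/10) \<Longrightarrow>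
  real (card (many_small_primes u v x z)) \<le> C1 * (x / ln x * tau (ln (ln z)))"
  using card_many_small_primes_le[OF assms(1,2)] by blast
 obtain C2 z2 where C2: "C2 > 0" "\<And>x z. z \<ge> z2 \<Longrightarrow> x \<ge> z2 \<Longrightarrow> z \<le> x powr (11/10) \<Longrightarrow>
  real (card (few_small_primes u a v x z)) \<le> C2 * (x / ln x * tau (ln (ln z)))"
  using card_few_small_primes_le[OF assms] by blast
 obtain z3 where z3: "\<And>z. z \<ge> z3 \<Longrightarrow> tau_large z"
  using tau_lower by auto
 let ?P = "\<lambda>x::real. x powr (1/2) \<le> x / ln x * x powr (-1/4) \<and> x \<ge> 3"
 have "eventually ?P at_top" by ((intro eventually_conj)?; (real_asymp | rule eventually_ge_at_top))
 then obtain x4 where x4: "\<And>x. x \<ge> x4 \<Longrightarrow> ?P x" by (auto simp: eventually_at_top_linorder)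
 define k where "k = real u + real_of_int \<bar>v\<bar>"
 have k1: "k \<ge> 1" using assms by (simp add: k_def)
 define Z where "Z = max (max z1 z2) x4"
 let ?P = "\<lambda>z::real. z powr (10/11) \<ge> Z \<and> z powr (1/11) \<ge> k \<and> z \<ge> max (max Z z3) k"
 have "eventually ?P at_top" by ((intro eventually_conj)?; (real_asymp | rule eventually_ge_at_top))
 then obtain z0 where z0: "\<And>z. z \<ge> z0 \<Longrightarrow> ?P z" by (auto simp: eventually_at_top_linorder)
 show ?thesis
 proof (rule exI[of _ "1 + C1 + C2"], rule exI[of _ z0], intro conjI allI impI)
  show "1 + C1 + C2 > 0" using C1 C2 by simp
  fix x z :: real assume z: "z \<ge> z0" and x: "x \<ge> 3"
  define T where "T = x / ln x * tau (ln (ln z))"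
  have zb: "z powr (10/11) \<ge> Z" "z powr (1/11) \<ge> k" "z \<ge> Z" "z \<ge> z3" "z \<ge> k" using z0[OF z] by auto
  note zt = z3[OF zb(4)]
  have lnx: "ln x > 0" using x by simp
  have "tau (ln (ln z)) > 0" using zt by (intro tau_pos) linarith
  then have T0: "T \<ge> 0" using x lnx by (simp add: T_def)
  have "real (card (scale_set a u v x z)) \<le> (1 + C1 + C2) * T"
  proof (cases "scale_set a u v x z = {}")
   case True
   then show ?thesis using T0 C1 C2 by simp
  next
   case False
   then obtain p where "p \<in> scale_set a u v x z" by blast
   then obtain q :: nat where q: "real p \<le> x" "int u * int p + v \<noteq> 0" "z < real_of_int (int q - a)" "(int q - a) dvd int u * int p + v"
    unfolding scale_set_def by blast
   have "real_of_int (int q - a) \<le> k * x" unfolding k_def using x by (intro linear_form_bound[OF q(1) _ q(2,4)]) simp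
   then have "z < k * x" using q(3) by linarith
   have xz: "z powr (10/11) \<le> x"
   proof -
    have "z powr (1/11) * z powr (10/11) = z" using zt by (simp add: powr_add[symmetric])
    moreover have "k * z powr (10/11) \<le> z powr (1/11) * z powr (10/11)" using zb by (intro mult_right_mono) auto
    ultimately have "k * z powr (10/11) \<le> k * x" using \<open>z < k * x\<close> by linarith
    then show ?thesis using k1 by simp
   qed
   then have xZ: "x \<ge> Z" using zb by linarith
   have zx: "z \<le> x powr (11/10)"
   proof -
    have "(z powr (10/11)) powr (11/10) \<le> x powr (11/10)" using xz by (intro powr_mono2) auto
    then show ?thesis using zt by (simp add: powr_powr)
   qed
   have sub: "scale_set a u v x z \<subseteq> primes_le (x powr (1/2)) \<union> many_small_primes u v x z \<union> few_small_primes u a v x z"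
   proof
    fix p assume p: "p \<in> scale_set a u v x z"
    obtain q :: nat where q: "prime q" "z < real_of_int (int q - a)" "real_of_int (int q - a) \<le> z\<^sup>2" "(int q - a) dvd int u * int p + v"
     using p by (auto simp: scale_set_def)
    have pp: "prime p" "real p \<le> x" "int u * int p + v \<noteq> 0" using p by (auto simp: scale_set_def)
    have "real_of_int (int q - a) > real_of_int \<bar>v\<bar>" using q(2) zb(5) by (simp add: k_def)
    then have dv: "int q - a > \<bar>v\<bar>" by (simp only: of_int_less_iff)
    have "int u * int p + v > 0"
    proof (rule ccontr)
     assume "\<not> int u * int p + v > 0"
     then have "\<bar>int u * int p + v\<bar> \<le> \<bar>v\<bar>" using zero_le_mult_iff[of "int u" "int p"] by linarith
     moreover have "\<bar>int q - a\<bar> \<le> \<bar>int u * int p + v\<bar>" using q(4) pp(3) by (simp add: dvd_imp_le_int)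
     ultimately show False using dv by linarith
    qed
    define d where "d = nat (int q - a)"
    have d: "int q - a = int d" using dv by (simp add: d_def)
    show "p \<in> primes_le (x powr (1/2)) \<union> many_small_primes u v x z \<union> few_small_primes u a v x z"
    proof (cases "real p \<le> x powr (1/2)")
     case True
     then show ?thesis using pp by (simp add: primes_le_iff)
    next
     case False
     then have ps: "p \<in> shifted_primes u v x" using pp \<open>int u * int p + v > 0\<close> by (simp add: shifted_primes_def)
     have "\<exists>d q :: nat. prime q \<and> int q = int d + a \<and> z < real d \<and> real d \<le> z\<^sup>2 \<and> int d dvd int u * int p + v"
      using q unfolding d by (intro exI[of _ d] exI[of _ q]) (use d in auto)
     then show ?thesis using ps by (auto simp: many_small_primes_def few_small_primes_def not_le)
    qed
   qed
   have fin: "finite (many_small_primes u v x z)" "finite (few_small_primes u a v x z)"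
    by (simp_all add: many_small_primes_def few_small_primes_def)
   have "card (scale_set a u v x z) \<le> card (primes_le (x powr (1/2)) \<union> many_small_primes u v x z \<union> few_small_primes u a v x z)"
    using sub fin by (intro card_mono) (auto simp: finite_primes_le)
   also have "\<dots> \<le> card (primes_le (x powr (1/2)) \<union> many_small_primes u v x z) + card (few_small_primes u a v x z)" by (rule card_Un_le)
   also have "card (primes_le (x powr (1/2)) \<union> many_small_primes u v x z) \<le> card (primes_le (x powr (1/2))) + card (many_small_primes u v x z)" by (rule card_Un_le)
   finally have "real (card (scale_set a u v x z)) \<le> real (card (primes_le (x powr (1/2)))) + real (card (many_small_primes u v x z)) + real (card (few_small_primes u a v x z))"
    by (simp only: of_nat_le_iff of_nat_add[symmetric] add_right_mono)
   also have "\<dots> \<le> T + C1 * T + C2 * T"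
   proof (intro add_mono)
    have "real (card (primes_le (x powr (1/2)))) \<le> x powr (1/2)" by (rule card_primes_le_le) simp
    also have "\<dots> \<le> x / ln x * x powr (-1/4)" using x4[of x] xZ by (simp add: Z_def)
    also have "\<dots> \<le> T" unfolding T_def
    proof (rule mult_left_mono)
     have "x powr (-1/4) \<le> x powr (11/10 * (-1/32))" using x by (intro powr_mono) auto
     also have "\<dots> = (x powr (11/10)) powr (-1/32)" by (simp add: powr_powr)
     also have "\<dots> \<le> z powr (-1/32)" using zx zt by (intro powr_mono2') auto
     finally show "x powr (-1/4) \<le> tau (ln (ln z))" using zt by linarith
    qed (use x lnx in simp)
    finally show "real (card (primes_le (x powr (1/2)))) \<le> T" .
    show "real (card (many_small_primes u v x z)) \<le> C1 * T" unfolding T_def using zb(3) xZ zx by (intro C1(2)) (auto simp: Z_def)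
    show "real (card (few_small_primes u a v x z)) \<le> C2 * T" unfolding T_def using zb(3) xZ zx by (intro C2(2)) (auto simp: Z_def)
   qed
   also have "\<dots> = (1 + C1 + C2) * T" by (simp add: algebra_simps)
   finally show ?thesis .
  qed
  then show "real (card (scale_set a u v x z)) \<le> (1 + C1 + C2) * (x / ln x * tau (ln (ln z)))" by (simp only: T_def)
 qed
qed

lemma sum_tau_scales_le:
 assumes "y \<ge> (3::real)" "ln (ln y) > 0"
 shows "(\<Sum>i<n. tau (ln (ln (y ^ 2 ^ i)))) \<le> tau (ln (ln y)) / (1 - exp (- eta0 * ln 2))"
proof -
 define r where "r = exp (- eta0 * ln 2)"
 have r: "0 < r" "r < 1" using eta0_pos by (auto simp: r_def)
 define M where "M = ln (ln y)"
 have M: "M > 0" using assms by (simp add: M_def)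
 have ly: "ln y > 0" using assms by simp
 have "tau (ln (ln (y ^ 2 ^ i))) \<le> tau M * r ^ i" for i
 proof -
  have "ln (y ^ 2 ^ i) = 2 ^ i * ln y" using assms by (simp add: ln_realpow)
  then have e: "ln (ln (y ^ 2 ^ i)) = real i * ln 2 + M" using ly by (simp add: ln_mult_pos ln_realpow M_def)
  have "tau (real i * ln 2 + M) \<le> exp (- eta0 * (real i * ln 2 + M)) / sqrt M"
   unfolding tau_def using M by (intro divide_left_mono) (auto intro!: mult_pos_pos add_nonneg_pos)
  also have "exp (- eta0 * (real i * ln 2 + M)) = exp (- eta0 * M) * r ^ i"
   unfolding r_def exp_of_nat_mult[symmetric] by (simp add: exp_add[symmetric] algebra_simps)
  finally show ?thesis unfolding e by (simp add: tau_def mult_ac)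
 qed
 then have "(\<Sum>i<n. tau (ln (ln (y ^ 2 ^ i)))) \<le> (\<Sum>i<n. tau M * r ^ i)" by (intro sum_mono)
 also have "\<dots> = tau M * (\<Sum>i<n. r ^ i)" by (simp only: sum_distrib_left)
 also have "\<dots> = tau M * ((1 - r ^ n) / (1 - r))" using r by (simp add: sum_gp_strict)
 also have "\<dots> \<le> tau M * (1 / (1 - r))" using r tau_pos[OF M] by (intro mult_left_mono divide_right_mono) auto
 finally show ?thesis by (simp add: M_def r_def)
qed

lemma P_count_le_large_y:
 fixes u :: nat and a v :: int
 assumes "u \<ge> 1" "v \<noteq> 0" "a \<noteq> 0" "v \<noteq> - a * int u"
 shows "\<exists>C y0. C > 0 \<and> (\<forall>x y. y \<ge> y0 \<longrightarrow> x \<ge> 3 \<longrightarrow> real (P_count a u v x y) \<le> C * (x / ln x * tau (ln (ln y))))"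
proof -
 obtain C z0 where C: "C > 0" "\<And>x z. z \<ge> z0 \<Longrightarrow> x \<ge> 3 \<Longrightarrow> real (card (scale_set a u v x z)) \<le> C * (x / ln x * tau (ln (ln z)))"
  using card_scale_set_le[OF assms] by blast
 let ?P = "\<lambda>y::real. ln (ln y) > 0"
 have "eventually ?P at_top" by ((intro eventually_conj)?; (real_asymp | rule eventually_ge_at_top))
 then obtain y1 where y1: "\<And>y. y \<ge> y1 \<Longrightarrow> ?P y" by (auto simp: eventually_at_top_linorder)
 define r where "r = exp (- eta0 * ln 2)"
 have r: "r < 1" using eta0_pos by (simp add: r_def)
 show ?thesis
 proof (rule exI[of _ "C / (1 - r)"], rule exI[of _ "max (max z0 y1) 3"], intro conjI allI impI)
  show "C / (1 - r) > 0" using C r by simp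
  fix x y :: real assume y: "y \<ge> max (max z0 y1) 3" and x: "x \<ge> 3"
  have yb: "y \<ge> z0" "y \<ge> 3" "ln (ln y) > 0" using y y1[of y] by auto
  define k where "k = real u + real_of_int \<bar>v\<bar>"
  have yn: "y ^ 2 ^ n \<ge> real n" for n
  proof -
   have "real n \<le> real (2 ^ n)" by (simp only: of_nat_le_iff) (simp add: less_imp_le)
   also have "\<dots> \<le> real (2 ^ (2 ^ n))" by (simp only: of_nat_le_iff) (simp add: less_imp_le)
   also have "\<dots> = 2 ^ 2 ^ n" by simp
   also have "\<dots> \<le> y ^ 2 ^ n" using yb by (intro power_mono) auto
   finally show ?thesis .
  qed
  obtain n :: nat where n: "real n \<ge> k * x" using real_arch_simple by blast
  have "{p::nat. prime p \<and> real p \<le> x \<and> int u * int p + v \<noteq> 0 \<and> has_shifted_prime_divisor_gt a y (int u * int p + v)}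
    \<subseteq> (\<Union>i<n. scale_set a u v x (y ^ 2 ^ i))"
  proof
   fix p assume p: "p \<in> {p::nat. prime p \<and> real p \<le> x \<and> int u * int p + v \<noteq> 0 \<and> has_shifted_prime_divisor_gt a y (int u * int p + v)}"
   then obtain q :: nat where q: "prime q" "real_of_int (int q - a) > y" "(int q - a) dvd int u * int p + v"
    by (auto simp: has_shifted_prime_divisor_gt_def)
   have pp: "prime p" "real p \<le> x" "int u * int p + v \<noteq> 0" using p by auto
   define d where "d = real_of_int (int q - a)"
   have "d \<le> k * x" unfolding d_def k_def using pp q x by (intro linear_form_bound) auto
   then have dn: "d \<le> y ^ 2 ^ n" using n yn[of n] by linarith
   define m where "m = (LEAST m. d \<le> y ^ 2 ^ m)"
   have dm: "d \<le> y ^ 2 ^ m" unfolding m_def using dn by (rule LeastI)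
   have mn: "m \<le> n" unfolding m_def using dn by (rule Least_le)
   have "m \<noteq> 0"
   proof
    assume "m = 0"
    then have "d \<le> y" using dm by simp
    then show False using q(2) unfolding d_def by linarith
   qed
   then obtain i where i: "m = Suc i" by (cases m) auto
   have "\<not> d \<le> y ^ 2 ^ i" using not_less_Least[of i "\<lambda>m. d \<le> y ^ 2 ^ m"] i by (simp add: m_def)
   moreover have "y ^ 2 ^ m = (y ^ 2 ^ i)\<^sup>2" by (simp add: i power_mult[symmetric] mult.commute)
   ultimately have "p \<in> scale_set a u v x (y ^ 2 ^ i)" using pp q dm by (auto simp: scale_set_def d_def)
   then show "p \<in> (\<Union>i<n. scale_set a u v x (y ^ 2 ^ i))" using i mn by auto
  qed
  then have "P_count a u v x y \<le> card (\<Union>i<n. scale_set a u v x (y ^ 2 ^ i))"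
   unfolding P_count_def using finite_scale_set by (intro card_mono) auto
  then have "real (P_count a u v x y) \<le> real (card (\<Union>i<n. scale_set a u v x (y ^ 2 ^ i)))" by simp
  also have "\<dots> \<le> (\<Sum>i<n. C * (x / ln x * tau (ln (ln (y ^ 2 ^ i)))))"
  proof (rule card_UN_le_sum)
   fix i
   have "y ^ 1 \<le> y ^ 2 ^ i" using yb by (intro power_increasing) auto
   then show "real (card (scale_set a u v x (y ^ 2 ^ i))) \<le> C * (x / ln x * tau (ln (ln (y ^ 2 ^ i))))"
    using yb x by (intro C(2)) auto
  qed simp
  also have "\<dots> = C * (x / ln x * (\<Sum>i<n. tau (ln (ln (y ^ 2 ^ i)))))" by (simp only: sum_distrib_left)
  also have "\<dots> \<le> C * (x / ln x * (tau (ln (ln y)) / (1 - r)))"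
   using C(1) x sum_tau_scales_le[OF yb(2,3), of n] by (intro mult_left_mono) (auto simp: r_def)
  also have "\<dots> = C / (1 - r) * (x / ln x * tau (ln (ln y)))" by simp
  finally show "real (P_count a u v x y) \<le> C / (1 - r) * (x / ln x * tau (ln (ln y)))" .
 qed
qed

abbreviation (input) prime_pair_set :: "nat \<Rightarrow> int \<Rightarrow> real \<Rightarrow> nat set" where
 "prime_pair_set d a x \<equiv> {p. prime p \<and> x powr (1/2) < real p \<and> real p \<le> x \<and> (\<exists>q::nat. prime q \<and> int q = int d * int p + a)}"

lemma card_prime_linear_pair_le:
 fixes d :: nat and a :: int
 assumes "d \<ge> 1" "a \<noteq> 0"
 shows "\<exists>C x0. C > 0 \<and> (\<forall>x\<ge>x0. real (card (prime_pair_set d a x))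
  \<le> C * (x / (ln x)\<^sup>2))"
proof -
 obtain C x1 where C: "C > 0" "\<And>x t M. x \<ge> x1 \<Longrightarrow> M \<ge> 1 \<Longrightarrow> real M \<le> x powr (3/4) \<Longrightarrow> 2 \<le> t \<Longrightarrow> t \<le> x powr (1/60) \<Longrightarrow>
  real (card (cofactor_primes d a x t M))
   \<le> C * (x / (ln t * ln x)) * (gfac M ^ 3 / real M)"
  using count_cofactor_rough[OF assms] by blast
 let ?P = "\<lambda>x::real. x powr (1/2) - x powr (1/60) \<ge> real_of_int \<bar>a\<bar> \<and> x powr (1/60) \<ge> 2 \<and> x powr (3/4) \<ge> 1 \<and> x \<ge> 3 \<and> x \<ge> x1"
 have "eventually ?P at_top" by ((intro eventually_conj)?; (real_asymp | rule eventually_ge_at_top))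
 then obtain x0 where x0: "\<And>x. x \<ge> x0 \<Longrightarrow> ?P x" by (auto simp: eventually_at_top_linorder)
 show ?thesis
 proof (rule exI[of _ "60 * C"], rule exI[of _ x0], intro conjI allI impI)
  show "60 * C > 0" using C by simp
  fix x assume x: "x \<ge> x0"
  note xb = x0[OF x]
  let ?R = "cofactor_primes d a x (x powr (1/60)) 1"
  have "prime_pair_set d a x \<subseteq> ?R"
  proof
   fix p assume "p \<in> prime_pair_set d a x"
   then obtain q :: nat where p: "prime p" "x powr (1/2) < real p" "real p \<le> x" and q: "prime q" "int q = int d * int p + a" by blast
   have "real_of_int (int q) = real_of_int (int d * int p + a)" by (simp only: q(2))
   then have "real q = real d * real p + real_of_int a" by simp
   moreover have "1 * real p \<le> real d * real p" using assms by (intro mult_right_mono) auto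
   ultimately have "x powr (1/60) \<le> real q" using p xb by linarith
   then have "rough (x powr (1/60)) q" using q(1) primes_dvd_imp_eq unfolding rough_def by blast
   then show "p \<in> ?R" using p q prime_gt_0_nat[OF q(1)] by auto
  qed
  then have "card (prime_pair_set d a x) \<le> card ?R"
   by (intro card_mono finite_subset[OF _ finite_primes_le[of x]]) (auto simp: primes_le_iff)
  then have "real (card (prime_pair_set d a x)) \<le> real (card ?R)"
   by (simp only: of_nat_le_iff)
  also have "\<dots> \<le> C * (x / (ln (x powr (1/60)) * ln x)) * (gfac 1 ^ 3 / real 1)"
   by (rule C(2)) (use xb in auto)
  also have "\<dots> = 60 * C * (x / (ln x)\<^sup>2)" using xb by (simp add: ln_powr gfac_def power2_eq_square)
  finally show "real (card (prime_pair_set d a x))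
   \<le> 60 * C * (x / (ln x)\<^sup>2)" .
 qed
qed

text \<open>A divisor \<open>e > y \<ge> u\<close> of \<open>u p\<close> is a multiple of \<open>p\<close>, so it equals \<open>d p\<close> with \<open>d dvd u\<close>, and \<open>d p + a\<close> is prime.\<close>

lemma P_count_zero_shift_le_large_y:
 fixes u :: nat and a :: int
 assumes "u \<ge> 1" "a \<noteq> 0"
 shows "\<exists>C y0. C > 0 \<and> (\<forall>x y. y \<ge> y0 \<longrightarrow> x \<ge> 3 \<longrightarrow> real (P_count a u 0 x y) \<le> C * (x / ln x * tau (ln (ln y))))"
proof -
 define B where "B = (\<lambda>x d. prime_pair_set d a x)"
 define I where "I = {d. d dvd u}"
 have finI: "finite I" using assms(1) by (simp add: I_def)
 have "\<forall>d\<in>I. \<exists>C x0. C > 0 \<and> (\<forall>x\<ge>x0. real (card (B x d)) \<le> C * (x / (ln x)\<^sup>2))"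
 proof
  fix d assume "d \<in> I"
  then have "d \<ge> 1" using assms(1) by (auto simp: I_def intro!: Suc_leI Nat.gr0I)
  then show "\<exists>C x0. C > 0 \<and> (\<forall>x\<ge>x0. real (card (B x d)) \<le> C * (x / (ln x)\<^sup>2))"
   unfolding B_def by (rule card_prime_linear_pair_le[OF _ assms(2)])
 qed
 then obtain C X where CX: "\<And>d. d \<in> I \<Longrightarrow> C d > 0 \<and> (\<forall>x\<ge>X d. real (card (B x d)) \<le> C d * (x / (ln x)\<^sup>2))"
  by metis
 define X0 where "X0 = Max (insert 3 (X ` I))"
 have X0: "X d \<le> X0" if "d \<in> I" for d using that finI by (simp add: X0_def)
 obtain z3 where z3: "\<And>z. z \<ge> z3 \<Longrightarrow> tau_large z"
  using tau_lower by auto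
 let ?P = "\<lambda>x::real. x powr (1/2) \<le> x / (ln x)\<^sup>2"
 have "eventually ?P at_top" by ((intro eventually_conj)?; (real_asymp | rule eventually_ge_at_top))
 then obtain x4 where x4: "\<And>x. x \<ge> x4 \<Longrightarrow> ?P x" by (auto simp: eventually_at_top_linorder)
 define Cs where "Cs = 1 + (\<Sum>d\<in>I. C d)"
 have Cs: "Cs > 0" unfolding Cs_def using CX by (intro add_pos_nonneg sum_nonneg) (auto simp: less_imp_le)
 define Z where "Z = max (max X0 x4) (real u)"
 show ?thesis
 proof (rule exI[of _ "2 * Cs"], rule exI[of _ "max z3 (real u * Z)"], intro conjI allI impI)
  show "2 * Cs > 0" using Cs by simp
  fix x y :: real assume y: "y \<ge> max z3 (real u * Z)" and x: "x \<ge> 3"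
  have yb: "y \<ge> 16" "ln (ln y) \<ge> 1" "tau (ln (ln y)) \<ge> 1 / ln y" "y \<ge> real u * Z" using y z3[of y] by auto
  have lnx: "ln x > 0" and lny: "ln y > 0" using x yb by auto
  have "Z \<ge> 1" using assms(1) by (simp add: Z_def)
  then have "real u * 1 \<le> real u * Z" by (intro mult_left_mono) auto
  then have uy: "real u \<le> y" using yb by simp
  define S where "S = {p::nat. prime p \<and> real p \<le> x \<and> int u * int p + 0 \<noteq> 0 \<and> has_shifted_prime_divisor_gt a y (int u * int p + 0)}"
  have key: "\<exists>d\<in>I. y < real u * real p \<and> (\<exists>q::nat. prime q \<and> int q = int d * int p + a)" if pS: "p \<in> S" for p
  proof -
   obtain q :: nat where q: "prime q" "real_of_int (int q - a) > y" "(int q - a) dvd int u * int p"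
    using pS by (auto simp: S_def has_shifted_prime_divisor_gt_def)
   have p: "prime p" using pS by (simp add: S_def)
   define e where "e = nat (int q - a)"
   have "int q - a > 0" using q(2) yb by linarith
   then have e: "int q - a = int e" "e > 0" by (simp_all add: e_def)
   have ey: "y < real e" using q(2) unfolding e(1) by simp
   have eu: "e dvd u * p" using q(3) unfolding e(1) by (metis of_nat_mult of_nat_dvd_iff)
   have "p dvd e"
   proof (rule ccontr)
    assume "\<not> p dvd e"
    then have "coprime p e" using p by (intro prime_imp_coprime)
    then have "e dvd u" using eu by (simp add: coprime_commute coprime_dvd_mult_left_iff)
    then have "e \<le> u" using assms(1) by (intro dvd_imp_le) auto
    then show False using ey uy by linarith
   qed
   then obtain d where d: "e = p * d" by (elim dvdE)
   then have "d \<in> I" using eu prime_gt_0_nat[OF p] by (simp add: I_def mult.commute)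
   moreover have "y < real u * real p"
   proof -
    have "d \<le> u" using \<open>d \<in> I\<close> assms(1) by (auto simp: I_def intro: dvd_imp_le)
    then have "real p * real d \<le> real p * real u" by (intro mult_left_mono) auto
    then show ?thesis using ey unfolding d by (simp add: mult.commute)
   qed
   moreover have "int q = int d * int p + a" using e(1) d by (simp add: mult.commute)
   ultimately show ?thesis using q(1) by blast
  qed
  have "real (card S) \<le> 2 * Cs * (x / ln x * tau (ln (ln y)))"
  proof (cases "S = {}")
   case True
   have "tau (ln (ln y)) > 0" using yb by (intro tau_pos) linarith
   then show ?thesis using True Cs x lnx by simp
  next
   case False
   then obtain p where p: "p \<in> S" by blast
   have yux: "y < real u * x"
   proof -
    have "y < real u * real p" using key[OF p] by blast
    also have "\<dots> \<le> real u * x" using p by (intro mult_left_mono) (auto simp: S_def)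
    finally show ?thesis .
   qed
   have "real u * Z \<le> real u * x" using yux yb by linarith
   then have xZ: "Z \<le> x" using assms(1) by simp
   have lyx: "ln y \<le> 2 * ln x"
   proof -
    have "real u * x \<le> x * x" using xZ x by (intro mult_right_mono) (auto simp: Z_def)
    then have "y \<le> x\<^sup>2" using yux by (simp add: power2_eq_square)
    then have "ln y \<le> ln (x\<^sup>2)" using yb x by (subst ln_le_cancel_iff) auto
    then show ?thesis using x by (simp add: ln_realpow)
   qed
   have "S \<subseteq> primes_le (x powr (1/2)) \<union> (\<Union>d\<in>I. B x d)"
   proof
    fix p assume pS: "p \<in> S"
    then have p: "prime p" "real p \<le> x" by (auto simp: S_def)
    show "p \<in> primes_le (x powr (1/2)) \<union> (\<Union>d\<in>I. B x d)"
    proof (cases "real p \<le> x powr (1/2)")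
     case False
     then show ?thesis using key[OF pS] p by (auto simp: B_def)
    qed (use p in \<open>simp add: primes_le_iff\<close>)
   qed
   moreover have "finite (B x d)" for d
    by (rule finite_subset[OF _ finite_primes_le[of x]]) (auto simp: B_def primes_le_iff)
   ultimately have "card S \<le> card (primes_le (x powr (1/2)) \<union> (\<Union>d\<in>I. B x d))"
    using finI by (intro card_mono) (auto simp: finite_primes_le)
   also have "\<dots> \<le> card (primes_le (x powr (1/2))) + card (\<Union>d\<in>I. B x d)" by (rule card_Un_le)
   finally have "real (card S) \<le> real (card (primes_le (x powr (1/2)))) + real (card (\<Union>d\<in>I. B x d))" by linarith
   also have "\<dots> \<le> x / (ln x)\<^sup>2 + (\<Sum>d\<in>I. C d * (x / (ln x)\<^sup>2))"
   proof (intro add_mono card_UN_le_sum finI)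
    have "real (card (primes_le (x powr (1/2)))) \<le> x powr (1/2)" by (rule card_primes_le_le) simp
    also have "\<dots> \<le> x / (ln x)\<^sup>2" using xZ by (intro x4) (simp add: Z_def)
    finally show "real (card (primes_le (x powr (1/2)))) \<le> x / (ln x)\<^sup>2" .
    fix d assume d: "d \<in> I"
    then have "X d \<le> x" using X0[OF d] xZ by (simp add: Z_def)
    then show "real (card (B x d)) \<le> C d * (x / (ln x)\<^sup>2)" using CX[OF d] by blast
   qed
   also have "\<dots> = Cs * (x / ln x * (1 / ln x))"
    by (simp only: Cs_def distrib_right sum_distrib_right[symmetric] mult_1_left) (simp add: power2_eq_square)
   also have "\<dots> \<le> Cs * (x / ln x * (2 * tau (ln (ln y))))"
   proof (intro mult_left_mono)
    have "1 / ln x \<le> 2 * (1 / ln y)" using lyx lnx lny by (simp add: field_simps)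
    then show "1 / ln x \<le> 2 * tau (ln (ln y))" using yb(3) by linarith
   qed (use Cs x lnx in auto)
   finally show ?thesis by (simp only: mult_ac)
  qed
  then show "real (P_count a u 0 x y) \<le> 2 * Cs * (x / ln x * tau (ln (ln y)))" by (simp only: P_count_def S_def)
 qed
qed

lemma P_count_constant_eq_0:
 assumes "v \<noteq> 0" "y \<ge> real_of_int \<bar>v\<bar>"
 shows "P_count a 0 v x y = 0"
proof -
 have "\<not> has_shifted_prime_divisor_gt a y v"
 proof
  assume "has_shifted_prime_divisor_gt a y v"
  then obtain q :: nat where q: "real_of_int (int q - a) > y" "(int q - a) dvd v" by (auto simp: has_shifted_prime_divisor_gt_def)
  have "\<bar>int q - a\<bar> \<le> \<bar>v\<bar>" using q(2) assms(1) by (simp add: dvd_imp_le_int)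
  then have "real_of_int (int q - a) \<le> real_of_int \<bar>v\<bar>" by linarith
  then show False using q(1) assms(2) by linarith
 qed
 then show ?thesis by (simp add: P_count_def)
qed

text \<open>For bounded \<open>y\<close> the trivial bound \<open>\<pi>(x)\<close> suffices, because the denominator is bounded there.\<close>

lemma P_count_le_of_large_y:
 fixes u :: nat and a v :: int
 assumes "\<exists>C y0. C > 0 \<and> (\<forall>x y. y \<ge> y0 \<longrightarrow> x \<ge> 3 \<longrightarrow> real (P_count a u v x y) \<le> C * (x / ln x * tau (ln (ln y))))"
 shows "\<exists>C>0. \<forall>x y :: real. x \<ge> 3 \<longrightarrow> y \<ge> 3 \<longrightarrow>
     real (P_count a u v x y) \<le> C * (real (prime_pi x) / (ln y powr eta0 * sqrt (ln (ln y))))"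
proof -
 obtain C y0 where C: "C > 0" "\<And>x y. y \<ge> y0 \<Longrightarrow> x \<ge> 3 \<Longrightarrow> real (P_count a u v x y) \<le> C * (x / ln x * tau (ln (ln y)))"
  using assms by blast
 obtain c where c: "c > 0" "\<And>x. x \<ge> 2 \<Longrightarrow> real (prime_pi x) \<ge> c * x / ln x" using prime_pi_lower by blast
 define f where "f = (\<lambda>y. ln y powr eta0 * sqrt (ln (ln y)))"
 define Y where "Y = max y0 3"
 have lny: "ln y > 1" "ln (ln y) > 0" if "y \<ge> 3" for y :: real
 proof -
  have "ln 3 \<le> ln y" using that by simp
  then show "ln y > 1" using ln3_gt_1 by linarith
  then show "ln (ln y) > 0" by simp
 qed
 have fpos: "f y > 0" if "y \<ge> 3" for y using lny[OF that] by (auto simp: f_def)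
 have fmono: "f y \<le> f y'" if "3 \<le> y" "y \<le> y'" for y y'
 proof -
  have l: "ln y \<le> ln y'" using that by simp
  then have "ln (ln y) \<le> ln (ln y')" using lny[OF that(1)] by (subst ln_le_cancel_iff) auto
  then show ?thesis unfolding f_def using l lny[OF that(1)] eta0_pos by (intro mult_mono powr_mono2) auto
 qed
 have taueq: "tau (ln (ln y)) = 1 / f y" if "y \<ge> 3" for y
 proof -
  have "ln y powr eta0 = exp (eta0 * ln (ln y))" using lny[OF that] by (simp add: powr_def)
  then show ?thesis unfolding tau_def f_def by (simp add: exp_minus inverse_eq_divide)
 qed
 define C' where "C' = C / c + f Y"
 have fY: "f Y > 0" by (rule fpos) (simp add: Y_def)
 show ?thesis
 proof (rule exI[of _ C'], intro conjI allI impI)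
  show "C' > 0" using C c fY by (simp add: C'_def add_pos_pos)
  fix x y :: real assume x: "x \<ge> 3" and y: "y \<ge> 3"
  define Q where "Q = real (prime_pi x) / f y"
  have Q0: "Q \<ge> 0" using fpos[OF y] by (simp add: Q_def)
  have "real (P_count a u v x y) \<le> C' * Q"
  proof (cases "y \<ge> Y")
   case True
   have "real (P_count a u v x y) \<le> C * (x / ln x * tau (ln (ln y)))" using True x by (intro C(2)) (auto simp: Y_def)
   also have "\<dots> = C / c * ((c * x / ln x) / f y)" using c by (simp add: taueq[OF y])
   also have "\<dots> \<le> C / c * Q" unfolding Q_def using C(1) c x fpos[OF y] by (intro mult_left_mono divide_right_mono) auto
   also have "\<dots> \<le> C' * Q" using Q0 fY by (intro mult_right_mono) (auto simp: C'_def)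
   finally show ?thesis .
  next
   case False
   have "P_count a u v x y \<le> prime_pi x"
    unfolding P_count_def prime_pi_def
    by (rule card_mono[OF finite_subset[OF _ finite_primes_le[of x]]]) (auto simp: primes_le_iff)
   then have "real (P_count a u v x y) \<le> real (prime_pi x)" by simp
   also have "\<dots> = f y * Q" using fpos[OF y] by (simp add: Q_def)
   also have "\<dots> \<le> C' * Q"
   proof (rule mult_right_mono[OF _ Q0])
    have "f y \<le> f Y" using False y by (intro fmono) auto
    moreover have "C / c > 0" using C c by simp
    ultimately show "f y \<le> C'" by (simp add: C'_def)
   qed
   finally show ?thesis .
  qed
  then show "real (P_count a u v x y) \<le> C' * (real (prime_pi x) / (ln y powr eta0 * sqrt (ln (ln y))))"
   by (simp only: Q_def f_def)
 qed
qed

theorem theorem1p7: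
 fixes a :: int and u :: nat and v :: int
 assumes "a \<noteq> 0" and "v \<noteq> - a * int u"
 shows "\<exists>C>0. \<forall>x y :: real. x \<ge> 3 \<longrightarrow> y \<ge> 3 \<longrightarrow>
     real (P_count a u v x y)
      \<le> C * (real (prime_pi x) / (ln y powr eta0 * sqrt (ln (ln y))))"
proof (rule P_count_le_of_large_y)
 consider "u = 0" | "u \<ge> 1" "v = 0" | "u \<ge> 1" "v \<noteq> 0" by linarith
 then show "\<exists>C y0. C > 0 \<and> (\<forall>x y. y \<ge> y0 \<longrightarrow> x \<ge> 3 \<longrightarrow> real (P_count a u v x y) \<le> C * (x / ln x * tau (ln (ln y))))"
 proof cases
  case 1
  then have v: "v \<noteq> 0" using assms(2) by simp
  obtain z3 where z3: "\<And>z. z \<ge> z3 \<Longrightarrow> tau_large z"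
   using tau_lower by auto
  show ?thesis
  proof (rule exI[of _ 1], rule exI[of _ "max z3 (real_of_int \<bar>v\<bar>)"], intro conjI allI impI)
   fix x y :: real assume y: "y \<ge> max z3 (real_of_int \<bar>v\<bar>)" and x: "x \<ge> 3"
   have "tau (ln (ln y)) > 0" using z3[of y] y by (intro tau_pos) linarith
   then show "real (P_count a u v x y) \<le> 1 * (x / ln x * tau (ln (ln y)))"
    using P_count_constant_eq_0[OF v, of y a x] y x 1 by simp
  qed simp
 next
  case 2
  then show ?thesis using P_count_zero_shift_le_large_y[of u a] assms(1) by simp
 next
  case 3
  then show ?thesis using assms by (intro P_count_le_large_y)
 qed
qed

end
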